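(* Let $m\ge2$, $n\ge1$, $I=\mathbb Z/m\mathbb Z$, let $q=(q_i)_{i\in I}\in(\mathbb C^\times)^I$ be regular, $t=\prod_{i\in I}q_i$ and $t_s=\prod_{0\le i\le s}q_i$ for $s=0,\dots,m-1$. Let $\mathcal C^0_{n,t}$ and $\mathcal C^0_{n,q}(m)$ be the Calogero--Moser spaces (with invertible $X$-matrices) for the tadpole quiver and for the framed cyclic quiver with $m$ cyclic vertices, equipped with their Poisson brackets (see context). Then the isomorphism of varieties $\xi:\mathcal C^0_{n,t}\to\mathcal C^0_{n,q}(m)$ sending the class of $(A,B,\widetilde V,\widetilde W)$ to the class of $$X_s=\operatorname{Id}_n,\ Z_s=t_sB\ (s=0,\dots,m-2),\quad X_{m-1}=A,\ Z_{m-1}=tA^{-1}B,\quad V=A^{-1}B^{-1}\widetilde V,\ W=\widetilde WBA$$ is a Poisson map.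
   Context: **Quivers.** For a quiver with arrow set $Q$, let $\bar Q$ be its double, obtained by adjoining an opposite arrow $a^*$ for each $a\in Q$, $(a^* )^*=a$; $t(a),h(a)$ are tail and head; $\epsilon(a)=1$ for $a\in Q$, $-1$ for $a\in\bar Q\setminus Q$. Paths in $\mathbb C\bar Q$ are composed from left to right ($ab=0$ unless $h(a)=t(b)$); $e_i$ are vertex idempotents spanning $B$. Let $\mathcal A$ be obtained from $\mathbb C\bar Q$ by inverting all $1+aa^*$, $a\in\bar Q$. An arrow $a$ is represented by a matrix of size $\alpha_{t(a)}\times\alpha_{h(a)}$ for a dimension vector $\alpha$. Two quivers are used: (i) the tadpole quiver: vertices $0,\infty$, arrows $x:0\to0$, $v:0\to\infty$, with $y=x^*$, $w=v^*$; arrows starting at $0$ are ordered $x<y<v$. (ii) the framed cyclic quiver: vertices $I\sqcup\{\infty\}$, arrows $x_i:i\to i+1$, $v:0\to\infty$, with $y_i=x_i^*$, $w=v^*$; arrows starting at $i\neq0$ are ordered $y_{i-1}<x_i$, those starting at $0$ are ordered $y_{m-1}<x_0<v$. **Double bracket.** Write $u=u'\otimes u''$ for elements of $\mathcal A\otimes\mathcal A$ (sum suppressed). Double derivations are $B$-linear derivations $\delta:\mathcal A\to\mathcal A\otimes\mathcal A$ for the outer bimodule structure $b(u'\otimes u'')c=bu'\otimes u''c$; they form a bimodule by $(b\delta c)(a)=\delta(a)'c\otimes b\,\delta(a)''$. $\frac{\partial}{\partial a}$ is the double derivation with $\frac{\partial a}{\partial a}=e_{t(a)}\otimes e_{h(a)}$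 and $\frac{\partial b}{\partial a}=0$ for arrows $b\ne a$. A product $\delta_1\delta_2$ defines $\{\!\{a,b\}\!\}_{\delta_1\delta_2}=\delta_2(b)'\delta_1(a)''\otimes\delta_1(a)'\delta_2(b)''-\delta_1(b)'\delta_2(a)''\otimes\delta_2(a)'\delta_1(b)''$, extended additively. Take $\{\!\{-,-\}\!\}=\{\!\{-,-\}\!\}_P$ with $$P=\tfrac12\sum_{a\in\bar Q}\epsilon(a)(1+a^*a)\tfrac{\partial}{\partial a}\tfrac{\partial}{\partial a^*}-\tfrac12\sum_{i}\sum_{a<b,\ t(a)=t(b)=i}F_aF_b,\qquad F_a=\tfrac{\partial}{\partial a^*}a^*-a\tfrac{\partial}{\partial a},$$ $i$ running over all vertices. **Spaces.** $\mathcal C^0_{n,t}$ is the space of quadruples $(A,B,\widetilde V,\widetilde W)$, $A,B\in\operatorname{GL}_n(\mathbb C)$, $\widetilde V\in\operatorname{Mat}_{n\times1}(\mathbb C)$, $\widetilde W\in\operatorname{Mat}_{1\times n}(\mathbb C)$ with $ABA^{-1}B^{-1}(\operatorname{Id}_n+\widetilde V\widetilde W)=t\operatorname{Id}_n$, modulo $g.(A,B,\widetilde V,\widetilde W)=(gAg^{-1},gBg^{-1},g\widetilde V,\widetilde Wg^{-1})$, $g\in\operatorname{GL}_n$. It consists of representations of the tadpole algebra $\mathcal A$ of dimension $(\alpha_\infty,\alpha_0)=(1,n)$ with $x,y,v,w$ represented by $A$ (invertible), $B-A^{-1}$, $\widetilde V$, $\widetilde W$. $\mathcal C^0_{n,q}(m)$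 is the space of collections $X_i,Y_i\in\operatorname{Mat}_n(\mathbb C)$ ($i\in I$), $V\in\operatorname{Mat}_{n\times1}(\mathbb C)$, $W\in\operatorname{Mat}_{1\times n}(\mathbb C)$ with all $X_i$ invertible and, with $Z_i=Y_i+X_i^{-1}$ invertible, $(Z_{i-1}X_{i-1})^{-1}X_iZ_i=q_i\operatorname{Id}_n$ ($i\ne0$), $(Z_{m-1}X_{m-1})^{-1}X_0Z_0(\operatorname{Id}_n+VW)=q_0\operatorname{Id}_n$, $(1+WV)^{-1}=t^{-n}$, modulo $\operatorname{GL}_n^m\ni(g_i)$: $X_i\mapsto g_iX_ig_{i+1}^{-1}$, $Y_i\mapsto g_{i+1}Y_ig_i^{-1}$, $V\mapsto g_0V$, $W\mapsto Wg_0^{-1}$. It consists of representations of the framed cyclic algebra $\mathcal A$ of dimension $1$ at $\infty$ and $n$ at each $i\in I$. Regularity of $q$ means $q^\beta=\prod_iq_i^{\beta_i}\ne1$ for all roots $\beta$ of the (unframed) cyclic quiver (the affine root system $\widetilde A_{m-1}$); both spaces are then smooth. **Poisson brackets.** For $a\in\mathcal A$ let $a_{ij}$ be its matrix entry functions on the representation space. The rule $\{a_{ij},b_{uv}\}=\{\!\{a,b\}\!\}'_{uj}\{\!\{a,b\}\!\}''_{iv}$ gives an antisymmetric biderivation, which induces Poisson brackets on the functions on $\mathcal C^0_{n,t}$ and $\mathcal C^0_{n,q}(m)$ (for $\mathcal C^0_{n,t}$: $\operatorname{GL}_n$-invariant functions restricted to the set of quadruples $(A,B,\widetilde V,\widetilde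 W)$ with $A,B$ invertible and $ABA^{-1}B^{-1}(\operatorname{Id}_n+\widetilde V\widetilde W)=t\operatorname{Id}_n$; for $\mathcal C^0_{n,q}(m)$: $\operatorname{GL}_n^m$-invariant functions restricted to the set of collections $(X_i,Y_i,V,W)$ with all $X_i$ and $Z_i=Y_i+X_i^{-1}$ invertible, $(Z_{i-1}X_{i-1})^{-1}X_iZ_i=q_i\operatorname{Id}_n$ for $i\ne0$, $(Z_{m-1}X_{m-1})^{-1}X_0Z_0(\operatorname{Id}_n+VW)=q_0\operatorname{Id}_n$ and $(1+WV)^{-1}=t^{-n}$). A map $\xi$ is Poisson if $\xi^*\{f,g\}=\{\xi^*f,\xi^*g\}$. *)

theory Defs
  imports
    "HOL-Analysis.Derivative"
    "HOL-Library.FuncSet"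
    "Jordan_Normal_Form.Determinant"
begin

section \<open>Quivers and the localised path algebra\<close>

datatype 'e darr = Arrow 'e | Opp 'e

primrec dstar :: "'e darr \<Rightarrow> 'e darr" where
  "dstar (Arrow a) = Opp a"
| "dstar (Opp a) = Arrow a"

primrec eps :: "'e darr \<Rightarrow> complex" where
  "eps (Arrow a) = 1"
| "eps (Opp a) = -1"

text \<open>Only the comparison of the ranks of two arrows with the same tail is ever used.\<close>

record ('v, 'e) quiver =
  verts :: "'v list"
  arrs :: "'e list"
  src :: "'e \<Rightarrow> 'v"
  tgt :: "'e \<Rightarrow> 'v"
  arrow_rank :: "'e darr \<Rightarrow> nat"

definition darrs :: "('v, 'e) quiver \<Rightarrow> 'e darr list" where
  "darrs Q = map Arrow (arrs Q) @ map Opp (arrs Q)"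

primrec dtail :: "('v, 'e) quiver \<Rightarrow> 'e darr \<Rightarrow> 'v" where
  "dtail Q (Arrow a) = src Q a"
| "dtail Q (Opp a) = tgt Q a"

primrec dhead :: "('v, 'e) quiver \<Rightarrow> 'e darr \<Rightarrow> 'v" where
  "dhead Q (Arrow a) = tgt Q a"
| "dhead Q (Opp a) = src Q a"

definition wf_quiver :: "('v, 'e) quiver \<Rightarrow> bool" where
  "wf_quiver Q \<longleftrightarrow> distinct (verts Q) \<and> distinct (arrs Q) \<and>
     (\<forall>a\<in>set (arrs Q). src Q a \<in> set (verts Q) \<and> tgt Q a \<in> set (verts Q))"

text \<open>
  The algebra \<open>\<A>\<close> is presented by generators and relations: its elements are the
  expressions below modulo the congruence \<open>aeq Q\<close>, where \<open>Inv a\<close> stands for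
  \<open>(1 + a a\<^sup>*)\<inverse>\<close>. Symbols that do not belong to the quiver are set to zero.
\<close>

datatype ('v, 'e) aexp =
    Zero
  | Vert 'v
  | Arr "'e darr"
  | Inv "'e darr"
  | Add "('v, 'e) aexp" "('v, 'e) aexp" (infixl \<open>\<boxplus>\<close> 65)
  | Scale complex "('v, 'e) aexp" (infixr \<open>\<star>\<close> 75)
  | Mul "('v, 'e) aexp" "('v, 'e) aexp" (infixl \<open>\<cdot>\<close> 70)

definition unit_elt :: "('v, 'e) quiver \<Rightarrow> ('v, 'e) aexp" where
  "unit_elt Q = foldr (\<lambda>v e. Vert v \<boxplus> e) (verts Q) Zero"

inductive aeq :: "('v, 'e) quiver \<Rightarrow> ('v, 'e) aexp \<Rightarrow> ('v, 'e) aexp \<Rightarrow> bool" for Q where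
  aeq_refl: "aeq Q e e"
| aeq_sym: "aeq Q e f \<Longrightarrow> aeq Q f e"
| aeq_trans: "aeq Q e f \<Longrightarrow> aeq Q f g \<Longrightarrow> aeq Q e g"
| aeq_add_cong: "aeq Q e e' \<Longrightarrow> aeq Q f f' \<Longrightarrow> aeq Q (e \<boxplus> f) (e' \<boxplus> f')"
| aeq_scale_cong: "aeq Q e e' \<Longrightarrow> aeq Q (c \<star> e) (c \<star> e')"
| aeq_mul_cong: "aeq Q e e' \<Longrightarrow> aeq Q f f' \<Longrightarrow> aeq Q (e \<cdot> f) (e' \<cdot> f')"
| aeq_add_assoc: "aeq Q ((e \<boxplus> f) \<boxplus> g) (e \<boxplus> (f \<boxplus> g))"
| aeq_add_comm: "aeq Q (e \<boxplus> f) (f \<boxplus> e)"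
| aeq_add_zero: "aeq Q (e \<boxplus> Zero) e"
| aeq_scale_add: "aeq Q (c \<star> (e \<boxplus> f)) (c \<star> e \<boxplus> c \<star> f)"
| aeq_add_scale: "aeq Q ((c + d) \<star> e) (c \<star> e \<boxplus> d \<star> e)"
| aeq_scale_scale: "aeq Q (c \<star> d \<star> e) ((c * d) \<star> e)"
| aeq_scale_one: "aeq Q (1 \<star> e) e"
| aeq_scale_zero: "aeq Q (0 \<star> e) Zero"
| aeq_mul_assoc: "aeq Q ((e \<cdot> f) \<cdot> g) (e \<cdot> (f \<cdot> g))"
| aeq_mul_addl: "aeq Q ((e \<boxplus> f) \<cdot> g) (e \<cdot> g \<boxplus> f \<cdot> g)"
| aeq_mul_addr: "aeq Q (e \<cdot> (f \<boxplus> g)) (e \<cdot> f \<boxplus> e \<cdot> g)"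
| aeq_mul_scalel: "aeq Q ((c \<star> e) \<cdot> f) (c \<star> (e \<cdot> f))"
| aeq_mul_scaler: "aeq Q (e \<cdot> (c \<star> f)) (c \<star> (e \<cdot> f))"
| aeq_one_mul: "aeq Q (unit_elt Q \<cdot> e) e"
| aeq_mul_one: "aeq Q (e \<cdot> unit_elt Q) e"
| aeq_no_vert: "v \<notin> set (verts Q) \<Longrightarrow> aeq Q (Vert v) Zero"
| aeq_no_arrow: "a \<notin> set (darrs Q) \<Longrightarrow> aeq Q (Arr a) Zero"
| aeq_idem: "aeq Q (Vert v \<cdot> Vert v) (Vert v)"
| aeq_orth: "v \<noteq> w \<Longrightarrow> aeq Q (Vert v \<cdot> Vert w) Zero"
| aeq_tail: "aeq Q (Vert (dtail Q a) \<cdot> Arr a) (Arr a)"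
| aeq_head: "aeq Q (Arr a \<cdot> Vert (dhead Q a)) (Arr a)"
| aeq_inv_left: "aeq Q (Inv a \<cdot> (unit_elt Q \<boxplus> Arr a \<cdot> Arr (dstar a))) (unit_elt Q)"
| aeq_inv_right: "aeq Q ((unit_elt Q \<boxplus> Arr a \<cdot> Arr (dstar a)) \<cdot> Inv a) (unit_elt Q)"

text \<open>An element \<open>\<Sum> u' \<otimes> u''\<close> of \<open>\<A> \<otimes> \<A>\<close> is represented by the list of its summands
  \<open>(u', u'')\<close>, modulo \<open>teq Q\<close>.\<close>

type_synonym ('v, 'e) tens = "(('v, 'e) aexp \<times> ('v, 'e) aexp) list"

inductive teq :: "('v, 'e) quiver \<Rightarrow> ('v, 'e) tens \<Rightarrow> ('v, 'e) tens \<Rightarrow> bool" for Q where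
  teq_refl: "teq Q S S"
| teq_sym: "teq Q S T \<Longrightarrow> teq Q T S"
| teq_trans: "teq Q S T \<Longrightarrow> teq Q T U \<Longrightarrow> teq Q S U"
| teq_append_cong: "teq Q S S' \<Longrightarrow> teq Q T T' \<Longrightarrow> teq Q (S @ T) (S' @ T')"
| teq_comm: "teq Q (S @ T) (T @ S)"
| teq_cong: "aeq Q u u' \<Longrightarrow> aeq Q w w' \<Longrightarrow> teq Q [(u, w)] [(u', w')]"
| teq_addl: "teq Q [(u \<boxplus> u', w)] [(u, w), (u', w)]"
| teq_addr: "teq Q [(u, w \<boxplus> w')] [(u, w), (u, w')]"
| teq_scale: "teq Q [(c \<star> u, w)] [(u, c \<star> w)]"
| teq_zero: "teq Q [(Zero, w)] []"

definition tscale :: "complex \<Rightarrow> ('v, 'e) tens \<Rightarrow> ('v, 'e) tens" where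
  "tscale c T = map (\<lambda>(u, w). (c \<star> u, w)) T"

definition outer_left :: "('v, 'e) aexp \<Rightarrow> ('v, 'e) tens \<Rightarrow> ('v, 'e) tens" where
  "outer_left b T = map (\<lambda>(u, w). (b \<cdot> u, w)) T"

definition outer_right :: "('v, 'e) tens \<Rightarrow> ('v, 'e) aexp \<Rightarrow> ('v, 'e) tens" where
  "outer_right T c = map (\<lambda>(u, w). (u, w \<cdot> c)) T"


section \<open>Double derivations and the double bracket\<close>

type_synonym ('v, 'e) dder = "('v, 'e) aexp \<Rightarrow> ('v, 'e) tens"

definition double_derivation :: "('v, 'e) quiver \<Rightarrow> ('v, 'e) dder \<Rightarrow> bool" where
  "double_derivation Q \<delta> \<longleftrightarrow>
     (\<forall>e f. aeq Q e f \<longrightarrow> teq Q (\<delta> e) (\<delta> f)) \<and>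
     (\<forall>e f. teq Q (\<delta> (e \<boxplus> f)) (\<delta> e @ \<delta> f)) \<and>
     (\<forall>c e. teq Q (\<delta> (c \<star> e)) (tscale c (\<delta> e))) \<and>
     (\<forall>e f. teq Q (\<delta> (e \<cdot> f)) (outer_right (\<delta> e) f @ outer_left e (\<delta> f))) \<and>
     (\<forall>v. teq Q (\<delta> (Vert v)) [])"

text \<open>The bimodule structure \<open>(b \<delta> c)(a) = \<delta>(a)' c \<otimes> b \<delta>(a)''\<close>.\<close>

definition dder_left :: "('v, 'e) aexp \<Rightarrow> ('v, 'e) dder \<Rightarrow> ('v, 'e) dder" where
  "dder_left b \<delta> = (\<lambda>a. map (\<lambda>(u, w). (u, b \<cdot> w)) (\<delta> a))"

definition dder_right :: "('v, 'e) dder \<Rightarrow> ('v, 'e) aexp \<Rightarrow> ('v, 'e) dder" where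
  "dder_right \<delta> c = (\<lambda>a. map (\<lambda>(u, w). (u \<cdot> c, w)) (\<delta> a))"

definition dder_minus :: "('v, 'e) dder \<Rightarrow> ('v, 'e) dder \<Rightarrow> ('v, 'e) dder" where
  "dder_minus \<delta> \<delta>' = (\<lambda>a. \<delta> a @ tscale (-1) (\<delta>' a))"

definition dd_arrow :: "('v, 'e) quiver \<Rightarrow> 'e darr \<Rightarrow> 'e darr \<Rightarrow> ('v, 'e) tens" where
  "dd_arrow Q a b = (if b = a then [(Vert (dtail Q a), Vert (dhead Q a))] else [])"

text \<open>The double derivation \<open>\<partial>/\<partial>a\<close>; see \<open>double_derivation_dd\<close> and
  \<open>double_derivation_unique\<close> below. The clause for \<open>Inv b\<close> is the one forced by the
  Leibniz rule for \<open>(1 + b b\<^sup>*)\<inverse> (1 + b b\<^sup>*) = 1\<close>.\<close>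

primrec dd :: "('v, 'e) quiver \<Rightarrow> 'e darr \<Rightarrow> ('v, 'e) dder" where
  "dd Q a Zero = []"
| "dd Q a (Vert v) = []"
| "dd Q a (Arr b) = dd_arrow Q a b"
| "dd Q a (Inv b) = tscale (-1) (outer_left (Inv b) (outer_right
      (outer_right (dd_arrow Q a b) (Arr (dstar b)) @ outer_left (Arr b) (dd_arrow Q a (dstar b)))
      (Inv b)))"
| "dd Q a (e \<boxplus> f) = dd Q a e @ dd Q a f"
| "dd Q a (c \<star> e) = tscale c (dd Q a e)"
| "dd Q a (e \<cdot> f) = outer_right (dd Q a e) f @ outer_left e (dd Q a f)"

definition prod_bracket ::
  "('v, 'e) dder \<Rightarrow> ('v, 'e) dder \<Rightarrow> ('v, 'e) aexp \<Rightarrow> ('v, 'e) aexp \<Rightarrow> ('v, 'e) tens" where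
  "prod_bracket \<delta>\<^sub>1 \<delta>\<^sub>2 a b =
     [(fst y \<cdot> snd x, fst x \<cdot> snd y). x \<leftarrow> \<delta>\<^sub>1 a, y \<leftarrow> \<delta>\<^sub>2 b] @
     tscale (-1) [(fst y \<cdot> snd x, fst x \<cdot> snd y). x \<leftarrow> \<delta>\<^sub>2 a, y \<leftarrow> \<delta>\<^sub>1 b]"

definition F_der :: "('v, 'e) quiver \<Rightarrow> 'e darr \<Rightarrow> ('v, 'e) dder" where
  "F_der Q a = dder_minus (dder_right (dd Q (dstar a)) (Arr (dstar a))) (dder_left (Arr a) (dd Q a))"

text \<open>The formal sum \<open>P\<close>, as the list of its terms \<open>(c, \<delta>\<^sub>1, \<delta>\<^sub>2)\<close>, each standing for
  \<open>c \<delta>\<^sub>1 \<delta>\<^sub>2\<close>.\<close>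

definition P_biv ::
  "('v, 'e) quiver \<Rightarrow> (complex \<times> ('v, 'e) dder \<times> ('v, 'e) dder) list" where
  "P_biv Q =
     [(eps a / 2, dder_left (unit_elt Q \<boxplus> Arr (dstar a) \<cdot> Arr a) (dd Q a), dd Q (dstar a)).
        a \<leftarrow> darrs Q] @
     [(- 1 / 2, F_der Q a, F_der Q b).
        i \<leftarrow> verts Q, a \<leftarrow> darrs Q, b \<leftarrow> darrs Q,
        dtail Q a = i \<and> dtail Q b = i \<and> arrow_rank Q a < arrow_rank Q b]"

definition dbracket ::
  "('v, 'e) quiver \<Rightarrow> ('v, 'e) aexp \<Rightarrow> ('v, 'e) aexp \<Rightarrow> ('v, 'e) tens" where
  "dbracket Q a b = concat (map (\<lambda>(c, \<delta>\<^sub>1, \<delta>\<^sub>2). tscale c (prod_bracket \<delta>\<^sub>1 \<delta>\<^sub>2 a b)) (P_biv Q))"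


section \<open>Representations\<close>

definition minv :: "complex mat \<Rightarrow> complex mat" where
  "minv A = the (mat_inverse A)"

definition GLn :: "nat \<Rightarrow> complex mat set" where
  "GLn n = {A \<in> carrier_mat n n. invertible_mat A}"

type_synonym 'e rep = "'e darr \<Rightarrow> complex mat"

definition alg_reps :: "('v, 'e) quiver \<Rightarrow> ('v \<Rightarrow> nat) \<Rightarrow> 'e rep set" where
  "alg_reps Q \<alpha> =
     {p \<in> (\<Pi>\<^sub>E a\<in>set (darrs Q). carrier_mat (\<alpha> (dtail Q a)) (\<alpha> (dhead Q a))).
        \<forall>a\<in>set (darrs Q). 1\<^sub>m (\<alpha> (dtail Q a)) + p a * p (dstar a) \<in> GLn (\<alpha> (dtail Q a))}"

text \<open>\<open>ev Q \<alpha> p e s r\<close> is the block with rows at the vertex \<open>s\<close> and columns at the vertex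
  \<open>r\<close> of the matrix by which \<open>e\<close> acts in the representation \<open>p\<close>.\<close>

primrec ev :: "('v, 'e) quiver \<Rightarrow> ('v \<Rightarrow> nat) \<Rightarrow> 'e rep \<Rightarrow> ('v, 'e) aexp \<Rightarrow>
    'v \<Rightarrow> 'v \<Rightarrow> complex mat" where
  "ev Q \<alpha> p Zero = (\<lambda>s r. 0\<^sub>m (\<alpha> s) (\<alpha> r))"
| "ev Q \<alpha> p (Vert v) = (\<lambda>s r. if s = v \<and> r = v then 1\<^sub>m (\<alpha> v) else 0\<^sub>m (\<alpha> s) (\<alpha> r))"
| "ev Q \<alpha> p (Arr a) = (\<lambda>s r. if a \<in> set (darrs Q) \<and> s = dtail Q a \<and> r = dhead Q a
      then p a else 0\<^sub>m (\<alpha> s) (\<alpha> r))"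
| "ev Q \<alpha> p (Inv a) = (\<lambda>s r. if s = r
      then (if a \<in> set (darrs Q) \<and> s = dtail Q a then minv (1\<^sub>m (\<alpha> s) + p a * p (dstar a))
            else 1\<^sub>m (\<alpha> s))
      else 0\<^sub>m (\<alpha> s) (\<alpha> r))"
| "ev Q \<alpha> p (e \<boxplus> f) = (\<lambda>s r. ev Q \<alpha> p e s r + ev Q \<alpha> p f s r)"
| "ev Q \<alpha> p (c \<star> e) = (\<lambda>s r. c \<cdot>\<^sub>m ev Q \<alpha> p e s r)"
| "ev Q \<alpha> p (e \<cdot> f) = (\<lambda>s r. foldr (\<lambda>k M. ev Q \<alpha> p e s k * ev Q \<alpha> p f k r + M)
      (verts Q) (0\<^sub>m (\<alpha> s) (\<alpha> r)))"

text \<open>The bracket on the representation space is the biderivation that on coordinates is given by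
  \<open>{a\<^sub>i\<^sub>j, b\<^sub>u\<^sub>v} = {{a,b}}'\<^sub>u\<^sub>j {{a,b}}''\<^sub>i\<^sub>v\<close>; see \<open>rep_bracket_entry\<close> below for this
  rule on all of \<open>\<A>\<close>.\<close>

definition coord_bracket :: "('v, 'e) quiver \<Rightarrow> ('v \<Rightarrow> nat) \<Rightarrow> 'e rep \<Rightarrow>
    'e darr \<Rightarrow> nat \<Rightarrow> nat \<Rightarrow> 'e darr \<Rightarrow> nat \<Rightarrow> nat \<Rightarrow> complex" where
  "coord_bracket Q \<alpha> p a i j b u v =
     (\<Sum>(c, d)\<leftarrow>dbracket Q (Arr a) (Arr b).
        ev Q \<alpha> p c (dtail Q b) (dhead Q a) $$ (u, j) *
        ev Q \<alpha> p d (dtail Q a) (dhead Q b) $$ (i, v))"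

definition shift_entry :: "'e rep \<Rightarrow> 'e darr \<Rightarrow> nat \<Rightarrow> nat \<Rightarrow> complex \<Rightarrow> 'e rep" where
  "shift_entry p a i j z = p(a := mat (dim_row (p a)) (dim_col (p a))
     (\<lambda>kl. p a $$ kl + (if kl = (i, j) then z else 0)))"

definition coord_deriv :: "('e rep \<Rightarrow> complex) \<Rightarrow> 'e darr \<Rightarrow> nat \<Rightarrow> nat \<Rightarrow> 'e rep \<Rightarrow> complex" where
  "coord_deriv F a i j p = deriv (\<lambda>z. F (shift_entry p a i j z)) 0"

definition rep_bracket :: "('v, 'e) quiver \<Rightarrow> ('v \<Rightarrow> nat) \<Rightarrow>
    ('e rep \<Rightarrow> complex) \<Rightarrow> ('e rep \<Rightarrow> complex) \<Rightarrow> 'e rep \<Rightarrow> complex" where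
  "rep_bracket Q \<alpha> F G p =
     (\<Sum>a\<in>set (darrs Q). \<Sum>i<\<alpha> (dtail Q a). \<Sum>j<\<alpha> (dhead Q a).
      \<Sum>b\<in>set (darrs Q). \<Sum>u<\<alpha> (dtail Q b). \<Sum>v<\<alpha> (dhead Q b).
        coord_deriv F a i j p * coord_deriv G b u v p * coord_bracket Q \<alpha> p a i j b u v)"


section \<open>Quotient spaces, their functions and Poisson brackets\<close>

text \<open>\<open>ambient\<close> is a principal Zariski open subset of the representation space, \<open>locus\<close> a closed
  subset of it, and both are stable under the group \<open>\<Prod>\<^sub>v GL\<close> over the vertices \<open>v \<noteq> framing\<close>.\<close>

record ('v, 'e) quot_data =
  quiv :: "('v, 'e) quiver"
  dimv :: "'v \<Rightarrow> nat"
  framing :: 'v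
  ambient :: "'e rep set"
  locus :: "'e rep set"

definition gauge_group :: "('v, 'e) quot_data \<Rightarrow> ('v \<Rightarrow> complex mat) set" where
  "gauge_group D = {g. (\<forall>v\<in>set (verts (quiv D)). g v \<in> GLn (dimv D v)) \<and>
                 g (framing D) = 1\<^sub>m (dimv D (framing D))}"

definition gauge_act :: "('v, 'e) quot_data \<Rightarrow> ('v \<Rightarrow> complex mat) \<Rightarrow> 'e rep \<Rightarrow> 'e rep" where
  "gauge_act D g p =
     (\<lambda>a\<in>set (darrs (quiv D)). g (dtail (quiv D) a) * p a * minv (g (dhead (quiv D) a)))"

definition gauge_orbit :: "('v, 'e) quot_data \<Rightarrow> 'e rep \<Rightarrow> 'e rep set" where
  "gauge_orbit D p = (\<lambda>g. gauge_act D g p) ` gauge_group D"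

definition quot_space :: "('v, 'e) quot_data \<Rightarrow> 'e rep set set" where
  "quot_space D = gauge_orbit D ` locus D"

inductive regular_fun :: "('v, 'e) quot_data \<Rightarrow> ('e rep \<Rightarrow> complex) \<Rightarrow> bool" for D where
  regular_coord: "a \<in> set (darrs (quiv D)) \<Longrightarrow> i < dimv D (dtail (quiv D) a) \<Longrightarrow>
     j < dimv D (dhead (quiv D) a) \<Longrightarrow> regular_fun D (\<lambda>p. p a $$ (i, j))"
| regular_const: "regular_fun D (\<lambda>p. c)"
| regular_add: "regular_fun D F \<Longrightarrow> regular_fun D G \<Longrightarrow> regular_fun D (\<lambda>p. F p + G p)"
| regular_mult: "regular_fun D F \<Longrightarrow> regular_fun D G \<Longrightarrow> regular_fun D (\<lambda>p. F p * G p)"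
| regular_inverse: "regular_fun D F \<Longrightarrow> (\<And>p. p \<in> ambient D \<Longrightarrow> F p \<noteq> 0) \<Longrightarrow> regular_fun D (\<lambda>p. inverse (F p))"

text \<open>\<open>lifts D \<phi> F\<close>: the function \<open>\<phi>\<close> on the quotient is induced by the invariant regular
  function \<open>F\<close>. Only the values of \<open>\<phi>\<close> on \<open>quot_space D\<close> matter.\<close>

definition lifts :: "('v, 'e) quot_data \<Rightarrow> ('e rep set \<Rightarrow> complex) \<Rightarrow> ('e rep \<Rightarrow> complex) \<Rightarrow> bool" where
  "lifts D \<phi> F \<longleftrightarrow> regular_fun D F \<and>
     (\<forall>p\<in>ambient D. \<forall>g\<in>gauge_group D. F (gauge_act D g p) = F p) \<and>
     (\<forall>p\<in>locus D. \<phi> (gauge_orbit D p) = F p)"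

definition quot_functions :: "('v, 'e) quot_data \<Rightarrow> ('e rep set \<Rightarrow> complex) set" where
  "quot_functions D = {\<phi>. \<exists>F. lifts D \<phi> F}"

text \<open>The value is independent of the invariant lifts \<open>F, G\<close> and of the point \<open>p\<close> of the class:
  this is what it means that the bracket on the representation space induces one on the quotient.\<close>

definition poisson_bracket :: "('v, 'e) quot_data \<Rightarrow>
    ('e rep set \<Rightarrow> complex) \<Rightarrow> ('e rep set \<Rightarrow> complex) \<Rightarrow> 'e rep set \<Rightarrow> complex" where
  "poisson_bracket D \<phi> \<psi> c = (THE z. \<exists>F G p. lifts D \<phi> F \<and> lifts D \<psi> G \<and> p \<in> c \<and>
     z = rep_bracket (quiv D) (dimv D) F G p)"

definition poisson_map :: "('v, 'e) quot_data \<Rightarrow> ('w, 'f) quot_data \<Rightarrow>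
    ('e rep set \<Rightarrow> 'f rep set) \<Rightarrow> bool" where
  "poisson_map D D' \<xi> \<longleftrightarrow> (\<forall>\<phi>\<in>quot_functions D'. \<forall>\<psi>\<in>quot_functions D'. \<forall>c\<in>quot_space D.
     poisson_bracket D' \<phi> \<psi> (\<xi> c) = poisson_bracket D (\<phi> \<circ> \<xi>) (\<psi> \<circ> \<xi>) c)"

text \<open>Both spaces below are affine with coordinate ring \<open>quot_functions\<close>, so an isomorphism is a
  bijection identifying the coordinate rings.\<close>

definition variety_iso :: "('v, 'e) quot_data \<Rightarrow> ('w, 'f) quot_data \<Rightarrow>
    ('e rep set \<Rightarrow> 'f rep set) \<Rightarrow> bool" where
  "variety_iso D D' \<xi> \<longleftrightarrow> bij_betw \<xi> (quot_space D) (quot_space D') \<and>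
     (\<forall>\<phi>. \<phi> \<in> quot_functions D' \<longleftrightarrow> \<phi> \<circ> \<xi> \<in> quot_functions D)"


section \<open>The two Calogero--Moser spaces\<close>

text \<open>Residue classes modulo \<open>m\<close> are represented by \<open>0, \<dots>, m - 1\<close>.\<close>

datatype vert = Infty | Cyc nat

datatype arr = X_arr nat | V_arr

fun cm_dim :: "nat \<Rightarrow> vert \<Rightarrow> nat" where
  "cm_dim n Infty = 1"
| "cm_dim n (Cyc i) = n"

fun tadpole_rank :: "arr darr \<Rightarrow> nat" where
  "tadpole_rank (Arrow (X_arr i)) = 0"
| "tadpole_rank (Opp (X_arr i)) = 1"
| "tadpole_rank (Arrow V_arr) = 2"
| "tadpole_rank (Opp V_arr) = 3"

definition tadpole_quiver :: "(vert, arr) quiver" where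
  "tadpole_quiver = \<lparr>verts = [Infty, Cyc 0], arrs = [X_arr 0, V_arr],
     src = (\<lambda>a. Cyc 0),
     tgt = (\<lambda>a. case a of X_arr i \<Rightarrow> Cyc 0 | V_arr \<Rightarrow> Infty),
     arrow_rank = tadpole_rank\<rparr>"

fun cyclic_rank :: "arr darr \<Rightarrow> nat" where
  "cyclic_rank (Opp (X_arr i)) = 0"
| "cyclic_rank (Arrow (X_arr i)) = 1"
| "cyclic_rank (Arrow V_arr) = 2"
| "cyclic_rank (Opp V_arr) = 3"

definition cyclic_quiver :: "nat \<Rightarrow> (vert, arr) quiver" where
  "cyclic_quiver m = \<lparr>verts = Infty # map Cyc [0..<m], arrs = map X_arr [0..<m] @ [V_arr],
     src = (\<lambda>a. case a of X_arr i \<Rightarrow> Cyc i | V_arr \<Rightarrow> Cyc 0),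
     tgt = (\<lambda>a. case a of X_arr i \<Rightarrow> Cyc (Suc i mod m) | V_arr \<Rightarrow> Infty),
     arrow_rank = cyclic_rank\<rparr>"

type_synonym quad = "complex mat \<times> complex mat \<times> complex mat \<times> complex mat"

definition tad_quads :: "nat \<Rightarrow> complex \<Rightarrow> quad set" where
  "tad_quads n t = {(A, B, V, W). A \<in> GLn n \<and> B \<in> GLn n \<and> V \<in> carrier_mat n 1 \<and> W \<in> carrier_mat 1 n \<and>
     A * B * minv A * minv B * (1\<^sub>m n + V * W) = t \<cdot>\<^sub>m 1\<^sub>m n}"

definition tad_rep :: "quad \<Rightarrow> arr rep" where
  "tad_rep = (\<lambda>(A, B, V, W). \<lambda>a\<in>set (darrs tadpole_quiver).
     case a of Arrow (X_arr i) \<Rightarrow> A | Opp (X_arr i) \<Rightarrow> B - minv A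
             | Arrow V_arr \<Rightarrow> V | Opp V_arr \<Rightarrow> W)"

definition tad_space :: "nat \<Rightarrow> complex \<Rightarrow> (vert, arr) quot_data" where
  "tad_space n t = \<lparr>quiv = tadpole_quiver, dimv = cm_dim n, framing = Infty,
     ambient = {p \<in> alg_reps tadpole_quiver (cm_dim n). p (Arrow (X_arr 0)) \<in> GLn n},
     locus = tad_rep ` tad_quads n t\<rparr>"

type_synonym collection = "(nat \<Rightarrow> complex mat) \<times> (nat \<Rightarrow> complex mat) \<times> complex mat \<times> complex mat"

definition cyc_rep :: "nat \<Rightarrow> collection \<Rightarrow> arr rep" where
  "cyc_rep m = (\<lambda>(X, Y, V, W). \<lambda>a\<in>set (darrs (cyclic_quiver m)).
     case a of Arrow (X_arr i) \<Rightarrow> X i | Opp (X_arr i) \<Rightarrow> Y i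
             | Arrow V_arr \<Rightarrow> V | Opp V_arr \<Rightarrow> W)"

definition cyc_collections :: "nat \<Rightarrow> nat \<Rightarrow> (nat \<Rightarrow> complex) \<Rightarrow> collection set" where
  "cyc_collections m n q = {(X, Y, V, W).
     let Z = (\<lambda>i. Y i + minv (X i)); t = (\<Prod>i<m. q i) in
     (\<forall>i<m. X i \<in> GLn n \<and> Y i \<in> carrier_mat n n \<and> Z i \<in> GLn n) \<and>
     V \<in> carrier_mat n 1 \<and> W \<in> carrier_mat 1 n \<and>
     (\<forall>i\<in>{0<..<m}. minv (Z (i - 1) * X (i - 1)) * X i * Z i = q i \<cdot>\<^sub>m 1\<^sub>m n) \<and>
     minv (Z (m - 1) * X (m - 1)) * X 0 * Z 0 * (1\<^sub>m n + V * W) = q 0 \<cdot>\<^sub>m 1\<^sub>m n \<and>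
     1\<^sub>m 1 + W * V \<in> GLn 1 \<and> minv (1\<^sub>m 1 + W * V) = inverse (t ^ n) \<cdot>\<^sub>m 1\<^sub>m 1}"

definition cyc_space :: "nat \<Rightarrow> nat \<Rightarrow> (nat \<Rightarrow> complex) \<Rightarrow> (vert, arr) quot_data" where
  "cyc_space m n q = \<lparr>quiv = cyclic_quiver m, dimv = cm_dim n, framing = Infty,
     ambient = {p \<in> alg_reps (cyclic_quiver m) (cm_dim n). \<forall>i<m. p (Arrow (X_arr i)) \<in> GLn n},
     locus = cyc_rep m ` cyc_collections m n q\<rparr>"

text \<open>Roots of the affine root system of type \<open>A\<^sub>m\<^sub>-\<^sub>1\<^sup>(\<^sup>1\<^sup>)\<close> with \<open>m \<ge> 2\<close>, as integer vectors
  supported on \<open>{..<m}\<close>: the real roots form the orbits of the simple roots under the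
  reflections \<open>\<beta> \<mapsto> \<beta> - (\<beta>, \<epsilon>\<^sub>i) \<epsilon>\<^sub>i\<close>, the imaginary ones are the nonzero multiples of
  \<open>\<delta> = (1, \<dots>, 1)\<close>. For \<open>m = 2\<close> both neighbours of \<open>i\<close> coincide, as they must.\<close>

inductive_set real_roots :: "nat \<Rightarrow> (nat \<Rightarrow> int) set" for m where
  real_root_simple: "i < m \<Longrightarrow> (\<lambda>j. if j = i then 1 else 0) \<in> real_roots m"
| real_root_reflect: "\<beta> \<in> real_roots m \<Longrightarrow> i < m \<Longrightarrow>
     \<beta>(i := \<beta> i - (2 * \<beta> i - \<beta> ((i + 1) mod m) - \<beta> ((i + m - 1) mod m))) \<in> real_roots m"

definition imaginary_roots :: "nat \<Rightarrow> (nat \<Rightarrow> int) set" where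
  "imaginary_roots m = {(\<lambda>j. if j < m then k else 0) | k. k \<noteq> 0}"

definition regular_param :: "nat \<Rightarrow> (nat \<Rightarrow> complex) \<Rightarrow> bool" where
  "regular_param m q \<longleftrightarrow> (\<forall>\<beta>\<in>real_roots m \<union> imaginary_roots m. (\<Prod>i<m. q i powi \<beta> i) \<noteq> 1)"

text \<open>The representative of the image of a quadruple: here \<open>Y\<^sub>s = Z\<^sub>s - X\<^sub>s\<inverse>\<close>.\<close>

definition xi_collection :: "nat \<Rightarrow> nat \<Rightarrow> (nat \<Rightarrow> complex) \<Rightarrow> quad \<Rightarrow> collection" where
  "xi_collection m n q = (\<lambda>(A, B, V, W).
     let t = (\<Prod>i<m. q i);
         X = (\<lambda>s. if s = m - 1 then A else 1\<^sub>m n);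
         Z = (\<lambda>s. if s = m - 1 then t \<cdot>\<^sub>m (minv A * B) else (\<Prod>i\<le>s. q i) \<cdot>\<^sub>m B)
     in (X, (\<lambda>s. Z s - minv (X s)), minv A * minv B * V, W * B * A))"

text \<open>The union ranges over the images of all representatives of \<open>c\<close>; it is a single
  class.\<close>

definition xi :: "nat \<Rightarrow> nat \<Rightarrow> (nat \<Rightarrow> complex) \<Rightarrow> arr rep set \<Rightarrow> arr rep set" where
  "xi m n q c = (\<Union>P \<in> {P \<in> tad_quads n (\<Prod>i<m. q i). tad_rep P \<in> c}.
     gauge_orbit (cyc_space m n q) (cyc_rep m (xi_collection m n q P)))"


section \<open>Well-definedness of \<open>\<partial>/\<partial>a\<close>\<close>

lemma teq_Cons: "teq Q [x] [y] \<Longrightarrow> teq Q S T \<Longrightarrow> teq Q (x # S) (y # T)"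
  using teq.teq_append_cong[of Q "[x]" "[y]" S T] by simp

lemma teq_map_pointwise:
  "(\<And>u w. (u, w) \<in> set T \<Longrightarrow> teq Q [f (u, w)] [g (u, w)]) \<Longrightarrow> teq Q (map f T) (map g T)"
  by (induction T) (auto intro: teq.teq_refl teq_Cons)

lemma teq_map_pointwise':
  "(\<And>u w. (u, w) \<in> set T \<Longrightarrow> teq Q [f (u, w)] [(u, w)]) \<Longrightarrow> teq Q (map f T) T"
  using teq_map_pointwise[of T Q f "\<lambda>x. x"] by simp

lemma teq_cong_tscale: "teq Q S T \<Longrightarrow> teq Q (tscale c S) (tscale c T)"
proof (induction rule: teq.induct)
  case (teq_scale d u w)
  have "teq Q [(c \<star> d \<star> u, w)] [((c * d) \<star> u, w)]"
    by (intro teq.teq_cong aeq.aeq_scale_scale aeq.aeq_refl)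
  moreover have "teq Q [((c * d) \<star> u, w)] [((d * c) \<star> u, w)]"
    by (simp add: mult.commute teq.teq_refl)
  moreover have "teq Q [((d * c) \<star> u, w)] [(d \<star> (c \<star> u), w)]"
    by (intro teq.teq_cong aeq.aeq_refl aeq.aeq_sym[OF aeq.aeq_scale_scale])
  moreover have "teq Q [(d \<star> (c \<star> u), w)] [(c \<star> u, d \<star> w)]" by (rule teq.teq_scale)
  ultimately show ?case unfolding tscale_def by (auto intro: teq.teq_trans)
next
  case (teq_addl u u' w)
  have "teq Q [(c \<star> (u \<boxplus> u'), w)] [(c \<star> u \<boxplus> c \<star> u', w)]"
    by (intro teq.teq_cong aeq.aeq_scale_add aeq.aeq_refl)
  with teq.teq_addl[of Q "c \<star> u" "c \<star> u'" w] show ?case unfolding tscale_def by (auto intro: teq.teq_trans)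
next
  case (teq_addr u w w')
  show ?case using teq.teq_addr[of Q "c \<star> u" w w'] by (simp add: tscale_def)
next
  case (teq_zero w)
  have "teq Q [(c \<star> Zero, w)] [(Zero, c \<star> w)]" by (rule teq.teq_scale)
  with teq.teq_zero[of Q "c \<star> w"] show ?case unfolding tscale_def by (auto intro: teq.teq_trans)
qed (auto simp: tscale_def intro: teq.teq_refl teq.teq_sym teq.teq_trans teq.teq_append_cong teq.teq_comm teq.teq_cong aeq.aeq_scale_cong)

lemma aeq_mul_zero: "aeq Q (b \<cdot> Zero) Zero" "aeq Q (Zero \<cdot> b) Zero"
proof -
  have "aeq Q (b \<cdot> Zero) (b \<cdot> (0 \<star> Zero))" by (intro aeq.aeq_mul_cong aeq.aeq_refl aeq.aeq_sym[OF aeq.aeq_scale_zero])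
  thus "aeq Q (b \<cdot> Zero) Zero" using aeq.aeq_mul_scaler aeq.aeq_scale_zero aeq.aeq_trans by metis
  have "aeq Q (Zero \<cdot> b) ((0 \<star> Zero) \<cdot> b)" by (intro aeq.aeq_mul_cong aeq.aeq_refl aeq.aeq_sym[OF aeq.aeq_scale_zero])
  thus "aeq Q (Zero \<cdot> b) Zero" using aeq.aeq_mul_scalel aeq.aeq_scale_zero aeq.aeq_trans by metis
qed

lemma teq_cong_left: "teq Q S T \<Longrightarrow> teq Q (outer_left b S) (outer_left b T)"
proof (induction rule: teq.induct)
  case (teq_scale d u w)
  have "teq Q [(b \<cdot> (d \<star> u), w)] [(d \<star> (b \<cdot> u), w)]"
    by (intro teq.teq_cong aeq.aeq_mul_scaler aeq.aeq_refl)
  with teq.teq_scale[of Q d "b \<cdot> u" w] show ?case unfolding outer_left_def by (auto intro: teq.teq_trans)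
next
  case (teq_addl u u' w)
  have "teq Q [(b \<cdot> (u \<boxplus> u'), w)] [(b \<cdot> u \<boxplus> b \<cdot> u', w)]"
    by (intro teq.teq_cong aeq.aeq_mul_addr aeq.aeq_refl)
  with teq.teq_addl[of Q "b \<cdot> u" "b \<cdot> u'" w] show ?case unfolding outer_left_def by (auto intro: teq.teq_trans)
next
  case (teq_addr u w w')
  show ?case using teq.teq_addr[of Q "b \<cdot> u" w w'] by (simp add: outer_left_def)
next
  case (teq_zero w)
  have "teq Q [(b \<cdot> Zero, w)] [(Zero, w)]" by (intro teq.teq_cong aeq_mul_zero aeq.aeq_refl)
  with teq.teq_zero[of Q w] show ?case unfolding outer_left_def by (auto intro: teq.teq_trans)
qed (auto simp: outer_left_def intro: teq.teq_refl teq.teq_sym teq.teq_trans teq.teq_append_cong teq.teq_comm teq.teq_cong aeq.aeq_mul_cong aeq.aeq_refl)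

lemma teq_cong_right: "teq Q S T \<Longrightarrow> teq Q (outer_right S b) (outer_right T b)"
proof (induction rule: teq.induct)
  case (teq_scale d u w)
  have "teq Q [(u, d \<star> (w \<cdot> b))] [(u, (d \<star> w) \<cdot> b)]"
    by (intro teq.teq_cong aeq.aeq_refl aeq.aeq_sym[OF aeq.aeq_mul_scalel])
  with teq.teq_scale[of Q d "u" "w \<cdot> b"] show ?case unfolding outer_right_def by (auto intro: teq.teq_trans)
next
  case (teq_addr u w w')
  have "teq Q [(u, (w \<boxplus> w') \<cdot> b)] [(u, w \<cdot> b \<boxplus> w' \<cdot> b)]"
    by (intro teq.teq_cong aeq.aeq_mul_addl aeq.aeq_refl)
  with teq.teq_addr[of Q u "w \<cdot> b" "w' \<cdot> b"] show ?case unfolding outer_right_def by (auto intro: teq.teq_trans)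
next
  case (teq_addl u w w')
  show ?case using teq.teq_addl[of Q u w "w' \<cdot> b"] by (simp add: outer_right_def)
next
  case (teq_zero w)
  show ?case using teq.teq_zero[of Q "w \<cdot> b"] by (simp add: outer_right_def)
qed (auto simp: outer_right_def intro: teq.teq_refl teq.teq_sym teq.teq_trans teq.teq_append_cong teq.teq_comm teq.teq_cong aeq.aeq_mul_cong aeq.aeq_refl)

lemma teq_right_elt: "aeq Q b c \<Longrightarrow> teq Q (outer_right T b) (outer_right T c)"
  unfolding outer_right_def
  by (rule teq_map_pointwise) (auto intro!: teq.teq_cong aeq.aeq_refl aeq.aeq_mul_cong)

lemma teq_left_elt: "aeq Q b c \<Longrightarrow> teq Q (outer_left b T) (outer_left c T)"
  unfolding outer_left_def
  by (rule teq_map_pointwise) (auto intro!: teq.teq_cong aeq.aeq_refl aeq.aeq_mul_cong)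

lemma teq_tscale_zero: "teq Q (tscale 0 T) []"
proof (induction T)
  case (Cons x T)
  obtain u w where x: "x = (u, w)" by fastforce
  have "teq Q [(0 \<star> u, w)] []"
    by (rule teq.teq_trans[OF teq.teq_cong[OF aeq.aeq_scale_zero aeq.aeq_refl] teq.teq_zero])
  from teq.teq_append_cong[OF this Cons] show ?case by (simp add: tscale_def x)
qed (simp add: tscale_def teq.teq_refl)

lemma teq_tscale_add: "teq Q (tscale (c + d) T) (tscale c T @ tscale d T)"
proof (induction T)
  case (Cons x T)
  obtain u w where x: "x = (u, w)" by fastforce
  have "teq Q [((c + d) \<star> u, w)] [(c \<star> u, w), (d \<star> u, w)]"
    by (rule teq.teq_trans[OF teq.teq_cong[OF aeq.aeq_add_scale aeq.aeq_refl] teq.teq_addl])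
  from teq.teq_append_cong[OF this Cons]
  have 1: "teq Q (tscale (c + d) (x # T)) ((c \<star> u, w) # (d \<star> u, w) # tscale c T @ tscale d T)"
    by (simp add: tscale_def x)
  have "teq Q ((d \<star> u, w) # tscale c T) (tscale c T @ [(d \<star> u, w)])"
    using teq.teq_comm[of Q "[(d \<star> u, w)]" "tscale c T"] by simp
  from teq.teq_append_cong[OF teq.teq_append_cong[OF teq.teq_refl[of Q "[(c \<star> u, w)]"] this] teq.teq_refl[of Q "tscale d T"]]
  have "teq Q ((c \<star> u, w) # (d \<star> u, w) # tscale c T @ tscale d T) (tscale c (x # T) @ tscale d (x # T))"
    by (simp add: tscale_def x)
  with 1 show ?case by (rule teq.teq_trans)
qed (simp add: tscale_def teq.teq_refl)

lemma teq_cancel: "teq Q (tscale (-1) T @ T) []" "teq Q (T @ tscale (-1) T) []"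
proof -
  have "teq Q (tscale 1 T) T" unfolding tscale_def
    by (rule teq_map_pointwise') (auto intro!: teq.teq_cong aeq.aeq_refl aeq.aeq_scale_one)
  hence "teq Q (tscale (-1) T @ tscale 1 T) (tscale (-1) T @ T)" by (intro teq.teq_append_cong teq.teq_refl)
  moreover have "teq Q (tscale (-1) T @ tscale 1 T) []"
    using teq.teq_trans[OF teq.teq_sym[OF teq_tscale_add[of Q "-1" 1 T]]] teq_tscale_zero[of Q T] by simp
  ultimately show *: "teq Q (tscale (-1) T @ T) []" by (meson teq.teq_trans teq.teq_sym)
  show "teq Q (T @ tscale (-1) T) []" using * teq.teq_comm by (rule teq.teq_trans[rotated])
qed

lemma outer_append [simp]:
  "outer_left b (S @ T) = outer_left b S @ outer_left b T"
  "outer_right (S @ T) b = outer_right S b @ outer_right T b"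
  "tscale c (S @ T) = tscale c S @ tscale c T"
  "outer_left b [] = []" "outer_right [] b = []" "tscale c [] = []"
  by (simp_all add: outer_left_def outer_right_def tscale_def)

lemma dd_unit [simp]: "dd Q a (unit_elt Q) = []"
proof -
  have "dd Q a (foldr (\<lambda>v e. Vert v \<boxplus> e) vs Zero) = []" for vs by (induction vs) auto
  thus ?thesis by (simp add: unit_elt_def)
qed

lemmas out_defs = outer_left_def outer_right_def tscale_def

lemma teq_dd:
  assumes a: "a \<in> set (darrs Q)"
  shows "aeq Q e f \<Longrightarrow> teq Q (dd Q a e) (dd Q a f)"
proof (induction rule: aeq.induct)
  case (aeq_mul_cong e e' f f')
  show ?case
    using teq.teq_trans[OF teq_cong_right[OF aeq_mul_cong.IH(1)] teq_right_elt[OF aeq_mul_cong.hyps(2)]]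
      teq.teq_trans[OF teq_cong_left[OF aeq_mul_cong.IH(2)] teq_left_elt[OF aeq_mul_cong.hyps(1)]]
    by (auto intro: teq.teq_append_cong)
next
  case (aeq_scale_cong e e' c)
  then show ?case by (auto intro: teq_cong_tscale)
next
  case (aeq_add_scale c d e)
  show ?case by (simp add: teq_tscale_add)
next
  case (aeq_scale_scale c d e)
  show ?case by (simp add: tscale_def o_def split_def)
     (rule teq_map_pointwise, auto intro!: teq.teq_cong aeq.aeq_refl aeq.aeq_scale_scale)
next
  case (aeq_scale_one e)
  show ?case unfolding dd.simps tscale_def
    by (rule teq_map_pointwise', auto intro!: teq.teq_cong aeq.aeq_refl aeq.aeq_scale_one)
next
  case (aeq_scale_zero e)
  show ?case by (simp add: teq_tscale_zero)
next
  case (aeq_mul_assoc e f g)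
  have 1: "teq Q (outer_right (outer_right (dd Q a e) f) g) (outer_right (dd Q a e) (f \<cdot> g))"
    unfolding outer_right_def map_map
    by (rule teq_map_pointwise) (auto intro!: teq.teq_cong aeq.aeq_refl aeq.aeq_mul_assoc)
  have 2: "outer_right (outer_left e (dd Q a f)) g = outer_left e (outer_right (dd Q a f) g)"
    by (simp add: out_defs split_def)
  have 3: "teq Q (outer_left (e \<cdot> f) (dd Q a g)) (outer_left e (outer_left f (dd Q a g)))"
    unfolding outer_left_def map_map
    by (rule teq_map_pointwise) (auto intro!: teq.teq_cong aeq.aeq_refl aeq.aeq_mul_assoc)
  show ?case using 1 2 3 by (auto intro!: teq.teq_append_cong teq.teq_refl)
next
  case (aeq_mul_addl e f g)
  have "teq Q (outer_left (e \<boxplus> f) T) (outer_left e T @ outer_left f T)" for T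
  proof (induction T)
    case (Cons x T)
    obtain u w where x: "x = (u, w)" by fastforce
    have "teq Q [((e \<boxplus> f) \<cdot> u, w)] [(e \<cdot> u, w), (f \<cdot> u, w)]"
      by (rule teq.teq_trans[OF teq.teq_cong[OF aeq.aeq_mul_addl aeq.aeq_refl] teq.teq_addl])
    from teq.teq_append_cong[OF this Cons]
    have 1: "teq Q (outer_left (e \<boxplus> f) (x # T)) ((e \<cdot> u, w) # (f \<cdot> u, w) # outer_left e T @ outer_left f T)"
      by (simp add: outer_left_def x)
    have "teq Q ((f \<cdot> u, w) # outer_left e T) (outer_left e T @ [(f \<cdot> u, w)])"
      using teq.teq_comm[of Q "[(f \<cdot> u, w)]" "outer_left e T"] by simp
    from teq.teq_append_cong[OF teq.teq_append_cong[OF teq.teq_refl[of Q "[(e \<cdot> u, w)]"] this] teq.teq_refl[of Q "outer_left f T"]]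
    have "teq Q ((e \<cdot> u, w) # (f \<cdot> u, w) # outer_left e T @ outer_left f T)
       (outer_left e (x # T) @ outer_left f (x # T))"
      by (simp add: outer_left_def x)
    with 1 show ?case by (rule teq.teq_trans)
  qed (simp add: teq.teq_refl)
  note * = this[of "dd Q a g"]
  have "teq Q (outer_right (dd Q a e) g @ outer_right (dd Q a f) g @ outer_left (e \<boxplus> f) (dd Q a g))
     (outer_right (dd Q a e) g @ outer_right (dd Q a f) g @ outer_left e (dd Q a g) @ outer_left f (dd Q a g))"
    by (intro teq.teq_append_cong teq.teq_refl *)
  moreover have "teq Q ((outer_right (dd Q a f) g @ outer_left e (dd Q a g)) @ outer_left f (dd Q a g))
     ((outer_left e (dd Q a g) @ outer_right (dd Q a f) g) @ outer_left f (dd Q a g))"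
    by (intro teq.teq_append_cong teq.teq_refl teq.teq_comm)
  from teq.teq_append_cong[OF teq.teq_refl[of Q "outer_right (dd Q a e) g"] this]
  have "teq Q (outer_right (dd Q a e) g @ outer_right (dd Q a f) g @ outer_left e (dd Q a g) @ outer_left f (dd Q a g))
    (outer_right (dd Q a e) g @ outer_left e (dd Q a g) @ outer_right (dd Q a f) g @ outer_left f (dd Q a g))"
    by simp
  ultimately show ?case by simp (rule teq.teq_trans)
next
  case (aeq_mul_addr e f g)
  have "teq Q (outer_right T (f \<boxplus> g)) (outer_right T f @ outer_right T g)" for T
  proof (induction T)
    case (Cons x T)
    obtain u w where x: "x = (u, w)" by fastforce
    have "teq Q [(u, w \<cdot> (f \<boxplus> g))] [(u, w \<cdot> f), (u, w \<cdot> g)]"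
      by (rule teq.teq_trans[OF teq.teq_cong[OF aeq.aeq_refl aeq.aeq_mul_addr] teq.teq_addr])
    from teq.teq_append_cong[OF this Cons]
    have 1: "teq Q (outer_right (x # T) (f \<boxplus> g)) ((u, w \<cdot> f) # (u, w \<cdot> g) # outer_right T f @ outer_right T g)"
      by (simp add: outer_right_def x)
    have "teq Q ((u, w \<cdot> g) # outer_right T f) (outer_right T f @ [(u, w \<cdot> g)])"
      using teq.teq_comm[of Q "[(u, w \<cdot> g)]" "outer_right T f"] by simp
    from teq.teq_append_cong[OF teq.teq_append_cong[OF teq.teq_refl[of Q "[(u, w \<cdot> f)]"] this] teq.teq_refl[of Q "outer_right T g"]]
    have "teq Q ((u, w \<cdot> f) # (u, w \<cdot> g) # outer_right T f @ outer_right T g)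
       (outer_right (x # T) f @ outer_right (x # T) g)"
      by (simp add: outer_right_def x)
    with 1 show ?case by (rule teq.teq_trans)
  qed (simp add: teq.teq_refl)
  note * = this[of "dd Q a e"]
  have "teq Q (outer_right (dd Q a e) (f \<boxplus> g) @ outer_left e (dd Q a f) @ outer_left e (dd Q a g))
     ((outer_right (dd Q a e) f @ outer_right (dd Q a e) g) @ outer_left e (dd Q a f) @ outer_left e (dd Q a g))"
    by (intro teq.teq_append_cong teq.teq_refl *)
  moreover have "teq Q ((outer_right (dd Q a e) g @ outer_left e (dd Q a f)) @ outer_left e (dd Q a g))
     ((outer_left e (dd Q a f) @ outer_right (dd Q a e) g) @ outer_left e (dd Q a g))"
    by (intro teq.teq_append_cong teq.teq_refl teq.teq_comm)
  from teq.teq_append_cong[OF teq.teq_refl[of Q "outer_right (dd Q a e) f"] this]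
  have "teq Q ((outer_right (dd Q a e) f @ outer_right (dd Q a e) g) @ outer_left e (dd Q a f) @ outer_left e (dd Q a g))
    (outer_right (dd Q a e) f @ outer_left e (dd Q a f) @ outer_right (dd Q a e) g @ outer_left e (dd Q a g))"
    by simp
  ultimately show ?case by simp (rule teq.teq_trans)
next
  case (aeq_mul_scalel c e f)
  have 1: "outer_right (tscale c (dd Q a e)) f = tscale c (outer_right (dd Q a e) f)"
    by (simp add: out_defs split_def)
  have 2: "teq Q (outer_left (c \<star> e) (dd Q a f)) (tscale c (outer_left e (dd Q a f)))"
    unfolding outer_left_def tscale_def map_map
    by (rule teq_map_pointwise) (auto intro!: teq.teq_cong aeq.aeq_refl aeq.aeq_mul_scalel)
  show ?case using 1 2 by (auto intro!: teq.teq_append_cong teq.teq_refl)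
next
  case (aeq_mul_scaler e c f)
  have "teq Q [(u, w \<cdot> (c \<star> f))] [(c \<star> u, w \<cdot> f)]" for u w
    by (rule teq.teq_trans[OF teq.teq_cong[OF aeq.aeq_refl aeq.aeq_mul_scaler] teq.teq_sym[OF teq.teq_scale]])
  hence 1: "teq Q (outer_right (dd Q a e) (c \<star> f)) (tscale c (outer_right (dd Q a e) f))"
    unfolding outer_right_def tscale_def map_map by (intro teq_map_pointwise) auto
  have 2: "teq Q (outer_left e (tscale c (dd Q a f))) (tscale c (outer_left e (dd Q a f)))"
    unfolding outer_left_def tscale_def map_map
    by (rule teq_map_pointwise) (auto intro!: teq.teq_cong aeq.aeq_refl aeq.aeq_mul_scaler)
  show ?case using 1 2 by (auto intro!: teq.teq_append_cong)
next
  case (aeq_one_mul e)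
  show ?case by (simp add: outer_left_def)
     (rule teq_map_pointwise', auto intro!: teq.teq_cong aeq.aeq_refl aeq.aeq_one_mul)
next
  case (aeq_mul_one e)
  show ?case by (simp add: outer_right_def)
     (rule teq_map_pointwise', auto intro!: teq.teq_cong aeq.aeq_refl aeq.aeq_mul_one)
next
  case (aeq_no_arrow b)
  then show ?case using a by (auto simp: dd_arrow_def teq.teq_refl)
next
  case (aeq_tail b)
  show ?case by (auto simp: dd_arrow_def out_defs intro!: teq.teq_refl teq.teq_cong aeq.aeq_refl aeq.aeq_idem)
next
  case (aeq_head b)
  show ?case by (auto simp: dd_arrow_def out_defs intro!: teq.teq_refl teq.teq_cong aeq.aeq_refl aeq.aeq_idem)
next
  case (aeq_inv_left b)
  define X where "X = dd Q a (Arr b \<cdot> Arr (dstar b))"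
  let ?u = "unit_elt Q \<boxplus> Arr b \<cdot> Arr (dstar b)"
  have I: "dd Q a (Inv b) = tscale (-1) (outer_left (Inv b) (outer_right X (Inv b)))"
    by (simp add: X_def)
  have "aeq Q ((w \<cdot> Inv b) \<cdot> ?u) w" for w
    using aeq.aeq_mul_assoc aeq.aeq_mul_cong[OF aeq.aeq_refl aeq.aeq_inv_left] aeq.aeq_mul_one aeq.aeq_trans by metis
  hence 1: "teq Q (outer_right (dd Q a (Inv b)) ?u) (tscale (-1) (outer_left (Inv b) X))"
    unfolding I out_defs map_map
    by (intro teq_map_pointwise) (auto intro!: teq.teq_cong aeq.aeq_refl)
  have "dd Q a (Inv b \<cdot> ?u) = outer_right (dd Q a (Inv b)) ?u @ outer_left (Inv b) X"
    by (simp add: X_def)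
  moreover have "teq Q \<dots> (tscale (-1) (outer_left (Inv b) X) @ outer_left (Inv b) X)"
    by (intro teq.teq_append_cong teq.teq_refl 1)
  ultimately show ?case using teq_cancel(1)[of Q "outer_left (Inv b) X"]
    by (metis teq.teq_trans dd_unit)
next
  case (aeq_inv_right b)
  define X where "X = dd Q a (Arr b \<cdot> Arr (dstar b))"
  let ?u = "unit_elt Q \<boxplus> Arr b \<cdot> Arr (dstar b)"
  have I: "dd Q a (Inv b) = tscale (-1) (outer_left (Inv b) (outer_right X (Inv b)))"
    by (simp add: X_def)
  have "aeq Q (?u \<cdot> (Inv b \<cdot> w)) w" for w
    using aeq.aeq_sym[OF aeq.aeq_mul_assoc] aeq.aeq_mul_cong[OF aeq.aeq_inv_right aeq.aeq_refl] aeq.aeq_one_mul aeq.aeq_trans by metis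
  moreover have "aeq Q (?u \<cdot> (c \<star> (Inv b \<cdot> w))) (c \<star> (?u \<cdot> (Inv b \<cdot> w)))" for c w
    by (rule aeq.aeq_mul_scaler)
  ultimately have "aeq Q (?u \<cdot> (c \<star> (Inv b \<cdot> w))) (c \<star> w)" for c w
    by (meson aeq.aeq_trans aeq.aeq_scale_cong)
  hence 1: "teq Q (outer_left ?u (dd Q a (Inv b))) (tscale (-1) (outer_right X (Inv b)))"
    unfolding I out_defs map_map
    by (intro teq_map_pointwise) (auto intro!: teq.teq_cong aeq.aeq_refl)
  have "dd Q a (?u \<cdot> Inv b) = outer_right X (Inv b) @ outer_left ?u (dd Q a (Inv b))"
    by (simp add: X_def)
  moreover have "teq Q \<dots> (outer_right X (Inv b) @ tscale (-1) (outer_right X (Inv b)))"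
    by (intro teq.teq_append_cong teq.teq_refl 1)
  ultimately show ?case using teq_cancel(2)[of Q "outer_right X (Inv b)"]
    by (metis teq.teq_trans dd_unit)
qed (auto intro: teq.teq_refl teq.teq_sym teq.teq_trans teq.teq_append_cong teq.teq_comm)

lemma double_derivation_dd:
  "a \<in> set (darrs Q) \<Longrightarrow> double_derivation Q (dd Q a)"
  by (auto simp: double_derivation_def teq_dd teq.teq_refl)

lemma double_derivation_unique:
  assumes d: "double_derivation Q \<delta>" "double_derivation Q \<delta>'"
    and eq: "\<And>a. a \<in> set (darrs Q) \<Longrightarrow> teq Q (\<delta> (Arr a)) (\<delta>' (Arr a))"
  shows "teq Q (\<delta> e) (\<delta>' e)"
proof -
  note D = d[unfolded double_derivation_def]
  have zero: "teq Q (\<delta> Zero) []" if "double_derivation Q \<delta>" for \<delta>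
  proof -
    from that have "teq Q (\<delta> Zero) (\<delta> (0 \<star> Zero))" "teq Q (\<delta> (0 \<star> Zero)) (tscale 0 (\<delta> Zero))"
      unfolding double_derivation_def using aeq.aeq_sym[OF aeq.aeq_scale_zero] by blast+
    thus ?thesis using teq_tscale_zero teq.teq_trans by blast
  qed
  have unit: "teq Q (\<delta> (unit_elt Q)) []" if "double_derivation Q \<delta>" for \<delta>
  proof -
    have "teq Q (\<delta> (foldr (\<lambda>v e. Vert v \<boxplus> e) vs Zero)) []" for vs
    proof (induction vs)
      case (Cons v vs)
      have "teq Q (\<delta> (Vert v)) []" using that by (auto simp: double_derivation_def)
      from teq.teq_append_cong[OF this Cons] show ?case
        using that unfolding double_derivation_def by simp (meson teq.teq_trans)
    qed (simp add: zero[OF that])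
    thus ?thesis by (simp add: unit_elt_def)
  qed
  have arr: "teq Q (\<delta> (Arr a)) (\<delta>' (Arr a))" for a
  proof (cases "a \<in> set (darrs Q)")
    case False
    hence "aeq Q (Arr a) Zero" by (rule aeq.aeq_no_arrow)
    hence "teq Q (\<delta> (Arr a)) []" "teq Q (\<delta>' (Arr a)) []"
      using D zero[OF d(1)] zero[OF d(2)] by (meson teq.teq_trans)+
    thus ?thesis by (meson teq.teq_trans teq.teq_sym)
  qed (rule eq)
  have mul: "teq Q (\<delta> (e \<cdot> f)) (\<delta>' (e \<cdot> f))"
    if "teq Q (\<delta> e) (\<delta>' e)" "teq Q (\<delta> f) (\<delta>' f)" for e f
  proof -
    have "teq Q (outer_right (\<delta> e) f @ outer_left e (\<delta> f)) (outer_right (\<delta>' e) f @ outer_left e (\<delta>' f))"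
      by (intro teq.teq_append_cong teq_cong_left teq_cong_right that)
    thus ?thesis using D by (meson teq.teq_trans teq.teq_sym)
  qed
  show ?thesis
  proof (induction e)
    case Zero show ?case using zero[OF d(1)] zero[OF d(2)] by (meson teq.teq_trans teq.teq_sym)
  next
    case (Vert v) show ?case using D by (meson teq.teq_trans teq.teq_sym)
  next
    case (Arr a) show ?case by (rule arr)
  next
    case (Inv b)
    let ?u = "unit_elt Q \<boxplus> Arr b \<cdot> Arr (dstar b)"
    have inv: "teq Q (\<delta> (Inv b)) (tscale (-1) (outer_right (outer_left (Inv b) (\<delta> ?u)) (Inv b)))"
      if dd: "double_derivation Q \<delta>" for \<delta>
    proof -
      have "teq Q (\<delta> (Inv b \<cdot> ?u)) []"
        using dd unit[OF dd] aeq.aeq_inv_left[of Q b] unfolding double_derivation_def by (meson teq.teq_trans)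
      hence "teq Q (outer_right (\<delta> (Inv b)) ?u @ outer_left (Inv b) (\<delta> ?u)) []"
        using dd unfolding double_derivation_def by (meson teq.teq_trans teq.teq_sym)
      from teq_cong_right[OF this, of "Inv b"]
      have A: "teq Q (outer_right (outer_right (\<delta> (Inv b)) ?u) (Inv b) @
          outer_right (outer_left (Inv b) (\<delta> ?u)) (Inv b)) []" by simp
      have "aeq Q ((w \<cdot> ?u) \<cdot> Inv b) w" for w
        using aeq.aeq_mul_assoc aeq.aeq_mul_cong[OF aeq.aeq_refl aeq.aeq_inv_right] aeq.aeq_mul_one aeq.aeq_trans by metis
      hence B: "teq Q (outer_right (outer_right (\<delta> (Inv b)) ?u) (Inv b)) (\<delta> (Inv b))"
        unfolding outer_right_def map_map
        by (intro teq_map_pointwise') (auto intro!: teq.teq_cong aeq.aeq_refl)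
      let ?R = "outer_right (outer_left (Inv b) (\<delta> ?u)) (Inv b)"
      have "teq Q (\<delta> (Inv b) @ ?R) []"
        using A teq.teq_append_cong[OF teq.teq_sym[OF B] teq.teq_refl[of Q ?R]] by (meson teq.teq_trans)
      from teq.teq_append_cong[OF this teq.teq_refl[of Q "tscale (-1) ?R"]]
      have 1: "teq Q (\<delta> (Inv b) @ ?R @ tscale (-1) ?R) (tscale (-1) ?R)" by simp
      have 2: "teq Q (\<delta> (Inv b) @ ?R @ tscale (-1) ?R) (\<delta> (Inv b))"
        using teq.teq_append_cong[OF teq.teq_refl[of Q "\<delta> (Inv b)"] teq_cancel(2)[of Q ?R]] by simp
      show ?thesis using 1 2 by (meson teq.teq_trans teq.teq_sym)
    qed
    have "teq Q (\<delta> ?u) (\<delta>' ?u)"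
    proof -
      have "teq Q (\<delta> (unit_elt Q) @ \<delta> (Arr b \<cdot> Arr (dstar b))) (\<delta>' (unit_elt Q) @ \<delta>' (Arr b \<cdot> Arr (dstar b)))"
        using unit[OF d(1)] unit[OF d(2)] mul[OF arr arr]
        by (intro teq.teq_append_cong) (meson teq.teq_trans teq.teq_sym)+
      thus ?thesis using D by (meson teq.teq_trans teq.teq_sym)
    qed
    hence "teq Q (tscale (-1) (outer_right (outer_left (Inv b) (\<delta> ?u)) (Inv b)))
      (tscale (-1) (outer_right (outer_left (Inv b) (\<delta>' ?u)) (Inv b)))"
      by (intro teq_cong_tscale teq_cong_right teq_cong_left)
    thus ?case using inv[OF d(1)] inv[OF d(2)] by (meson teq.teq_trans teq.teq_sym)
  next
    case (Add e f)
    from teq.teq_append_cong[OF this] show ?case using D by (meson teq.teq_trans teq.teq_sym)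
  next
    case (Scale c e)
    from teq_cong_tscale[OF this] show ?case using D by (meson teq.teq_trans teq.teq_sym)
  next
    case (Mul e f) thus ?case by (rule mul)
  qed
qed


section \<open>Matrix entries and the bracket rule on the whole algebra\<close>

definition vidx :: "('v, 'e) quiver \<Rightarrow> ('v \<Rightarrow> nat) \<Rightarrow> ('v \<times> nat) set" where
  "vidx Q \<alpha> = Sigma (set (verts Q)) (\<lambda>v. {..<\<alpha> v})"

definition entry :: "('v, 'e) quiver \<Rightarrow> ('v \<Rightarrow> nat) \<Rightarrow> 'e rep \<Rightarrow> ('v, 'e) aexp \<Rightarrow>
    'v \<times> nat \<Rightarrow> 'v \<times> nat \<Rightarrow> complex" where
  "entry Q \<alpha> p e x y = ev Q \<alpha> p e (fst x) (fst y) $$ (snd x, snd y)"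

lemma finite_vidx [simp]: "finite (vidx Q \<alpha>)"
  by (simp add: vidx_def)

lemma vidxD: "x \<in> vidx Q \<alpha> \<Longrightarrow> fst x \<in> set (verts Q) \<and> snd x < \<alpha> (fst x)"
  by (auto simp: vidx_def)

lemma minv:
  assumes "A \<in> GLn n"
  shows "minv A \<in> carrier_mat n n" "A * minv A = 1\<^sub>m n" "minv A * A = 1\<^sub>m n"
proof -
  have A: "A \<in> carrier_mat n n" and inv: "invertible_mat A" using assms by (auto simp: GLn_def)
  from inv obtain B where "inverts_mat A B" "inverts_mat B A" by (auto simp: invertible_mat_def)
  hence AB: "A * B = 1\<^sub>m n" "B * A = 1\<^sub>m (dim_row B)" using A by (auto simp: inverts_mat_def)
  have "dim_col B = n" using AB(1) by (metis index_mult_mat(3) index_one_mat(3))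
  moreover have "dim_row B = n" using AB(2) A by (metis index_mult_mat(3) index_one_mat(3) carrier_matD(2))
  ultimately have B: "B \<in> carrier_mat n n" by auto
  have "A \<in> Units (ring_mat TYPE(complex) n ())"
    using A B AB by (auto simp: Units_def ring_mat_def)
  then obtain C where C: "mat_inverse A = Some C" using mat_inverse(1)[OF A, where b="()"] by (cases "mat_inverse A") auto
  from mat_inverse(2)[OF A this] C
  show "minv A \<in> carrier_mat n n" "A * minv A = 1\<^sub>m n" "minv A * A = 1\<^sub>m n" by (auto simp: minv_def)
qed

lemma alg_repsD:
  assumes "p \<in> alg_reps Q \<alpha>" "a \<in> set (darrs Q)"
  shows "p a \<in> carrier_mat (\<alpha> (dtail Q a)) (\<alpha> (dhead Q a))"
    "1\<^sub>m (\<alpha> (dtail Q a)) + p a * p (dstar a) \<in> GLn (\<alpha> (dtail Q a))"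
  using assms by (auto simp: alg_reps_def)

lemma dstar_simps [simp]:
  "dtail Q (dstar a) = dhead Q a" "dhead Q (dstar a) = dtail Q a"
  "dstar a \<in> set (darrs Q) \<longleftrightarrow> a \<in> set (darrs Q)"
  by (cases a; force simp: darrs_def)+

lemma foldr_carrier:
  "(\<And>k. k \<in> set vs \<Longrightarrow> A k \<in> carrier_mat n m) \<Longrightarrow>
   foldr (\<lambda>k M. A k + M) vs (0\<^sub>m n m) \<in> carrier_mat n m"
  by (induction vs) auto

lemma foldr_index:
  "(\<And>k. k \<in> set vs \<Longrightarrow> A k \<in> carrier_mat n m) \<Longrightarrow> distinct vs \<Longrightarrow> i < n \<Longrightarrow> j < m \<Longrightarrow>
   foldr (\<lambda>k M. A k + M) vs (0\<^sub>m n m) $$ (i, j) = (\<Sum>k\<in>set vs. A k $$ (i, j))"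
proof (induction vs)
  case (Cons v vs)
  have "foldr (\<lambda>k M. A k + M) vs (0\<^sub>m n m) \<in> carrier_mat n m"
    by (rule foldr_carrier) (use Cons.prems in auto)
  with Cons show ?case by (auto simp del: index_add_mat simp: index_add_mat(1)[of i _ j])
qed auto

lemma ev_carrier: "p \<in> alg_reps Q \<alpha> \<Longrightarrow> ev Q \<alpha> p e s r \<in> carrier_mat (\<alpha> s) (\<alpha> r)"
proof (induction e arbitrary: s r)
  case (Inv a) thus ?case using minv(1)[OF alg_repsD(2)] by auto
next
  case (Mul e f) thus ?case by (auto intro!: foldr_carrier mult_carrier_mat)
qed (use alg_repsD(1) in auto)

lemma wf_quiverD:
  assumes "wf_quiver Q"
  shows "distinct (verts Q)" "a \<in> set (darrs Q) \<Longrightarrow> dtail Q a \<in> set (verts Q)"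
    "a \<in> set (darrs Q) \<Longrightarrow> dhead Q a \<in> set (verts Q)" "distinct (darrs Q)"
  using assms by (auto simp: wf_quiver_def darrs_def distinct_map inj_on_def)

lemma entry_simps:
  assumes wf: "wf_quiver Q" and p: "p \<in> alg_reps Q \<alpha>"
    and x: "x \<in> vidx Q \<alpha>" and y: "y \<in> vidx Q \<alpha>"
  shows "entry Q \<alpha> p Zero x y = 0"
    "entry Q \<alpha> p (Vert v) x y = (if fst x = v \<and> x = y then 1 else 0)"
    "entry Q \<alpha> p (e \<boxplus> f) x y = entry Q \<alpha> p e x y + entry Q \<alpha> p f x y"
    "entry Q \<alpha> p (c \<star> e) x y = c * entry Q \<alpha> p e x y"
    "entry Q \<alpha> p (e \<cdot> f) x y = (\<Sum>z\<in>vidx Q \<alpha>. entry Q \<alpha> p e x z * entry Q \<alpha> p f z y)"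
proof -
  note xy = vidxD[OF x] vidxD[OF y]
  note car = ev_carrier[OF p]
  have dims [simp]: "dim_row (ev Q \<alpha> p e s r) = \<alpha> s" "dim_col (ev Q \<alpha> p e s r) = \<alpha> r" for e s r
    using car[of e s r] by auto
  show "entry Q \<alpha> p Zero x y = 0"
    "entry Q \<alpha> p (Vert v) x y = (if fst x = v \<and> x = y then 1 else 0)"
    "entry Q \<alpha> p (e \<boxplus> f) x y = entry Q \<alpha> p e x y + entry Q \<alpha> p f x y"
    "entry Q \<alpha> p (c \<star> e) x y = c * entry Q \<alpha> p e x y"
    using xy by (auto simp: entry_def prod_eq_iff)
  have "entry Q \<alpha> p (e \<cdot> f) x y =
      (\<Sum>k\<in>set (verts Q). (ev Q \<alpha> p e (fst x) k * ev Q \<alpha> p f k (fst y)) $$ (snd x, snd y))"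
    unfolding entry_def ev.simps
    by (rule foldr_index) (use xy wf_quiverD(1)[OF wf] car in \<open>auto intro: mult_carrier_mat\<close>)
  also have "\<dots> = (\<Sum>k\<in>set (verts Q). \<Sum>l<\<alpha> k. entry Q \<alpha> p e x (k, l) * entry Q \<alpha> p f (k, l) y)"
    using xy by (intro sum.cong refl) (auto simp: scalar_prod_def entry_def atLeast0LessThan)
  also have "\<dots> = (\<Sum>z\<in>vidx Q \<alpha>. entry Q \<alpha> p e x z * entry Q \<alpha> p f z y)"
    unfolding vidx_def by (subst sum.Sigma) (auto simp: split_def)
  finally show "entry Q \<alpha> p (e \<cdot> f) x y = (\<Sum>z\<in>vidx Q \<alpha>. entry Q \<alpha> p e x z * entry Q \<alpha> p f z y)" .
qed

lemma sum_delta_vidx: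
  assumes "x \<in> vidx Q \<alpha>"
  shows "(\<Sum>z\<in>vidx Q \<alpha>. (if x = z then 1 else 0) * f z) = (f x :: complex)"
    "(\<Sum>z\<in>vidx Q \<alpha>. f z * (if z = x then 1 else 0)) = (f x :: complex)"
proof -
  have "(\<Sum>z\<in>vidx Q \<alpha>. (if x = z then 1 else 0) * f z) = (\<Sum>z\<in>vidx Q \<alpha>. if x = z then f z else 0)"
    by (rule sum.cong) auto
  thus "(\<Sum>z\<in>vidx Q \<alpha>. (if x = z then 1 else 0) * f z) = f x" using assms by simp
  have "(\<Sum>z\<in>vidx Q \<alpha>. f z * (if z = x then 1 else 0)) = (\<Sum>z\<in>vidx Q \<alpha>. if z = x then f z else 0)"
    by (rule sum.cong) auto
  thus "(\<Sum>z\<in>vidx Q \<alpha>. f z * (if z = x then 1 else 0)) = f x" using assms by simp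
qed

lemma entry_unit:
  assumes wf: "wf_quiver Q" and p: "p \<in> alg_reps Q \<alpha>"
    and x: "x \<in> vidx Q \<alpha>" and y: "y \<in> vidx Q \<alpha>"
  shows "entry Q \<alpha> p (unit_elt Q) x y = (if x = y then 1 else 0)"
proof -
  note s = entry_simps[OF wf p x y]
  have "distinct vs \<Longrightarrow> entry Q \<alpha> p (foldr (\<lambda>v e. Vert v \<boxplus> e) vs Zero) x y =
      (if fst x \<in> set vs \<and> x = y then 1 else 0)" for vs
    by (induction vs) (auto simp: s)
  thus ?thesis using wf_quiverD(1)[OF wf] vidxD[OF x] by (simp add: unit_elt_def)
qed

lemma entry_arr:
  assumes "x \<in> vidx Q \<alpha>" "y \<in> vidx Q \<alpha>"
  shows "entry Q \<alpha> p (Arr a) x y =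
    (if a \<in> set (darrs Q) \<and> fst x = dtail Q a \<and> fst y = dhead Q a then p a $$ (snd x, snd y) else 0)"
  using vidxD[OF assms(1)] vidxD[OF assms(2)] by (auto simp: entry_def)

lemma entry_inv:
  assumes wf: "wf_quiver Q" and p: "p \<in> alg_reps Q \<alpha>"
    and x: "x \<in> vidx Q \<alpha>" and y: "y \<in> vidx Q \<alpha>"
  shows "entry Q \<alpha> p (Inv a \<cdot> (unit_elt Q \<boxplus> Arr a \<cdot> Arr (dstar a))) x y = (if x = y then 1 else 0)"
    "entry Q \<alpha> p ((unit_elt Q \<boxplus> Arr a \<cdot> Arr (dstar a)) \<cdot> Inv a) x y = (if x = y then 1 else 0)"
proof -
  define M where "M = 1\<^sub>m (\<alpha> (dtail Q a)) + p a * p (dstar a)"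
  let ?u = "unit_elt Q \<boxplus> Arr a \<cdot> Arr (dstar a)"
  let ?t = "dtail Q a"
  have U: "entry Q \<alpha> p ?u x y =
      (if fst x = fst y then if a \<in> set (darrs Q) \<and> fst x = ?t then M $$ (snd x, snd y)
       else if x = y then 1 else 0 else 0)" (is "_ = ?M x y")
    if x: "x \<in> vidx Q \<alpha>" and y: "y \<in> vidx Q \<alpha>" for x y
  proof -
    have "entry Q \<alpha> p (Arr a \<cdot> Arr (dstar a)) x y =
      (\<Sum>k\<in>set (verts Q). \<Sum>l<\<alpha> k. entry Q \<alpha> p (Arr a) x (k, l) * entry Q \<alpha> p (Arr (dstar a)) (k, l) y)"
      unfolding entry_simps(5)[OF wf p x y]
      unfolding vidx_def by (subst sum.Sigma) (auto simp: split_def)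
    also have "\<dots> = (\<Sum>k\<in>set (verts Q). if k = dhead Q a then
         (if a \<in> set (darrs Q) \<and> fst x = ?t \<and> fst y = ?t then
         (\<Sum>l<\<alpha> k. p a $$ (snd x, l) * p (dstar a) $$ (l, snd y)) else 0) else 0)"
      using x y by (intro sum.cong refl) (auto simp: entry_arr vidx_def)
    also have "\<dots> = (if a \<in> set (darrs Q) \<and> fst x = ?t \<and> fst y = ?t then
         (\<Sum>l<\<alpha> (dhead Q a). p a $$ (snd x, l) * p (dstar a) $$ (l, snd y)) else 0)"
      using wf_quiverD(3)[OF wf, of a] by auto
    also have "\<dots> = (if a \<in> set (darrs Q) \<and> fst x = ?t \<and> fst y = ?t then (p a * p (dstar a)) $$ (snd x, snd y) else 0)"
      using alg_repsD(1)[OF p, of a] alg_repsD(1)[OF p, of "dstar a"] vidxD[OF x] vidxD[OF y]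
      by (auto simp: scalar_prod_def atLeast0LessThan)
    finally show ?thesis
      using alg_repsD(1)[OF p, of a] alg_repsD(1)[OF p, of "dstar a"] vidxD[OF x] vidxD[OF y]
      by (auto simp: entry_simps[OF wf p x y] entry_unit[OF wf p x y] M_def prod_eq_iff)
  qed
  have V: "entry Q \<alpha> p (Inv a) x y =
      (if fst x = fst y then if a \<in> set (darrs Q) \<and> fst x = ?t then minv M $$ (snd x, snd y)
       else if x = y then 1 else 0 else 0)"
    if x: "x \<in> vidx Q \<alpha>" and y: "y \<in> vidx Q \<alpha>" for x y
    using vidxD[OF x] vidxD[OF y] by (auto simp: entry_def M_def prod_eq_iff)
  have prod: "(\<Sum>z\<in>vidx Q \<alpha>. F x z * G z y) = (if x = y then 1 else (0::complex))"
    if F: "\<And>z. z \<in> vidx Q \<alpha> \<Longrightarrow> F x z = (if fst x = fst z then if a \<in> set (darrs Q) \<and> fst x = ?t then A $$ (snd x, snd z)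
       else if x = z then 1 else 0 else 0)"
      and G: "\<And>z. z \<in> vidx Q \<alpha> \<Longrightarrow> G z y = (if fst z = fst y then if a \<in> set (darrs Q) \<and> fst z = ?t then B $$ (snd z, snd y)
       else if z = y then 1 else 0 else 0)"
      and AB: "a \<in> set (darrs Q) \<Longrightarrow> A \<in> carrier_mat (\<alpha> ?t) (\<alpha> ?t) \<and> B \<in> carrier_mat (\<alpha> ?t) (\<alpha> ?t) \<and> A * B = 1\<^sub>m (\<alpha> ?t)"
    for F G A B
  proof (cases "a \<in> set (darrs Q) \<and> fst x = ?t")
    case False
    have "(\<Sum>z\<in>vidx Q \<alpha>. F x z * G z y) = (\<Sum>z\<in>vidx Q \<alpha>. (if x = z then 1 else 0) * G z y)"
      using False by (intro sum.cong refl) (auto simp: F)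
    also have "\<dots> = G x y" using x by (rule sum_delta_vidx)
    finally show ?thesis using False x by (auto simp: G)
  next
    case True
    note c = AB[OF conjunct1[OF True]]
    have "(\<Sum>z\<in>vidx Q \<alpha>. F x z * G z y) = (\<Sum>k\<in>set (verts Q). \<Sum>l<\<alpha> k. F x (k, l) * G (k, l) y)"
      unfolding vidx_def by (subst sum.Sigma) (auto simp: split_def)
    also have "\<dots> = (\<Sum>k\<in>set (verts Q). if k = ?t then
        (\<Sum>l<\<alpha> k. A $$ (snd x, l) * (if fst y = ?t then B $$ (l, snd y) else 0)) else 0)"
      using True by (intro sum.cong refl) (auto simp: F G vidx_def intro!: sum.cong)
    also have "\<dots> = (\<Sum>l<\<alpha> ?t. A $$ (snd x, l) * (if fst y = ?t then B $$ (l, snd y) else 0))"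
      using wf_quiverD(2)[OF wf, of a] True by auto
    also have "\<dots> = (if fst y = ?t then (A * B) $$ (snd x, snd y) else 0)"
    proof (cases "fst y = ?t")
      case y: True
      have "snd x < dim_row A" "snd y < dim_col B" using c vidxD[OF x] vidxD[OF assms(4)] True y by auto
      hence "(A * B) $$ (snd x, snd y) = (\<Sum>l<\<alpha> ?t. A $$ (snd x, l) * B $$ (l, snd y))"
        using c by (subst index_mult_mat(1)) (auto simp: scalar_prod_def atLeast0LessThan)
      thus ?thesis using y by simp
    qed simp
    finally show ?thesis using c vidxD[OF x] vidxD[OF y] True by (auto simp: prod_eq_iff)
  qed
  note Mi = minv[OF alg_repsD(2)[OF p], of a, folded M_def]
  have Mc: "a \<in> set (darrs Q) \<Longrightarrow> M \<in> carrier_mat (\<alpha> ?t) (\<alpha> ?t)"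
    using alg_repsD(2)[OF p, of a] by (auto simp: M_def GLn_def)
  show "entry Q \<alpha> p (Inv a \<cdot> ?u) x y = (if x = y then 1 else 0)"
    unfolding entry_simps(5)[OF wf p x y]
    by (rule prod[where A="minv M" and B=M]) (use Mi Mc U V x y in auto)
  show "entry Q \<alpha> p (?u \<cdot> Inv a) x y = (if x = y then 1 else 0)"
    unfolding entry_simps(5)[OF wf p x y]
    by (rule prod[where A=M and B="minv M"]) (use Mi Mc U V x y in auto)
qed

lemma entry_aeq:
  assumes wf: "wf_quiver Q" and p: "p \<in> alg_reps Q \<alpha>"
  shows "aeq Q e f \<Longrightarrow> x \<in> vidx Q \<alpha> \<Longrightarrow> y \<in> vidx Q \<alpha> \<Longrightarrow> entry Q \<alpha> p e x y = entry Q \<alpha> p f x y"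
proof (induction arbitrary: x y rule: aeq.induct)
  case (aeq_mul_assoc e f g)
  note s = entry_simps[OF wf p]
  let ?E = "entry Q \<alpha> p" and ?I = "vidx Q \<alpha>"
  have "?E (e \<cdot> f \<cdot> g) x y = (\<Sum>z\<in>?I. \<Sum>w\<in>?I. ?E e x w * ?E f w z * ?E g z y)"
    using aeq_mul_assoc.prems by (simp add: s sum_distrib_right)
  also have "\<dots> = (\<Sum>w\<in>?I. \<Sum>z\<in>?I. ?E e x w * ?E f w z * ?E g z y)" by (rule sum.swap)
  also have "\<dots> = ?E (e \<cdot> (f \<cdot> g)) x y"
    using aeq_mul_assoc.prems by (simp add: s sum_distrib_left mult.assoc)
  finally show ?case .
next
  case (aeq_one_mul e)
  then show ?case by (simp add: entry_simps(5)[OF wf p] entry_unit[OF wf p] sum_delta_vidx)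
next
  case (aeq_mul_one e)
  then show ?case by (simp add: entry_simps(5)[OF wf p] entry_unit[OF wf p] sum_delta_vidx)
next
  case (aeq_no_vert v)
  then show ?case using vidxD by (fastforce simp: entry_simps[OF wf p])
next
  case (aeq_idem v)
  have "(\<Sum>z\<in>vidx Q \<alpha>. entry Q \<alpha> p (Vert v) x z * entry Q \<alpha> p (Vert v) z y) =
    (\<Sum>z\<in>vidx Q \<alpha>. (if x = z then 1 else 0) * (if fst x = v then entry Q \<alpha> p (Vert v) z y else 0))"
    using aeq_idem by (intro sum.cong refl) (auto simp: entry_simps[OF wf p])
  also have "\<dots> = entry Q \<alpha> p (Vert v) x y"
    using aeq_idem by (subst sum_delta_vidx) (auto simp: entry_simps[OF wf p])
  finally show ?case using aeq_idem by (simp add: entry_simps(5)[OF wf p])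
next
  case (aeq_orth v w)
  then show ?case by (auto simp: entry_simps[OF wf p] intro!: sum.neutral)
next
  case (aeq_tail a)
  have "(\<Sum>z\<in>vidx Q \<alpha>. entry Q \<alpha> p (Vert (dtail Q a)) x z * entry Q \<alpha> p (Arr a) z y) =
    (\<Sum>z\<in>vidx Q \<alpha>. (if x = z then 1 else 0) * (if fst x = dtail Q a then entry Q \<alpha> p (Arr a) z y else 0))"
    using aeq_tail by (intro sum.cong refl) (auto simp: entry_simps[OF wf p])
  also have "\<dots> = entry Q \<alpha> p (Arr a) x y"
    using aeq_tail by (subst sum_delta_vidx) (auto simp: entry_arr)
  finally show ?case using aeq_tail by (simp add: entry_simps(5)[OF wf p])
next
  case (aeq_head a)
  have "(\<Sum>z\<in>vidx Q \<alpha>. entry Q \<alpha> p (Arr a) x z * entry Q \<alpha> p (Vert (dhead Q a)) z y) =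
    (\<Sum>z\<in>vidx Q \<alpha>. (if fst y = dhead Q a then entry Q \<alpha> p (Arr a) x z else 0) * (if z = y then 1 else 0))"
    using aeq_head by (intro sum.cong refl) (auto simp: entry_simps[OF wf p])
  also have "\<dots> = entry Q \<alpha> p (Arr a) x y"
    using aeq_head by (subst sum_delta_vidx) (auto simp: entry_arr)
  finally show ?case using aeq_head by (simp add: entry_simps(5)[OF wf p])
next
  case (aeq_inv_left a)
  show ?case using entry_inv(1)[OF wf p aeq_inv_left] entry_unit[OF wf p aeq_inv_left] by metis
next
  case (aeq_inv_right a)
  show ?case using entry_inv(2)[OF wf p aeq_inv_right] entry_unit[OF wf p aeq_inv_right] by metis
qed (simp_all add: entry_simps[OF wf p] entry_arr algebra_simps sum.distrib sum_distrib_left)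

definition tev :: "('v, 'e) quiver \<Rightarrow> ('v \<Rightarrow> nat) \<Rightarrow> 'e rep \<Rightarrow> ('v, 'e) tens \<Rightarrow>
    'v \<times> nat \<Rightarrow> 'v \<times> nat \<Rightarrow> 'v \<times> nat \<Rightarrow> 'v \<times> nat \<Rightarrow> complex" where
  "tev Q \<alpha> p T x y x' y' = (\<Sum>(c, d)\<leftarrow>T. entry Q \<alpha> p c x y * entry Q \<alpha> p d x' y')"

lemma tev_simps [simp]:
  "tev Q \<alpha> p [] x y x' y' = 0"
  "tev Q \<alpha> p ((c, d) # T) x y x' y' = entry Q \<alpha> p c x y * entry Q \<alpha> p d x' y' + tev Q \<alpha> p T x y x' y'"
  "tev Q \<alpha> p (S @ T) x y x' y' = tev Q \<alpha> p S x y x' y' + tev Q \<alpha> p T x y x' y'"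
  by (simp_all add: tev_def)

lemma tev_ops:
  assumes wf: "wf_quiver Q" and p: "p \<in> alg_reps Q \<alpha>"
    and I: "x \<in> vidx Q \<alpha>" "y \<in> vidx Q \<alpha>" "x' \<in> vidx Q \<alpha>" "y' \<in> vidx Q \<alpha>"
  shows "tev Q \<alpha> p (tscale c T) x y x' y' = c * tev Q \<alpha> p T x y x' y'"
    "tev Q \<alpha> p (outer_left b T) x y x' y' = (\<Sum>z\<in>vidx Q \<alpha>. entry Q \<alpha> p b x z * tev Q \<alpha> p T z y x' y')"
    "tev Q \<alpha> p (outer_right T b) x y x' y' = (\<Sum>z\<in>vidx Q \<alpha>. tev Q \<alpha> p T x y x' z * entry Q \<alpha> p b z y')"
    "tev Q \<alpha> p (map (\<lambda>(u, w). (u, b \<cdot> w)) T) x y x' y' = (\<Sum>z\<in>vidx Q \<alpha>. entry Q \<alpha> p b x' z * tev Q \<alpha> p T x y z y')"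
    "tev Q \<alpha> p (map (\<lambda>(u, w). (u \<cdot> b, w)) T) x y x' y' = (\<Sum>z\<in>vidx Q \<alpha>. tev Q \<alpha> p T x z x' y' * entry Q \<alpha> p b z y)"
  by (induction T; force simp: out_defs entry_simps[OF wf p] I algebra_simps sum.distrib
        sum_distrib_left sum_distrib_right)+

lemma shift_carrier:
  assumes "p \<in> (\<Pi>\<^sub>E a\<in>set (darrs Q). carrier_mat (\<alpha> (dtail Q a)) (\<alpha> (dhead Q a)))" "a \<in> set (darrs Q)"
  shows "shift_entry p a k l z \<in> (\<Pi>\<^sub>E a\<in>set (darrs Q). carrier_mat (\<alpha> (dtail Q a)) (\<alpha> (dhead Q a)))"
  using assms by (auto simp: shift_entry_def PiE_iff extensional_def)

lemma shift_zero:
  assumes "p \<in> alg_reps Q \<alpha>"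
  shows "shift_entry p a k l 0 = p"
proof -
  have "mat (dim_row (p a)) (dim_col (p a)) (\<lambda>kl. p a $$ kl) = p a"
    by (intro eq_matI) auto
  thus ?thesis by (simp add: shift_entry_def)
qed

lemma det_tendsto:
  assumes "\<And>z. A z \<in> carrier_mat n n" "B \<in> carrier_mat n n"
    and "\<And>i j. i < n \<Longrightarrow> j < n \<Longrightarrow> ((\<lambda>z. A z $$ (i, j)) \<longlongrightarrow> B $$ (i, j)) F"
  shows "((\<lambda>z. det (A z)) \<longlongrightarrow> (det B :: complex)) F"
  unfolding det_def'[OF assms(1)] det_def'[OF assms(2)]
proof (intro tendsto_sum tendsto_mult tendsto_const tendsto_prod, goal_cases)
  case (1 \<pi> i)
  thus ?case using assms(3)[of i "\<pi> i"] by (auto simp: permutes_in_image)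
qed

lemma GLn_det: "A \<in> GLn n \<longleftrightarrow> A \<in> carrier_mat n n \<and> det A \<noteq> (0::complex)"
proof (cases "A \<in> carrier_mat n n")
  case A: True
  show ?thesis
  proof
    assume G: "A \<in> GLn n"
    have "det A * det (minv A) = 1" using det_mult[OF A minv(1)[OF G]] minv(2)[OF G] by simp
    thus "A \<in> carrier_mat n n \<and> det A \<noteq> 0" using A by auto
  next
    assume d: "A \<in> carrier_mat n n \<and> det A \<noteq> 0"
    note adj = adj_mat[OF A]
    have "A * (inverse (det A) \<cdot>\<^sub>m adj_mat A) = 1\<^sub>m n" "(inverse (det A) \<cdot>\<^sub>m adj_mat A) * A = 1\<^sub>m n"
      using adj d by (auto simp: mult_smult_distrib[OF A adj(1)] mult_smult_assoc_mat[OF adj(1) A] smult_smult_assoc)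
    thus "A \<in> GLn n" using A adj(1) unfolding GLn_def invertible_mat_def inverts_mat_def by auto
  qed
qed (auto simp: GLn_def)

lemma minv_adj:
  assumes "A \<in> GLn n"
  shows "minv A = inverse (det A) \<cdot>\<^sub>m adj_mat A"
proof -
  have A: "A \<in> carrier_mat n n" and d: "det A \<noteq> 0" using assms by (auto simp: GLn_det)
  note adj = adj_mat[OF A]
  let ?B = "inverse (det A) \<cdot>\<^sub>m adj_mat A"
  have B: "?B \<in> carrier_mat n n" using adj by auto
  have AB: "A * ?B = 1\<^sub>m n"
    using adj d by (auto simp: mult_smult_distrib[OF A adj(1)] smult_smult_assoc)
  have "minv A = minv A * (A * ?B)" using AB minv(1)[OF assms] by simp
  also have "\<dots> = (minv A * A) * ?B" using minv(1)[OF assms] A B by (metis assoc_mult_mat)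
  also have "\<dots> = ?B" unfolding minv(3)[OF assms] by (rule left_mult_one_mat[OF B])
  finally show ?thesis .
qed

lemma minv_tendsto:
  assumes A: "\<And>z. A z \<in> carrier_mat n n" and B: "B \<in> GLn n"
    and ev: "eventually (\<lambda>z. A z \<in> GLn n) F"
    and lim: "\<And>i j. i < n \<Longrightarrow> j < n \<Longrightarrow> ((\<lambda>z. A z $$ (i, j)) \<longlongrightarrow> B $$ (i, j)) F"
    and ij: "i < n" "j < n"
  shows "((\<lambda>z. minv (A z) $$ (i, j)) \<longlongrightarrow> minv B $$ (i, j)) F"
proof -
  have Bc: "B \<in> carrier_mat n n" and Bd: "det B \<noteq> 0" using B by (auto simp: GLn_det)
  have eq: "minv C $$ (i, j) = inverse (det C) * ((-1) ^ (j + i) * det (mat_delete C j i))"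
    if "C \<in> GLn n" for C
  proof -
    have "C \<in> carrier_mat n n" using that by (auto simp: GLn_def)
    thus ?thesis using ij adj_mat(1)[of C n] by (simp add: minv_adj[OF that] adj_mat_def cofactor_def)
  qed
  have "((\<lambda>z. inverse (det (A z)) * ((-1) ^ (j + i) * det (mat_delete (A z) j i))) \<longlongrightarrow>
     inverse (det B) * ((-1) ^ (j + i) * det (mat_delete B j i))) F"
  proof (intro tendsto_mult tendsto_const tendsto_inverse Bd)
    show "((\<lambda>z. det (A z)) \<longlongrightarrow> det B) F" by (rule det_tendsto[where n=n]) (use A Bc lim in auto)
    show "((\<lambda>z. det (mat_delete (A z) j i)) \<longlongrightarrow> det (mat_delete B j i)) F"
    proof (rule det_tendsto[where n="n - 1"])
      fix k l assume kl: "k < n - 1" "l < n - 1"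
      have "mat_delete C j i $$ (k, l) = C $$ (if k < j then k else Suc k, if l < i then l else Suc l)"
        if "C \<in> carrier_mat n n" for C :: "complex mat"
        using kl that by (auto simp: mat_delete_def)
      thus "((\<lambda>z. mat_delete (A z) j i $$ (k, l)) \<longlongrightarrow> mat_delete B j i $$ (k, l)) F"
        using A Bc kl lim by simp
    qed (rule mat_delete_carrier[OF A] mat_delete_carrier[OF Bc])+
  qed
  also have "inverse (det B) * ((-1) ^ (j + i) * det (mat_delete B j i)) = minv B $$ (i, j)"
    by (rule eq[OF B, symmetric])
  finally show ?thesis
    by (rule Lim_transform_eventually) (use ev in eventually_elim, simp add: eq)
qed

lemma shift_index:
  assumes "p b \<in> carrier_mat r c" "i < r" "j < c"
  shows "shift_entry p a k l z b $$ (i, j) = p b $$ (i, j) + (if b = a \<and> i = k \<and> j = l then z else 0)"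
  using assms by (auto simp: shift_entry_def)

lemma shift_gram_tendsto:
  assumes p: "p \<in> alg_reps Q \<alpha>" and a: "a \<in> set (darrs Q)" and b: "b \<in> set (darrs Q)"
    and ij: "i < \<alpha> (dtail Q b)" "j < \<alpha> (dtail Q b)"
  shows "((\<lambda>z. (1\<^sub>m (\<alpha> (dtail Q b)) + shift_entry p a k l z b * shift_entry p a k l z (dstar b)) $$ (i, j))
    \<longlongrightarrow> (1\<^sub>m (\<alpha> (dtail Q b)) + p b * p (dstar b)) $$ (i, j)) (at 0)"
proof -
  note c = alg_repsD(1)[OF p b] alg_repsD(1)[OF p, of "dstar b"]
  have P: "p \<in> (\<Pi>\<^sub>E a\<in>set (darrs Q). carrier_mat (\<alpha> (dtail Q a)) (\<alpha> (dhead Q a)))"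
    using p by (simp add: alg_reps_def)
  have s: "shift_entry p a k l z b' \<in> carrier_mat (\<alpha> (dtail Q b')) (\<alpha> (dhead Q b'))"
    if "b' \<in> set (darrs Q)" for z b'
    using shift_carrier[OF P a] that by (auto simp: PiE_iff)
  have G: "(1\<^sub>m (\<alpha> (dtail Q b)) + X * Y) $$ (i, j) = (if i = j then 1 else 0) + (\<Sum>m<\<alpha> (dhead Q b). X $$ (i, m) * Y $$ (m, j))"
    if "X \<in> carrier_mat (\<alpha> (dtail Q b)) (\<alpha> (dhead Q b))" "Y \<in> carrier_mat (\<alpha> (dhead Q b)) (\<alpha> (dtail Q b))"
    for X Y :: "complex mat"
    using that ij by (auto simp: scalar_prod_def atLeast0LessThan)
  have t: "((\<lambda>z. shift_entry p a k l z b' $$ (i', j')) \<longlongrightarrow> p b' $$ (i', j')) (at 0)"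
    if "b' \<in> set (darrs Q)" "i' < \<alpha> (dtail Q b')" "j' < \<alpha> (dhead Q b')" for b' i' j'
  proof -
    have "((\<lambda>z. p b' $$ (i', j') + (if b' = a \<and> i' = k \<and> j' = l then z else 0)) \<longlongrightarrow> p b' $$ (i', j') + 0) (at 0)"
    proof (cases "b' = a \<and> i' = k \<and> j' = l")
      case False
      hence "(\<lambda>z. p b' $$ (i', j') + (if b' = a \<and> i' = k \<and> j' = l then z else 0)) = (\<lambda>z. p b' $$ (i', j') + 0)"
        by auto
      thus ?thesis by (simp only: tendsto_const)
    qed (auto intro!: tendsto_eq_intros)
    thus ?thesis using shift_index[of p b', OF alg_repsD(1)[OF p that(1)] that(2,3)] by simp
  qed
  have "((\<lambda>z. (if i = j then 1 else 0) + (\<Sum>m<\<alpha> (dhead Q b). shift_entry p a k l z b $$ (i, m) * shift_entry p a k l z (dstar b) $$ (m, j)))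
    \<longlongrightarrow> (if i = j then 1 else 0) + (\<Sum>m<\<alpha> (dhead Q b). p b $$ (i, m) * p (dstar b) $$ (m, j))) (at 0)"
    by (intro tendsto_add tendsto_const tendsto_sum tendsto_mult t) (use b ij in auto)
  thus ?thesis using s[of b] s[of "dstar b"] c b by (simp add: G)
qed

lemma shift_eventually:
  assumes p: "p \<in> alg_reps Q \<alpha>" and a: "a \<in> set (darrs Q)"
  shows "eventually (\<lambda>z. shift_entry p a k l z \<in> alg_reps Q \<alpha>) (at 0)"
proof -
  have P: "p \<in> (\<Pi>\<^sub>E a\<in>set (darrs Q). carrier_mat (\<alpha> (dtail Q a)) (\<alpha> (dhead Q a)))"
    using p by (simp add: alg_reps_def)
  have s: "shift_entry p a k l z b \<in> carrier_mat (\<alpha> (dtail Q b)) (\<alpha> (dhead Q b))"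
    if "b \<in> set (darrs Q)" for z b
    using shift_carrier[OF P a] that by (auto simp: PiE_iff)
  have "\<forall>b\<in>set (darrs Q). eventually (\<lambda>z. 1\<^sub>m (\<alpha> (dtail Q b)) +
      shift_entry p a k l z b * shift_entry p a k l z (dstar b) \<in> GLn (\<alpha> (dtail Q b))) (at 0)"
  proof
    fix b assume b: "b \<in> set (darrs Q)"
    let ?M = "\<lambda>z. 1\<^sub>m (\<alpha> (dtail Q b)) + shift_entry p a k l z b * shift_entry p a k l z (dstar b)"
    have c: "?M z \<in> carrier_mat (\<alpha> (dtail Q b)) (\<alpha> (dtail Q b))" for z
      using s[of b z] s[of "dstar b" z] b by auto
    have "((\<lambda>z. det (?M z)) \<longlongrightarrow> det (1\<^sub>m (\<alpha> (dtail Q b)) + p b * p (dstar b))) (at 0)"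
      by (rule det_tendsto[OF c _ shift_gram_tendsto[OF p a b]])
         (use alg_repsD(2)[OF p b] in \<open>auto simp: GLn_def\<close>)
    moreover have "det (1\<^sub>m (\<alpha> (dtail Q b)) + p b * p (dstar b)) \<noteq> 0"
      using alg_repsD(2)[OF p b] by (simp add: GLn_det)
    ultimately have "eventually (\<lambda>z. det (?M z) \<noteq> 0) (at 0)" by (rule tendsto_imp_eventually_ne)
    thus "eventually (\<lambda>z. ?M z \<in> GLn (\<alpha> (dtail Q b))) (at 0)"
      by eventually_elim (simp add: GLn_det c[unfolded atomize_all])
  qed
  hence "eventually (\<lambda>z. \<forall>b\<in>set (darrs Q). 1\<^sub>m (\<alpha> (dtail Q b)) +
      shift_entry p a k l z b * shift_entry p a k l z (dstar b) \<in> GLn (\<alpha> (dtail Q b))) (at 0)"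
    by (simp add: eventually_ball_finite)
  thus ?thesis by eventually_elim (simp add: alg_reps_def shift_carrier[OF P a, unfolded PiE_iff] PiE_iff)
qed

lemma deriv_cont_mult:
  fixes g h :: "complex \<Rightarrow> complex"
  assumes "(g \<longlongrightarrow> g0) (at 0)" "(h has_field_derivative D) (at 0)" "h 0 = 0"
  shows "((\<lambda>z. g z * h z) has_field_derivative (g0 * D)) (at 0)"
proof -
  have "((\<lambda>z. (h z - h 0) / (z - 0)) \<longlongrightarrow> D) (at 0)" using assms(2) by (simp add: has_field_derivative_iff)
  from tendsto_mult[OF assms(1) this] show ?thesis
    by (simp add: has_field_derivative_iff assms(3))
qed

lemma entry_inv_tendsto:
  assumes wf: "wf_quiver Q" and p: "p \<in> alg_reps Q \<alpha>" and a: "a \<in> set (darrs Q)"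
    and x: "x \<in> vidx Q \<alpha>" and y: "y \<in> vidx Q \<alpha>"
  shows "((\<lambda>z. entry Q \<alpha> (shift_entry p a k l z) (Inv b) x y) \<longlongrightarrow> entry Q \<alpha> p (Inv b) x y) (at 0)"
proof (cases "fst x = fst y \<and> b \<in> set (darrs Q) \<and> fst x = dtail Q b")
  case True
  have P: "p \<in> (\<Pi>\<^sub>E a\<in>set (darrs Q). carrier_mat (\<alpha> (dtail Q a)) (\<alpha> (dhead Q a)))"
    using p by (simp add: alg_reps_def)
  have s: "shift_entry p a k l z b \<in> carrier_mat (\<alpha> (dtail Q b)) (\<alpha> (dhead Q b))"
    if "b \<in> set (darrs Q)" for z b
    using shift_carrier[OF P a] that by (auto simp: PiE_iff)
  let ?M = "\<lambda>p. 1\<^sub>m (\<alpha> (dtail Q b)) + p b * p (dstar b)"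
  have "((\<lambda>z. minv (?M (shift_entry p a k l z)) $$ (snd x, snd y)) \<longlongrightarrow> minv (?M p) $$ (snd x, snd y)) (at 0)"
  proof (rule minv_tendsto[where n="\<alpha> (dtail Q b)"])
    show "?M (shift_entry p a k l z) \<in> carrier_mat (\<alpha> (dtail Q b)) (\<alpha> (dtail Q b))" for z
      using s[of b z] s[of "dstar b" z] True by auto
    show "?M p \<in> GLn (\<alpha> (dtail Q b))" using alg_repsD(2)[OF p] True by blast
    show "\<forall>\<^sub>F z in at 0. ?M (shift_entry p a k l z) \<in> GLn (\<alpha> (dtail Q b))"
      using shift_eventually[OF p a, of k l] by eventually_elim (use alg_repsD(2) True in blast)
    show "((\<lambda>z. ?M (shift_entry p a k l z) $$ (i, j)) \<longlongrightarrow> ?M p $$ (i, j)) (at 0)"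
      if "i < \<alpha> (dtail Q b)" "j < \<alpha> (dtail Q b)" for i j
      using shift_gram_tendsto[OF p a] True that by blast
  qed (use True vidxD[OF x] vidxD[OF y] in auto)
  thus ?thesis using True by (simp add: entry_def)
qed (auto simp: entry_def)

lemma entry_has_derivative:
  assumes wf: "wf_quiver Q" and p: "p \<in> alg_reps Q \<alpha>" and a: "a \<in> set (darrs Q)"
    and kl: "k < \<alpha> (dtail Q a)" "l < \<alpha> (dhead Q a)"
  shows "x \<in> vidx Q \<alpha> \<Longrightarrow> y \<in> vidx Q \<alpha> \<Longrightarrow>
    ((\<lambda>z. entry Q \<alpha> (shift_entry p a k l z) e x y) has_field_derivative
      tev Q \<alpha> p (dd Q a e) x (dtail Q a, k) (dhead Q a, l) y) (at 0)"
proof -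
  let ?p = "shift_entry p a k l" and ?I = "vidx Q \<alpha>"
  let ?t = "(dtail Q a, k)" and ?h = "(dhead Q a, l)"
  have th: "?t \<in> ?I" "?h \<in> ?I" using kl wf_quiverD(2,3)[OF wf a] by (auto simp: vidx_def)
  note ops = tev_ops[OF wf p _ th]
  note p0 [simp] = shift_zero[OF p]
  have ev: "eventually (\<lambda>z. ?p z \<in> alg_reps Q \<alpha>) (nhds 0)"
    using shift_eventually[OF p a, of k l] p by (simp add: eventually_nhds_conv_at)
  have trans: "(f has_field_derivative D) (at 0)"
    if "(g has_field_derivative D) (at 0)" "\<And>z. ?p z \<in> alg_reps Q \<alpha> \<Longrightarrow> f z = g z" for f g D
  proof -
    have "eventually (\<lambda>z. f z = g z) (nhds 0)" using ev by eventually_elim (rule that(2))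
    from DERIV_cong_ev[OF HOL.refl this HOL.refl] show ?thesis using that(1) by blast
  qed
  define HD where "HD e T \<longleftrightarrow> (\<forall>x\<in>?I. \<forall>y\<in>?I.
    ((\<lambda>z. entry Q \<alpha> (?p z) e x y) has_field_derivative tev Q \<alpha> p T x ?t ?h y) (at 0))" for e T
  have arr: "HD (Arr b) (dd_arrow Q a b)" for b
    unfolding HD_def
  proof (intro ballI)
    fix x y assume xy: "x \<in> ?I" "y \<in> ?I"
    have T: "tev Q \<alpha> p (dd_arrow Q a b) x ?t ?h y = (if b = a \<and> x = ?t \<and> y = ?h then 1 else 0)"
      using entry_simps(2)[OF wf p xy(1) th(1)] entry_simps(2)[OF wf p th(2) xy(2)]
      by (auto simp: dd_arrow_def)
    have E: "entry Q \<alpha> (?p z) (Arr b) x y = entry Q \<alpha> p (Arr b) x y + (if b = a \<and> x = ?t \<and> y = ?h then z else 0)" for z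
      using alg_repsD(1)[OF p, of b] vidxD[OF xy(1)] vidxD[OF xy(2)] a
      by (auto simp: entry_arr[OF xy] shift_index prod_eq_iff)
    show "((\<lambda>z. entry Q \<alpha> (?p z) (Arr b) x y) has_field_derivative tev Q \<alpha> p (dd_arrow Q a b) x ?t ?h y) (at 0)"
      unfolding T E by (cases "b = a \<and> x = ?t \<and> y = ?h"; simp only: if_True if_False)
        (auto intro!: derivative_eq_intros)
  qed
  have mul: "HD (e \<cdot> f) (outer_right T f @ outer_left e S)" if "HD e T" "HD f S" for e f T S
    unfolding HD_def
  proof (intro ballI)
    fix x y assume xy: "x \<in> ?I" "y \<in> ?I"
    have "((\<lambda>z. \<Sum>w\<in>?I. entry Q \<alpha> (?p z) e x w * entry Q \<alpha> (?p z) f w y) has_field_derivative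
       (\<Sum>w\<in>?I. tev Q \<alpha> p T x ?t ?h w * entry Q \<alpha> (?p 0) f w y + tev Q \<alpha> p S w ?t ?h y * entry Q \<alpha> (?p 0) e x w)) (at 0)"
      using that xy unfolding HD_def by (intro DERIV_sum DERIV_mult) auto
    from trans[OF this entry_simps(5)[OF wf _ xy]]
    show "((\<lambda>z. entry Q \<alpha> (?p z) (e \<cdot> f) x y) has_field_derivative
       tev Q \<alpha> p (outer_right T f @ outer_left e S) x ?t ?h y) (at 0)"
      by (simp add: ops xy sum.distrib mult.commute)
  qed
  have inv: "HD (Inv b) (dd Q a (Inv b))" for b
    unfolding HD_def
  proof (intro ballI)
    fix x y assume xy: "x \<in> ?I" "y \<in> ?I"
    let ?g = "Arr b \<cdot> Arr (dstar b)"
    let ?u = "unit_elt Q \<boxplus> ?g"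
    let ?X = "outer_right (dd_arrow Q a b) (Arr (dstar b)) @ outer_left (Arr b) (dd_arrow Q a (dstar b))"
    let ?N = "\<lambda>z. entry Q \<alpha> (?p z) (Inv b)" and ?G = "\<lambda>z. entry Q \<alpha> (?p z) ?g"
    have G: "HD ?g ?X" by (rule mul[OF arr arr])
    have N: "?N z x y = ?N 0 x y + (\<Sum>w\<in>?I. \<Sum>w'\<in>?I. ?N z x w * ((?G 0 w w' - ?G z w w') * ?N 0 w' y))"
      if z: "?p z \<in> alg_reps Q \<alpha>" for z
    proof -
      let ?U = "\<lambda>z. entry Q \<alpha> (?p z) ?u"
      have p0': "?p 0 \<in> alg_reps Q \<alpha>" using p by simp
      have U: "?G 0 w w' - ?G z w w' = ?U 0 w w' - ?U z w w'" if "w \<in> ?I" "w' \<in> ?I" for w w'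
        using entry_simps(3)[OF wf z that] entry_simps(3)[OF wf p0' that]
          entry_unit[OF wf z that] entry_unit[OF wf p0' that] by simp
      have "(\<Sum>w\<in>?I. \<Sum>w'\<in>?I. ?N z x w * ((?G 0 w w' - ?G z w w') * ?N 0 w' y)) =
        (\<Sum>w\<in>?I. \<Sum>w'\<in>?I. ?N z x w * ((?U 0 w w' - ?U z w w') * ?N 0 w' y))"
        by (intro sum.cong HOL.refl) (simp only: U)
      also have "\<dots> = (\<Sum>w\<in>?I. \<Sum>w'\<in>?I. ?N z x w * (?U 0 w w' * ?N 0 w' y)) -
        (\<Sum>w\<in>?I. \<Sum>w'\<in>?I. ?N z x w * ?U z w w' * ?N 0 w' y)"
        by (simp add: left_diff_distrib right_diff_distrib sum_subtractf mult.assoc)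
      also have "(\<Sum>w\<in>?I. \<Sum>w'\<in>?I. ?N z x w * ?U z w w' * ?N 0 w' y) =
          (\<Sum>w'\<in>?I. (\<Sum>w\<in>?I. ?N z x w * ?U z w w') * ?N 0 w' y)"
        by (subst sum.swap) (simp add: sum_distrib_right)
      also have "\<dots> = (\<Sum>w'\<in>?I. (if x = w' then 1 else 0) * ?N 0 w' y)"
        using entry_inv(1)[OF wf z xy(1)] by (intro sum.cong HOL.refl) (simp add: entry_simps(5)[OF wf z xy(1)])
      also have "\<dots> = ?N 0 x y" using xy(1) by (rule sum_delta_vidx)
      also have "(\<Sum>w\<in>?I. \<Sum>w'\<in>?I. ?N z x w * (?U 0 w w' * ?N 0 w' y)) =
          (\<Sum>w\<in>?I. ?N z x w * (if w = y then 1 else 0))"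
      proof (intro sum.cong HOL.refl)
        fix w assume w: "w \<in> ?I"
        have "(\<Sum>w'\<in>?I. ?U 0 w w' * ?N 0 w' y) = (if w = y then 1 else 0)"
          using entry_inv(2)[OF wf p0' w xy(2), of b] unfolding entry_simps(5)[OF wf p0' w xy(2)] .
        thus "(\<Sum>w'\<in>?I. ?N z x w * (?U 0 w w' * ?N 0 w' y)) = ?N z x w * (if w = y then 1 else 0)"
          by (simp only: sum_distrib_left[symmetric])
      qed
      also have "\<dots> = ?N z x y" using xy(2) by (rule sum_delta_vidx)
      finally show ?thesis by simp
    qed
    have "((\<lambda>z. ?N 0 x y + (\<Sum>w\<in>?I. \<Sum>w'\<in>?I. ?N z x w * ((?G 0 w w' - ?G z w w') * ?N 0 w' y)))
      has_field_derivative 0 + (\<Sum>w\<in>?I. \<Sum>w'\<in>?I. ?N 0 x w * ((0 - tev Q \<alpha> p ?X w ?t ?h w') * ?N 0 w' y))) (at 0)"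
    proof (intro DERIV_add DERIV_const DERIV_sum)
      fix w w' assume w: "w \<in> ?I" "w' \<in> ?I"
      have 1: "((\<lambda>z. ?N z x w) \<longlongrightarrow> ?N 0 x w) (at 0)"
        using entry_inv_tendsto[OF wf p a xy(1) w(1)] by simp
      have 2: "((\<lambda>z. (?G 0 w w' - ?G z w w') * ?N 0 w' y) has_field_derivative
          (0 - tev Q \<alpha> p ?X w ?t ?h w') * ?N 0 w' y) (at 0)"
        by (intro DERIV_cmult_right DERIV_diff DERIV_const) (use G w in \<open>unfold HD_def, blast\<close>)
      show "((\<lambda>z. ?N z x w * ((?G 0 w w' - ?G z w w') * ?N 0 w' y)) has_field_derivative
          ?N 0 x w * ((0 - tev Q \<alpha> p ?X w ?t ?h w') * ?N 0 w' y)) (at 0)"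
        by (rule deriv_cont_mult[OF 1 2]) simp
    qed
    from trans[OF this N]
    have D: "((\<lambda>z. ?N z x y) has_field_derivative
      0 + (\<Sum>w\<in>?I. \<Sum>w'\<in>?I. ?N 0 x w * ((0 - tev Q \<alpha> p ?X w ?t ?h w') * ?N 0 w' y))) (at 0)" .
    have alg: "-1 * (A * (B * C)) = A * ((0 - B) * C)" for A B C :: complex by simp
    let ?M = "entry Q \<alpha> p (Inv b)"
    have S: "tev Q \<alpha> p (outer_right ?X (Inv b)) w ?t ?h y = (\<Sum>w'\<in>?I. tev Q \<alpha> p ?X w ?t ?h w' * ?M w' y)"
      if "w \<in> ?I" for w
      by (rule ops(3)[OF that xy(2)])
    have "tev Q \<alpha> p (dd Q a (Inv b)) x ?t ?h y = -1 * (\<Sum>w\<in>?I. ?M x w * tev Q \<alpha> p (outer_right ?X (Inv b)) w ?t ?h y)"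
      unfolding dd.simps ops(1)[OF xy] ops(2)[OF xy] ..
    also have "\<dots> = -1 * (\<Sum>w\<in>?I. ?M x w * (\<Sum>w'\<in>?I. tev Q \<alpha> p ?X w ?t ?h w' * ?M w' y))"
      using S by (metis (no_types, lifting) sum.cong)
    also have "\<dots> = (\<Sum>w\<in>?I. \<Sum>w'\<in>?I. -1 * (?M x w * (tev Q \<alpha> p ?X w ?t ?h w' * ?M w' y)))"
      by (simp only: sum_distrib_left)
    also have "(\<Sum>w\<in>?I. \<Sum>w'\<in>?I. -1 * (?M x w * (tev Q \<alpha> p ?X w ?t ?h w' * ?M w' y))) =
        0 + (\<Sum>w\<in>?I. \<Sum>w'\<in>?I. ?N 0 x w * ((0 - tev Q \<alpha> p ?X w ?t ?h w') * ?N 0 w' y))"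
      unfolding add_0_left p0 by (intro sum.cong HOL.refl alg)
    finally have E: "tev Q \<alpha> p (dd Q a (Inv b)) x ?t ?h y =
      0 + (\<Sum>w\<in>?I. \<Sum>w'\<in>?I. ?N 0 x w * ((0 - tev Q \<alpha> p ?X w ?t ?h w') * ?N 0 w' y))" .
    show "((\<lambda>z. ?N z x y) has_field_derivative tev Q \<alpha> p (dd Q a (Inv b)) x ?t ?h y) (at 0)"
      unfolding E by (rule D)
  qed
  have "HD e (dd Q a e)"
  proof (induction e)
    case Zero show ?case unfolding HD_def
    proof (intro ballI)
      fix x y assume xy: "x \<in> ?I" "y \<in> ?I"
      show "((\<lambda>z. entry Q \<alpha> (?p z) Zero x y) has_field_derivative tev Q \<alpha> p (dd Q a Zero) x ?t ?h y) (at 0)"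
        unfolding dd.simps tev_simps(1)
        by (rule trans[OF DERIV_const entry_simps(1)[OF wf _ xy]])
    qed
  next
    case (Vert v) show ?case unfolding HD_def
    proof (intro ballI)
      fix x y assume xy: "x \<in> ?I" "y \<in> ?I"
      show "((\<lambda>z. entry Q \<alpha> (?p z) (Vert v) x y) has_field_derivative tev Q \<alpha> p (dd Q a (Vert v)) x ?t ?h y) (at 0)"
        unfolding dd.simps tev_simps(1)
        by (rule trans[OF DERIV_const entry_simps(2)[OF wf _ xy]])
    qed
  next
    case (Arr b) show ?case using arr by simp
  next
    case (Inv b) show ?case by (rule inv)
  next
    case (Add e f) show ?case unfolding HD_def
    proof (intro ballI)
      fix x y assume xy: "x \<in> ?I" "y \<in> ?I"
      from Add xy have "((\<lambda>z. entry Q \<alpha> (?p z) e x y + entry Q \<alpha> (?p z) f x y) has_field_derivative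
        (tev Q \<alpha> p (dd Q a e) x ?t ?h y + tev Q \<alpha> p (dd Q a f) x ?t ?h y)) (at 0)"
        unfolding HD_def by (intro DERIV_add) auto
      from trans[OF this entry_simps(3)[OF wf _ xy]]
      show "((\<lambda>z. entry Q \<alpha> (?p z) (e \<boxplus> f) x y) has_field_derivative tev Q \<alpha> p (dd Q a (e \<boxplus> f)) x ?t ?h y) (at 0)"
        by simp
    qed
  next
    case (Scale c e) show ?case unfolding HD_def
    proof (intro ballI)
      fix x y assume xy: "x \<in> ?I" "y \<in> ?I"
      from Scale xy have "((\<lambda>z. c * entry Q \<alpha> (?p z) e x y) has_field_derivative
        (c * tev Q \<alpha> p (dd Q a e) x ?t ?h y)) (at 0)"
        unfolding HD_def by (intro DERIV_cmult) auto
      from trans[OF this entry_simps(4)[OF wf _ xy]]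
      show "((\<lambda>z. entry Q \<alpha> (?p z) (c \<star> e) x y) has_field_derivative tev Q \<alpha> p (dd Q a (c \<star> e)) x ?t ?h y) (at 0)"
        by (simp add: ops xy)
    qed
  next
    case (Mul e f) thus ?case using mul by simp
  qed
  thus "x \<in> vidx Q \<alpha> \<Longrightarrow> y \<in> vidx Q \<alpha> \<Longrightarrow>
    ((\<lambda>z. entry Q \<alpha> (?p z) e x y) has_field_derivative tev Q \<alpha> p (dd Q a e) x ?t ?h y) (at 0)"
    by (simp add: HD_def)
qed

lemma coord_deriv_entry:
  assumes "wf_quiver Q" "p \<in> alg_reps Q \<alpha>" "a \<in> set (darrs Q)"
    and "k < \<alpha> (dtail Q a)" "l < \<alpha> (dhead Q a)" "x \<in> vidx Q \<alpha>" "y \<in> vidx Q \<alpha>"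
  shows "coord_deriv (\<lambda>p. entry Q \<alpha> p e x y) a k l p = tev Q \<alpha> p (dd Q a e) x (dtail Q a, k) (dhead Q a, l) y"
  unfolding coord_deriv_def by (rule DERIV_imp_deriv[OF entry_has_derivative[OF assms]])

lemma tev_dd_block:
  assumes wf: "wf_quiver Q" and p: "p \<in> alg_reps Q \<alpha>"
    and zz: "z' \<in> vidx Q \<alpha>" "z \<in> vidx Q \<alpha>" and ne: "fst z' \<noteq> dtail Q a \<or> fst z \<noteq> dhead Q a"
  shows "x \<in> vidx Q \<alpha> \<Longrightarrow> y \<in> vidx Q \<alpha> \<Longrightarrow> tev Q \<alpha> p (dd Q a e) x z' z y = 0"
proof -
  note ops = tev_ops[OF wf p _ zz]
  have arr: "tev Q \<alpha> p (dd_arrow Q a b) x z' z y = 0" if "x \<in> vidx Q \<alpha>" "y \<in> vidx Q \<alpha>" for b x y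
    using ne entry_simps(2)[OF wf p that(1) zz(1)] entry_simps(2)[OF wf p zz(2) that(2)]
    by (auto simp: dd_arrow_def)
  show "x \<in> vidx Q \<alpha> \<Longrightarrow> y \<in> vidx Q \<alpha> \<Longrightarrow> tev Q \<alpha> p (dd Q a e) x z' z y = 0"
    by (induction e arbitrary: x y) (auto simp: ops arr)
qed

definition arrow_idx :: "('v, 'e) quiver \<Rightarrow> ('v \<Rightarrow> nat) \<Rightarrow> ('e darr \<times> nat \<times> nat) set" where
  "arrow_idx Q \<alpha> = Sigma (set (darrs Q)) (\<lambda>a. {..<\<alpha> (dtail Q a)} \<times> {..<\<alpha> (dhead Q a)})"

lemma finite_arrow_idx [simp]: "finite (arrow_idx Q \<alpha>)"
  by (simp add: arrow_idx_def)

lemma sum_arrow_idx: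
  "(\<Sum>a\<in>set (darrs Q). \<Sum>k<\<alpha> (dtail Q a). \<Sum>l<\<alpha> (dhead Q a). f a k l) =
   (\<Sum>(a, k, l)\<in>arrow_idx Q \<alpha>. f a k l)"
  unfolding arrow_idx_def
  by (subst sum.Sigma[symmetric]) (auto simp: sum.cartesian_product intro!: sum.cong)

text \<open>Every double derivation is determined by its values on arrows; this is the evaluated form
  of that fact for those occurring in \<open>P\<close>.\<close>

definition good_dder :: "('v, 'e) quiver \<Rightarrow> ('v \<Rightarrow> nat) \<Rightarrow> 'e rep \<Rightarrow> ('v, 'e) dder \<Rightarrow> bool" where
  "good_dder Q \<alpha> p \<delta> \<longleftrightarrow> (\<forall>e. \<forall>x\<in>vidx Q \<alpha>. \<forall>y\<in>vidx Q \<alpha>. \<forall>z\<in>vidx Q \<alpha>. \<forall>z'\<in>vidx Q \<alpha>.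
     tev Q \<alpha> p (\<delta> e) x z' z y = (\<Sum>(a, k, l)\<in>arrow_idx Q \<alpha>.
       tev Q \<alpha> p (dd Q a e) x (dtail Q a, k) (dhead Q a, l) y *
       tev Q \<alpha> p (\<delta> (Arr a)) (dtail Q a, k) z' z (dhead Q a, l)))"

lemma arrow_idxD:
  assumes "wf_quiver Q" "(a, k, l) \<in> arrow_idx Q \<alpha>"
  shows "(dtail Q a, k) \<in> vidx Q \<alpha>" "(dhead Q a, l) \<in> vidx Q \<alpha>" "a \<in> set (darrs Q)"
    "k < \<alpha> (dtail Q a)" "l < \<alpha> (dhead Q a)"
  using assms wf_quiverD(2,3)[OF assms(1), of a] by (auto simp: arrow_idx_def vidx_def)

lemma good_dd:
  assumes wf: "wf_quiver Q" and p: "p \<in> alg_reps Q \<alpha>" and b: "b \<in> set (darrs Q)"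
  shows "good_dder Q \<alpha> p (dd Q b)"
  unfolding good_dder_def
proof (intro allI ballI)
  fix e x y z z' assume I: "x \<in> vidx Q \<alpha>" "y \<in> vidx Q \<alpha>" "z \<in> vidx Q \<alpha>" "z' \<in> vidx Q \<alpha>"
  have T: "tev Q \<alpha> p (dd_arrow Q b a) (dtail Q a, k) z' z (dhead Q a, l) =
      (if (a, k, l) = (b, snd z', snd z) \<and> fst z' = dtail Q b \<and> fst z = dhead Q b then 1 else 0)"
    if "(a, k, l) \<in> arrow_idx Q \<alpha>" for a k l
  proof (cases "a = b")
    case True
    show ?thesis
      using entry_simps(2)[OF wf p arrow_idxD(1)[OF wf that] I(4), of "dtail Q a"]
        entry_simps(2)[OF wf p I(3) arrow_idxD(2)[OF wf that], of "dhead Q a"]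
      by (cases z, cases z') (auto simp: dd_arrow_def True)
  qed (simp add: dd_arrow_def)
  have "(\<Sum>(a, k, l)\<in>arrow_idx Q \<alpha>.
       tev Q \<alpha> p (dd Q a e) x (dtail Q a, k) (dhead Q a, l) y *
       tev Q \<alpha> p (dd Q b (Arr a)) (dtail Q a, k) z' z (dhead Q a, l)) =
     (\<Sum>j\<in>arrow_idx Q \<alpha>. if j = (b, snd z', snd z) then
        (if fst z' = dtail Q b \<and> fst z = dhead Q b then tev Q \<alpha> p (dd Q b e) x z' z y else 0) else 0)"
  proof (intro sum.cong HOL.refl, clarify)
    fix a k l assume J: "(a, k, l) \<in> arrow_idx Q \<alpha>"
    show "tev Q \<alpha> p (dd Q a e) x (dtail Q a, k) (dhead Q a, l) y *
       tev Q \<alpha> p (dd Q b (Arr a)) (dtail Q a, k) z' z (dhead Q a, l) =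
       (if (a, k, l) = (b, snd z', snd z) then
        (if fst z' = dtail Q b \<and> fst z = dhead Q b then tev Q \<alpha> p (dd Q b e) x z' z y else 0) else 0)"
      unfolding dd.simps T[OF J] by (cases z, cases z') auto
  qed
  also have "\<dots> = (if fst z' = dtail Q b \<and> fst z = dhead Q b then tev Q \<alpha> p (dd Q b e) x z' z y else 0)"
    using vidxD[OF I(3)] vidxD[OF I(4)] b by (auto simp: arrow_idx_def)
  also have "\<dots> = tev Q \<alpha> p (dd Q b e) x z' z y"
    using tev_dd_block[OF wf p I(4) I(3) _ I(1) I(2)] by auto
  finally show "tev Q \<alpha> p (dd Q b e) x z' z y = (\<Sum>(a, k, l)\<in>arrow_idx Q \<alpha>.
       tev Q \<alpha> p (dd Q a e) x (dtail Q a, k) (dhead Q a, l) y *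
       tev Q \<alpha> p (dd Q b (Arr a)) (dtail Q a, k) z' z (dhead Q a, l))" by simp
qed

lemma good_left:
  assumes wf: "wf_quiver Q" and p: "p \<in> alg_reps Q \<alpha>" and g: "good_dder Q \<alpha> p \<delta>"
  shows "good_dder Q \<alpha> p (dder_left b \<delta>)"
  unfolding good_dder_def dder_left_def
proof (intro allI ballI)
  fix e x y z z' assume I: "x \<in> vidx Q \<alpha>" "y \<in> vidx Q \<alpha>" "z \<in> vidx Q \<alpha>" "z' \<in> vidx Q \<alpha>"
  let ?D = "\<lambda>(a, k, l). tev Q \<alpha> p (dd Q a e) x (dtail Q a, k) (dhead Q a, l) y"
  let ?A = "\<lambda>z (a, k, l). tev Q \<alpha> p (\<delta> (Arr a)) (dtail Q a, k) z' z (dhead Q a, l)"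
  have "tev Q \<alpha> p (map (\<lambda>(u, w). (u, b \<cdot> w)) (\<delta> e)) x z' z y =
    (\<Sum>w\<in>vidx Q \<alpha>. entry Q \<alpha> p b z w * tev Q \<alpha> p (\<delta> e) x z' w y)"
    by (rule tev_ops(4)[OF wf p I(1,4,3,2)])
  also have "\<dots> = (\<Sum>w\<in>vidx Q \<alpha>. entry Q \<alpha> p b z w * (\<Sum>j\<in>arrow_idx Q \<alpha>. ?D j * ?A w j))"
    using g I by (intro sum.cong refl) (auto simp: good_dder_def split_def)
  also have "\<dots> = (\<Sum>j\<in>arrow_idx Q \<alpha>. ?D j * (\<Sum>w\<in>vidx Q \<alpha>. entry Q \<alpha> p b z w * ?A w j))"
    unfolding sum_distrib_left by (subst sum.swap) (simp add: mult.left_commute)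
  also have "\<dots> = (\<Sum>(a, k, l)\<in>arrow_idx Q \<alpha>. ?D (a, k, l) *
      tev Q \<alpha> p (map (\<lambda>(u, w). (u, b \<cdot> w)) (\<delta> (Arr a))) (dtail Q a, k) z' z (dhead Q a, l))"
    using arrow_idxD[OF wf] tev_ops(4)[OF wf p _ I(4,3)] by (intro sum.cong refl) auto
  finally show "tev Q \<alpha> p (map (\<lambda>(u, w). (u, b \<cdot> w)) (\<delta> e)) x z' z y = (\<Sum>(a, k, l)\<in>arrow_idx Q \<alpha>.
      tev Q \<alpha> p (dd Q a e) x (dtail Q a, k) (dhead Q a, l) y *
      tev Q \<alpha> p (map (\<lambda>(u, w). (u, b \<cdot> w)) (\<delta> (Arr a))) (dtail Q a, k) z' z (dhead Q a, l))" by simp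
qed

lemma good_right:
  assumes wf: "wf_quiver Q" and p: "p \<in> alg_reps Q \<alpha>" and g: "good_dder Q \<alpha> p \<delta>"
  shows "good_dder Q \<alpha> p (dder_right \<delta> b)"
  unfolding good_dder_def dder_right_def
proof (intro allI ballI)
  fix e x y z z' assume I: "x \<in> vidx Q \<alpha>" "y \<in> vidx Q \<alpha>" "z \<in> vidx Q \<alpha>" "z' \<in> vidx Q \<alpha>"
  let ?D = "\<lambda>(a, k, l). tev Q \<alpha> p (dd Q a e) x (dtail Q a, k) (dhead Q a, l) y"
  let ?A = "\<lambda>z' (a, k, l). tev Q \<alpha> p (\<delta> (Arr a)) (dtail Q a, k) z' z (dhead Q a, l)"
  have "tev Q \<alpha> p (map (\<lambda>(u, w). (u \<cdot> b, w)) (\<delta> e)) x z' z y =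
    (\<Sum>w\<in>vidx Q \<alpha>. tev Q \<alpha> p (\<delta> e) x w z y * entry Q \<alpha> p b w z')"
    by (rule tev_ops(5)[OF wf p I(1,4,3,2)])
  also have "\<dots> = (\<Sum>w\<in>vidx Q \<alpha>. (\<Sum>j\<in>arrow_idx Q \<alpha>. ?D j * ?A w j) * entry Q \<alpha> p b w z')"
    using g I by (intro sum.cong refl) (auto simp: good_dder_def split_def)
  also have "\<dots> = (\<Sum>j\<in>arrow_idx Q \<alpha>. ?D j * (\<Sum>w\<in>vidx Q \<alpha>. ?A w j * entry Q \<alpha> p b w z'))"
    unfolding sum_distrib_left sum_distrib_right by (subst sum.swap) (simp add: mult.assoc)
  also have "\<dots> = (\<Sum>(a, k, l)\<in>arrow_idx Q \<alpha>. ?D (a, k, l) *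
      tev Q \<alpha> p (map (\<lambda>(u, w). (u \<cdot> b, w)) (\<delta> (Arr a))) (dtail Q a, k) z' z (dhead Q a, l))"
    using arrow_idxD[OF wf] tev_ops(5)[OF wf p _ I(4,3)] by (intro sum.cong refl) auto
  finally show "tev Q \<alpha> p (map (\<lambda>(u, w). (u \<cdot> b, w)) (\<delta> e)) x z' z y = (\<Sum>(a, k, l)\<in>arrow_idx Q \<alpha>.
      tev Q \<alpha> p (dd Q a e) x (dtail Q a, k) (dhead Q a, l) y *
      tev Q \<alpha> p (map (\<lambda>(u, w). (u \<cdot> b, w)) (\<delta> (Arr a))) (dtail Q a, k) z' z (dhead Q a, l))" by simp
qed

lemma good_minus:
  assumes wf: "wf_quiver Q" and p: "p \<in> alg_reps Q \<alpha>" and g: "good_dder Q \<alpha> p \<delta>" "good_dder Q \<alpha> p \<delta>'"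
  shows "good_dder Q \<alpha> p (dder_minus \<delta> \<delta>')"
  unfolding good_dder_def dder_minus_def
proof (intro allI ballI)
  fix e x y z z' assume I: "x \<in> vidx Q \<alpha>" "y \<in> vidx Q \<alpha>" "z \<in> vidx Q \<alpha>" "z' \<in> vidx Q \<alpha>"
  have "tev Q \<alpha> p (\<delta> e @ tscale (-1) (\<delta>' e)) x z' z y = tev Q \<alpha> p (\<delta> e) x z' z y - tev Q \<alpha> p (\<delta>' e) x z' z y"
    using tev_ops(1)[OF wf p I(1,4,3,2)] by simp
  also have "\<dots> = (\<Sum>(a, k, l)\<in>arrow_idx Q \<alpha>. tev Q \<alpha> p (dd Q a e) x (dtail Q a, k) (dhead Q a, l) y *
       (tev Q \<alpha> p (\<delta> (Arr a)) (dtail Q a, k) z' z (dhead Q a, l) -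
        tev Q \<alpha> p (\<delta>' (Arr a)) (dtail Q a, k) z' z (dhead Q a, l)))"
    using g I by (simp add: good_dder_def right_diff_distrib sum_subtractf split_def)
  also have "\<dots> = (\<Sum>(a, k, l)\<in>arrow_idx Q \<alpha>. tev Q \<alpha> p (dd Q a e) x (dtail Q a, k) (dhead Q a, l) y *
       tev Q \<alpha> p (\<delta> (Arr a) @ tscale (-1) (\<delta>' (Arr a))) (dtail Q a, k) z' z (dhead Q a, l))"
    using arrow_idxD[OF wf] tev_ops(1)[OF wf p _ I(4,3)] by (intro sum.cong refl) auto
  finally show "tev Q \<alpha> p (\<delta> e @ tscale (-1) (\<delta>' e)) x z' z y = \<dots>" .
qed

lemma tev_pairs:
  assumes wf: "wf_quiver Q" and p: "p \<in> alg_reps Q \<alpha>"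
    and I: "x \<in> vidx Q \<alpha>" "y \<in> vidx Q \<alpha>" "x' \<in> vidx Q \<alpha>" "y' \<in> vidx Q \<alpha>"
  shows "tev Q \<alpha> p [(fst Y \<cdot> snd X, fst X \<cdot> snd Y). X \<leftarrow> S, Y \<leftarrow> T] x' y x y' =
    (\<Sum>z\<in>vidx Q \<alpha>. \<Sum>z'\<in>vidx Q \<alpha>. tev Q \<alpha> p S x z' z y * tev Q \<alpha> p T x' z z' y')"
proof (induction S)
  case (Cons X S)
  obtain u w where X: "X = (u, w)" by fastforce
  have "tev Q \<alpha> p (map (\<lambda>Y. (fst Y \<cdot> snd X, fst X \<cdot> snd Y)) T) x' y x y' =
    (\<Sum>z\<in>vidx Q \<alpha>. \<Sum>z'\<in>vidx Q \<alpha>. entry Q \<alpha> p u x z' * entry Q \<alpha> p w z y * tev Q \<alpha> p T x' z z' y')"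
  proof (induction T)
    case (Cons Y T)
    obtain c d where Y: "Y = (c, d)" by fastforce
    have "entry Q \<alpha> p (c \<cdot> w) x' y * entry Q \<alpha> p (u \<cdot> d) x y' =
      (\<Sum>z\<in>vidx Q \<alpha>. \<Sum>z'\<in>vidx Q \<alpha>. entry Q \<alpha> p u x z' * entry Q \<alpha> p w z y * (entry Q \<alpha> p c x' z * entry Q \<alpha> p d z' y'))"
      unfolding entry_simps(5)[OF wf p I(3,2)] entry_simps(5)[OF wf p I(1,4)] sum_product
      by (intro sum.cong refl) (simp add: mult_ac)
    with Cons show ?case by (simp add: X Y sum.distrib distrib_left)
  qed simp
  with Cons show ?case by (simp add: X sum.distrib distrib_right)
qed simp

lemma tev_prod_bracket:
  assumes wf: "wf_quiver Q" and p: "p \<in> alg_reps Q \<alpha>"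
    and I: "x \<in> vidx Q \<alpha>" "y \<in> vidx Q \<alpha>" "x' \<in> vidx Q \<alpha>" "y' \<in> vidx Q \<alpha>"
  shows "tev Q \<alpha> p (prod_bracket \<delta> \<delta>' e f) x' y x y' =
    (\<Sum>z\<in>vidx Q \<alpha>. \<Sum>z'\<in>vidx Q \<alpha>. tev Q \<alpha> p (\<delta> e) x z' z y * tev Q \<alpha> p (\<delta>' f) x' z z' y') -
    (\<Sum>z\<in>vidx Q \<alpha>. \<Sum>z'\<in>vidx Q \<alpha>. tev Q \<alpha> p (\<delta>' e) x z' z y * tev Q \<alpha> p (\<delta> f) x' z z' y')"
  unfolding prod_bracket_def
  by (simp add: tev_ops(1)[OF wf p I(3,2,1,4)] tev_pairs[OF wf p I])

lemma prod_bracket_expand: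
  assumes wf: "wf_quiver Q" and p: "p \<in> alg_reps Q \<alpha>" and g: "good_dder Q \<alpha> p \<delta>" "good_dder Q \<alpha> p \<delta>'"
    and I: "x \<in> vidx Q \<alpha>" "y \<in> vidx Q \<alpha>" "x' \<in> vidx Q \<alpha>" "y' \<in> vidx Q \<alpha>"
  shows "tev Q \<alpha> p (prod_bracket \<delta> \<delta>' e f) x' y x y' =
    (\<Sum>(a, k, l)\<in>arrow_idx Q \<alpha>. \<Sum>(b, u, v)\<in>arrow_idx Q \<alpha>.
       tev Q \<alpha> p (dd Q a e) x (dtail Q a, k) (dhead Q a, l) y *
       tev Q \<alpha> p (dd Q b f) x' (dtail Q b, u) (dhead Q b, v) y' *
       tev Q \<alpha> p (prod_bracket \<delta> \<delta>' (Arr a) (Arr b)) (dtail Q b, u) (dhead Q a, l) (dtail Q a, k) (dhead Q b, v))"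
proof -
  let ?I = "vidx Q \<alpha>" and ?J = "arrow_idx Q \<alpha>"
  let ?t = "\<lambda>j. (dtail Q (fst j), fst (snd j))" and ?h = "\<lambda>j. (dhead Q (fst j), snd (snd j))"
  let ?D = "\<lambda>j. tev Q \<alpha> p (dd Q (fst j) e) x (?t j) (?h j) y"
  let ?E = "\<lambda>j. tev Q \<alpha> p (dd Q (fst j) f) x' (?t j) (?h j) y'"
  let ?A = "\<lambda>\<delta> z' z j. tev Q \<alpha> p (\<delta> (Arr (fst j))) (?t j) z' z (?h j)"
  have half: "(\<Sum>z\<in>?I. \<Sum>z'\<in>?I. tev Q \<alpha> p (\<delta> e) x z' z y * tev Q \<alpha> p (\<delta>' f) x' z z' y') =
      (\<Sum>j\<in>?J. \<Sum>j'\<in>?J. ?D j * ?E j' * (\<Sum>z\<in>?I. \<Sum>z'\<in>?I. ?A \<delta> z' z j * ?A \<delta>' z z' j'))"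
    if g: "good_dder Q \<alpha> p \<delta>" "good_dder Q \<alpha> p \<delta>'" for \<delta> \<delta>'
  proof -
    have "(\<Sum>z\<in>?I. \<Sum>z'\<in>?I. tev Q \<alpha> p (\<delta> e) x z' z y * tev Q \<alpha> p (\<delta>' f) x' z z' y') =
      (\<Sum>z\<in>?I. \<Sum>z'\<in>?I. (\<Sum>j\<in>?J. ?D j * ?A \<delta> z' z j) * (\<Sum>j'\<in>?J. ?E j' * ?A \<delta>' z z' j'))"
      using g I by (intro sum.cong refl) (simp add: good_dder_def split_def)
    also have "\<dots> = (\<Sum>z\<in>?I. \<Sum>z'\<in>?I. \<Sum>j\<in>?J. \<Sum>j'\<in>?J. ?D j * ?E j' * (?A \<delta> z' z j * ?A \<delta>' z z' j'))"
      by (intro sum.cong HOL.refl, subst sum_product, intro sum.cong HOL.refl, simp only: mult_ac)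
    also have "\<dots> = (\<Sum>z\<in>?I. \<Sum>j\<in>?J. \<Sum>j'\<in>?J. \<Sum>z'\<in>?I. ?D j * ?E j' * (?A \<delta> z' z j * ?A \<delta>' z z' j'))"
      by (intro sum.cong refl, subst sum.swap, intro sum.cong refl, rule sum.swap)
    also have "\<dots> = (\<Sum>j\<in>?J. \<Sum>j'\<in>?J. \<Sum>z\<in>?I. \<Sum>z'\<in>?I. ?D j * ?E j' * (?A \<delta> z' z j * ?A \<delta>' z z' j'))"
      by (subst sum.swap, intro sum.cong refl, rule sum.swap)
    finally show ?thesis by (simp only: sum_distrib_left)
  qed
  have "tev Q \<alpha> p (prod_bracket \<delta> \<delta>' e f) x' y x y' =
    (\<Sum>j\<in>?J. \<Sum>j'\<in>?J. ?D j * ?E j' * ((\<Sum>z\<in>?I. \<Sum>z'\<in>?I. ?A \<delta> z' z j * ?A \<delta>' z z' j') -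
       (\<Sum>z\<in>?I. \<Sum>z'\<in>?I. ?A \<delta>' z' z j * ?A \<delta> z z' j')))"
    unfolding tev_prod_bracket[OF wf p I] half[OF g] half[OF g(2,1)]
    by (simp only: right_diff_distrib sum_subtractf)
  also have "\<dots> = (\<Sum>j\<in>?J. \<Sum>j'\<in>?J. ?D j * ?E j' *
      tev Q \<alpha> p (prod_bracket \<delta> \<delta>' (Arr (fst j)) (Arr (fst j'))) (?t j') (?h j) (?t j) (?h j'))"
  proof (intro sum.cong refl)
    fix j j' assume "j \<in> ?J" "j' \<in> ?J"
    hence "?t j \<in> ?I" "?h j \<in> ?I" "?t j' \<in> ?I" "?h j' \<in> ?I"
      using arrow_idxD[OF wf, of "fst j" "fst (snd j)" "snd (snd j)"]
        arrow_idxD[OF wf, of "fst j'" "fst (snd j')" "snd (snd j')"] by auto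
    from tev_prod_bracket[OF wf p this, of \<delta> \<delta>' "Arr (fst j)" "Arr (fst j')"]
    show "?D j * ?E j' * ((\<Sum>z\<in>?I. \<Sum>z'\<in>?I. ?A \<delta> z' z j * ?A \<delta>' z z' j') -
       (\<Sum>z\<in>?I. \<Sum>z'\<in>?I. ?A \<delta>' z' z j * ?A \<delta> z z' j')) = ?D j * ?E j' *
      tev Q \<alpha> p (prod_bracket \<delta> \<delta>' (Arr (fst j)) (Arr (fst j'))) (?t j') (?h j) (?t j) (?h j')"
      by (simp only:)
  qed
  finally show ?thesis by (simp only: split_def)
qed

lemma good_P:
  assumes wf: "wf_quiver Q" and p: "p \<in> alg_reps Q \<alpha>" and P: "(c, \<delta>, \<delta>') \<in> set (P_biv Q)"
  shows "good_dder Q \<alpha> p \<delta>" "good_dder Q \<alpha> p \<delta>'"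
proof -
  have F: "good_dder Q \<alpha> p (F_der Q a)" if "a \<in> set (darrs Q)" for a
    unfolding F_der_def using that
    by (intro good_minus[OF wf p] good_right[OF wf p] good_left[OF wf p] good_dd[OF wf p]) auto
  from P consider a where "a \<in> set (darrs Q)" "\<delta> = dder_left (unit_elt Q \<boxplus> Arr (dstar a) \<cdot> Arr a) (dd Q a)"
      "\<delta>' = dd Q (dstar a)"
    | a b where "a \<in> set (darrs Q)" "b \<in> set (darrs Q)" "\<delta> = F_der Q a" "\<delta>' = F_der Q b"
    unfolding P_biv_def by (auto split: if_splits)
  hence "good_dder Q \<alpha> p \<delta> \<and> good_dder Q \<alpha> p \<delta>'"
    by cases (simp_all add: F good_left[OF wf p good_dd[OF wf p]] good_dd[OF wf p])
  thus "good_dder Q \<alpha> p \<delta>" "good_dder Q \<alpha> p \<delta>'" by simp_all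
qed

lemma rep_bracket_entry:
  assumes wf: "wf_quiver Q" and p: "p \<in> alg_reps Q \<alpha>"
    and I: "x \<in> vidx Q \<alpha>" "y \<in> vidx Q \<alpha>" "x' \<in> vidx Q \<alpha>" "y' \<in> vidx Q \<alpha>"
  shows "rep_bracket Q \<alpha> (\<lambda>p. entry Q \<alpha> p e x y) (\<lambda>p. entry Q \<alpha> p f x' y') p =
    (\<Sum>(c, d)\<leftarrow>dbracket Q e f. entry Q \<alpha> p c x' y * entry Q \<alpha> p d x y')"
proof -
  let ?J = "arrow_idx Q \<alpha>"
  let ?D = "\<lambda>a k l. tev Q \<alpha> p (dd Q a e) x (dtail Q a, k) (dhead Q a, l) y"
  let ?E = "\<lambda>b u v. tev Q \<alpha> p (dd Q b f) x' (dtail Q b, u) (dhead Q b, v) y'"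
  have coord: "coord_bracket Q \<alpha> p a k l b u v =
      tev Q \<alpha> p (dbracket Q (Arr a) (Arr b)) (dtail Q b, u) (dhead Q a, l) (dtail Q a, k) (dhead Q b, v)" for a k l b u v
    by (simp add: coord_bracket_def tev_def entry_def)
  have db: "tev Q \<alpha> p (dbracket Q e f) x' y x y' =
      (\<Sum>(c, \<delta>, \<delta>')\<leftarrow>P_biv Q. c * tev Q \<alpha> p (prod_bracket \<delta> \<delta>' e f) x' y x y')"
    if I: "x \<in> vidx Q \<alpha>" "y \<in> vidx Q \<alpha>" "x' \<in> vidx Q \<alpha>" "y' \<in> vidx Q \<alpha>" for e f x y x' y'
  proof -
    have "tev Q \<alpha> p (concat (map (\<lambda>(c, \<delta>, \<delta>'). tscale c (prod_bracket \<delta> \<delta>' e f)) L)) x' y x y' =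
      (\<Sum>(c, \<delta>, \<delta>')\<leftarrow>L. c * tev Q \<alpha> p (prod_bracket \<delta> \<delta>' e f) x' y x y')" for L
      by (induction L) (auto simp: tev_ops(1)[OF wf p I(3,2,1,4)])
    thus ?thesis by (simp add: dbracket_def)
  qed
  have "rep_bracket Q \<alpha> (\<lambda>p. entry Q \<alpha> p e x y) (\<lambda>p. entry Q \<alpha> p f x' y') p =
    (\<Sum>(a, k, l)\<in>?J. \<Sum>(b, u, v)\<in>?J.
       coord_deriv (\<lambda>p. entry Q \<alpha> p e x y) a k l p * coord_deriv (\<lambda>p. entry Q \<alpha> p f x' y') b u v p *
       coord_bracket Q \<alpha> p a k l b u v)"
    by (simp only: rep_bracket_def sum_arrow_idx[where Q=Q and \<alpha>=\<alpha>])
  also have "\<dots> = (\<Sum>(a, k, l)\<in>?J. \<Sum>(b, u, v)\<in>?J. \<Sum>(c, \<delta>, \<delta>')\<leftarrow>P_biv Q. ?D a k l * ?E b u v *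
      (c * tev Q \<alpha> p (prod_bracket \<delta> \<delta>' (Arr a) (Arr b)) (dtail Q b, u) (dhead Q a, l) (dtail Q a, k) (dhead Q b, v)))"
  proof (intro sum.cong HOL.refl, clarify, intro sum.cong HOL.refl, clarify)
    fix a k l b u v assume J: "(a, k, l) \<in> ?J" "(b, u, v) \<in> ?J"
    note A = arrow_idxD[OF wf J(1)] and B = arrow_idxD[OF wf J(2)]
    show "coord_deriv (\<lambda>p. entry Q \<alpha> p e x y) a k l p * coord_deriv (\<lambda>p. entry Q \<alpha> p f x' y') b u v p *
       coord_bracket Q \<alpha> p a k l b u v = (\<Sum>(c, \<delta>, \<delta>')\<leftarrow>P_biv Q. ?D a k l * ?E b u v *
      (c * tev Q \<alpha> p (prod_bracket \<delta> \<delta>' (Arr a) (Arr b)) (dtail Q b, u) (dhead Q a, l) (dtail Q a, k) (dhead Q b, v)))"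
      unfolding coord_deriv_entry[OF wf p A(3-5) I(1,2)] coord_deriv_entry[OF wf p B(3-5) I(3,4)]
        coord db[OF A(1,2) B(1,2)] split_def
      by (rule sum_list_const_mult[symmetric])
  qed
  also have "\<dots> = (\<Sum>(c, \<delta>, \<delta>')\<leftarrow>P_biv Q. c * (\<Sum>(a, k, l)\<in>?J. \<Sum>(b, u, v)\<in>?J. ?D a k l * ?E b u v *
      tev Q \<alpha> p (prod_bracket \<delta> \<delta>' (Arr a) (Arr b)) (dtail Q b, u) (dhead Q a, l) (dtail Q a, k) (dhead Q b, v)))"
  proof -
    have "(\<Sum>j\<in>?J. \<Sum>j'\<in>?J. \<Sum>(c, \<delta>, \<delta>')\<leftarrow>L. G j j' * (c * H \<delta> \<delta>' j j')) =
      (\<Sum>(c, \<delta>, \<delta>')\<leftarrow>L. c * (\<Sum>j\<in>?J. \<Sum>j'\<in>?J. G j j' * H \<delta> \<delta>' j j'))"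
      for L :: "(complex \<times> ('a, 'b) dder \<times> ('a, 'b) dder) list" and G H
      by (induction L) (auto simp: sum.distrib sum_distrib_left mult.left_commute)
    from this[where G="\<lambda>(a, k, l) (b, u, v). ?D a k l * ?E b u v" and L="P_biv Q" and H="\<lambda>\<delta> \<delta>' (a, k, l) (b, u, v).
      tev Q \<alpha> p (prod_bracket \<delta> \<delta>' (Arr a) (Arr b)) (dtail Q b, u) (dhead Q a, l) (dtail Q a, k) (dhead Q b, v)"]
    show ?thesis by (simp only: split_def)
  qed
  also have "\<dots> = (\<Sum>(c, \<delta>, \<delta>')\<leftarrow>P_biv Q. c * tev Q \<alpha> p (prod_bracket \<delta> \<delta>' e f) x' y x y')"
    by (intro arg_cong[where f=sum_list] map_cong refl)
       (auto simp: prod_bracket_expand[OF wf p good_P[OF wf p] I])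
  also have "\<dots> = tev Q \<alpha> p (dbracket Q e f) x' y x y'" by (rule db[OF I, symmetric])
  finally show ?thesis by (simp add: tev_def)
qed

lemma wf_quivers: "wf_quiver tadpole_quiver" "m > 0 \<Longrightarrow> wf_quiver (cyclic_quiver m)"
  by (auto simp: wf_quiver_def tadpole_quiver_def cyclic_quiver_def distinct_map inj_on_def)

end

theory Submission imports Defs begin

text \<open>The bracket of invariant functions on a representation space is written as the derivative of one
  along the Hamiltonian vector field of the other, both expressed through matrix gradients. On
  representatives, \<open>\<xi>\<close> has an inverse up to gauge transformations, namely \<open>A = X\<^sub>0 \<cdots> X\<^sub>m\<^sub>-\<^sub>1\<close>,
  \<open>B = X\<^sub>0 Z\<^sub>0 / q\<^sub>0\<close>, \<open>V' = B A V\<close>, \<open>W' = W A\<^sup>-\<^sup>1 B\<^sup>-\<^sup>1\<close>, which makes sense on the whole ambient space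
  of the cyclic quiver. The derivative of this map sends the Hamiltonian vector field of a pulled
  back invariant function to the Hamiltonian vector field of the function itself, up to an infinitesimal
  gauge transformation. A given lift of a function on the cyclic side need not be such a pullback, but
  it agrees with one where the relations at the vertices \<open>i \<noteq> 0\<close> hold; these relations define a graph to which
  Hamiltonian vector fields of invariant functions are tangent, so the brackets do not change.\<close>

section \<open>Finitely supported matrices\<close>

text \<open>Lifts of functions live on the ambient spaces, where none of the defining relations
  holds, so the comparison has to be made there. This singles out \<open>phi\<close> as the map to
  differentiate: it sends a gauge transformation to its components at vertex 0 and at infinity, it
  satisfies \<open>phi (psi p) = p\<close> without any relation, and it involves the arrows
  \<open>y_i\<close> through \<open>y_0\<close> alone. A pulled back function therefore has zero
  gradient in \<open>y_k\<close> for k > 0, so its Hamiltonian field at \<open>x_k\<close> is an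
  infinitesimal change of basis, and in the derivative of \<open>A = X_0 ... X_{m-1}\<close> these
  terms telescope. What remains are three identities between A, B, their inverses and two gradients
  (\<open>ring_identities\<close>). They hold because the moments at the tadpole vertex add up to 0,
  the infinitesimal form of invariance, which expresses the framing arrows' contribution through the
  gradients in A and B. The order on the arrows enters only through \<open>moment_shift\<close>. The
  other composition, \<open>psi (phi p)\<close>, is a gauge transform of p only under the relations
  at the vertices other than 0; this is why arbitrary lifts on the cyclic side need the tangency
  argument.\<close>

text \<open>Blocks of all formats are embedded in one ring without unit, so that ring identities
  need no format side conditions; unit matrices become idempotents.\<close>

typedef fmat = "{f :: nat \<Rightarrow> nat \<Rightarrow> complex. \<exists>N. \<forall>i j. N \<le> i \<or> N \<le> j \<longrightarrow> f i j = 0}"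
  morphisms ent Fmat
  by (rule exI[of _ "\<lambda>_ _. 0"]) auto

definition fbound :: "nat \<Rightarrow> fmat \<Rightarrow> bool" where
  "fbound N x \<longleftrightarrow> (\<forall>i j. N \<le> i \<or> N \<le> j \<longrightarrow> ent x i j = 0)"

definition fsize :: "fmat \<Rightarrow> nat" where
  "fsize x = (LEAST N. fbound N x)"

lemma fbound_fsize: "fbound (fsize x) x"
proof -
  have "\<exists>N. fbound N x" using ent[of x] by (auto simp: fbound_def)
  thus ?thesis unfolding fsize_def by (rule LeastI_ex)
qed

lemma fbound_mono: "fbound N x \<Longrightarrow> N \<le> M \<Longrightarrow> fbound M x"
  by (auto simp: fbound_def)

lemma fbound_common: "\<exists>N. fbound N x \<and> fbound N y \<and> fbound N z"
  using fbound_fsize fbound_mono by (meson max.cobounded1 max.cobounded2)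

lemma ent_Fmat:
  assumes "\<And>i j. N \<le> i \<or> N \<le> j \<Longrightarrow> f i j = 0"
  shows "ent (Fmat f) = f"
  using assms by (intro Fmat_inverse) auto

lemma fmat_eqI: "(\<And>i j. ent x i j = ent y i j) \<Longrightarrow> x = y"
  by (metis ent_inject ext)

instantiation fmat :: ring
begin

definition "0 = Fmat (\<lambda>_ _. 0)"
definition "x + y = Fmat (\<lambda>i j. ent x i j + ent y i j)"
definition "- x = Fmat (\<lambda>i j. - ent x i j)"
definition "x - y = Fmat (\<lambda>i j. ent x i j - ent y i j)"
definition "x * y = Fmat (\<lambda>i j. \<Sum>k<fsize x. ent x i k * ent y k j)"

lemma ent_ops:
  "ent 0 i j = 0"
  "ent (x + y) i j = ent x i j + ent y i j"
  "ent (- x) i j = - ent x i j"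
  "ent (x - y) i j = ent x i j - ent y i j"
proof -
  obtain N where "fbound N x" "fbound N y" using fbound_common by blast
  hence b: "N \<le> i \<or> N \<le> j \<Longrightarrow> ent x i j = 0 \<and> ent y i j = 0" for i j by (auto simp: fbound_def)
  show "ent 0 i j = 0" by (simp add: zero_fmat_def ent_Fmat[of 0])
  show "ent (x + y) i j = ent x i j + ent y i j" using b by (simp add: plus_fmat_def ent_Fmat[of N])
  show "ent (- x) i j = - ent x i j" using b by (simp add: uminus_fmat_def ent_Fmat[of N])
  show "ent (x - y) i j = ent x i j - ent y i j" using b by (simp add: minus_fmat_def ent_Fmat[of N])
qed

lemma ent_mult_fsize: "ent (x * y) i j = (\<Sum>k<fsize x. ent x i k * ent y k j)"
proof -
  obtain N where "fbound N x" "fbound N y" using fbound_common by blast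
  hence "N \<le> i \<or> N \<le> j \<Longrightarrow> (\<Sum>k<fsize x. ent x i k * ent y k j) = 0" for i j
    by (auto simp: fbound_def)
  thus ?thesis by (simp add: times_fmat_def ent_Fmat[of N])
qed

text \<open>Only the summation index has to be truncated, so a bound on one of the two factors is
  enough.\<close>

lemma ent_mult:
  assumes "fbound N x \<or> fbound N y"
  shows "ent (x * y) i j = (\<Sum>k<N. ent x i k * ent y k j)"
proof -
  have "(\<Sum>k<fsize x. ent x i k * ent y k j) = (\<Sum>k<N. ent x i k * ent y k j)"
    using fbound_fsize[of x] assms
    by (intro sum.mono_neutral_cong) (auto simp: fbound_def not_less)
  thus ?thesis by (simp add: ent_mult_fsize)
qed

instance
proof
  fix x y z :: fmat
  obtain N where N: "fbound N x" "fbound N y" "fbound N z" using fbound_common by blast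
  show "(x * y) * z = x * (y * z)"
  proof (rule fmat_eqI)
    fix i j
    have "ent ((x * y) * z) i j = (\<Sum>k<N. \<Sum>l<N. ent x i l * ent y l k * ent z k j)"
      using N by (simp add: ent_mult[of N] sum_distrib_right)
    also have "\<dots> = (\<Sum>l<N. \<Sum>k<N. ent x i l * ent y l k * ent z k j)" by (rule sum.swap)
    also have "\<dots> = ent (x * (y * z)) i j"
      using N by (simp add: ent_mult[of N] sum_distrib_left mult.assoc)
    finally show "ent ((x * y) * z) i j = ent (x * (y * z)) i j" .
  qed
  have "ent ((x + y) * z) i j = ent (x * z + y * z) i j"
    "ent (x * (y + z)) i j = ent (x * y + x * z) i j" for i j
    using N by (auto simp: ent_mult[of N] ent_ops algebra_simps sum.distrib)
  thus "(x + y) * z = x * z + y * z" "x * (y + z) = x * y + x * z" by (auto intro: fmat_eqI)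
qed (auto intro!: fmat_eqI simp: ent_ops)

end

definition fscale :: "complex \<Rightarrow> fmat \<Rightarrow> fmat" (infixr \<open>\<odot>\<close> 75) where
  "c \<odot> x = Fmat (\<lambda>i j. c * ent x i j)"

lemma ent_fscale [simp]: "ent (c \<odot> x) i j = c * ent x i j"
  using fbound_fsize[of x] by (subst fscale_def, subst ent_Fmat[of "fsize x"]) (auto simp: fbound_def)

declare ent_ops [simp]

lemma fscale_simps [simp]:
  "(c \<odot> x) * y = c \<odot> (x * y)" "x * (c \<odot> y) = c \<odot> (x * y)" "c \<odot> d \<odot> x = (c * d) \<odot> x" "1 \<odot> x = x"
  "0 \<odot> x = 0" "c \<odot> 0 = 0"
proof -
  obtain N where "fbound N x" "fbound N y" using fbound_common by blast
  thus "(c \<odot> x) * y = c \<odot> (x * y)" "x * (c \<odot> y) = c \<odot> (x * y)"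
    by (auto intro!: fmat_eqI simp: ent_mult[of N] fbound_def sum_distrib_left mult_ac)
qed (auto intro!: fmat_eqI)

lemma fscale_distrib:
  "c \<odot> (x + y) = c \<odot> x + c \<odot> y" "c \<odot> (x - y) = c \<odot> x - c \<odot> y" "c \<odot> (- x) = - (c \<odot> x)"
  by (auto intro!: fmat_eqI simp: algebra_simps)

definition fid :: "nat \<Rightarrow> fmat" where
  "fid n = Fmat (\<lambda>i j. if i = j \<and> i < n then 1 else 0)"

lemma ent_fid [simp]: "ent (fid n) i j = (if i = j \<and> i < n then 1 else 0)"
  by (subst fid_def, subst ent_Fmat[of n]) auto

definition felem :: "nat \<Rightarrow> nat \<Rightarrow> fmat" where
  "felem i j = Fmat (\<lambda>k l. if k = i \<and> l = j then 1 else 0)"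

lemma ent_felem [simp]: "ent (felem i j) k l = (if k = i \<and> l = j then 1 else 0)"
  by (subst felem_def, subst ent_Fmat[of "Suc (max i j)"]) auto

definition ftrace :: "fmat \<Rightarrow> complex" where
  "ftrace x = (\<Sum>i<fsize x. ent x i i)"

lemma ftrace_bound: "fbound N x \<Longrightarrow> ftrace x = (\<Sum>i<N. ent x i i)"
  using fbound_fsize[of x] unfolding ftrace_def
  by (intro sum.mono_neutral_cong) (auto simp: fbound_def not_less)

lemma fbound_ops [intro]:
  "fbound N x \<Longrightarrow> fbound N y \<Longrightarrow> fbound N (x + y)"
  "fbound N x \<Longrightarrow> fbound N y \<Longrightarrow> fbound N (x - y)"
  "fbound N x \<Longrightarrow> fbound N (- x)"
  "fbound N x \<Longrightarrow> fbound N (c \<odot> x)"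
  "fbound N x \<Longrightarrow> fbound N y \<Longrightarrow> fbound N (x * y)"
  by (auto simp: fbound_def ent_mult[of N])

lemma ftrace_simps [simp]:
  "ftrace 0 = 0" "ftrace (x + y) = ftrace x + ftrace y" "ftrace (x - y) = ftrace x - ftrace y"
  "ftrace (- x) = - ftrace x" "ftrace (c \<odot> x) = c * ftrace x"
proof -
  obtain N where N: "fbound N x" "fbound N y" using fbound_common by blast
  show "ftrace 0 = 0" by (simp add: ftrace_def)
  show "ftrace (x + y) = ftrace x + ftrace y" "ftrace (x - y) = ftrace x - ftrace y"
    "ftrace (- x) = - ftrace x" "ftrace (c \<odot> x) = c * ftrace x"
    using N fbound_ops[of N]
    by (simp_all add: ftrace_bound[of N] sum.distrib sum_subtractf sum_negf sum_distrib_left)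
qed

lemma ftrace_mult: "fbound N x \<Longrightarrow> fbound N y \<Longrightarrow> ftrace (x * y) = (\<Sum>i<N. \<Sum>j<N. ent x i j * ent y j i)"
  using fbound_ops(5)[of N x y] by (simp add: ftrace_bound[of N] ent_mult[of N])

lemma ftrace_commute: "ftrace (x * y) = ftrace (y * x)"
proof -
  obtain N where N: "fbound N x" "fbound N y" using fbound_common by blast
  show ?thesis unfolding ftrace_mult[OF N] ftrace_mult[OF N(2,1)]
    by (subst sum.swap) (simp add: mult.commute)
qed

lemma ftrace_rotate: "ftrace (x * (y * z)) = ftrace (y * (z * x))"
  using ftrace_commute[of x "y * z"] by (simp add: mult.assoc)

lemma ftrace_sum [simp]: "ftrace (sum f S) = (\<Sum>x\<in>S. ftrace (f x))"
  by (induction S rule: infinite_finite_induct) auto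

lemma ent_sum [simp]: "ent (sum f S) i j = (\<Sum>x\<in>S. ent (f x) i j)"
  by (induction S rule: infinite_finite_induct) auto

lemma ftrace_felem [simp]: "ftrace (x * felem i j) = ent x j i"
proof -
  obtain N where "fbound N x" using fbound_fsize by blast
  define M where "M = max N (Suc (max i j))"
  have M: "fbound M x" "fbound M (felem i j)" "i < M" "j < M"
    using \<open>fbound N x\<close> by (auto simp: fbound_def M_def)
  have "ftrace (x * felem i j) = (\<Sum>k<M. \<Sum>l<M. if l = i then if k = j then ent x k l else 0 else 0)"
    unfolding ftrace_mult[OF M(1,2)] by (intro sum.cong refl) auto
  thus ?thesis using M by simp
qed

text \<open>The format of a rectangular block is carried by absorption equations with these
  idempotents. They serve as rewrite rules where ordinary matrices would require side conditions on
  dimensions.\<close>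

lemma fid_absorb:
  "(\<forall>i j. n \<le> i \<longrightarrow> ent x i j = 0) \<longleftrightarrow> fid n * x = x"
  "(\<forall>i j. n \<le> j \<longrightarrow> ent x i j = 0) \<longleftrightarrow> x * fid n = x"
proof -
  have b: "fbound n (fid n)" by (auto simp: fbound_def)
  have "ent (fid n * x) i j = (if i < n then ent x i j else 0)" for i j
  proof -
    have "ent (fid n * x) i j = (\<Sum>k<n. if k = i then ent x i j else 0)"
      unfolding ent_mult[OF disjI1[OF b]] by (intro sum.cong) auto
    thus ?thesis by simp
  qed
  thus "(\<forall>i j. n \<le> i \<longrightarrow> ent x i j = 0) \<longleftrightarrow> fid n * x = x"
    by (metis fmat_eqI not_le)
  have "ent (x * fid n) i j = (if j < n then ent x i j else 0)" for i j
  proof -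
    have "ent (x * fid n) i j = (\<Sum>k<n. if k = j then ent x i j else 0)"
      unfolding ent_mult[OF disjI2[OF b]] by (intro sum.cong) auto
    thus ?thesis by simp
  qed
  thus "(\<forall>i j. n \<le> j \<longrightarrow> ent x i j = 0) \<longleftrightarrow> x * fid n = x"
    by (metis fmat_eqI not_le)
qed

lemma fid_idem [simp]: "fid n * fid n = fid n"
  by (rule fid_absorb(1)[THEN iffD1]) auto

section \<open>Embedding of complex matrices into the ring\<close>

definition em :: "complex mat \<Rightarrow> fmat" where
  "em M = Fmat (\<lambda>i j. if i < dim_row M \<and> j < dim_col M then M $$ (i, j) else 0)"

lemma ent_em [simp]: "ent (em M) i j = (if i < dim_row M \<and> j < dim_col M then M $$ (i, j) else 0)"
  by (subst em_def, subst ent_Fmat[of "max (dim_row M) (dim_col M)"]) auto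

lemma em_mult: "dim_col A = dim_row B \<Longrightarrow> em (A * B) = em A * em B"
proof (rule fmat_eqI)
  fix i j assume d: "dim_col A = dim_row B"
  define N where "N = max (dim_row A) (dim_col A)"
  have "fbound N (em A)" by (auto simp: fbound_def N_def)
  hence "ent (em A * em B) i j = (\<Sum>k<N. ent (em A) i k * ent (em B) k j)"
    by (intro ent_mult) auto
  also have "\<dots> = (\<Sum>k<dim_col A. ent (em A) i k * ent (em B) k j)"
    by (intro sum.mono_neutral_right) (auto simp: N_def)
  also have "\<dots> = ent (em (A * B)) i j"
    using d by (auto simp: scalar_prod_def atLeast0LessThan intro!: sum.cong)
  finally show "ent (em (A * B)) i j = ent (em A * em B) i j" by simp
qed

lemma em_simps [simp]:
  "dim_row A = dim_row B \<Longrightarrow> dim_col A = dim_col B \<Longrightarrow> em (A + B) = em A + em B"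
  "dim_row A = dim_row B \<Longrightarrow> dim_col A = dim_col B \<Longrightarrow> em (A - B) = em A - em B"
  "em (c \<cdot>\<^sub>m A) = c \<odot> em A"
  "em (1\<^sub>m n) = fid n"
  "em (0\<^sub>m n k) = 0"
  by (auto intro!: fmat_eqI)

lemma em_inject:
  assumes "dim_row A = dim_row B" "dim_col A = dim_col B" "em A = em B"
  shows "A = B"
proof (rule eq_matI)
  fix i j assume "i < dim_row B" "j < dim_col B"
  thus "A $$ (i, j) = B $$ (i, j)" using assms ent_em[of A i j] ent_em[of B i j] by simp
qed (use assms in auto)

lemma em_fid [simp]: "dim_row A = n \<Longrightarrow> fid n * em A = em A" "dim_col A = n \<Longrightarrow> em A * fid n = em A"
  by (rule fid_absorb[THEN iffD1]; simp)+

lemma em_minv: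
  assumes "A \<in> GLn n"
  shows "em A * em (minv A) = fid n" "em (minv A) * em A = fid n"
proof -
  have A: "A \<in> carrier_mat n n" using assms by (simp add: GLn_def)
  note m = minv[OF assms]
  show "em A * em (minv A) = fid n" "em (minv A) * em A = fid n"
    using em_mult[of A "minv A"] em_mult[of "minv A" A] A m by auto
qed

text \<open>By multiplicativity of the determinant a one-sided inverse of a square matrix suffices.
  Inverses are recognised in this way from a single identity in the ring.\<close>

lemma GLn_emI:
  assumes A: "A \<in> carrier_mat n n" and B: "B \<in> carrier_mat n n" and AB: "em A * em B = fid n"
  shows "A \<in> GLn n" "minv A = B"
proof -
  have 1: "A * B = 1\<^sub>m n" using A B AB by (intro em_inject) (auto simp: em_mult)
  have "det A * det B = 1" using det_mult[OF A B] 1 by simp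
  thus G: "A \<in> GLn n" using A by (auto simp: GLn_det)
  note m = minv[OF G]
  have "minv A = minv A * (A * B)" using 1 m by simp
  also have "\<dots> = (minv A * A) * B" using m A B by (metis assoc_mult_mat)
  finally show "minv A = B" using m B by simp
qed

lemma GLn_carrier: "A \<in> GLn n \<Longrightarrow> A \<in> carrier_mat n n" by (simp add: GLn_def)

lemma GLn_dims [simp]: "A \<in> GLn n \<Longrightarrow> dim_row A = n" "A \<in> GLn n \<Longrightarrow> dim_col A = n"
  "A \<in> GLn n \<Longrightarrow> dim_row (minv A) = n" "A \<in> GLn n \<Longrightarrow> dim_col (minv A) = n"
  using GLn_carrier[of A n] minv(1)[of A n] by auto

lemma GLn_mult: "A \<in> GLn n \<Longrightarrow> B \<in> GLn n \<Longrightarrow> A * B \<in> GLn n"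
  by (auto simp: GLn_det det_mult)

lemma GLn_minv: "A \<in> GLn n \<Longrightarrow> minv A \<in> GLn n"
  using GLn_emI(1)[of "minv A" n A] em_minv[of A n] minv(1)[of A n] GLn_carrier by blast

lemma GLn_one [simp]: "1\<^sub>m n \<in> GLn n" by (simp add: GLn_det)

lemma GLn_smult: "A \<in> GLn n \<Longrightarrow> c \<noteq> 0 \<Longrightarrow> c \<cdot>\<^sub>m A \<in> GLn n"
  by (auto simp: GLn_det)

lemma minv_minv: "A \<in> GLn n \<Longrightarrow> minv (minv A) = A"
  using GLn_emI(2)[of "minv A" n A] em_minv[of A n] minv(1)[of A n] GLn_carrier by blast

lemma minv_mult:
  assumes "A \<in> GLn n" "B \<in> GLn n"
  shows "minv (A * B) = minv B * minv A"
proof (rule GLn_emI(2))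
  show "A * B \<in> carrier_mat n n" using GLn_mult[OF assms] by (rule GLn_carrier)
  show "minv B * minv A \<in> carrier_mat n n"
    using GLn_mult[OF GLn_minv[OF assms(2)] GLn_minv[OF assms(1)]] by (rule GLn_carrier)
  have "em (A * B) * em (minv B * minv A) = em A * (em B * em (minv B)) * em (minv A)"
    using assms by (simp add: em_mult mult.assoc)
  thus "em (A * B) * em (minv B * minv A) = fid n" using assms by (simp add: em_minv)
qed

lemma minv_one [simp]: "minv (1\<^sub>m n) = 1\<^sub>m n"
  by (rule GLn_emI(2)) auto

section \<open>Derivatives of matrix-valued functions\<close>

text \<open>The bound common to all z near 0 makes the entries of a product finite sums over a fixed
  range, as the product rule needs. Since only a neighbourhood of 0 counts, curves may be redefined
  far from 0.\<close>

definition mderiv :: "(complex \<Rightarrow> fmat) \<Rightarrow> fmat \<Rightarrow> bool" where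
  "mderiv M D \<longleftrightarrow> (\<exists>N. eventually (\<lambda>z. fbound N (M z)) (nhds 0)) \<and>
     (\<forall>i j. ((\<lambda>z. ent (M z) i j) has_field_derivative ent D i j) (at 0))"

lemma has_derivative_cong_nhds:
  fixes f g :: "complex \<Rightarrow> complex"
  assumes "(f has_field_derivative d) (at 0)" "eventually (\<lambda>z. f z = g z) (nhds 0)"
  shows "(g has_field_derivative d) (at 0)"
  using DERIV_cong_ev[OF HOL.refl assms(2) HOL.refl] assms(1) by blast

lemma mderiv_cong:
  assumes "mderiv M D" "eventually (\<lambda>z. M z = M' z) (nhds 0)"
  shows "mderiv M' D"
proof -
  obtain N where N: "eventually (\<lambda>z. fbound N (M z)) (nhds 0)"
    and d: "\<And>i j. ((\<lambda>z. ent (M z) i j) has_field_derivative ent D i j) (at 0)"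
    using assms(1) by (auto simp: mderiv_def)
  have "eventually (\<lambda>z. fbound N (M' z)) (nhds 0)" using N assms(2) by eventually_elim simp
  moreover have "((\<lambda>z. ent (M' z) i j) has_field_derivative ent D i j) (at 0)" for i j
    by (rule has_derivative_cong_nhds[OF d]) (use assms(2) in eventually_elim, simp)
  ultimately show ?thesis by (auto simp: mderiv_def)
qed

lemma mderiv_const: "mderiv (\<lambda>z. x) 0"
  using fbound_fsize[of x] by (auto simp: mderiv_def)

lemma mderiv_id_scale: "mderiv (\<lambda>z. z \<odot> x) x"
  unfolding mderiv_def
proof (intro conjI allI exI)
  show "\<forall>\<^sub>F z in nhds 0. fbound (fsize x) (z \<odot> x)" using fbound_fsize[of x] by (intro always_eventually) auto
qed (auto intro!: derivative_eq_intros)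

lemma mderiv_common_bound:
  assumes "mderiv M D" "mderiv M' D'"
  obtains N where "eventually (\<lambda>z. fbound N (M z) \<and> fbound N (M' z)) (nhds 0)"
proof -
  obtain K L where "eventually (\<lambda>z. fbound K (M z)) (nhds 0)" "eventually (\<lambda>z. fbound L (M' z)) (nhds 0)"
    using assms by (auto simp: mderiv_def)
  hence "eventually (\<lambda>z. fbound (max K L) (M z) \<and> fbound (max K L) (M' z)) (nhds 0)"
    by eventually_elim (auto intro: fbound_mono)
  thus ?thesis by (rule that)
qed

lemma mderiv_add:
  assumes "mderiv M D" "mderiv M' D'"
  shows "mderiv (\<lambda>z. M z + M' z) (D + D')"
proof -
  obtain N where N: "eventually (\<lambda>z. fbound N (M z) \<and> fbound N (M' z)) (nhds 0)"
    by (rule mderiv_common_bound[OF assms])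
  have "eventually (\<lambda>z. fbound N (M z + M' z)) (nhds 0)" using N by eventually_elim auto
  thus ?thesis using assms by (auto simp: mderiv_def intro!: DERIV_add)
qed

lemma mderiv_scale:
  assumes "mderiv M D"
  shows "mderiv (\<lambda>z. c \<odot> M z) (c \<odot> D)"
proof -
  obtain N where N: "eventually (\<lambda>z. fbound N (M z)) (nhds 0)" using assms by (auto simp: mderiv_def)
  have "eventually (\<lambda>z. fbound N (c \<odot> M z)) (nhds 0)" using N by eventually_elim auto
  thus ?thesis using assms by (auto simp: mderiv_def intro!: DERIV_cmult)
qed

lemma mderiv_diff:
  assumes "mderiv M D" "mderiv M' D'"
  shows "mderiv (\<lambda>z. M z - M' z) (D - D')"
proof -
  have e: "x - y = x + (-1) \<odot> y" for x y :: fmat by (rule fmat_eqI) simp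
  show ?thesis unfolding e by (intro mderiv_add mderiv_scale assms)
qed

lemma mderiv_mult:
  assumes "mderiv M D" "mderiv M' D'"
  shows "mderiv (\<lambda>z. M z * M' z) (D * M' 0 + M 0 * D')"
proof -
  obtain N where N: "eventually (\<lambda>z. fbound N (M z) \<and> fbound N (M' z)) (nhds 0)"
    by (rule mderiv_common_bound[OF assms])
  from eventually_nhds_x_imp_x[OF N] have N0: "fbound N (M 0)" "fbound N (M' 0)" by auto
  have "eventually (\<lambda>z. fbound N (M z * M' z)) (nhds 0)" using N by eventually_elim auto
  moreover have "((\<lambda>z. ent (M z * M' z) i j) has_field_derivative ent (D * M' 0 + M 0 * D') i j) (at 0)" for i j
  proof (rule has_derivative_cong_nhds)
    show "eventually (\<lambda>z. (\<Sum>k<N. ent (M z) i k * ent (M' z) k j) = ent (M z * M' z) i j) (nhds 0)"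
      using N by eventually_elim (auto simp: ent_mult[of N])
    have "((\<lambda>z. \<Sum>k<N. ent (M z) i k * ent (M' z) k j) has_field_derivative
       (\<Sum>k<N. ent D i k * ent (M' 0) k j + ent D' k j * ent (M 0) i k)) (at 0)"
      using assms unfolding mderiv_def by (intro DERIV_sum DERIV_mult) auto
    thus "((\<lambda>z. \<Sum>k<N. ent (M z) i k * ent (M' z) k j) has_field_derivative ent (D * M' 0 + M 0 * D') i j) (at 0)"
      using N0 by (simp add: ent_mult[of N] sum.distrib mult.commute)
  qed
  ultimately show ?thesis by (auto simp: mderiv_def)
qed

lemma mderiv_entry_tendsto:
  assumes "mderiv M D"
  shows "((\<lambda>z. ent (M z) i j) \<longlongrightarrow> ent (M 0) i j) (at 0)"
  using assms DERIV_isCont unfolding mderiv_def isCont_def by blast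

lemma mderiv_GLn:
  assumes A: "\<And>z. A z \<in> carrier_mat n n" and d: "mderiv (\<lambda>z. em (A z)) D" and A0: "A 0 \<in> GLn n"
  shows "eventually (\<lambda>z. A z \<in> GLn n) (nhds 0)"
    and "i < n \<Longrightarrow> j < n \<Longrightarrow> ((\<lambda>z. A z $$ (i, j)) \<longlongrightarrow> A 0 $$ (i, j)) (at 0)"
proof -
  show lim: "((\<lambda>z. A z $$ (i, j)) \<longlongrightarrow> A 0 $$ (i, j)) (at 0)" if "i < n" "j < n" for i j
    using mderiv_entry_tendsto[OF d, of i j] A that by (simp add: carrier_matD[OF A])
  have "((\<lambda>z. det (A z)) \<longlongrightarrow> det (A 0)) (at 0)" by (rule det_tendsto[OF A A lim])
  moreover have "det (A 0) \<noteq> 0" using A0 by (simp add: GLn_det)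
  ultimately have "eventually (\<lambda>z. det (A z) \<noteq> 0) (at 0)" by (rule tendsto_imp_eventually_ne)
  hence "eventually (\<lambda>z. A z \<in> GLn n) (at 0)" by eventually_elim (use A in \<open>auto simp: GLn_det\<close>)
  thus "eventually (\<lambda>z. A z \<in> GLn n) (nhds 0)" using A0 by (simp add: eventually_nhds_conv_at)
qed

text \<open>By the identity \<open>A(z)^-1 = A(0)^-1 + A(z)^-1 (A(0) - A(z)) A(0)^-1\<close>,
  continuity of the inverse suffices: the middle factor vanishes at 0, so the product has as
  derivative the limit of the outer factors times the derivative of the middle one
  (\<open>deriv_cont_mult\<close>).\<close>

lemma mderiv_minv:
  assumes A: "\<And>z. A z \<in> carrier_mat n n" and d: "mderiv (\<lambda>z. em (A z)) D" and A0: "A 0 \<in> GLn n"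
  shows "mderiv (\<lambda>z. em (minv (A z))) (- (em (minv (A 0)) * D * em (minv (A 0))))"
proof -
  note G = mderiv_GLn[OF A d A0]
  let ?I = "\<lambda>z. em (minv (A z))"
  have b: "fbound n (em M)" if "M \<in> GLn n" for M using that by (auto simp: fbound_def)
  have bi: "fbound n (em (minv M))" if "M \<in> GLn n" for M using that by (auto simp: fbound_def)
  have dD: "((\<lambda>z. ent (em (A z)) k l) has_field_derivative ent D k l) (at 0)" for k l
    using d by (auto simp: mderiv_def)
  \<comment> \<open>The entries of \<open>A z\<close> outside the square block are identically 0,
    hence so are their derivatives; this permits sums over \<open>k, l < n\<close> below.\<close>
  have bD: "ent D k l = 0" if "n \<le> k \<or> n \<le> l" for k l
  proof -
    have "ent (em (A z)) k l = 0" for z using that carrier_matD[OF A, of z] by auto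
    with dD[of k l] have "((\<lambda>z. 0 :: complex) has_field_derivative ent D k l) (at 0)" by simp
    thus ?thesis using DERIV_unique[OF _ DERIV_const] by blast
  qed
  have "eventually (\<lambda>z. fbound n (?I z)) (nhds 0)" using G(1) by eventually_elim (rule bi)
  moreover have "((\<lambda>z. ent (?I z) i j) has_field_derivative ent (- (?I 0 * D * ?I 0)) i j) (at 0)" for i j
  proof (cases "i < n \<and> j < n")
    case False
    have "ent (?I z) i j = 0" if "A z \<in> GLn n" for z
      using bi[OF that] False unfolding fbound_def not_less[symmetric] by blast
    hence "((\<lambda>z. ent (?I z) i j) has_field_derivative 0) (at 0)"
      by (intro has_derivative_cong_nhds[OF DERIV_const[of 0]], use G(1) in eventually_elim) auto
    moreover have "fbound n (- (?I 0 * D * ?I 0))"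
      using bi[OF A0] bD by (intro fbound_ops) (auto simp: fbound_def)
    ultimately show ?thesis using False by (auto simp: fbound_def)
  next
    case True
    let ?f = "\<lambda>z. ent (?I 0) i j + (\<Sum>k<n. \<Sum>l<n. ent (?I z) i k * ((ent (em (A 0)) k l - ent (em (A z)) k l) * ent (?I 0) l j))"
    have ev: "?f z = ent (?I z) i j" if z: "A z \<in> GLn n" for z
    proof -
      have "?I z = ?I 0 + ?I z * ((em (A 0) - em (A z)) * ?I 0)"
        using z A0 em_fid(2)[of "minv (A z)"]
        by (simp add: algebra_simps em_minv mult.assoc[symmetric])
      moreover have "ent (?I z * ((em (A 0) - em (A z)) * ?I 0)) i j =
        (\<Sum>k<n. \<Sum>l<n. ent (?I z) i k * ((ent (em (A 0)) k l - ent (em (A z)) k l) * ent (?I 0) l j))"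
        using bi[OF z] bi[OF A0] b[OF z] b[OF A0]
        by (simp add: ent_mult[of n] fbound_ops sum_distrib_left)
      ultimately show ?thesis by (metis ent_ops(2))
    qed
    have "(?f has_field_derivative 0 + (\<Sum>k<n. \<Sum>l<n. ent (?I 0) i k * ((0 - ent D k l) * ent (?I 0) l j))) (at 0)"
    proof (intro DERIV_add DERIV_const DERIV_sum)
      fix k l assume kl: "k \<in> {..<n}" "l \<in> {..<n}"
      have "((\<lambda>z. minv (A z) $$ (i, k)) \<longlongrightarrow> minv (A 0) $$ (i, k)) (at 0)"
        by (rule minv_tendsto[OF A A0 _ G(2)])
           (use G(1) True kl in \<open>auto simp: eventually_nhds_conv_at\<close>)
      hence 1: "((\<lambda>z. ent (?I z) i k) \<longlongrightarrow> ent (?I 0) i k) (at 0)"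
      proof (rule Lim_transform_eventually[THEN tendsto_eq_rhs])
        show "eventually (\<lambda>z. minv (A z) $$ (i, k) = ent (?I z) i k) (at 0)"
          using eventually_nhds_conv_at[THEN iffD1, OF G(1)] True kl
          by (auto elim!: eventually_mono)
        show "minv (A 0) $$ (i, k) = ent (?I 0) i k" using A0 True kl by simp
      qed
      have 2: "((\<lambda>z. (ent (em (A 0)) k l - ent (em (A z)) k l) * ent (?I 0) l j) has_field_derivative
          (0 - ent D k l) * ent (?I 0) l j) (at 0)"
        by (intro DERIV_cmult_right DERIV_diff DERIV_const dD)
      show "((\<lambda>z. ent (?I z) i k * ((ent (em (A 0)) k l - ent (em (A z)) k l) * ent (?I 0) l j)) has_field_derivative
          ent (?I 0) i k * ((0 - ent D k l) * ent (?I 0) l j)) (at 0)"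
        by (rule deriv_cont_mult[OF 1 2]) simp
    qed
    moreover have "0 + (\<Sum>k<n. \<Sum>l<n. ent (?I 0) i k * ((0 - ent D k l) * ent (?I 0) l j)) = ent (- (?I 0 * D * ?I 0)) i j"
      using bi[OF A0] bD by (simp add: mult.assoc ent_mult[of n] fbound_def sum_negf sum_distrib_left)
    ultimately have "(?f has_field_derivative ent (- (?I 0 * D * ?I 0)) i j) (at 0)" by simp
    thus ?thesis
      by (rule has_derivative_cong_nhds) (use G(1) in eventually_elim, rule ev)
  qed
  ultimately show ?thesis by (auto simp: mderiv_def)
qed

lemma ftrace_mult_rect:
  assumes "\<And>i j. r \<le> i \<or> c \<le> j \<Longrightarrow> ent x i j = 0"
  shows "ftrace (x * y) = (\<Sum>i<r. \<Sum>j<c. ent x i j * ent y j i)"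
proof -
  obtain N where N: "fbound N x" "fbound N y" using fbound_common by blast
  define M where "M = max N (max r c)"
  have M: "fbound M x" "fbound M y" using N fbound_mono by (auto simp: M_def)
  have "ftrace (x * y) = (\<Sum>i<M. \<Sum>j<M. ent x i j * ent y j i)" by (rule ftrace_mult[OF M])
  also have "\<dots> = (\<Sum>i<r. \<Sum>j<M. ent x i j * ent y j i)"
    using assms by (intro sum.mono_neutral_right) (auto simp: M_def not_less)
  also have "\<dots> = (\<Sum>i<r. \<Sum>j<c. ent x i j * ent y j i)"
    using assms by (intro sum.cong refl sum.mono_neutral_right) (auto simp: M_def not_less)
  finally show ?thesis .
qed

section \<open>Gradients of regular functions\<close>

definition formats :: "('v, 'e) quiver \<Rightarrow> ('v \<Rightarrow> nat) \<Rightarrow> 'e rep set" where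
  "formats Q \<alpha> = (\<Pi>\<^sub>E a\<in>set (darrs Q). carrier_mat (\<alpha> (dtail Q a)) (\<alpha> (dhead Q a)))"

lemma alg_reps_formats: "p \<in> alg_reps Q \<alpha> \<Longrightarrow> p \<in> formats Q \<alpha>"
  by (simp add: alg_reps_def formats_def)

lemma formatsD:
  assumes "p \<in> formats Q \<alpha>" "a \<in> set (darrs Q)"
  shows "p a \<in> carrier_mat (\<alpha> (dtail Q a)) (\<alpha> (dhead Q a))"
    "dim_row (p a) = \<alpha> (dtail Q a)" "dim_col (p a) = \<alpha> (dhead Q a)"
proof -
  show "p a \<in> carrier_mat (\<alpha> (dtail Q a)) (\<alpha> (dhead Q a))" using assms by (auto simp: formats_def)
  thus "dim_row (p a) = \<alpha> (dtail Q a)" "dim_col (p a) = \<alpha> (dhead Q a)" by auto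
qed

text \<open>The indices are transposed: the derivative in the entry (i, j) of \<open>a\<close>
  stands at (j, i). The gradient then has the format of the opposite arrow, the differential of F is
  a sum of traces, and cyclicity of the trace becomes available.\<close>

definition grad :: "('v, 'e) quiver \<Rightarrow> ('v \<Rightarrow> nat) \<Rightarrow> ('e rep \<Rightarrow> complex) \<Rightarrow> 'e rep \<Rightarrow> 'e darr \<Rightarrow> fmat" where
  "grad Q \<alpha> F p a = Fmat (\<lambda>j i. if a \<in> set (darrs Q) \<and> j < \<alpha> (dhead Q a) \<and> i < \<alpha> (dtail Q a)
     then coord_deriv F a i j p else 0)"

lemma ent_grad [simp]: "ent (grad Q \<alpha> F p a) j i =
   (if a \<in> set (darrs Q) \<and> j < \<alpha> (dhead Q a) \<and> i < \<alpha> (dtail Q a) then coord_deriv F a i j p else 0)"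
  by (subst grad_def, subst ent_Fmat[of "max (\<alpha> (dhead Q a)) (\<alpha> (dtail Q a))"]) auto

lemma grad_fid [simp]:
  "k = \<alpha> (dhead Q a) \<Longrightarrow> fid k * grad Q \<alpha> F p a = grad Q \<alpha> F p a"
  "k = \<alpha> (dtail Q a) \<Longrightarrow> grad Q \<alpha> F p a * fid k = grad Q \<alpha> F p a"
  by (rule fid_absorb[THEN iffD1]; simp)+

lemma em_shift_entry:
  assumes "p b \<in> carrier_mat r c" "a = b \<Longrightarrow> i < r \<and> j < c"
  shows "em (shift_entry p a i j z b) = em (p b) + (if b = a then z \<odot> felem i j else 0)"
  using assms by (auto intro!: fmat_eqI simp: shift_entry_def)

lemma mderiv_shift_entry:
  assumes "p \<in> formats Q \<alpha>" "(a, i, j) \<in> arrow_idx Q \<alpha>" "b \<in> set (darrs Q)"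
  shows "mderiv (\<lambda>z. em (shift_entry p a i j z b)) (if b = a then felem i j else 0)"
proof -
  have e: "em (shift_entry p a i j z b) = em (p b) + (if b = a then z \<odot> felem i j else 0)" for z
    by (rule em_shift_entry[of p b, OF formatsD(1)[OF assms(1,3)]]) (use assms(2) in \<open>auto simp: arrow_idx_def\<close>)
  have "mderiv (\<lambda>z. em (p b) + (if b = a then z \<odot> felem i j else 0)) (0 + (if b = a then felem i j else 0))"
    by (intro mderiv_add mderiv_const) (auto intro: mderiv_id_scale mderiv_const)
  thus ?thesis by (simp add: e)
qed

text \<open>Derivatives along coordinate lines, which is all that \<open>coord_deriv\<close> knows,
  do not by themselves give a chain rule. Induction on the construction of F yields coefficients
  valid for every differentiable curve through p; \<open>regular_fun_chain\<close> identifies them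
  with the partial derivatives by inserting coordinate lines. The curve may leave
  \<open>ambient D\<close> away from 0, because in the case of an inverse the value at p alone must
  be nonzero.\<close>

lemma regular_fun_differentiable:
  assumes "regular_fun D F" "p \<in> ambient D"
  shows "\<exists>d. \<forall>\<gamma> \<delta>. \<gamma> 0 = p \<longrightarrow> (\<forall>z. \<gamma> z \<in> formats (quiv D) (dimv D)) \<longrightarrow>
     (\<forall>a\<in>set (darrs (quiv D)). mderiv (\<lambda>z. em (\<gamma> z a)) (\<delta> a)) \<longrightarrow>
     ((\<lambda>z. F (\<gamma> z)) has_field_derivative
        (\<Sum>(a, i, j)\<in>arrow_idx (quiv D) (dimv D). d a i j * ent (\<delta> a) i j)) (at 0)"
  using assms
proof (induction rule: regular_fun.induct)
  case (regular_coord a i j)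
  let ?d = "\<lambda>b k l. if b = a \<and> k = i \<and> l = j then 1 else (0 :: complex)"
  show ?case
  proof (rule exI[of _ ?d], intro allI impI, goal_cases)
    case (1 \<gamma> \<delta>)
    have "(\<Sum>(b, k, l)\<in>arrow_idx (quiv D) (dimv D). ?d b k l * ent (\<delta> b) k l) =
      (\<Sum>t\<in>arrow_idx (quiv D) (dimv D). if t = (a, i, j) then ent (\<delta> a) i j else 0)"
      by (intro sum.cong) (auto split: if_splits)
    also have "\<dots> = ent (\<delta> a) i j" using regular_coord by (simp add: arrow_idx_def)
    finally have s: "(\<Sum>(b, k, l)\<in>arrow_idx (quiv D) (dimv D). ?d b k l * ent (\<delta> b) k l) = ent (\<delta> a) i j" .
    have "((\<lambda>z. ent (em (\<gamma> z a)) i j) has_field_derivative ent (\<delta> a) i j) (at 0)"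
      using 1(3) regular_coord(1) by (auto simp: mderiv_def)
    moreover have "ent (em (\<gamma> z a)) i j = \<gamma> z a $$ (i, j)" for z
      using formatsD(2,3)[OF _ regular_coord(1), of "\<gamma> z" "dimv D"] 1(2) regular_coord by simp
    ultimately show ?case unfolding s by simp
  qed
next
  case (regular_const c)
  show ?case by (rule exI[of _ "\<lambda>_ _ _. 0"]) (auto simp: split_def)
next
  case (regular_add F G)
  then obtain d e where de:
    "\<And>\<gamma> \<delta>. \<gamma> 0 = p \<Longrightarrow> (\<forall>z. \<gamma> z \<in> formats (quiv D) (dimv D)) \<Longrightarrow>
     (\<forall>a\<in>set (darrs (quiv D)). mderiv (\<lambda>z. em (\<gamma> z a)) (\<delta> a)) \<Longrightarrow>
     ((\<lambda>z. F (\<gamma> z)) has_field_derivative (\<Sum>(a, i, j)\<in>arrow_idx (quiv D) (dimv D). d a i j * ent (\<delta> a) i j)) (at 0)"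
    "\<And>\<gamma> \<delta>. \<gamma> 0 = p \<Longrightarrow> (\<forall>z. \<gamma> z \<in> formats (quiv D) (dimv D)) \<Longrightarrow>
     (\<forall>a\<in>set (darrs (quiv D)). mderiv (\<lambda>z. em (\<gamma> z a)) (\<delta> a)) \<Longrightarrow>
     ((\<lambda>z. G (\<gamma> z)) has_field_derivative (\<Sum>(a, i, j)\<in>arrow_idx (quiv D) (dimv D). e a i j * ent (\<delta> a) i j)) (at 0)"
    by blast
  show ?case
    by (rule exI[of _ "\<lambda>a i j. d a i j + e a i j"], intro allI impI)
      (use DERIV_add[OF de] in \<open>simp add: split_def distrib_right sum.distrib\<close>)
next
  case (regular_mult F G)
  then obtain d e where de:
    "\<And>\<gamma> \<delta>. \<gamma> 0 = p \<Longrightarrow> (\<forall>z. \<gamma> z \<in> formats (quiv D) (dimv D)) \<Longrightarrow>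
     (\<forall>a\<in>set (darrs (quiv D)). mderiv (\<lambda>z. em (\<gamma> z a)) (\<delta> a)) \<Longrightarrow>
     ((\<lambda>z. F (\<gamma> z)) has_field_derivative (\<Sum>(a, i, j)\<in>arrow_idx (quiv D) (dimv D). d a i j * ent (\<delta> a) i j)) (at 0)"
    "\<And>\<gamma> \<delta>. \<gamma> 0 = p \<Longrightarrow> (\<forall>z. \<gamma> z \<in> formats (quiv D) (dimv D)) \<Longrightarrow>
     (\<forall>a\<in>set (darrs (quiv D)). mderiv (\<lambda>z. em (\<gamma> z a)) (\<delta> a)) \<Longrightarrow>
     ((\<lambda>z. G (\<gamma> z)) has_field_derivative (\<Sum>(a, i, j)\<in>arrow_idx (quiv D) (dimv D). e a i j * ent (\<delta> a) i j)) (at 0)"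
    by blast
  show ?case
  proof (rule exI[of _ "\<lambda>a i j. d a i j * G p + e a i j * F p"], intro allI impI, goal_cases)
    case (1 \<gamma> \<delta>)
    from DERIV_mult[OF de(1)[OF 1] de(2)[OF 1]] 1(1) show ?case
      by (simp add: split_def algebra_simps sum.distrib sum_distrib_left)
  qed
next
  case (regular_inverse F)
  then obtain d where d:
    "\<And>\<gamma> \<delta>. \<gamma> 0 = p \<Longrightarrow> (\<forall>z. \<gamma> z \<in> formats (quiv D) (dimv D)) \<Longrightarrow>
     (\<forall>a\<in>set (darrs (quiv D)). mderiv (\<lambda>z. em (\<gamma> z a)) (\<delta> a)) \<Longrightarrow>
     ((\<lambda>z. F (\<gamma> z)) has_field_derivative (\<Sum>(a, i, j)\<in>arrow_idx (quiv D) (dimv D). d a i j * ent (\<delta> a) i j)) (at 0)"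
    by blast
  have "F p \<noteq> 0" using regular_inverse by blast
  show ?case
  proof (rule exI[of _ "\<lambda>a i j. - (inverse (F p) * d a i j * inverse (F p))"], intro allI impI, goal_cases)
    case (1 \<gamma> \<delta>)
    from DERIV_inverse_fun[OF d[OF 1]] 1(1) \<open>F p \<noteq> 0\<close> show ?case
      by (simp add: split_def sum_distrib_right sum_distrib_left sum_negf mult_ac power2_eq_square)
  qed
qed

lemma regular_fun_chain:
  assumes F: "regular_fun D F" and p: "p \<in> ambient D"
    and \<gamma>: "\<gamma> 0 = p" "\<And>z. \<gamma> z \<in> formats (quiv D) (dimv D)"
      "\<And>a. a \<in> set (darrs (quiv D)) \<Longrightarrow> mderiv (\<lambda>z. em (\<gamma> z a)) (\<delta> a)"
  shows "((\<lambda>z. F (\<gamma> z)) has_field_derivative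
     (\<Sum>a\<in>set (darrs (quiv D)). ftrace (grad (quiv D) (dimv D) F p a * \<delta> a))) (at 0)"
proof -
  let ?Q = "quiv D" and ?\<alpha> = "dimv D"
  obtain d where d: "\<And>\<gamma> \<delta>. \<gamma> 0 = p \<Longrightarrow> (\<forall>z. \<gamma> z \<in> formats ?Q ?\<alpha>) \<Longrightarrow>
     (\<forall>a\<in>set (darrs ?Q). mderiv (\<lambda>z. em (\<gamma> z a)) (\<delta> a)) \<Longrightarrow>
     ((\<lambda>z. F (\<gamma> z)) has_field_derivative (\<Sum>(a, i, j)\<in>arrow_idx ?Q ?\<alpha>. d a i j * ent (\<delta> a) i j)) (at 0)"
    using regular_fun_differentiable[OF F p] by blast
  have pf: "p \<in> formats ?Q ?\<alpha>" using \<gamma>(1,2) by blast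
  have c: "coord_deriv F a i j p = d a i j" if aij: "(a, i, j) \<in> arrow_idx ?Q ?\<alpha>" for a i j
  proof -
    have a: "a \<in> set (darrs ?Q)" using aij by (auto simp: arrow_idx_def)
    have 0: "shift_entry p a i j 0 = p"
      by (auto simp: shift_entry_def intro!: ext eq_matI)
    have "((\<lambda>z. F (shift_entry p a i j z)) has_field_derivative
       (\<Sum>(b, k, l)\<in>arrow_idx ?Q ?\<alpha>. d b k l * ent (if b = a then felem i j else 0) k l)) (at 0)"
      using 0 shift_carrier[OF pf[unfolded formats_def] a] mderiv_shift_entry[OF pf aij]
      by (intro d) (auto simp: formats_def)
    moreover have "(\<Sum>(b, k, l)\<in>arrow_idx ?Q ?\<alpha>. d b k l * ent (if b = a then felem i j else 0) k l) =
       (\<Sum>t\<in>arrow_idx ?Q ?\<alpha>. if t = (a, i, j) then d a i j else 0)"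
      by (intro sum.cong) (auto split: if_splits)
    ultimately have "((\<lambda>z. F (shift_entry p a i j z)) has_field_derivative d a i j) (at 0)"
      using aij by simp
    thus ?thesis unfolding coord_deriv_def by (rule DERIV_imp_deriv)
  qed
  have "(\<Sum>(a, i, j)\<in>arrow_idx ?Q ?\<alpha>. d a i j * ent (\<delta> a) i j) =
    (\<Sum>(a, i, j)\<in>arrow_idx ?Q ?\<alpha>. coord_deriv F a i j p * ent (\<delta> a) i j)"
    using c by (intro sum.cong) auto
  also have "\<dots> = (\<Sum>a\<in>set (darrs ?Q). \<Sum>i<?\<alpha> (dtail ?Q a). \<Sum>j<?\<alpha> (dhead ?Q a). coord_deriv F a i j p * ent (\<delta> a) i j)"
    by (rule sum_arrow_idx[symmetric])
  also have "\<dots> = (\<Sum>a\<in>set (darrs ?Q). ftrace (grad ?Q ?\<alpha> F p a * \<delta> a))"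
  proof (intro sum.cong refl)
    fix a assume "a \<in> set (darrs ?Q)"
    thus "(\<Sum>i<?\<alpha> (dtail ?Q a). \<Sum>j<?\<alpha> (dhead ?Q a). coord_deriv F a i j p * ent (\<delta> a) i j) =
      ftrace (grad ?Q ?\<alpha> F p a * \<delta> a)"
      by (subst ftrace_mult_rect[of "?\<alpha> (dhead ?Q a)" "?\<alpha> (dtail ?Q a)"]) (auto simp: sum.swap[of _ "{..<?\<alpha> (dtail ?Q a)}"])
  qed
  finally show ?thesis using d[of \<gamma>, OF \<gamma>(1), of \<delta>] \<gamma>(2,3) by simp
qed

lemma eventually_alg_reps:
  assumes \<gamma>: "\<And>z. \<gamma> z \<in> formats Q \<alpha>" "\<gamma> 0 \<in> alg_reps Q \<alpha>"
    and d: "\<And>a. a \<in> set (darrs Q) \<Longrightarrow> mderiv (\<lambda>z. em (\<gamma> z a)) (\<delta> a)"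
  shows "eventually (\<lambda>z. \<gamma> z \<in> alg_reps Q \<alpha>) (nhds 0)"
proof -
  have "eventually (\<lambda>z. 1\<^sub>m (\<alpha> (dtail Q a)) + \<gamma> z a * \<gamma> z (dstar a) \<in> GLn (\<alpha> (dtail Q a))) (nhds 0)"
    if a: "a \<in> set (darrs Q)" for a
  proof (rule mderiv_GLn(1))
    have a': "dstar a \<in> set (darrs Q)" using a by simp
    note f = formatsD[OF \<gamma>(1) a] formatsD[OF \<gamma>(1) a', simplified]
    show "1\<^sub>m (\<alpha> (dtail Q a)) + \<gamma> z a * \<gamma> z (dstar a) \<in> carrier_mat (\<alpha> (dtail Q a)) (\<alpha> (dtail Q a))" for z
      using f by auto
    show "1\<^sub>m (\<alpha> (dtail Q a)) + \<gamma> 0 a * \<gamma> 0 (dstar a) \<in> GLn (\<alpha> (dtail Q a))"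
      using alg_repsD(2)[OF \<gamma>(2) a] .
    have "em (1\<^sub>m (\<alpha> (dtail Q a)) + \<gamma> z a * \<gamma> z (dstar a)) = fid (\<alpha> (dtail Q a)) + em (\<gamma> z a) * em (\<gamma> z (dstar a))" for z
      using f by (simp add: em_mult)
    thus "mderiv (\<lambda>z. em (1\<^sub>m (\<alpha> (dtail Q a)) + \<gamma> z a * \<gamma> z (dstar a)))
      (0 + (\<delta> a * em (\<gamma> 0 (dstar a)) + em (\<gamma> 0 a) * \<delta> (dstar a)))"
      using mderiv_add[OF mderiv_const mderiv_mult[OF d[OF a] d[OF a']]] by simp
  qed
  hence "eventually (\<lambda>z. \<forall>a\<in>set (darrs Q). 1\<^sub>m (\<alpha> (dtail Q a)) + \<gamma> z a * \<gamma> z (dstar a) \<in> GLn (\<alpha> (dtail Q a))) (nhds 0)"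
    by (simp add: eventually_ball_finite)
  thus ?thesis by eventually_elim (use \<gamma>(1) in \<open>auto simp: alg_reps_def formats_def\<close>)
qed

section \<open>The bracket in terms of gradients\<close>

text \<open>The matrix by which \<open>F_a\<close> acts on F (\<open>placed_F_der\<close>). The sum
  over the arrows with tail v, paired with an infinitesimal gauge transformation at v, is minus the
  derivative of F along the orbit.\<close>

definition moment :: "('v, 'e) quiver \<Rightarrow> ('v \<Rightarrow> nat) \<Rightarrow> ('e rep \<Rightarrow> complex) \<Rightarrow> 'e rep \<Rightarrow> 'e darr \<Rightarrow> fmat" where
  "moment Q \<alpha> F p a = grad Q \<alpha> F p (dstar a) * em (p (dstar a)) - em (p a) * grad Q \<alpha> F p a"

text \<open>The signed sum of the moments at the arrows with the same tail: the contribution of the terms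
  \<open>F\<^sub>a F\<^sub>b\<close> of \<open>P\<close> to the Hamiltonian vector field.\<close>

definition moment_shift :: "('v, 'e) quiver \<Rightarrow> ('v \<Rightarrow> nat) \<Rightarrow> ('e rep \<Rightarrow> complex) \<Rightarrow> 'e rep \<Rightarrow> 'e darr \<Rightarrow> fmat" where
  "moment_shift Q \<alpha> G p a =
     (\<Sum>b\<in>{b\<in>set (darrs Q). dtail Q b = dtail Q a \<and> arrow_rank Q b < arrow_rank Q a}. moment Q \<alpha> G p b) -
     (\<Sum>b\<in>{b\<in>set (darrs Q). dtail Q b = dtail Q a \<and> arrow_rank Q a < arrow_rank Q b}. moment Q \<alpha> G p b)"

text \<open>Twice the Hamiltonian vector field of G, for G in the second argument of the bracket;
  the factor 2 clears the coefficients 1/2 of P (\<open>rep_bracket_hamiltonian\<close>).\<close>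

definition hamiltonian :: "('v, 'e) quiver \<Rightarrow> ('v \<Rightarrow> nat) \<Rightarrow> ('e rep \<Rightarrow> complex) \<Rightarrow> 'e rep \<Rightarrow> 'e darr \<Rightarrow> fmat" where
  "hamiltonian Q \<alpha> G p a =
     eps a \<odot> ((fid (\<alpha> (dtail Q a)) + em (p a) * em (p (dstar a))) * grad Q \<alpha> G p (dstar a) +
              grad Q \<alpha> G p (dstar a) * (fid (\<alpha> (dhead Q a)) + em (p (dstar a)) * em (p a))) -
     moment_shift Q \<alpha> G p a * em (p a) + em (p a) * moment_shift Q \<alpha> G p (dstar a)"

text \<open>The double derivation applied to F, as one matrix indexed by all vertices. The two inner
  indices are interchanged so that the bimodule structure on double derivations becomes left and
  right matrix multiplication and a bracket term becomes the trace of a product.\<close>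

definition dmat :: "('v, 'e) quiver \<Rightarrow> ('v \<Rightarrow> nat) \<Rightarrow> 'e rep \<Rightarrow> ('v, 'e) dder \<Rightarrow> ('e rep \<Rightarrow> complex) \<Rightarrow>
    'v \<times> nat \<Rightarrow> 'v \<times> nat \<Rightarrow> complex" where
  "dmat Q \<alpha> p \<delta> F z z' = (\<Sum>(a, i, j)\<in>arrow_idx Q \<alpha>.
     coord_deriv F a i j p * tev Q \<alpha> p (\<delta> (Arr a)) (dtail Q a, i) z' z (dhead Q a, j))"

text \<open>The double derivations occurring in P produce matrices with a single nonzero block. This
  predicate locates the block, so that it can be replaced by an element of the ring.\<close>

definition placed :: "('v, 'e) quiver \<Rightarrow> ('v \<Rightarrow> nat) \<Rightarrow> ('v \<times> nat \<Rightarrow> 'v \<times> nat \<Rightarrow> complex) \<Rightarrow> 'v \<Rightarrow> 'v \<Rightarrow> fmat \<Rightarrow> bool" where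
  "placed Q \<alpha> M s r x \<longleftrightarrow> fid (\<alpha> s) * x = x \<and> x * fid (\<alpha> r) = x \<and> s \<in> set (verts Q) \<and> r \<in> set (verts Q) \<and>
     (\<forall>z\<in>vidx Q \<alpha>. \<forall>z'\<in>vidx Q \<alpha>. M z z' = (if fst z = s \<and> fst z' = r then ent x (snd z) (snd z') else 0))"

lemma dstar_dstar [simp]: "dstar (dstar a) = a" by (cases a) auto

lemma eps_dstar [simp]: "eps (dstar a) = - eps a" by (cases a) auto

lemma sum_dstar: "(\<Sum>a\<in>set (darrs Q). f (dstar a)) = (\<Sum>a\<in>set (darrs Q). f a)"
  by (rule sum.reindex_bij_witness[of _ dstar dstar]) auto

lemma sum_vidx: "(\<Sum>z\<in>vidx Q \<alpha>. f z) = (\<Sum>v\<in>set (verts Q). \<Sum>k<\<alpha> v. f (v, k))"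
  unfolding vidx_def by (subst sum.Sigma) (auto simp: split_def)

lemma sum_vidx_at:
  assumes "s \<in> set (verts Q)"
  shows "(\<Sum>z\<in>vidx Q \<alpha>. if fst z = s then f (snd z) else 0) = (\<Sum>k<\<alpha> s. f k)"
proof -
  have "(\<Sum>z\<in>vidx Q \<alpha>. if fst z = s then f (snd z) else 0) =
    (\<Sum>v\<in>set (verts Q). if v = s then \<Sum>k<\<alpha> v. f k else 0)"
    unfolding sum_vidx by (intro sum.cong) auto
  thus ?thesis using assms by simp
qed

lemma placed_outside:
  assumes "placed Q \<alpha> M s r x"
  shows "\<alpha> s \<le> i \<or> \<alpha> r \<le> j \<Longrightarrow> ent x i j = 0"
  using assms fid_absorb[of "\<alpha> s" x] fid_absorb[of "\<alpha> r" x] by (auto simp: placed_def)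

lemma placed_trace:
  assumes M: "placed Q \<alpha> M s r x" and M': "placed Q \<alpha> M' r s y"
  shows "(\<Sum>z\<in>vidx Q \<alpha>. \<Sum>z'\<in>vidx Q \<alpha>. M z z' * M' z' z) = ftrace (x * y)"
proof -
  have v: "s \<in> set (verts Q)" "r \<in> set (verts Q)" using M by (auto simp: placed_def)
  have "(\<Sum>z\<in>vidx Q \<alpha>. \<Sum>z'\<in>vidx Q \<alpha>. M z z' * M' z' z) =
    (\<Sum>z\<in>vidx Q \<alpha>. if fst z = s then \<Sum>z'\<in>vidx Q \<alpha>. if fst z' = r then ent x (snd z) (snd z') * ent y (snd z') (snd z) else 0 else 0)"
    using M M' by (intro sum.cong HOL.refl) (auto simp: placed_def intro!: sum.cong sum.neutral)
  also have "\<dots> = (\<Sum>k<\<alpha> s. \<Sum>l<\<alpha> r. ent x k l * ent y l k)"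
  proof -
    have "(\<Sum>z'\<in>vidx Q \<alpha>. if fst z' = r then ent x k (snd z') * ent y (snd z') k else 0) = (\<Sum>l<\<alpha> r. ent x k l * ent y l k)" for k
      by (rule sum_vidx_at[OF v(2), where f="\<lambda>l. ent x k l * ent y l k"])
    note inner = this
    show ?thesis unfolding inner
      by (rule sum_vidx_at[OF v(1), where f="\<lambda>k. \<Sum>l<\<alpha> r. ent x k l * ent y l k"])
  qed
  also have "\<dots> = ftrace (x * y)"
    by (rule ftrace_mult_rect[symmetric]) (rule placed_outside[OF M])
  finally show ?thesis .
qed

context
  fixes Q :: "('v, 'e) quiver" and \<alpha> :: "'v \<Rightarrow> nat" and p :: "'e rep"
  assumes wf: "wf_quiver Q" and p: "p \<in> alg_reps Q \<alpha>"
begin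

abbreviation "I \<equiv> vidx Q \<alpha>"
abbreviation "J \<equiv> arrow_idx Q \<alpha>"

text \<open>Interchanging the sums over coordinates with those over the inner indices of the tensors
  separates the factor depending on F from the one depending on G.\<close>

lemma rep_bracket_dmat:
  "rep_bracket Q \<alpha> F G p = (\<Sum>(c, \<delta>, \<delta>')\<leftarrow>P_biv Q. c *
     ((\<Sum>z\<in>I. \<Sum>z'\<in>I. dmat Q \<alpha> p \<delta> F z z' * dmat Q \<alpha> p \<delta>' G z' z) -
      (\<Sum>z\<in>I. \<Sum>z'\<in>I. dmat Q \<alpha> p \<delta>' F z z' * dmat Q \<alpha> p \<delta> G z' z)))"
proof -
  let ?t = "\<lambda>j. (dtail Q (fst j), fst (snd j))" and ?h = "\<lambda>j. (dhead Q (fst j), snd (snd j))"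
  let ?f = "\<lambda>j. coord_deriv F (fst j) (fst (snd j)) (snd (snd j)) p"
  let ?g = "\<lambda>j. coord_deriv G (fst j) (fst (snd j)) (snd (snd j)) p"
  let ?T = "\<lambda>\<delta> z' z j. tev Q \<alpha> p (\<delta> (Arr (fst j))) (?t j) z' z (?h j)"
  have half: "(\<Sum>j\<in>J. \<Sum>j'\<in>J. ?f j * ?g j' * (\<Sum>z\<in>I. \<Sum>z'\<in>I. ?T \<delta> z' z j * ?T \<delta>' z z' j')) =
      (\<Sum>z\<in>I. \<Sum>z'\<in>I. dmat Q \<alpha> p \<delta> F z z' * dmat Q \<alpha> p \<delta>' G z' z)" for \<delta> \<delta>'
  proof -
    have "(\<Sum>z\<in>I. \<Sum>z'\<in>I. dmat Q \<alpha> p \<delta> F z z' * dmat Q \<alpha> p \<delta>' G z' z) =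
      (\<Sum>z\<in>I. \<Sum>z'\<in>I. \<Sum>j\<in>J. \<Sum>j'\<in>J. ?f j * ?g j' * (?T \<delta> z' z j * ?T \<delta>' z z' j'))"
      unfolding dmat_def split_def sum_product by (intro sum.cong HOL.refl) (simp only: mult_ac)
    also have "\<dots> = (\<Sum>z\<in>I. \<Sum>j\<in>J. \<Sum>j'\<in>J. \<Sum>z'\<in>I. ?f j * ?g j' * (?T \<delta> z' z j * ?T \<delta>' z z' j'))"
      by (intro sum.cong HOL.refl, subst sum.swap, intro sum.cong HOL.refl, rule sum.swap)
    also have "\<dots> = (\<Sum>j\<in>J. \<Sum>j'\<in>J. \<Sum>z\<in>I. \<Sum>z'\<in>I. ?f j * ?g j' * (?T \<delta> z' z j * ?T \<delta>' z z' j'))"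
      by (subst sum.swap, intro sum.cong HOL.refl, rule sum.swap)
    finally show ?thesis by (simp only: sum_distrib_left)
  qed
  have coord: "coord_bracket Q \<alpha> p (fst j) (fst (snd j)) (snd (snd j)) (fst j') (fst (snd j')) (snd (snd j')) =
      (\<Sum>(c, \<delta>, \<delta>')\<leftarrow>P_biv Q. c * ((\<Sum>z\<in>I. \<Sum>z'\<in>I. ?T \<delta> z' z j * ?T \<delta>' z z' j') -
        (\<Sum>z\<in>I. \<Sum>z'\<in>I. ?T \<delta>' z' z j * ?T \<delta> z z' j')))"
    if "j \<in> J" "j' \<in> J" for j j'
  proof -
    have J: "?t j \<in> I" "?h j \<in> I" "?t j' \<in> I" "?h j' \<in> I"
      using that arrow_idxD[OF wf, of "fst j" "fst (snd j)" "snd (snd j)"]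
        arrow_idxD[OF wf, of "fst j'" "fst (snd j')" "snd (snd j')"] by auto
    have "tev Q \<alpha> p (concat (map (\<lambda>(c, \<delta>, \<delta>'). tscale c (prod_bracket \<delta> \<delta>' e f)) L)) (?t j') (?h j) (?t j) (?h j') =
      (\<Sum>(c, \<delta>, \<delta>')\<leftarrow>L. c * tev Q \<alpha> p (prod_bracket \<delta> \<delta>' e f) (?t j') (?h j) (?t j) (?h j'))" for L e f
      by (induction L) (auto simp: tev_ops(1)[OF wf p J(3,2,1,4)])
    moreover have "coord_bracket Q \<alpha> p (fst j) (fst (snd j)) (snd (snd j)) (fst j') (fst (snd j')) (snd (snd j')) =
      tev Q \<alpha> p (dbracket Q (Arr (fst j)) (Arr (fst j'))) (?t j') (?h j) (?t j) (?h j')"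
      by (simp add: coord_bracket_def tev_def entry_def)
    ultimately show ?thesis by (simp add: dbracket_def tev_prod_bracket[OF wf p J])
  qed
  have lin: "(\<Sum>j\<in>J. \<Sum>j'\<in>J. ?f j * ?g j' * (\<Sum>(c, \<delta>, \<delta>')\<leftarrow>L. c * H \<delta> \<delta>' j j')) =
      (\<Sum>(c, \<delta>, \<delta>')\<leftarrow>L. c * (\<Sum>j\<in>J. \<Sum>j'\<in>J. ?f j * ?g j' * H \<delta> \<delta>' j j'))"
    for L :: "(complex \<times> ('v, 'e) dder \<times> ('v, 'e) dder) list" and H
    by (induction L) (auto simp: sum.distrib sum_distrib_left distrib_left mult.left_commute)
  have "rep_bracket Q \<alpha> F G p = (\<Sum>j\<in>J. \<Sum>j'\<in>J. ?f j * ?g j' *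
      coord_bracket Q \<alpha> p (fst j) (fst (snd j)) (snd (snd j)) (fst j') (fst (snd j')) (snd (snd j')))"
    by (simp only: rep_bracket_def sum_arrow_idx[where Q=Q and \<alpha>=\<alpha>] split_def)
  also have "\<dots> = (\<Sum>j\<in>J. \<Sum>j'\<in>J. ?f j * ?g j' * (\<Sum>(c, \<delta>, \<delta>')\<leftarrow>P_biv Q. c * ((\<Sum>z\<in>I. \<Sum>z'\<in>I. ?T \<delta> z' z j * ?T \<delta>' z z' j') -
        (\<Sum>z\<in>I. \<Sum>z'\<in>I. ?T \<delta>' z' z j * ?T \<delta> z z' j'))))"
    by (intro sum.cong HOL.refl) (simp only: coord)
  also have "\<dots> = (\<Sum>(c, \<delta>, \<delta>')\<leftarrow>P_biv Q. c *
     ((\<Sum>z\<in>I. \<Sum>z'\<in>I. dmat Q \<alpha> p \<delta> F z z' * dmat Q \<alpha> p \<delta>' G z' z) -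
      (\<Sum>z\<in>I. \<Sum>z'\<in>I. dmat Q \<alpha> p \<delta>' F z z' * dmat Q \<alpha> p \<delta> G z' z)))"
    unfolding lin by (simp only: right_diff_distrib sum_subtractf half)
  finally show ?thesis .
qed

text \<open>Each term of P is antisymmetrised by \<open>prod_bracket\<close>, and exchanging F with
  G exchanges the two halves. This later carries a statement about the first argument of the bracket
  over to the second.\<close>

lemma rep_bracket_antisym: "rep_bracket Q \<alpha> G F p = - rep_bracket Q \<alpha> F G p"
proof -
  have neg: "(\<Sum>(c, \<delta>, \<delta>')\<leftarrow>L. c * (H \<delta>' \<delta> - H \<delta> \<delta>')) = - (\<Sum>(c, \<delta>, \<delta>')\<leftarrow>L. c * (H \<delta> \<delta>' - H \<delta>' \<delta>))"
    for L :: "(complex \<times> ('v, 'e) dder \<times> ('v, 'e) dder) list" and H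
    by (induction L) (auto simp: algebra_simps)
  have swap: "(\<Sum>z\<in>I. \<Sum>z'\<in>I. dmat Q \<alpha> p \<delta> G z z' * dmat Q \<alpha> p \<delta>' F z' z) =
     (\<Sum>z\<in>I. \<Sum>z'\<in>I. dmat Q \<alpha> p \<delta>' F z z' * dmat Q \<alpha> p \<delta> G z' z)" for \<delta> \<delta>'
    by (subst sum.swap) (simp only: mult.commute)
  show ?thesis
    unfolding rep_bracket_dmat swap by (rule neg)
qed

lemma placed_dd:
  assumes b: "b \<in> set (darrs Q)"
  shows "placed Q \<alpha> (dmat Q \<alpha> p (dd Q b) F) (dhead Q b) (dtail Q b) (grad Q \<alpha> F p b)"
  unfolding placed_def
proof (intro conjI ballI)
  fix z z' assume I: "z \<in> I" "z' \<in> I"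
  have T: "tev Q \<alpha> p (dd_arrow Q b a) (dtail Q a, k) z' z (dhead Q a, l) =
      (if (a, k, l) = (b, snd z', snd z) \<and> fst z' = dtail Q b \<and> fst z = dhead Q b then 1 else 0)"
    if "(a, k, l) \<in> J" for a k l
  proof (cases "a = b")
    case True
    show ?thesis
      using entry_simps(2)[OF wf p arrow_idxD(1)[OF wf that] I(2), of "dtail Q a"]
        entry_simps(2)[OF wf p I(1) arrow_idxD(2)[OF wf that], of "dhead Q a"]
      by (cases z, cases z') (auto simp: dd_arrow_def True)
  qed (simp add: dd_arrow_def)
  have "dmat Q \<alpha> p (dd Q b) F z z' = (\<Sum>j\<in>J. if j = (b, snd z', snd z) then
      (if fst z = dhead Q b \<and> fst z' = dtail Q b then coord_deriv F b (snd z') (snd z) p else 0) else 0)"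
    unfolding dmat_def
  proof (intro sum.cong HOL.refl, clarify)
    fix a k l assume "(a, k, l) \<in> J"
    from T[OF this] show "coord_deriv F a k l p * tev Q \<alpha> p (dd Q b (Arr a)) (dtail Q a, k) z' z (dhead Q a, l) =
      (if (a, k, l) = (b, snd z', snd z) then
      (if fst z = dhead Q b \<and> fst z' = dtail Q b then coord_deriv F b (snd z') (snd z) p else 0) else 0)"
      by auto
  qed
  thus "dmat Q \<alpha> p (dd Q b) F z z' =
      (if fst z = dhead Q b \<and> fst z' = dtail Q b then ent (grad Q \<alpha> F p b) (snd z) (snd z') else 0)"
    using vidxD[OF I(1)] vidxD[OF I(2)] b by (auto simp: arrow_idx_def)
qed (use wf_quiverD(2,3)[OF wf b] in auto)

text \<open>Only the columns of \<open>c\<close> at the vertex s matter, since the rows of the other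
  factor at the remaining vertices are zero. For \<open>unit_elt Q\<close> this leaves a single
  identity block.\<close>

lemma placed_left:
  assumes M: "placed Q \<alpha> (dmat Q \<alpha> p \<delta> F) s r x" and s': "s' \<in> set (verts Q)" and y: "fid (\<alpha> s') * y = y"
    and c: "\<And>z w. z \<in> I \<Longrightarrow> w \<in> I \<Longrightarrow> fst w = s \<Longrightarrow> entry Q \<alpha> p c z w = (if fst z = s' then ent y (snd z) (snd w) else 0)"
  shows "placed Q \<alpha> (dmat Q \<alpha> p (dder_left c \<delta>) F) s' r (y * x)"
  unfolding placed_def
proof (intro conjI ballI)
  show "fid (\<alpha> s') * (y * x) = y * x" "y * x * fid (\<alpha> r) = y * x"
    using y M by (simp_all add: placed_def mult.assoc flip: mult.assoc[of "fid _" y x])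
  show "s' \<in> set (verts Q)" "r \<in> set (verts Q)" using s' M by (auto simp: placed_def)
  fix z z' assume I: "z \<in> I" "z' \<in> I"
  have "dmat Q \<alpha> p (dder_left c \<delta>) F z z' = (\<Sum>w\<in>I. entry Q \<alpha> p c z w * dmat Q \<alpha> p \<delta> F w z')"
  proof -
    have "dmat Q \<alpha> p (dder_left c \<delta>) F z z' = (\<Sum>(a, i, j)\<in>J. \<Sum>w\<in>I. entry Q \<alpha> p c z w *
        (coord_deriv F a i j p * tev Q \<alpha> p (\<delta> (Arr a)) (dtail Q a, i) z' w (dhead Q a, j)))"
      unfolding dmat_def dder_left_def
      by (intro sum.cong HOL.refl)
         (auto simp: tev_ops(4)[OF wf p _ I(2,1)] arrow_idxD[OF wf] sum_distrib_left mult_ac)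
    also have "\<dots> = (\<Sum>w\<in>I. entry Q \<alpha> p c z w * dmat Q \<alpha> p \<delta> F w z')"
      unfolding split_def dmat_def by (subst sum.swap) (simp only: sum_distrib_left)
    finally show ?thesis .
  qed
  also have "\<dots> = (\<Sum>w\<in>I. if fst w = s then if fst z = s' \<and> fst z' = r then ent y (snd z) (snd w) * ent x (snd w) (snd z') else 0 else 0)"
    using M I c by (intro sum.cong HOL.refl) (auto simp: placed_def)
  also have "\<dots> = (if fst z = s' \<and> fst z' = r then \<Sum>k<\<alpha> s. ent y (snd z) k * ent x k (snd z') else 0)"
    using M by (subst sum_vidx_at) (auto simp: placed_def)
  also have "(\<Sum>k<\<alpha> s. ent y (snd z) k * ent x k (snd z')) = ent (y * x) (snd z) (snd z')"
  proof -
    have "y * x = (y * fid (\<alpha> s)) * x" using M by (simp add: placed_def mult.assoc)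
    moreover have "fbound (max (\<alpha> s) (fsize x)) x" using fbound_fsize fbound_mono by (metis max.cobounded2)
    hence "ent (y * x) (snd z) (snd z') = (\<Sum>k<max (\<alpha> s) (fsize x). ent y (snd z) k * ent x k (snd z'))"
      by (intro ent_mult) auto
    moreover have "\<dots> = (\<Sum>k<\<alpha> s. ent y (snd z) k * ent x k (snd z'))"
      using placed_outside[OF M] by (intro sum.mono_neutral_right) (auto simp: not_less)
    ultimately show ?thesis by simp
  qed
  finally show "dmat Q \<alpha> p (dder_left c \<delta>) F z z' = (if fst z = s' \<and> fst z' = r then ent (y * x) (snd z) (snd z') else 0)" .
qed

lemma placed_right:
  assumes M: "placed Q \<alpha> (dmat Q \<alpha> p \<delta> F) s r x" and r': "r' \<in> set (verts Q)" and y: "y * fid (\<alpha> r') = y"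
    and c: "\<And>z w. z \<in> I \<Longrightarrow> w \<in> I \<Longrightarrow> fst w = r \<Longrightarrow> entry Q \<alpha> p c w z = (if fst z = r' then ent y (snd w) (snd z) else 0)"
  shows "placed Q \<alpha> (dmat Q \<alpha> p (dder_right \<delta> c) F) s r' (x * y)"
  unfolding placed_def
proof (intro conjI ballI)
  show "fid (\<alpha> s) * (x * y) = x * y" "x * y * fid (\<alpha> r') = x * y"
    using y M by (simp_all add: placed_def mult.assoc flip: mult.assoc[of "fid _" x y])
  show "s \<in> set (verts Q)" "r' \<in> set (verts Q)" using r' M by (auto simp: placed_def)
  fix z z' assume I: "z \<in> I" "z' \<in> I"
  have "dmat Q \<alpha> p (dder_right \<delta> c) F z z' = (\<Sum>w\<in>I. dmat Q \<alpha> p \<delta> F z w * entry Q \<alpha> p c w z')"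
  proof -
    have "dmat Q \<alpha> p (dder_right \<delta> c) F z z' = (\<Sum>(a, i, j)\<in>J. \<Sum>w\<in>I.
        (coord_deriv F a i j p * tev Q \<alpha> p (\<delta> (Arr a)) (dtail Q a, i) w z (dhead Q a, j)) * entry Q \<alpha> p c w z')"
      unfolding dmat_def dder_right_def
      by (intro sum.cong HOL.refl)
         (auto simp: tev_ops(5)[OF wf p _ I(2,1)] arrow_idxD[OF wf] sum_distrib_left mult_ac)
    also have "\<dots> = (\<Sum>w\<in>I. dmat Q \<alpha> p \<delta> F z w * entry Q \<alpha> p c w z')"
      unfolding split_def dmat_def by (subst sum.swap) (simp only: sum_distrib_right)
    finally show ?thesis .
  qed
  also have "\<dots> = (\<Sum>w\<in>I. if fst w = r then if fst z = s \<and> fst z' = r' then ent x (snd z) (snd w) * ent y (snd w) (snd z') else 0 else 0)"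
    using M I c by (intro sum.cong HOL.refl) (auto simp: placed_def)
  also have "\<dots> = (if fst z = s \<and> fst z' = r' then \<Sum>k<\<alpha> r. ent x (snd z) k * ent y k (snd z') else 0)"
    using M by (subst sum_vidx_at) (auto simp: placed_def)
  also have "(\<Sum>k<\<alpha> r. ent x (snd z) k * ent y k (snd z')) = ent (x * y) (snd z) (snd z')"
  proof -
    have "fbound (max (\<alpha> r) (fsize x)) x" using fbound_fsize fbound_mono by (metis max.cobounded2)
    hence "ent (x * y) (snd z) (snd z') = (\<Sum>k<max (\<alpha> r) (fsize x). ent x (snd z) k * ent y k (snd z'))"
      by (intro ent_mult) auto
    moreover have "\<dots> = (\<Sum>k<\<alpha> r. ent x (snd z) k * ent y k (snd z'))"
      using placed_outside[OF M] by (intro sum.mono_neutral_right) (auto simp: not_less)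
    ultimately show ?thesis by simp
  qed
  finally show "dmat Q \<alpha> p (dder_right \<delta> c) F z z' = (if fst z = s \<and> fst z' = r' then ent (x * y) (snd z) (snd z') else 0)" .
qed

lemma placed_diff:
  assumes "placed Q \<alpha> (dmat Q \<alpha> p \<delta> F) s r x" "placed Q \<alpha> (dmat Q \<alpha> p \<delta>' F) s r x'"
  shows "placed Q \<alpha> (dmat Q \<alpha> p (dder_minus \<delta> \<delta>') F) s r (x - x')"
proof -
  have "dmat Q \<alpha> p (dder_minus \<delta> \<delta>') F z z' = dmat Q \<alpha> p \<delta> F z z' - dmat Q \<alpha> p \<delta>' F z z'"
    if I: "z \<in> I" "z' \<in> I" for z z'
    unfolding dmat_def dder_minus_def sum_subtractf[symmetric]
    by (intro sum.cong HOL.refl)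
       (auto simp: tev_ops(1)[OF wf p _ I(2,1)] arrow_idxD[OF wf] algebra_simps)
  thus ?thesis using assms by (simp add: placed_def left_diff_distrib right_diff_distrib)
qed

lemma em_arr_fid:
  assumes "a \<in> set (darrs Q)"
  shows "k = \<alpha> (dtail Q a) \<Longrightarrow> fid k * em (p a) = em (p a)" "k = \<alpha> (dhead Q a) \<Longrightarrow> em (p a) * fid k = em (p a)"
  using formatsD[OF alg_reps_formats[OF p] assms] by auto

lemma placed_F_der:
  assumes a: "a \<in> set (darrs Q)"
  shows "placed Q \<alpha> (dmat Q \<alpha> p (F_der Q a) F) (dtail Q a) (dtail Q a) (moment Q \<alpha> F p a)"
proof -
  note d = formatsD[OF alg_reps_formats[OF p]] and v = wf_quiverD(2,3)[OF wf a]
  have a': "dstar a \<in> set (darrs Q)" using a by simp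
  have "placed Q \<alpha> (dmat Q \<alpha> p (dder_right (dd Q (dstar a)) (Arr (dstar a))) F) (dtail Q a) (dtail Q a)
     (grad Q \<alpha> F p (dstar a) * em (p (dstar a)))"
    using v placed_dd[OF a', of F] d(2,3)[OF a']
    by (intro placed_right[where r="dhead Q a"]) (auto simp: entry_arr a dest!: vidxD)
  moreover have "placed Q \<alpha> (dmat Q \<alpha> p (dder_left (Arr a) (dd Q a)) F) (dtail Q a) (dtail Q a)
     (em (p a) * grad Q \<alpha> F p a)"
    using v placed_dd[OF a, of F] d(2,3)[OF a]
    by (intro placed_left[where s="dhead Q a"]) (auto simp: entry_arr a dest!: vidxD)
  ultimately show ?thesis unfolding F_der_def moment_def by (rule placed_diff)
qed

lemma placed_unit_dd:
  assumes a: "a \<in> set (darrs Q)"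
  shows "placed Q \<alpha> (dmat Q \<alpha> p (dder_left (unit_elt Q \<boxplus> Arr (dstar a) \<cdot> Arr a) (dd Q a)) F) (dhead Q a) (dtail Q a)
     ((fid (\<alpha> (dhead Q a)) + em (p (dstar a)) * em (p a)) * grad Q \<alpha> F p a)"
proof (rule placed_left[OF placed_dd[OF a]])
  note d = formatsD[OF alg_reps_formats[OF p]] and v = wf_quiverD(2,3)[OF wf a]
  have a': "dstar a \<in> set (darrs Q)" using a by simp
  show "dhead Q a \<in> set (verts Q)" by (rule v)
  show "fid (\<alpha> (dhead Q a)) * (fid (\<alpha> (dhead Q a)) + em (p (dstar a)) * em (p a)) = fid (\<alpha> (dhead Q a)) + em (p (dstar a)) * em (p a)"
    using em_arr_fid[OF a'] by (simp add: distrib_left flip: mult.assoc)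
  fix z w assume I: "z \<in> I" "w \<in> I" and w: "fst w = dhead Q a"
  have "entry Q \<alpha> p (Arr (dstar a) \<cdot> Arr a) z w = (\<Sum>u\<in>I. if fst u = dtail Q a then
      if fst z = dhead Q a then p (dstar a) $$ (snd z, snd u) * p a $$ (snd u, snd w) else 0 else 0)"
    using I w a unfolding entry_simps(5)[OF wf p I]
    by (intro sum.cong HOL.refl) (auto simp: entry_arr)
  also have "\<dots> = (if fst z = dhead Q a then \<Sum>k<\<alpha> (dtail Q a). p (dstar a) $$ (snd z, k) * p a $$ (k, snd w) else 0)"
    using v by (subst sum_vidx_at) auto
  also have "\<dots> = (if fst z = dhead Q a then ent (em (p (dstar a)) * em (p a)) (snd z) (snd w) else 0)"
    using vidxD[OF I(1)] vidxD[OF I(2)] w d(2,3)[OF a] d(2,3)[OF a']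
    by (subst em_mult[symmetric]) (auto simp: scalar_prod_def atLeast0LessThan)
  finally show "entry Q \<alpha> p (unit_elt Q \<boxplus> Arr (dstar a) \<cdot> Arr a) z w =
    (if fst z = dhead Q a then ent (fid (\<alpha> (dhead Q a)) + em (p (dstar a)) * em (p a)) (snd z) (snd w) else 0)"
    using vidxD[OF I(1)] vidxD[OF I(2)] w
    by (auto simp: entry_simps(3)[OF wf p I] entry_unit[OF wf p I] prod_eq_iff)
qed

lemma rep_bracket_traces:
  "2 * rep_bracket Q \<alpha> F G p =
     (\<Sum>a\<in>set (darrs Q). eps a *
        (ftrace ((fid (\<alpha> (dhead Q a)) + em (p (dstar a)) * em (p a)) * grad Q \<alpha> F p a * grad Q \<alpha> G p (dstar a)) -
         ftrace (grad Q \<alpha> F p (dstar a) * ((fid (\<alpha> (dhead Q a)) + em (p (dstar a)) * em (p a)) * grad Q \<alpha> G p a)))) -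
     (\<Sum>a\<in>set (darrs Q). \<Sum>b\<in>set (darrs Q). if dtail Q b = dtail Q a \<and> arrow_rank Q a < arrow_rank Q b
        then ftrace (moment Q \<alpha> F p a * moment Q \<alpha> G p b) - ftrace (moment Q \<alpha> F p b * moment Q \<alpha> G p a) else 0)"
proof -
  let ?D = "dmat Q \<alpha> p" and ?m = "moment Q \<alpha>"
  let ?B = "\<lambda>\<delta> \<delta>'. (\<Sum>z\<in>I. \<Sum>z'\<in>I. ?D \<delta> F z z' * ?D \<delta>' G z' z) - (\<Sum>z\<in>I. \<Sum>z'\<in>I. ?D \<delta>' F z z' * ?D \<delta> G z' z)"
  have dist: "distinct (darrs Q)" "distinct (verts Q)" using wf_quiverD[OF wf] by auto
  let ?S = "\<lambda>L. 2 * (\<Sum>(c, \<delta>, \<delta>')\<leftarrow>L. c * ?B \<delta> \<delta>')"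
  have S_concat: "?S (concat (map g xs)) = (\<Sum>x\<leftarrow>xs. ?S (g x))" for g and xs :: "'z list"
    by (induction xs) (simp_all add: distrib_left)
  have S_if: "?S (if P then [(- 1 / 2, \<delta>, \<delta>')] else []) = - (if P then ?B \<delta> \<delta>' else 0)" for P \<delta> \<delta>'
  proof -
    have "2 * (- 1 / 2 * x) = - x" for x :: complex by simp
    thus ?thesis by (cases P) (simp_all only: if_True if_False list.map prod.case sum_list.Cons sum_list.Nil add_0_right mult_zero_right minus_zero)
  qed
  have S_first: "?S (map (\<lambda>a. (eps a / 2, L a, R a)) xs) = (\<Sum>a\<leftarrow>xs. eps a * ?B (L a) (R a))" for L R xs
    by (induction xs) (simp_all add: algebra_simps)
  have "?S (P_biv Q) =
    (\<Sum>a\<leftarrow>darrs Q. eps a * ?B (dder_left (unit_elt Q \<boxplus> Arr (dstar a) \<cdot> Arr a) (dd Q a)) (dd Q (dstar a))) -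
    (\<Sum>i\<leftarrow>verts Q. \<Sum>a\<leftarrow>darrs Q. \<Sum>b\<leftarrow>darrs Q. if dtail Q a = i \<and> dtail Q b = i \<and> arrow_rank Q a < arrow_rank Q b
       then ?B (F_der Q a) (F_der Q b) else 0)"
    unfolding P_biv_def map_append sum_list_append distrib_left S_concat S_if S_first
      diff_conv_add_uminus[of "sum_list (map _ _)"] uminus_sum_list_map o_def ..
  also have "\<dots> = (\<Sum>a\<in>set (darrs Q). eps a * ?B (dder_left (unit_elt Q \<boxplus> Arr (dstar a) \<cdot> Arr a) (dd Q a)) (dd Q (dstar a))) -
    (\<Sum>a\<in>set (darrs Q). \<Sum>b\<in>set (darrs Q). if dtail Q b = dtail Q a \<and> arrow_rank Q a < arrow_rank Q b
       then ?B (F_der Q a) (F_der Q b) else 0)"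
  proof -
    \<comment> \<open>The vertex i in the second sum of P is determined by a, being its
      tail.\<close>
    have "(\<Sum>i\<in>set (verts Q). \<Sum>a\<in>set (darrs Q). \<Sum>b\<in>set (darrs Q). if dtail Q a = i \<and> dtail Q b = i \<and> arrow_rank Q a < arrow_rank Q b
       then ?B (F_der Q a) (F_der Q b) else 0) =
      (\<Sum>a\<in>set (darrs Q). \<Sum>i\<in>set (verts Q). if i = dtail Q a then \<Sum>b\<in>set (darrs Q). if dtail Q b = dtail Q a \<and> arrow_rank Q a < arrow_rank Q b
       then ?B (F_der Q a) (F_der Q b) else 0 else 0)"
      by (subst sum.swap) (intro sum.cong HOL.refl, auto intro!: sum.cong)
    also have "\<dots> = (\<Sum>a\<in>set (darrs Q). \<Sum>b\<in>set (darrs Q). if dtail Q b = dtail Q a \<and> arrow_rank Q a < arrow_rank Q b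
       then ?B (F_der Q a) (F_der Q b) else 0)"
      using wf_quiverD(2)[OF wf] by (intro sum.cong HOL.refl) auto
    finally show ?thesis by (simp only: sum_list_distinct_conv_sum_set dist)
  qed
  also have "(\<Sum>a\<in>set (darrs Q). \<Sum>b\<in>set (darrs Q). if dtail Q b = dtail Q a \<and> arrow_rank Q a < arrow_rank Q b
       then ?B (F_der Q a) (F_der Q b) else 0) =
     (\<Sum>a\<in>set (darrs Q). \<Sum>b\<in>set (darrs Q). if dtail Q b = dtail Q a \<and> arrow_rank Q a < arrow_rank Q b
        then ftrace (?m F p a * ?m G p b) - ftrace (?m F p b * ?m G p a) else 0)"
  proof (intro sum.cong HOL.refl if_cong)
    fix a b assume ab: "a \<in> set (darrs Q)" "b \<in> set (darrs Q)" "dtail Q b = dtail Q a \<and> arrow_rank Q a < arrow_rank Q b"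
    note P = placed_F_der[OF ab(1)] placed_F_der[OF ab(2), unfolded conjunct1[OF ab(3)]]
    show "?B (F_der Q a) (F_der Q b) = ftrace (?m F p a * ?m G p b) - ftrace (?m F p b * ?m G p a)"
      unfolding placed_trace[OF P(1) P(2)] placed_trace[OF P(2) P(1)] ..
  qed
  also have "(\<Sum>a\<in>set (darrs Q). eps a * ?B (dder_left (unit_elt Q \<boxplus> Arr (dstar a) \<cdot> Arr a) (dd Q a)) (dd Q (dstar a))) =
     (\<Sum>a\<in>set (darrs Q). eps a *
        (ftrace ((fid (\<alpha> (dhead Q a)) + em (p (dstar a)) * em (p a)) * grad Q \<alpha> F p a * grad Q \<alpha> G p (dstar a)) -
         ftrace (grad Q \<alpha> F p (dstar a) * ((fid (\<alpha> (dhead Q a)) + em (p (dstar a)) * em (p a)) * grad Q \<alpha> G p a))))"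
  proof (intro sum.cong HOL.refl)
    fix a assume a: "a \<in> set (darrs Q)"
    hence "dstar a \<in> set (darrs Q)" by simp
    note P = placed_unit_dd[OF a] placed_dd[OF this, simplified]
    show "eps a * ?B (dder_left (unit_elt Q \<boxplus> Arr (dstar a) \<cdot> Arr a) (dd Q a)) (dd Q (dstar a)) = eps a *
        (ftrace ((fid (\<alpha> (dhead Q a)) + em (p (dstar a)) * em (p a)) * grad Q \<alpha> F p a * grad Q \<alpha> G p (dstar a)) -
         ftrace (grad Q \<alpha> F p (dstar a) * ((fid (\<alpha> (dhead Q a)) + em (p (dstar a)) * em (p a)) * grad Q \<alpha> G p a)))"
      unfolding placed_trace[OF P(1) P(2)] placed_trace[OF P(2) P(1)] ..
  qed
  finally show ?thesis unfolding rep_bracket_dmat .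
qed

text \<open>Every term is brought into the form of a trace of \<open>grad F a\<close> times a matrix
  without F: terms with the gradient at \<open>dstar a\<close> are reindexed by the involution,
  which reverses \<open>eps\<close>, and the others are rotated under the trace.\<close>

theorem rep_bracket_hamiltonian:
  "2 * rep_bracket Q \<alpha> F G p = (\<Sum>a\<in>set (darrs Q). ftrace (grad Q \<alpha> F p a * hamiltonian Q \<alpha> G p a))"
proof -
  let ?A = "set (darrs Q)" and ?f = "grad Q \<alpha> F p" and ?g = "grad Q \<alpha> G p" and ?r = "\<lambda>a. em (p a)"
  let ?l = "moment Q \<alpha> F p" and ?m = "moment Q \<alpha> G p" and ?C = "moment_shift Q \<alpha> G p"
  let ?u = "\<lambda>a. fid (\<alpha> (dhead Q a)) + ?r (dstar a) * ?r a"
  let ?lt = "\<lambda>a b. dtail Q b = dtail Q a \<and> arrow_rank Q a < arrow_rank Q b"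
  have 1: "(\<Sum>a\<in>?A. eps a * (ftrace (?u a * ?f a * ?g (dstar a)) - ftrace (?f (dstar a) * (?u a * ?g a)))) =
    (\<Sum>a\<in>?A. ftrace (?f a * (eps a \<odot> (?u (dstar a) * ?g (dstar a) + ?g (dstar a) * ?u a))))"
  proof -
    have "(\<Sum>a\<in>?A. eps a * (ftrace (?u a * ?f a * ?g (dstar a)) - ftrace (?f (dstar a) * (?u a * ?g a)))) =
      (\<Sum>a\<in>?A. eps a * ftrace (?u a * ?f a * ?g (dstar a))) + (\<Sum>a\<in>?A. - eps a * ftrace (?f (dstar a) * (?u a * ?g a)))"
      by (simp add: right_diff_distrib sum_subtractf sum_negf)
    also have "(\<Sum>a\<in>?A. - eps a * ftrace (?f (dstar a) * (?u a * ?g a))) =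
        (\<Sum>a\<in>?A. eps a * ftrace (?f a * (?u (dstar a) * ?g (dstar a))))"
      by (subst sum_dstar[symmetric]) simp
    also have "(\<Sum>a\<in>?A. eps a * ftrace (?u a * ?f a * ?g (dstar a))) = (\<Sum>a\<in>?A. eps a * ftrace (?f a * (?g (dstar a) * ?u a)))"
      by (intro sum.cong HOL.refl) (simp only: mult.assoc ftrace_rotate[of "?u _"])
    finally show ?thesis by (simp only: fscale_simps ftrace_simps distrib_left sum.distrib add.commute)
  qed
  have 2: "(\<Sum>a\<in>?A. \<Sum>b\<in>?A. if ?lt a b then ftrace (?l a * ?m b) - ftrace (?l b * ?m a) else 0) =
     - (\<Sum>a\<in>?A. ftrace (?l a * ?C a))"
  proof -
    have "(\<Sum>a\<in>?A. \<Sum>b\<in>?A. if ?lt a b then ftrace (?l a * ?m b) - ftrace (?l b * ?m a) else 0) =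
      (\<Sum>a\<in>?A. \<Sum>b\<in>?A. if ?lt a b then ftrace (?l a * ?m b) else 0) - (\<Sum>a\<in>?A. \<Sum>b\<in>?A. if ?lt a b then ftrace (?l b * ?m a) else 0)"
      unfolding sum_subtractf[symmetric] by (intro sum.cong HOL.refl) auto
    also have "(\<Sum>a\<in>?A. \<Sum>b\<in>?A. if ?lt a b then ftrace (?l b * ?m a) else 0) = (\<Sum>b\<in>?A. \<Sum>a\<in>?A. if ?lt a b then ftrace (?l b * ?m a) else 0)"
      by (rule sum.swap)
    also have "\<dots> = (\<Sum>a\<in>?A. ftrace (?l a * (\<Sum>b\<in>{b\<in>?A. dtail Q b = dtail Q a \<and> arrow_rank Q b < arrow_rank Q a}. ?m b)))"
      by (intro sum.cong HOL.refl) (auto simp: sum_distrib_left sum.inter_filter intro!: sum.cong)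
    also have "(\<Sum>a\<in>?A. \<Sum>b\<in>?A. if ?lt a b then ftrace (?l a * ?m b) else 0) = (\<Sum>a\<in>?A. ftrace (?l a * (\<Sum>b\<in>{b\<in>?A. ?lt a b}. ?m b)))"
      by (intro sum.cong HOL.refl) (auto simp: sum_distrib_left sum.inter_filter intro!: sum.cong)
    finally show ?thesis by (simp add: moment_shift_def right_diff_distrib sum_subtractf)
  qed
  \<comment> \<open>Unfolding the moments of F puts the shift at the tail of a to the left of a, and
    the one at its head, which is the tail of \<open>dstar a\<close>, to the right.\<close>
  have 3: "(\<Sum>a\<in>?A. ftrace (?l a * ?C a)) = (\<Sum>a\<in>?A. ftrace (?f a * (?r a * ?C (dstar a) - ?C a * ?r a)))"
  proof -
    have "(\<Sum>a\<in>?A. ftrace (?l a * ?C a)) = (\<Sum>a\<in>?A. ftrace (?f (dstar a) * (?r (dstar a) * ?C a))) - (\<Sum>a\<in>?A. ftrace (?r a * (?f a * ?C a)))"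
      by (simp add: moment_def left_diff_distrib sum_subtractf mult.assoc)
    also have "(\<Sum>a\<in>?A. ftrace (?f (dstar a) * (?r (dstar a) * ?C a))) = (\<Sum>a\<in>?A. ftrace (?f a * (?r a * ?C (dstar a))))"
      by (subst sum_dstar[symmetric]) simp
    also have "(\<Sum>a\<in>?A. ftrace (?r a * (?f a * ?C a))) = (\<Sum>a\<in>?A. ftrace (?f a * (?C a * ?r a)))"
      by (simp only: ftrace_rotate[of "?r _"])
    finally show ?thesis by (simp add: right_diff_distrib sum_subtractf)
  qed
  have "2 * rep_bracket Q \<alpha> F G p = (\<Sum>a\<in>?A. ftrace (?f a * (eps a \<odot> (?u (dstar a) * ?g (dstar a) + ?g (dstar a) * ?u a)))) +
     (\<Sum>a\<in>?A. ftrace (?f a * (?r a * ?C (dstar a) - ?C a * ?r a)))"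
    unfolding rep_bracket_traces 1 2 3 by simp
  also have "\<dots> = (\<Sum>a\<in>?A. ftrace (?f a * hamiltonian Q \<alpha> G p a))"
    unfolding sum.distrib[symmetric]
    by (intro sum.cong HOL.refl) (simp add: hamiltonian_def distrib_left right_diff_distrib)
  finally show ?thesis .
qed

end

section \<open>Gauge transformations\<close>

lemma gauge_groupD: "g \<in> gauge_group D \<Longrightarrow> v \<in> set (verts (quiv D)) \<Longrightarrow> g v \<in> GLn (dimv D v)"
  by (simp add: gauge_group_def)

lemma rep_eqI:
  assumes "p \<in> formats Q \<alpha>" "p' \<in> formats Q \<alpha>" "\<And>a. a \<in> set (darrs Q) \<Longrightarrow> em (p a) = em (p' a)"
  shows "p = p'"
proof (rule PiE_ext)
  show "p \<in> Pi\<^sub>E (set (darrs Q)) (\<lambda>a. carrier_mat (\<alpha> (dtail Q a)) (\<alpha> (dhead Q a)))"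
    "p' \<in> Pi\<^sub>E (set (darrs Q)) (\<lambda>a. carrier_mat (\<alpha> (dtail Q a)) (\<alpha> (dhead Q a)))"
    using assms(1,2) by (auto simp: formats_def)
  fix a assume a: "a \<in> set (darrs Q)"
  show "p a = p' a"
    by (rule em_inject) (use formatsD[OF assms(1) a] formatsD[OF assms(2) a] assms(3)[OF a] in auto)
qed

lemma formats_em_fid:
  assumes "p \<in> formats Q \<alpha>" "a \<in> set (darrs Q)"
  shows "k = \<alpha> (dtail Q a) \<Longrightarrow> fid k * em (p a) = em (p a)" "k = \<alpha> (dhead Q a) \<Longrightarrow> em (p a) * fid k = em (p a)"
  using formatsD[OF assms] by auto

lemma fid_absorb_mult: "fid n * x = x \<Longrightarrow> fid n * (x * y) = x * y"
  by (simp flip: mult.assoc)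

lemma fid_felem: "k < n \<Longrightarrow> fid n * felem k l = felem k l" "l < n \<Longrightarrow> felem k l * fid n = felem k l"
  by (rule fid_absorb[THEN iffD1]; auto)+

context
  fixes D :: "('v, 'e) quot_data"
  assumes wf: "wf_quiver (quiv D)"
begin

lemma gauge_endpoints:
  assumes "g \<in> gauge_group D" "a \<in> set (darrs (quiv D))"
  shows "g (dtail (quiv D) a) \<in> GLn (dimv D (dtail (quiv D) a))" "g (dhead (quiv D) a) \<in> GLn (dimv D (dhead (quiv D) a))"
  using assms wf_quiverD(2,3)[OF wf assms(2)] by (auto intro: gauge_groupD)

lemma gauge_act_formats:
  assumes "g \<in> gauge_group D" "p \<in> formats (quiv D) (dimv D)"
  shows "gauge_act D g p \<in> formats (quiv D) (dimv D)"
  unfolding formats_def gauge_act_def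
proof (rule restrict_PiE_iff[THEN iffD2], rule ballI)
  fix a assume a: "a \<in> set (darrs (quiv D))"
  note G = gauge_endpoints[OF assms(1) a]
  show "g (dtail (quiv D) a) * p a * minv (g (dhead (quiv D) a)) \<in> carrier_mat (dimv D (dtail (quiv D) a)) (dimv D (dhead (quiv D) a))"
    using GLn_carrier[OF G(1)] minv(1)[OF G(2)] formatsD(1)[OF assms(2) a] by (intro mult_carrier_mat)
qed

lemma em_gauge_act:
  assumes "g \<in> gauge_group D" "p \<in> formats (quiv D) (dimv D)" "a \<in> set (darrs (quiv D))"
  shows "em (gauge_act D g p a) = em (g (dtail (quiv D) a)) * (em (p a) * em (minv (g (dhead (quiv D) a))))"
  using assms formatsD[OF assms(2,3)] gauge_endpoints[OF assms(1,3)]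
  by (simp add: gauge_act_def em_mult mult.assoc)

lemma gauge_group_mult:
  "g \<in> gauge_group D \<Longrightarrow> h \<in> gauge_group D \<Longrightarrow> (\<lambda>v. g v * h v) \<in> gauge_group D"
  by (auto simp: gauge_group_def GLn_mult)

lemma gauge_group_inv: "g \<in> gauge_group D \<Longrightarrow> (\<lambda>v. minv (g v)) \<in> gauge_group D"
  by (auto simp: gauge_group_def GLn_minv)

lemma gauge_group_one: "(\<lambda>v. 1\<^sub>m (dimv D v)) \<in> gauge_group D"
  by (auto simp: gauge_group_def)

lemma gauge_act_mult:
  assumes g: "g \<in> gauge_group D" and h: "h \<in> gauge_group D" and p: "p \<in> formats (quiv D) (dimv D)"
  shows "gauge_act D g (gauge_act D h p) = gauge_act D (\<lambda>v. g v * h v) p"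
proof (rule rep_eqI)
  fix a assume a: "a \<in> set (darrs (quiv D))"
  note G = gauge_endpoints[OF g a] gauge_endpoints[OF h a]
  show "em (gauge_act D g (gauge_act D h p) a) = em (gauge_act D (\<lambda>v. g v * h v) p a)"
    using G by (simp add: em_gauge_act[OF g gauge_act_formats[OF h p] a] em_gauge_act[OF h p a]
        em_gauge_act[OF gauge_group_mult[OF g h] p a] minv_mult em_mult mult.assoc)
qed (use gauge_act_formats gauge_group_mult assms in blast)+

lemma gauge_act_one:
  assumes p: "p \<in> formats (quiv D) (dimv D)"
  shows "gauge_act D (\<lambda>v. 1\<^sub>m (dimv D v)) p = p"
proof (rule rep_eqI)
  fix a assume a: "a \<in> set (darrs (quiv D))"
  show "em (gauge_act D (\<lambda>v. 1\<^sub>m (dimv D v)) p a) = em (p a)"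
    using formats_em_fid[OF p a] by (simp add: em_gauge_act[OF gauge_group_one p a])
qed (use gauge_act_formats[OF gauge_group_one p] p in auto)

lemma gauge_act_inv:
  assumes g: "g \<in> gauge_group D" and p: "p \<in> formats (quiv D) (dimv D)"
  shows "gauge_act D (\<lambda>v. minv (g v)) (gauge_act D g p) = p"
proof -
  have "gauge_act D (\<lambda>v. minv (g v) * g v) p = gauge_act D (\<lambda>v. 1\<^sub>m (dimv D v)) p"
  proof -
    have "minv (g v) * g v = 1\<^sub>m (dimv D v)" if "v \<in> set (verts (quiv D))" for v
      using minv(3)[OF gauge_groupD[OF g that]] .
    thus ?thesis unfolding gauge_act_def using wf_quiverD(2,3)[OF wf] by (intro restrict_ext) auto
  qed
  thus ?thesis by (simp add: gauge_act_mult[OF gauge_group_inv[OF g] g p] gauge_act_one[OF p])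
qed

lemma gauge_orbit_self: "p \<in> formats (quiv D) (dimv D) \<Longrightarrow> p \<in> gauge_orbit D p"
  unfolding gauge_orbit_def using gauge_act_one gauge_group_one by (metis image_eqI)

lemma gauge_orbit_act:
  assumes g: "g \<in> gauge_group D" and p: "p \<in> formats (quiv D) (dimv D)"
  shows "gauge_orbit D (gauge_act D g p) = gauge_orbit D p"
proof
  show "gauge_orbit D (gauge_act D g p) \<subseteq> gauge_orbit D p"
    unfolding gauge_orbit_def using gauge_act_mult[OF _ g p] gauge_group_mult[OF _ g] by force
  have "gauge_act D h p = gauge_act D (\<lambda>v. h v * minv (g v)) (gauge_act D g p)" if h: "h \<in> gauge_group D" for h
    using gauge_act_mult[OF h gauge_group_inv[OF g] gauge_act_formats[OF g p]] gauge_act_inv[OF g p] by simp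
  thus "gauge_orbit D p \<subseteq> gauge_orbit D (gauge_act D g p)"
    unfolding gauge_orbit_def using gauge_group_mult[OF _ gauge_group_inv[OF g]] by force
qed

lemma gauge_alg_reps:
  assumes g: "g \<in> gauge_group D" and p: "p \<in> alg_reps (quiv D) (dimv D)"
  shows "gauge_act D g p \<in> alg_reps (quiv D) (dimv D)"
proof -
  note f = alg_reps_formats[OF p]
  have "1\<^sub>m (dimv D (dtail (quiv D) a)) + gauge_act D g p a * gauge_act D g p (dstar a) \<in> GLn (dimv D (dtail (quiv D) a))"
    if a: "a \<in> set (darrs (quiv D))" for a
  proof -
    have a': "dstar a \<in> set (darrs (quiv D))" using a by simp
    let ?t = "dtail (quiv D) a" and ?h = "dhead (quiv D) a"
    let ?k = "dimv D ?t"
    note G = gauge_endpoints[OF g a]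
    note d = formatsD[OF f a] formatsD[OF f a', simplified]
      formatsD[OF gauge_act_formats[OF g f] a] formatsD[OF gauge_act_formats[OF g f] a', simplified]
    have "em (1\<^sub>m ?k + gauge_act D g p a * gauge_act D g p (dstar a)) =
      fid ?k + em (g ?t) * (em (p a) * (em (minv (g ?h)) * em (g ?h)) * (em (p (dstar a)) * em (minv (g ?t))))"
      using d by (simp add: em_mult em_gauge_act[OF g f a] em_gauge_act[OF g f a'] mult.assoc)
    also have "\<dots> = em (g ?t * (1\<^sub>m ?k + p a * p (dstar a)) * minv (g ?t))"
      using G d by (simp add: em_minv em_mult distrib_left distrib_right mult.assoc)
    finally have "1\<^sub>m ?k + gauge_act D g p a * gauge_act D g p (dstar a) = g ?t * (1\<^sub>m ?k + p a * p (dstar a)) * minv (g ?t)"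
      using d G by (intro em_inject) auto
    thus ?thesis using alg_repsD(2)[OF p a] G by (simp add: GLn_mult GLn_minv)
  qed
  thus ?thesis using gauge_act_formats[OF g f] by (auto simp: alg_reps_def formats_def)
qed

text \<open>F is constant along the curve \<open>1 + z E_kl\<close> of group elements acting at v,
  and its derivative at z = 0 is minus the entry (l, k) of the sum. The framing vertex is excluded
  because the group acts trivially there.\<close>

lemma moment_sum_zero:
  assumes F: "regular_fun D F" and inv: "\<And>g. g \<in> gauge_group D \<Longrightarrow> F (gauge_act D g p) = F p"
    and p: "p \<in> ambient D" "p \<in> formats (quiv D) (dimv D)"
    and v: "v \<in> set (verts (quiv D))" "v \<noteq> framing D"
  shows "(\<Sum>a\<in>{a\<in>set (darrs (quiv D)). dtail (quiv D) a = v}. moment (quiv D) (dimv D) F p a) = 0"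
    (is "?S = 0")
proof (rule fmat_eqI)
  let ?Q = "quiv D" and ?\<alpha> = "dimv D" let ?n = "dimv D v" let ?A = "set (darrs ?Q)"
  let ?f = "grad ?Q ?\<alpha> F p"
  fix l k
  have "fid ?n * ?S = ?S \<and> ?S * fid ?n = ?S"
  proof -
    have "fid ?n * moment ?Q ?\<alpha> F p a = moment ?Q ?\<alpha> F p a \<and> moment ?Q ?\<alpha> F p a * fid ?n = moment ?Q ?\<alpha> F p a"
      if "a \<in> ?A" "dtail ?Q a = v" for a
    proof -
      have a': "dstar a \<in> ?A" using that by simp
      have "fid ?n * em (p a) = em (p a)" "em (p (dstar a)) * fid ?n = em (p (dstar a))"
        "fid ?n * ?f (dstar a) = ?f (dstar a)" "?f a * fid ?n = ?f a"
        using that formats_em_fid[OF p(2) that(1)] formats_em_fid[OF p(2) a'] by auto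
      thus ?thesis by (simp add: moment_def algebra_simps fid_absorb_mult)
    qed
    thus ?thesis by (simp add: sum_distrib_left sum_distrib_right)
  qed
  hence out: "\<not> (l < ?n \<and> k < ?n) \<Longrightarrow> ent ?S l k = 0"
    using fid_absorb[of ?n ?S] by (meson not_le)
  show "ent ?S l k = ent 0 l k"
  proof (cases "l < ?n \<and> k < ?n")
    case True
    define g where "g = (\<lambda>(z :: complex) w. if w = v then 1\<^sub>m ?n + z \<cdot>\<^sub>m mat ?n ?n (\<lambda>ij. if ij = (k, l) then 1 else 0) else 1\<^sub>m (?\<alpha> w))"
    define D' where "D' w = (if w = v then felem k l else 0)" for w
    have g0: "g 0 w = 1\<^sub>m (?\<alpha> w)" for w by (auto simp: g_def intro!: eq_matI)
    have gc: "g z w \<in> carrier_mat (?\<alpha> w) (?\<alpha> w)" for z w by (auto simp: g_def)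
    have eg: "em (g z w) = fid (?\<alpha> w) + z \<odot> D' w" for z w
      using True by (auto simp: g_def D'_def intro!: fmat_eqI)
    have "mderiv (\<lambda>z. fid (?\<alpha> w) + z \<odot> D' w) (0 + D' w)" for w
      by (intro mderiv_add mderiv_const mderiv_id_scale)
    hence dg: "mderiv (\<lambda>z. em (g z w)) (D' w)" for w by (simp add: eg)
    have "mderiv (\<lambda>z. em (minv (g z w))) (- (em (minv (g 0 w)) * D' w * em (minv (g 0 w))))" for w
      by (rule mderiv_minv[OF gc dg]) (simp add: g0)
    moreover have "em (minv (g 0 w)) * D' w * em (minv (g 0 w)) = D' w" for w
      using True by (auto simp: g0 D'_def fid_felem)
    ultimately have dgi: "mderiv (\<lambda>z. em (minv (g z w))) (- D' w)" for w by simp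
    have "eventually (\<lambda>z. g z w \<in> GLn (?\<alpha> w)) (nhds 0)" for w
      by (rule mderiv_GLn(1)[OF gc dg]) (simp add: g0)
    hence "eventually (\<lambda>z. \<forall>w\<in>set (verts ?Q). g z w \<in> GLn (?\<alpha> w)) (nhds 0)"
      by (simp add: eventually_ball_finite)
    hence ev: "eventually (\<lambda>z. g z \<in> gauge_group D) (nhds 0)"
      by eventually_elim (use v(2) in \<open>auto simp: gauge_group_def g_def\<close>)
    \<comment> \<open>The chain rule asks for a curve of the right formats at all z, while
      \<open>g z\<close> may be singular far from 0; the constant p fills in there.\<close>
    define \<gamma> where "\<gamma> z = (if g z \<in> gauge_group D then gauge_act D (g z) p else p)" for z
    define \<delta> where "\<delta> a = D' (dtail ?Q a) * em (p a) - em (p a) * D' (dhead ?Q a)" for a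
    have "((\<lambda>z. F (\<gamma> z)) has_field_derivative (\<Sum>a\<in>?A. ftrace (?f a * \<delta> a))) (at 0)"
    proof (rule regular_fun_chain[OF F p(1)])
      have "g 0 = (\<lambda>w. 1\<^sub>m (?\<alpha> w))" using g0 by (intro ext)
      thus "\<gamma> 0 = p" using gauge_act_one[OF p(2)] by (simp add: \<gamma>_def)
      show "\<gamma> z \<in> formats ?Q ?\<alpha>" for z using gauge_act_formats[OF _ p(2)] p(2) by (simp add: \<gamma>_def)
      fix a assume a: "a \<in> ?A"
      let ?e = "\<lambda>z. em (g z (dtail ?Q a)) * (em (p a) * em (minv (g z (dhead ?Q a))))"
      have "mderiv ?e (D' (dtail ?Q a) * (em (p a) * em (minv (g 0 (dhead ?Q a)))) +
         em (g 0 (dtail ?Q a)) * (0 * em (minv (g 0 (dhead ?Q a))) + em (p a) * - D' (dhead ?Q a)))"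
        by (intro mderiv_mult dg dgi mderiv_const)
      also have "(D' (dtail ?Q a) * (em (p a) * em (minv (g 0 (dhead ?Q a)))) +
         em (g 0 (dtail ?Q a)) * (0 * em (minv (g 0 (dhead ?Q a))) + em (p a) * - D' (dhead ?Q a))) = \<delta> a"
        using formats_em_fid[OF p(2) a] by (simp add: g0 \<delta>_def flip: mult.assoc)
      finally show "mderiv (\<lambda>z. em (\<gamma> z a)) (\<delta> a)"
        by (rule mderiv_cong) (use ev in eventually_elim, simp add: \<gamma>_def em_gauge_act[OF _ p(2) a])
    qed
    moreover have "F (\<gamma> z) = F p" for z using inv by (simp add: \<gamma>_def)
    ultimately have "((\<lambda>z. F p) has_field_derivative (\<Sum>a\<in>?A. ftrace (?f a * \<delta> a))) (at 0)" by simp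
    hence "(\<Sum>a\<in>?A. ftrace (?f a * \<delta> a)) = 0" using DERIV_unique DERIV_const by blast
    moreover have "(\<Sum>a\<in>?A. ftrace (?f a * \<delta> a)) = - ftrace (?S * felem k l)"
    proof -
      have "(\<Sum>a\<in>?A. ftrace (?f a * \<delta> a)) =
        (\<Sum>a\<in>?A. ftrace (em (p a) * ?f a * D' (dtail ?Q a))) - (\<Sum>a\<in>?A. ftrace (?f a * em (p a) * D' (dhead ?Q a)))"
        by (simp add: \<delta>_def right_diff_distrib sum_subtractf mult.assoc ftrace_rotate[of "em (p _)" "?f _"])
      also have "(\<Sum>a\<in>?A. ftrace (?f a * em (p a) * D' (dhead ?Q a))) =
          (\<Sum>a\<in>?A. ftrace (?f (dstar a) * em (p (dstar a)) * D' (dtail ?Q a)))"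
        by (subst sum_dstar[symmetric]) simp
      finally have "(\<Sum>a\<in>?A. ftrace (?f a * \<delta> a)) = - (\<Sum>a\<in>?A. ftrace (moment ?Q ?\<alpha> F p a * D' (dtail ?Q a)))"
        by (simp add: moment_def left_diff_distrib sum_subtractf)
      also have "(\<Sum>a\<in>?A. ftrace (moment ?Q ?\<alpha> F p a * D' (dtail ?Q a))) =
        (\<Sum>a\<in>{a\<in>?A. dtail ?Q a = v}. ftrace (moment ?Q ?\<alpha> F p a * felem k l))"
        by (subst sum.inter_filter) (auto simp: D'_def intro!: sum.cong)
      finally show ?thesis by (simp only: sum_distrib_right ftrace_sum)
    qed
    ultimately show ?thesis by (simp only: ftrace_felem) simp
  qed (use out in simp)
qed

text \<open>The involution on arrows combines the two halves of the infinitesimal action into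
  moments, and grouping by tails leaves the sums that vanish by invariance. Thus a Hamiltonian field
  may be altered by a gauge direction before it is paired with an invariant function.\<close>

lemma gauge_direction_zero:
  assumes F: "regular_fun D F" and inv: "\<And>g. g \<in> gauge_group D \<Longrightarrow> F (gauge_act D g p) = F p"
    and p: "p \<in> ambient D" "p \<in> formats (quiv D) (dimv D)" and \<Xi>: "\<Xi> (framing D) = 0"
  shows "(\<Sum>a\<in>set (darrs (quiv D)). ftrace (grad (quiv D) (dimv D) F p a *
     (\<Xi> (dtail (quiv D) a) * em (p a) - em (p a) * \<Xi> (dhead (quiv D) a)))) = 0"
proof -
  let ?Q = "quiv D" and ?\<alpha> = "dimv D" let ?A = "set (darrs ?Q)" let ?f = "grad ?Q ?\<alpha> F p"
  have "(\<Sum>a\<in>?A. ftrace (?f a * (\<Xi> (dtail ?Q a) * em (p a) - em (p a) * \<Xi> (dhead ?Q a)))) =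
    (\<Sum>a\<in>?A. ftrace (em (p a) * ?f a * \<Xi> (dtail ?Q a))) - (\<Sum>a\<in>?A. ftrace (?f a * em (p a) * \<Xi> (dhead ?Q a)))"
    by (simp add: right_diff_distrib sum_subtractf mult.assoc)
      (simp only: ftrace_rotate[of _ _ "em (p _)"] ftrace_rotate)
  also have "(\<Sum>a\<in>?A. ftrace (?f a * em (p a) * \<Xi> (dhead ?Q a))) =
      (\<Sum>a\<in>?A. ftrace (?f (dstar a) * em (p (dstar a)) * \<Xi> (dtail ?Q a)))"
    by (subst sum_dstar[symmetric]) simp
  finally have "(\<Sum>a\<in>?A. ftrace (?f a * (\<Xi> (dtail ?Q a) * em (p a) - em (p a) * \<Xi> (dhead ?Q a)))) =
     - (\<Sum>a\<in>?A. ftrace (moment ?Q ?\<alpha> F p a * \<Xi> (dtail ?Q a)))"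
    by (simp add: moment_def left_diff_distrib sum_subtractf)
  also have "(\<Sum>a\<in>?A. ftrace (moment ?Q ?\<alpha> F p a * \<Xi> (dtail ?Q a))) =
    (\<Sum>v\<in>set (verts ?Q). \<Sum>a\<in>{a\<in>?A. dtail ?Q a = v}. ftrace (moment ?Q ?\<alpha> F p a * \<Xi> (dtail ?Q a)))"
    by (rule sum.group[symmetric]) (use wf_quiverD(2)[OF wf] in auto)
  also have "\<dots> = (\<Sum>v\<in>set (verts ?Q). ftrace ((\<Sum>a\<in>{a\<in>?A. dtail ?Q a = v}. moment ?Q ?\<alpha> F p a) * \<Xi> v))"
    by (intro sum.cong HOL.refl) (simp add: sum_distrib_right)
  also have "\<dots> = 0"
  proof (intro sum.neutral ballI)
    fix v assume v: "v \<in> set (verts ?Q)"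
    show "ftrace ((\<Sum>a\<in>{a\<in>?A. dtail ?Q a = v}. moment ?Q ?\<alpha> F p a) * \<Xi> v) = 0"
      using moment_sum_zero[OF F inv p v] \<Xi> by (cases "v = framing D") auto
  qed
  finally show ?thesis by simp
qed

end

section \<open>Regular maps\<close>

text \<open>\<open>regular_fun\<close> is about total functions given by formulas and depends on
  their values outside \<open>ambient D\<close>. Entries of matrix expressions, in particular of
  inverses, agree with such formulas on \<open>ambient D\<close> only.\<close>

definition regular_on :: "('v, 'e) quot_data \<Rightarrow> ('e rep \<Rightarrow> complex) \<Rightarrow> bool" where
  "regular_on D f \<longleftrightarrow> (\<exists>F. regular_fun D F \<and> (\<forall>p\<in>ambient D. F p = f p))"

definition regular_mat :: "('v, 'e) quot_data \<Rightarrow> ('e rep \<Rightarrow> fmat) \<Rightarrow> bool" where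
  "regular_mat D M \<longleftrightarrow> (\<exists>N. \<forall>p\<in>ambient D. fbound N (M p)) \<and> (\<forall>i j. regular_on D (\<lambda>p. ent (M p) i j))"

lemma regular_on_cong: "regular_on D f \<Longrightarrow> (\<And>p. p \<in> ambient D \<Longrightarrow> f p = g p) \<Longrightarrow> regular_on D g"
  by (auto simp: regular_on_def)

lemma regular_on_const: "regular_on D (\<lambda>p. c)"
  using regular_fun.regular_const[of D c] by (auto simp: regular_on_def)

lemma regular_on_add: "regular_on D f \<Longrightarrow> regular_on D g \<Longrightarrow> regular_on D (\<lambda>p. f p + g p)"
  unfolding regular_on_def by (elim exE conjE) (intro exI conjI, erule (1) regular_fun.regular_add, simp)

lemma regular_on_mult: "regular_on D f \<Longrightarrow> regular_on D g \<Longrightarrow> regular_on D (\<lambda>p. f p * g p)"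
  unfolding regular_on_def by (elim exE conjE) (intro exI conjI, erule (1) regular_fun.regular_mult, simp)

lemma regular_on_inverse:
  "regular_on D f \<Longrightarrow> (\<And>p. p \<in> ambient D \<Longrightarrow> f p \<noteq> 0) \<Longrightarrow> regular_on D (\<lambda>p. inverse (f p))"
  unfolding regular_on_def
  by (elim exE conjE) (intro exI conjI, erule regular_fun.regular_inverse, auto)

lemma regular_on_sum: "(\<And>x. x \<in> S \<Longrightarrow> regular_on D (f x)) \<Longrightarrow> regular_on D (\<lambda>p. \<Sum>x\<in>S. f x p)"
  by (induction S rule: infinite_finite_induct) (auto intro: regular_on_const regular_on_add)

lemma regular_on_prod: "(\<And>x. x \<in> S \<Longrightarrow> regular_on D (f x)) \<Longrightarrow> regular_on D (\<lambda>p. \<Prod>x\<in>S. f x p)"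
  by (induction S rule: infinite_finite_induct) (auto intro: regular_on_const regular_on_mult)

lemma regular_on_det:
  assumes "\<And>p. p \<in> ambient D \<Longrightarrow> A p \<in> carrier_mat n n"
    "\<And>i j. i < n \<Longrightarrow> j < n \<Longrightarrow> regular_on D (\<lambda>p. A p $$ (i, j))"
  shows "regular_on D (\<lambda>p. det (A p))"
proof (rule regular_on_cong)
  show "regular_on D (\<lambda>p. \<Sum>\<pi>\<in>{\<pi>. \<pi> permutes {0..<n}}. signof \<pi> * (\<Prod>i = 0..<n. A p $$ (i, \<pi> i)))"
    by (intro regular_on_sum regular_on_mult regular_on_const regular_on_prod assms(2))
       (auto simp: permutes_in_image)
qed (simp add: det_def'[OF assms(1)])

lemma regular_mat_cong:
  assumes "regular_mat D M" "\<And>p. p \<in> ambient D \<Longrightarrow> M p = M' p"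
  shows "regular_mat D M'"
proof -
  have "regular_on D (\<lambda>p. ent (M' p) i j)" for i j
    by (rule regular_on_cong[of D "\<lambda>p. ent (M p) i j"]) (use assms in \<open>auto simp: regular_mat_def\<close>)
  thus ?thesis using assms by (auto simp: regular_mat_def)
qed

lemma regular_mat_const: "regular_mat D (\<lambda>p. x)"
  using fbound_fsize[of x] by (auto simp: regular_mat_def intro: regular_on_const)

lemma regular_mat_bound:
  assumes "regular_mat D M" "regular_mat D M'"
  obtains N where "\<And>p. p \<in> ambient D \<Longrightarrow> fbound N (M p)" "\<And>p. p \<in> ambient D \<Longrightarrow> fbound N (M' p)"
proof -
  obtain K L where KL: "\<forall>p\<in>ambient D. fbound K (M p)" "\<forall>p\<in>ambient D. fbound L (M' p)"
    using assms by (auto simp: regular_mat_def)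
  show ?thesis by (rule that[of "max K L"]) (use KL in \<open>auto intro: fbound_mono\<close>)
qed

lemma regular_mat_add:
  assumes "regular_mat D M" "regular_mat D M'"
  shows "regular_mat D (\<lambda>p. M p + M' p)"
proof -
  obtain N where "\<And>p. p \<in> ambient D \<Longrightarrow> fbound N (M p)" "\<And>p. p \<in> ambient D \<Longrightarrow> fbound N (M' p)"
    by (rule regular_mat_bound[OF assms]) blast
  thus ?thesis using assms by (auto simp: regular_mat_def intro!: regular_on_add)
qed

lemma regular_mat_mult:
  assumes "regular_mat D M" "regular_mat D M'"
  shows "regular_mat D (\<lambda>p. M p * M' p)"
proof -
  obtain N where N: "\<And>p. p \<in> ambient D \<Longrightarrow> fbound N (M p)" "\<And>p. p \<in> ambient D \<Longrightarrow> fbound N (M' p)"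
    by (rule regular_mat_bound[OF assms]) blast
  have "regular_on D (\<lambda>p. ent (M p * M' p) i j)" for i j
  proof (rule regular_on_cong)
    show "regular_on D (\<lambda>p. \<Sum>k<N. ent (M p) i k * ent (M' p) k j)"
      using assms by (intro regular_on_sum regular_on_mult) (auto simp: regular_mat_def)
  qed (use N in \<open>simp add: ent_mult[of N]\<close>)
  moreover have "\<forall>p\<in>ambient D. fbound N (M p * M' p)" using N by blast
  ultimately show ?thesis by (auto simp: regular_mat_def)
qed

lemma regular_mat_scale:
  assumes "regular_mat D M"
  shows "regular_mat D (\<lambda>p. c \<odot> M p)"
proof -
  obtain N where "\<forall>p\<in>ambient D. fbound N (M p)" using assms by (auto simp: regular_mat_def)
  hence "\<forall>p\<in>ambient D. fbound N (c \<odot> M p)" by auto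
  thus ?thesis using assms by (auto simp: regular_mat_def intro!: regular_on_mult regular_on_const)
qed

lemma regular_mat_diff:
  assumes "regular_mat D M" "regular_mat D M'"
  shows "regular_mat D (\<lambda>p. M p - M' p)"
proof -
  have e: "x - y = x + (-1) \<odot> y" for x y :: fmat by (rule fmat_eqI) simp
  show ?thesis unfolding e by (intro regular_mat_add regular_mat_scale assms)
qed

text \<open>Cramer's rule: the entries are signed minors divided by a determinant that has no zero
  on \<open>ambient D\<close>.\<close>

lemma regular_mat_minv:
  assumes A: "\<And>p. p \<in> ambient D \<Longrightarrow> A p \<in> GLn n" and r: "regular_mat D (\<lambda>p. em (A p))"
  shows "regular_mat D (\<lambda>p. em (minv (A p)))"
proof -
  have e: "regular_on D (\<lambda>p. A p $$ (i, j))" if "i < n" "j < n" for i j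
  proof (rule regular_on_cong)
    show "regular_on D (\<lambda>p. ent (em (A p)) i j)" using r by (simp add: regular_mat_def del: ent_em)
  qed (use that GLn_dims[OF A] in simp)
  have b: "\<forall>p\<in>ambient D. fbound n (em (minv (A p)))"
    using GLn_dims[OF A] by (auto simp: fbound_def)
  have "regular_on D (\<lambda>p. ent (em (minv (A p))) i j)" for i j
  proof (cases "i < n \<and> j < n")
    case True
    have "regular_on D (\<lambda>p. inverse (det (A p)) * ((-1) ^ (j + i) * det (mat_delete (A p) j i)))"
    proof (intro regular_on_mult regular_on_inverse regular_on_const)
      show "regular_on D (\<lambda>p. det (A p))" by (rule regular_on_det[OF GLn_carrier[OF A] e])
      show "regular_on D (\<lambda>p. det (mat_delete (A p) j i))"
      proof (rule regular_on_det[where n="n - 1"])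
        fix k l assume kl: "k < n - 1" "l < n - 1"
        show "regular_on D (\<lambda>p. mat_delete (A p) j i $$ (k, l))"
        proof (rule regular_on_cong)
          show "regular_on D (\<lambda>p. A p $$ (if k < j then k else Suc k, if l < i then l else Suc l))"
            using kl by (intro e) auto
        qed (use kl GLn_dims[OF A] in \<open>simp add: mat_delete_def\<close>)
      qed (rule mat_delete_carrier[OF GLn_carrier[OF A]])
    qed (use A in \<open>auto simp: GLn_det\<close>)
    thus ?thesis
    proof (rule regular_on_cong)
      fix p assume p: "p \<in> ambient D"
      show "inverse (det (A p)) * ((-1) ^ (j + i) * det (mat_delete (A p) j i)) = ent (em (minv (A p))) i j"
        using True A[OF p] adj_mat(1)[OF GLn_carrier[OF A[OF p]]]
        by (simp add: minv_adj[OF A[OF p]] adj_mat_def cofactor_def)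
    qed
  next
    case False
    show ?thesis by (rule regular_on_cong[OF regular_on_const[of D 0]]) (use GLn_dims[OF A] False in auto)
  qed
  thus ?thesis using b by (auto simp: regular_mat_def)
qed

lemma regular_mat_coord:
  assumes a: "a \<in> set (darrs (quiv D))" and f: "ambient D \<subseteq> formats (quiv D) (dimv D)"
  shows "regular_mat D (\<lambda>p. em (p a))"
proof -
  let ?r = "dimv D (dtail (quiv D) a)" and ?c = "dimv D (dhead (quiv D) a)"
  have d: "dim_row (p a) = ?r" "dim_col (p a) = ?c" if "p \<in> ambient D" for p
    using formatsD[OF _ a] f that by auto
  have "regular_on D (\<lambda>p. ent (em (p a)) i j)" for i j
  proof (cases "i < ?r \<and> j < ?c")
    case True
    have "regular_on D (\<lambda>p. p a $$ (i, j))"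
      using regular_fun.regular_coord[OF a] True by (auto simp: regular_on_def)
    thus ?thesis by (rule regular_on_cong) (use d True in simp)
  next
    case False
    show ?thesis by (rule regular_on_cong[OF regular_on_const[of D 0]]) (use d False in auto)
  qed
  moreover have "fbound (max ?r ?c) (em (p a))" if "p \<in> ambient D" for p
    using d[OF that] by (auto simp: fbound_def)
  ultimately show ?thesis by (auto simp: regular_mat_def)
qed

lemma regular_fun_compose:
  assumes F: "regular_fun D' F" and \<Theta>: "\<And>p. p \<in> ambient D \<Longrightarrow> \<Theta> p \<in> ambient D'"
    and f: "ambient D' \<subseteq> formats (quiv D') (dimv D')"
    and r: "\<And>a. a \<in> set (darrs (quiv D')) \<Longrightarrow> regular_mat D (\<lambda>p. em (\<Theta> p a))"
  shows "regular_on D (\<lambda>p. F (\<Theta> p))"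
  using F
proof (induction rule: regular_fun.induct)
  case (regular_coord a i j)
  show ?case
  proof (rule regular_on_cong)
    show "regular_on D (\<lambda>p. ent (em (\<Theta> p a)) i j)" using r[OF regular_coord(1)] by (auto simp: regular_mat_def)
  next
    fix p assume "p \<in> ambient D"
    hence "\<Theta> p \<in> formats (quiv D') (dimv D')" using \<Theta> f by blast
    from formatsD[OF this regular_coord(1)] show "ent (em (\<Theta> p a)) i j = \<Theta> p a $$ (i, j)" using regular_coord by simp
  qed
next
  case (regular_inverse F)
  show ?case by (rule regular_on_inverse[OF regular_inverse.IH]) (rule regular_inverse.hyps(2)[OF \<Theta>])
qed (auto intro: regular_on_const regular_on_add regular_on_mult)

text \<open>Used in both directions, for \<open>psi\<close> and for \<open>phi\<close>. The map has
  to respect orbits only, with a group element of the target that may depend on p and g; this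
  already makes the pullback of an invariant function invariant.\<close>

lemma lifts_pullback:
  assumes F: "lifts D' \<phi> F" and \<Theta>: "\<And>p. p \<in> ambient D \<Longrightarrow> \<Theta> p \<in> ambient D'"
    and f: "ambient D' \<subseteq> formats (quiv D') (dimv D')"
    and r: "\<And>a. a \<in> set (darrs (quiv D')) \<Longrightarrow> regular_mat D (\<lambda>p. em (\<Theta> p a))"
    and stable: "\<And>p g. p \<in> ambient D \<Longrightarrow> g \<in> gauge_group D \<Longrightarrow> gauge_act D g p \<in> ambient D"
    and equi: "\<And>p g. p \<in> ambient D \<Longrightarrow> g \<in> gauge_group D \<Longrightarrow>
      \<exists>g'\<in>gauge_group D'. \<Theta> (gauge_act D g p) = gauge_act D' g' (\<Theta> p)"
    and locus: "\<And>p. p \<in> locus D \<Longrightarrow> p \<in> ambient D \<and> \<Theta> p \<in> locus D' \<and> \<psi> (gauge_orbit D p) = \<phi> (gauge_orbit D' (\<Theta> p))"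
  obtains G where "lifts D \<psi> G" "\<And>p. p \<in> ambient D \<Longrightarrow> G p = F (\<Theta> p)"
proof -
  have "regular_on D (\<lambda>p. F (\<Theta> p))"
    by (rule regular_fun_compose[OF _ \<Theta> f r]) (use F in \<open>simp add: lifts_def\<close>)
  then obtain G where G: "regular_fun D G" "\<And>p. p \<in> ambient D \<Longrightarrow> G p = F (\<Theta> p)"
    by (auto simp: regular_on_def)
  have "G (gauge_act D g p) = G p" if pg: "p \<in> ambient D" "g \<in> gauge_group D" for p g
  proof -
    obtain g' where "g' \<in> gauge_group D'" "\<Theta> (gauge_act D g p) = gauge_act D' g' (\<Theta> p)" using equi[OF pg] by blast
    thus ?thesis using F G(2)[OF stable[OF pg]] G(2)[OF pg(1)] \<Theta>[OF pg(1)] by (simp add: lifts_def)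
  qed
  moreover have "\<psi> (gauge_orbit D p) = G p" if "p \<in> locus D" for p
    using locus[OF that] F G(2) by (simp add: lifts_def)
  ultimately have "lifts D \<psi> G" using G(1) by (simp add: lifts_def)
  thus ?thesis using G(2) by (rule that)
qed

section \<open>The two Calogero--Moser spaces\<close>

text \<open>Sylvester's identity, from two factorisations of the block matrix with rows (1, V) and
  (-W, 1) into block triangular matrices.\<close>

lemma det_one_plus_commute:
  fixes V W :: "complex mat"
  assumes V: "V \<in> carrier_mat n k" and W: "W \<in> carrier_mat k n"
  shows "det (1\<^sub>m n + V * W) = det (1\<^sub>m k + W * V)"
proof -
  have c: "1\<^sub>m n + V * W \<in> carrier_mat n n" "1\<^sub>m k + W * V \<in> carrier_mat k k" "- W \<in> carrier_mat k n"
    using V W by auto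
  let ?L = "four_block_mat (1\<^sub>m n) (0\<^sub>m n k) (- W) (1\<^sub>m k)"
  let ?U = "four_block_mat (1\<^sub>m n) V (0\<^sub>m k n) (1\<^sub>m k + W * V)"
  let ?U' = "four_block_mat (1\<^sub>m n + V * W) V (0\<^sub>m k n) (1\<^sub>m k)"
  have L: "det ?L = 1"
    using det_four_block_mat_upper_right_zero[OF one_carrier_mat HOL.refl c(3) one_carrier_mat] by simp
  have U: "det ?U = det (1\<^sub>m k + W * V)"
    using det_four_block_mat_lower_left_zero[OF one_carrier_mat V HOL.refl c(2)] by simp
  have U': "det ?U' = det (1\<^sub>m n + V * W)"
    using det_four_block_mat_lower_left_zero[OF c(1) V HOL.refl one_carrier_mat] by simp
  have 1: "?L * ?U = four_block_mat (1\<^sub>m n) V (- W) (1\<^sub>m k)"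
    using V W by (subst mult_four_block_mat[of _ n n _ k _ k _ _ n _ k]) (auto intro!: arg_cong[of _ _ "four_block_mat _ _ _"] eq_matI)
  have 2: "?U' * ?L = four_block_mat (1\<^sub>m n) V (- W) (1\<^sub>m k)"
    using V W by (subst mult_four_block_mat[of _ n n _ k _ k _ _ n _ k]) (auto intro!: arg_cong[of _ _ "\<lambda>x. four_block_mat x _ _ _"] eq_matI)
  have "det ?L * det ?U = det ?U' * det ?L"
    using 1 2 det_mult[of ?L "n + k" ?U] det_mult[of ?U' "n + k" ?L] c V W by (metis four_block_carrier_mat one_carrier_mat)
  thus ?thesis by (simp only: L U U' mult_1 mult_1_right)
qed

lemma GLn_em_cong: "N \<in> GLn n \<Longrightarrow> M \<in> carrier_mat n n \<Longrightarrow> em M = em N \<Longrightarrow> M \<in> GLn n"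
  using em_inject[of M N] GLn_dims[of N n] by (metis carrier_matD)

lemma GLn_cancel:
  assumes "A \<in> GLn n"
  shows "em (minv A) * em A = fid n" "em A * em (minv A) = fid n"
    "em (minv A) * (em A * x) = fid n * x" "em A * (em (minv A) * x) = fid n * x"
    "fid n * em A = em A" "em A * fid n = em A" "fid n * em (minv A) = em (minv A)" "em (minv A) * fid n = em (minv A)"
    "fid n * (em A * x) = em A * x" "fid n * (em (minv A) * x) = em (minv A) * x"
  using em_minv[OF assms] GLn_dims[OF assms] by (simp_all flip: mult.assoc)

lemma em_mult_carrier: "A \<in> carrier_mat r k \<Longrightarrow> B \<in> carrier_mat k c \<Longrightarrow> em (A * B) = em A * em B"
  by (rule em_mult) auto

lemma em_eq_iff: "dim_row A = dim_row B \<Longrightarrow> dim_col A = dim_col B \<Longrightarrow> A = B \<longleftrightarrow> em A = em B"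
  using em_inject by blast

lemma em_fid_carrier:
  "A \<in> carrier_mat r c \<Longrightarrow> fid r * em A = em A" "A \<in> carrier_mat r c \<Longrightarrow> em A * fid c = em A"
  "A \<in> carrier_mat r c \<Longrightarrow> fid r * (em A * x) = em A * x"
  by (auto simp flip: mult.assoc)

lemma fscale_cancel: "c \<noteq> 0 \<Longrightarrow> c \<odot> x = c \<odot> y \<longleftrightarrow> x = y"
  by (metis fscale_simps(3,4) left_inverse)

section \<open>Arrows, gauge groups, ambient spaces and loci of the two quivers\<close>

lemma tad_darrs: "a \<in> set (darrs tadpole_quiver) \<longleftrightarrow>
   a = Arrow (X_arr 0) \<or> a = Opp (X_arr 0) \<or> a = Arrow V_arr \<or> a = Opp V_arr"
  by (auto simp: darrs_def tadpole_quiver_def)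

lemma cyc_darrs: "a \<in> set (darrs (cyclic_quiver m)) \<longleftrightarrow>
   (\<exists>i<m. a = Arrow (X_arr i)) \<or> (\<exists>i<m. a = Opp (X_arr i)) \<or> a = Arrow V_arr \<or> a = Opp V_arr"
  by (auto simp: darrs_def cyclic_quiver_def)

lemma ball_tad_darrs: "(\<forall>a\<in>set (darrs tadpole_quiver). P a) \<longleftrightarrow>
   P (Arrow (X_arr 0)) \<and> P (Opp (X_arr 0)) \<and> P (Arrow V_arr) \<and> P (Opp V_arr)"
  by (auto simp: tad_darrs)

lemma ball_cyc_darrs: "(\<forall>a\<in>set (darrs (cyclic_quiver m)). P a) \<longleftrightarrow>
   (\<forall>i<m. P (Arrow (X_arr i)) \<and> P (Opp (X_arr i))) \<and> P (Arrow V_arr) \<and> P (Opp V_arr)"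
  by (auto simp: cyc_darrs)

lemma quiver_ends [simp]:
  "src tadpole_quiver a = Cyc 0" "tgt tadpole_quiver (X_arr i) = Cyc 0" "tgt tadpole_quiver V_arr = Infty"
  "src (cyclic_quiver m) (X_arr i) = Cyc i" "tgt (cyclic_quiver m) (X_arr i) = Cyc (Suc i mod m)"
  "src (cyclic_quiver m) V_arr = Cyc 0" "tgt (cyclic_quiver m) V_arr = Infty"
  "verts tadpole_quiver = [Infty, Cyc 0]" "verts (cyclic_quiver m) = Infty # map Cyc [0..<m]"
  "arrow_rank tadpole_quiver = tadpole_rank" "arrow_rank (cyclic_quiver m) = cyclic_rank"
  by (simp_all add: tadpole_quiver_def cyclic_quiver_def)

lemma space_simps [simp]:
  "quiv (tad_space n t) = tadpole_quiver" "dimv (tad_space n t) = cm_dim n" "framing (tad_space n t) = Infty"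
  "quiv (cyc_space m n q) = cyclic_quiver m" "dimv (cyc_space m n q) = cm_dim n" "framing (cyc_space m n q) = Infty"
  by (simp_all add: tad_space_def cyc_space_def)

lemma gauge_group_tad:
  "g \<in> gauge_group (tad_space n t) \<longleftrightarrow> g (Cyc 0) \<in> GLn n \<and> g Infty = 1\<^sub>m 1"
  by (auto simp: gauge_group_def)

lemma gauge_group_cyc:
  "g \<in> gauge_group (cyc_space m n q) \<longleftrightarrow> (\<forall>i<m. g (Cyc i) \<in> GLn n) \<and> g Infty = 1\<^sub>m 1"
  by (auto simp: gauge_group_def)

primrec cprod :: "nat \<Rightarrow> (nat \<Rightarrow> complex mat) \<Rightarrow> nat \<Rightarrow> complex mat" where
  "cprod n X 0 = 1\<^sub>m n"
| "cprod n X (Suc k) = cprod n X k * X k"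

lemma cprod_GLn: "(\<And>i. i < k \<Longrightarrow> X i \<in> GLn n) \<Longrightarrow> cprod n X k \<in> GLn n"
  by (induction k) (auto intro: GLn_mult)

lemma cprod_carrier: "(\<And>i. i < k \<Longrightarrow> X i \<in> carrier_mat n n) \<Longrightarrow> cprod n X k \<in> carrier_mat n n"
  by (induction k) auto

text \<open>The open conditions of the tadpole ambient space in the coordinates A, B, V, W, without
  the defining equation of the locus (\<open>tad_ambient_iff\<close>).\<close>

definition quad_ok :: "nat \<Rightarrow> quad \<Rightarrow> bool" where
  "quad_ok n = (\<lambda>(A, B, V, W). A \<in> GLn n \<and> B \<in> GLn n \<and> V \<in> carrier_mat n 1 \<and> W \<in> carrier_mat 1 n \<and>
     1\<^sub>m n + V * W \<in> GLn n)"

definition quad_of :: "arr rep \<Rightarrow> quad" where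
  "quad_of p = (p (Arrow (X_arr 0)), p (Opp (X_arr 0)) + minv (p (Arrow (X_arr 0))), p (Arrow V_arr), p (Opp V_arr))"

text \<open>The map \<open>xi\<close> on representatives. Reading the quadruple off p by
  \<open>quad_of\<close> extends it to the whole tadpole ambient space.\<close>

definition psi :: "nat \<Rightarrow> nat \<Rightarrow> (nat \<Rightarrow> complex) \<Rightarrow> arr rep \<Rightarrow> arr rep" where
  "psi m n q p = cyc_rep m (xi_collection m n q (quad_of p))"

text \<open>The inverse of \<open>\<xi>\<close> on representatives: the transformation with \<open>g\<^sub>i = X\<^sub>0 \<cdots> X\<^sub>i\<^sub>-\<^sub>1\<close> makes
  \<open>X\<^sub>0, \<dots>, X\<^sub>m\<^sub>-\<^sub>2\<close> trivial, and \<open>B\<close> is then read off from \<open>X\<^sub>0 Z\<^sub>0 = 1 + X\<^sub>0 Y\<^sub>0\<close>.\<close>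

definition phi_quad :: "nat \<Rightarrow> nat \<Rightarrow> (nat \<Rightarrow> complex) \<Rightarrow> arr rep \<Rightarrow> quad" where
  "phi_quad m n q p = (let A = cprod n (\<lambda>i. p (Arrow (X_arr i))) m;
       B = inverse (q 0) \<cdot>\<^sub>m (1\<^sub>m n + p (Arrow (X_arr 0)) * p (Opp (X_arr 0)))
     in (A, B, B * A * p (Arrow V_arr), p (Opp V_arr) * minv A * minv B))"

definition phi :: "nat \<Rightarrow> nat \<Rightarrow> (nat \<Rightarrow> complex) \<Rightarrow> arr rep \<Rightarrow> arr rep" where
  "phi m n q p = tad_rep (phi_quad m n q p)"

lemma tad_formatsD:
  assumes "p \<in> formats tadpole_quiver (cm_dim n)"
  shows "p (Arrow (X_arr 0)) \<in> carrier_mat n n" "p (Opp (X_arr 0)) \<in> carrier_mat n n"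
    "p (Arrow V_arr) \<in> carrier_mat n 1" "p (Opp V_arr) \<in> carrier_mat 1 n"
  using formatsD(1)[OF assms, of "Arrow (X_arr 0)"] formatsD(1)[OF assms, of "Opp (X_arr 0)"]
    formatsD(1)[OF assms, of "Arrow V_arr"] formatsD(1)[OF assms, of "Opp V_arr"]
  by (simp_all add: tad_darrs)

lemma cyc_formatsD:
  assumes "p \<in> formats (cyclic_quiver m) (cm_dim n)"
  shows "i < m \<Longrightarrow> p (Arrow (X_arr i)) \<in> carrier_mat n n" "i < m \<Longrightarrow> p (Opp (X_arr i)) \<in> carrier_mat n n"
    "p (Arrow V_arr) \<in> carrier_mat n 1" "p (Opp V_arr) \<in> carrier_mat 1 n"
  using formatsD(1)[OF assms, of "Arrow (X_arr i)"] formatsD(1)[OF assms, of "Opp (X_arr i)"]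
    formatsD(1)[OF assms, of "Arrow V_arr"] formatsD(1)[OF assms, of "Opp V_arr"]
  by (simp_all add: cyc_darrs)

lemma tad_rep_simps [simp]:
  "tad_rep (A, B, V, W) (Arrow (X_arr 0)) = A" "tad_rep (A, B, V, W) (Opp (X_arr 0)) = B - minv A"
  "tad_rep (A, B, V, W) (Arrow V_arr) = V" "tad_rep (A, B, V, W) (Opp V_arr) = W"
  by (simp_all add: tad_rep_def tad_darrs)

lemma cyc_rep_simps [simp]:
  "i < m \<Longrightarrow> cyc_rep m (X, Y, V, W) (Arrow (X_arr i)) = X i" "i < m \<Longrightarrow> cyc_rep m (X, Y, V, W) (Opp (X_arr i)) = Y i"
  "cyc_rep m (X, Y, V, W) (Arrow V_arr) = V" "cyc_rep m (X, Y, V, W) (Opp V_arr) = W"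
  by (simp_all add: cyc_rep_def cyc_darrs)

lemma tad_rep_formats:
  assumes "A \<in> GLn n" "B \<in> GLn n" "V \<in> carrier_mat n 1" "W \<in> carrier_mat 1 n"
  shows "tad_rep (A, B, V, W) \<in> formats tadpole_quiver (cm_dim n)"
proof -
  have "tad_rep (A, B, V, W) \<in> extensional (set (darrs tadpole_quiver))" by (simp add: tad_rep_def)
  thus ?thesis
    using assms minus_carrier_mat[OF minv(1)[OF assms(1)], of B]
    unfolding formats_def PiE_iff ball_tad_darrs by (simp add: GLn_carrier)
qed

lemma cyc_rep_formats:
  assumes "\<And>i. i < m \<Longrightarrow> X i \<in> carrier_mat n n" "\<And>i. i < m \<Longrightarrow> Y i \<in> carrier_mat n n"
    "V \<in> carrier_mat n 1" "W \<in> carrier_mat 1 n"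
  shows "cyc_rep m (X, Y, V, W) \<in> formats (cyclic_quiver m) (cm_dim n)"
proof -
  have "cyc_rep m (X, Y, V, W) a \<in> carrier_mat (cm_dim n (dtail (cyclic_quiver m) a)) (cm_dim n (dhead (cyclic_quiver m) a))"
    if "a \<in> set (darrs (cyclic_quiver m))" for a
    using that[unfolded cyc_darrs] assms by (elim disjE exE conjE) simp_all
  thus ?thesis unfolding formats_def PiE_iff by (simp add: cyc_rep_def)
qed

lemma GLn_one_plus_commute:
  assumes "V \<in> carrier_mat n k" "W \<in> carrier_mat k n"
  shows "1\<^sub>m k + W * V \<in> GLn k \<longleftrightarrow> 1\<^sub>m n + V * W \<in> GLn n"
proof -
  have "1\<^sub>m k + W * V \<in> carrier_mat k k" "1\<^sub>m n + V * W \<in> carrier_mat n n" using assms by auto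
  thus ?thesis by (simp only: GLn_det det_one_plus_commute[OF assms])
qed

text \<open>For invertible x one has \<open>1 + x y = x (y + x^-1)\<close> and
  \<open>1 + y x = (y + x^-1) x\<close>, so both are invertible exactly when B is. The conditions at
  the two ends of v are equivalent by Sylvester's identity.\<close>

lemma tad_ambient_iff:
  "p \<in> ambient (tad_space n t) \<longleftrightarrow> p \<in> formats tadpole_quiver (cm_dim n) \<and> quad_ok n (quad_of p)"
proof -
  have "p \<in> ambient (tad_space n t) \<longleftrightarrow> quad_ok n (quad_of p)" if f: "p \<in> formats tadpole_quiver (cm_dim n)"
  proof -
    note c = tad_formatsD[OF f]
    let ?A = "p (Arrow (X_arr 0))" and ?y = "p (Opp (X_arr 0))"
    have "p \<in> ambient (tad_space n t) \<longleftrightarrow> ?A \<in> GLn n \<and> 1\<^sub>m n + ?A * ?y \<in> GLn n \<and> 1\<^sub>m n + ?y * ?A \<in> GLn n \<and>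
        1\<^sub>m n + p (Arrow V_arr) * p (Opp V_arr) \<in> GLn n"
      using f GLn_one_plus_commute[OF c(3,4)]
      by (auto simp: tad_space_def alg_reps_def formats_def ball_tad_darrs)
    also have "\<dots> \<longleftrightarrow> quad_ok n (quad_of p)"
    proof (cases "?A \<in> GLn n")
      case A: True
      note s = em_mult_carrier[of _ n n _ n] GLn_cancel[OF A] em_fid_carrier[OF c(2)] mult.assoc distrib_left distrib_right
      have B: "?y + minv ?A \<in> carrier_mat n n" using c minv(1)[OF A] by auto
      have e: "1\<^sub>m n + ?A * ?y = ?A * (?y + minv ?A)" "1\<^sub>m n + ?y * ?A = (?y + minv ?A) * ?A"
        using c B A minv(1)[OF A] by (auto intro!: em_inject simp: s add.commute)
      have "?A * (?y + minv ?A) \<in> GLn n \<longleftrightarrow> ?y + minv ?A \<in> GLn n"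
        "(?y + minv ?A) * ?A \<in> GLn n \<longleftrightarrow> ?y + minv ?A \<in> GLn n"
        using A B by (auto simp: GLn_det det_mult)
      thus ?thesis using A c e by (auto simp: quad_ok_def quad_of_def)
    qed (auto simp: quad_ok_def quad_of_def)
    finally show ?thesis .
  qed
  moreover have "p \<in> ambient (tad_space n t) \<Longrightarrow> p \<in> formats tadpole_quiver (cm_dim n)"
    by (auto simp: tad_space_def alg_reps_formats)
  ultimately show ?thesis by blast
qed

lemma quad_of_tad_rep:
  assumes "quad_ok n P"
  shows "quad_of (tad_rep P) = P" "tad_rep P \<in> ambient (tad_space n t)"
proof -
  obtain A B V W where P: "P = (A, B, V, W)" by (cases P)
  have 1: "B - minv A + minv A = B" using assms by (auto simp: P quad_ok_def intro!: em_inject)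
  thus 2: "quad_of (tad_rep P) = P" by (simp add: P quad_of_def)
  show "tad_rep P \<in> ambient (tad_space n t)"
    using assms tad_rep_formats[of A n B V W] unfolding tad_ambient_iff 2 by (auto simp: P quad_ok_def)
qed

lemma tad_rep_quad_of:
  assumes "p \<in> ambient (tad_space n t)"
  shows "tad_rep (quad_of p) = p" "quad_ok n (quad_of p)" "p \<in> formats tadpole_quiver (cm_dim n)"
proof -
  show q: "quad_ok n (quad_of p)" and f: "p \<in> formats tadpole_quiver (cm_dim n)" using assms by (auto simp: tad_ambient_iff)
  have "tad_rep (quad_of p) \<in> formats tadpole_quiver (cm_dim n)"
    using quad_of_tad_rep(2)[OF q] by (simp add: tad_ambient_iff)
  thus "tad_rep (quad_of p) = p"
    by (rule rep_eqI[OF _ f])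
      (use tad_formatsD[OF f] q in \<open>auto simp: tad_darrs quad_of_def quad_ok_def\<close>)
qed

text \<open>Multiplying the commutator equation by suitable words in A, B and their inverses frees
  it of inverses; the resulting form \<open>(1 + V W) A B = t B A\<close> is used
  throughout.\<close>

lemma tad_quads_iff:
  "(A, B, V, W) \<in> tad_quads n t \<longleftrightarrow> A \<in> GLn n \<and> B \<in> GLn n \<and> V \<in> carrier_mat n 1 \<and> W \<in> carrier_mat 1 n \<and>
     (fid n + em V * em W) * (em A * em B) = t \<odot> (em B * em A)"
proof -
  have "A * B * minv A * minv B * (1\<^sub>m n + V * W) = t \<cdot>\<^sub>m 1\<^sub>m n \<longleftrightarrow> (fid n + em V * em W) * (em A * em B) = t \<odot> (em B * em A)"
    if G: "A \<in> GLn n" "B \<in> GLn n" and c: "V \<in> carrier_mat n 1" "W \<in> carrier_mat 1 n"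
  proof -
    note s = GLn_cancel[OF G(1)] GLn_cancel[OF G(2)] em_fid_carrier[OF c(1)] em_fid_carrier[OF c(2)] mult.assoc distrib_left distrib_right
    let ?M = "em A * em B * em (minv A) * em (minv B) * (fid n + em V * em W)"
    have "A * B * minv A * minv B * (1\<^sub>m n + V * W) = t \<cdot>\<^sub>m 1\<^sub>m n \<longleftrightarrow> ?M = t \<odot> fid n"
      using G c by (subst em_eq_iff) (auto simp: em_mult)
    also have "\<dots> \<longleftrightarrow> em B * em A * em (minv B) * em (minv A) * ?M * (em A * em B) =
        em B * em A * em (minv B) * em (minv A) * (t \<odot> fid n) * (em A * em B)"
    proof
      assume "em B * em A * em (minv B) * em (minv A) * ?M * (em A * em B) =
        em B * em A * em (minv B) * em (minv A) * (t \<odot> fid n) * (em A * em B)"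
      hence "em A * em B * em (minv A) * em (minv B) * (em B * em A * em (minv B) * em (minv A) * ?M * (em A * em B)) * (em (minv B) * em (minv A)) =
        em A * em B * em (minv A) * em (minv B) * (em B * em A * em (minv B) * em (minv A) * (t \<odot> fid n) * (em A * em B)) * (em (minv B) * em (minv A))"
        by (simp only:)
      thus "?M = t \<odot> fid n" by (simp add: s fscale_distrib)
    qed simp
    also have "\<dots> \<longleftrightarrow> (fid n + em V * em W) * (em A * em B) = t \<odot> (em B * em A)" by (simp add: s)
    finally show ?thesis .
  qed
  thus ?thesis by (auto simp: tad_quads_def)
qed

lemma tad_quads_ok:
  assumes "P \<in> tad_quads n t" "t \<noteq> 0"
  shows "quad_ok n P"
proof -
  obtain A B V W where P: "P = (A, B, V, W)" by (cases P)
  note h = assms(1)[unfolded P tad_quads_iff]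
  have c: "1\<^sub>m n + V * W \<in> carrier_mat n n" using h by auto
  have "em ((1\<^sub>m n + V * W) * (A * B)) = em (t \<cdot>\<^sub>m (B * A))" using h by (auto simp: em_mult)
  hence "(1\<^sub>m n + V * W) * (A * B) = t \<cdot>\<^sub>m (B * A)" using h c by (intro em_inject) auto
  hence "det (1\<^sub>m n + V * W) * (det A * det B) = t ^ n * (det B * det A)"
    using h c det_mult[OF c, of "A * B"] by (auto simp: det_mult GLn_det)
  hence "det (1\<^sub>m n + V * W) \<noteq> 0" using h assms(2) by (auto simp: GLn_det)
  thus ?thesis using h c by (auto simp: P quad_ok_def GLn_det)
qed

text \<open>The determinants of A and B cancel in the relation \<open>(1 + V W) A B = t B A\<close>.
  On the cyclic side this yields the relation at the framing vertex.\<close>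

lemma tad_quads_det:
  assumes "(A, B, V, W) \<in> tad_quads n t"
  shows "det (1\<^sub>m 1 + W * V) = t ^ n"
proof -
  note h = assms[unfolded tad_quads_iff]
  have c: "1\<^sub>m n + V * W \<in> carrier_mat n n" using h by auto
  have "em ((1\<^sub>m n + V * W) * (A * B)) = em (t \<cdot>\<^sub>m (B * A))" using h by (auto simp: em_mult)
  hence "(1\<^sub>m n + V * W) * (A * B) = t \<cdot>\<^sub>m (B * A)" using h c by (intro em_inject) auto
  hence "det (1\<^sub>m n + V * W) * (det A * det B) = t ^ n * (det B * det A)"
    using h c det_mult[OF c, of "A * B"] by (auto simp: det_mult GLn_det)
  thus ?thesis using h det_one_plus_commute[of V n 1 W] by (auto simp: GLn_det)
qed

lemma tad_locus_iff:
  assumes "t \<noteq> 0"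
  shows "p \<in> locus (tad_space n t) \<longleftrightarrow> p \<in> ambient (tad_space n t) \<and> quad_of p \<in> tad_quads n t"
proof -
  have l: "locus (tad_space n t) = tad_rep ` tad_quads n t" by (simp add: tad_space_def)
  show ?thesis unfolding l
    using quad_of_tad_rep[OF tad_quads_ok[OF _ assms]] tad_rep_quad_of(1)[of p n t] by (metis (no_types, lifting) imageE imageI)
qed

lemma cyc_ambient_iff:
  "p \<in> ambient (cyc_space m n q) \<longleftrightarrow> p \<in> formats (cyclic_quiver m) (cm_dim n) \<and>
     (\<forall>i<m. p (Arrow (X_arr i)) \<in> GLn n \<and> 1\<^sub>m n + p (Arrow (X_arr i)) * p (Opp (X_arr i)) \<in> GLn n) \<and>
     1\<^sub>m n + p (Arrow V_arr) * p (Opp V_arr) \<in> GLn n" (is "?L \<longleftrightarrow> ?R")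
proof -
  have "?L \<longleftrightarrow> ?R" if f: "p \<in> formats (cyclic_quiver m) (cm_dim n)"
  proof -
    note c = cyc_formatsD[OF f]
    have "1\<^sub>m n + p (Opp (X_arr i)) * p (Arrow (X_arr i)) \<in> GLn n \<longleftrightarrow> 1\<^sub>m n + p (Arrow (X_arr i)) * p (Opp (X_arr i)) \<in> GLn n"
      if "i < m" for i
      by (rule GLn_one_plus_commute) (use c that in auto)
    moreover have "1\<^sub>m 1 + p (Opp V_arr) * p (Arrow V_arr) \<in> GLn 1 \<longleftrightarrow> 1\<^sub>m n + p (Arrow V_arr) * p (Opp V_arr) \<in> GLn n"
      by (rule GLn_one_plus_commute) (use c in auto)
    moreover have "?L \<longleftrightarrow> (\<forall>i<m. p (Arrow (X_arr i)) \<in> GLn n \<and> 1\<^sub>m n + p (Arrow (X_arr i)) * p (Opp (X_arr i)) \<in> GLn n \<and>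
        1\<^sub>m n + p (Opp (X_arr i)) * p (Arrow (X_arr i)) \<in> GLn n) \<and>
        1\<^sub>m n + p (Arrow V_arr) * p (Opp V_arr) \<in> GLn n \<and> 1\<^sub>m 1 + p (Opp V_arr) * p (Arrow V_arr) \<in> GLn 1"
      using f by (auto simp: cyc_space_def alg_reps_def formats_def ball_cyc_darrs)
    ultimately show ?thesis using f by blast
  qed
  moreover have "?L \<Longrightarrow> p \<in> formats (cyclic_quiver m) (cm_dim n)"
    by (auto simp: cyc_space_def alg_reps_formats)
  ultimately show ?thesis by blast
qed

lemma em_minv_mult_iff:
  assumes "M \<in> GLn n" "fid n * x = x"
  shows "em (minv M) * x = c \<odot> fid n \<longleftrightarrow> x = c \<odot> em M"
proof
  assume "em (minv M) * x = c \<odot> fid n"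
  hence "em M * (em (minv M) * x) = em M * (c \<odot> fid n)" by simp
  thus "x = c \<odot> em M" using assms GLn_cancel[OF assms(1)] by simp
qed (use GLn_cancel[OF assms(1)] in simp)

lemma minv_one_dim:
  assumes "M \<in> carrier_mat 1 1" "det M = c" "c \<noteq> 0"
  shows "M \<in> GLn 1" "minv M = inverse c \<cdot>\<^sub>m 1\<^sub>m 1"
proof -
  have M: "M = c \<cdot>\<^sub>m 1\<^sub>m 1" using assms det_single[of M] by (intro eq_matI) auto
  have "em M * em (inverse c \<cdot>\<^sub>m 1\<^sub>m 1) = fid 1" using assms(3) unfolding M by simp
  from GLn_emI[OF assms(1) _ this] show "M \<in> GLn 1" "minv M = inverse c \<cdot>\<^sub>m 1\<^sub>m 1" by auto
qed

lemma GLn_em_conj: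
  assumes "M \<in> carrier_mat n n" "N \<in> GLn n" "G \<in> GLn n" "em M = em G * (em N * em (minv G))"
  shows "M \<in> GLn n"
proof (rule GLn_em_cong)
  show "G * N * minv G \<in> GLn n" using assms by (intro GLn_mult GLn_minv)
  show "em M = em (G * N * minv G)" using assms by (simp add: em_mult mult.assoc)
qed (rule assms)

locale cm_spaces =
  fixes m n :: nat and q :: "nat \<Rightarrow> complex" and t :: complex
  assumes m: "m \<ge> 2" and q0: "\<And>i. i < m \<Longrightarrow> q i \<noteq> 0" and t_def: "t = (\<Prod>i<m. q i)"
begin

abbreviation "T \<equiv> tad_space n t"
abbreviation "C \<equiv> cyc_space m n q"
abbreviation "cx p i \<equiv> em (p (Arrow (X_arr i)))"
abbreviation "cy p i \<equiv> em (p (Opp (X_arr i)))"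
abbreviation "cv p \<equiv> em (p (Arrow V_arr))"
abbreviation "cw p \<equiv> em (p (Opp V_arr))"
abbreviation "tp s \<equiv> \<Prod>i\<le>s. q i"

lemma m_facts: "0 < m" "m - 1 < m" "Suc (m - 1) = m" "0 \<noteq> m - 1" "0 < m - 1"
  using m by auto

lemma t_nonzero: "t \<noteq> 0" using q0 by (auto simp: t_def)

lemma tp_nonzero: "s < m \<Longrightarrow> tp s \<noteq> 0" using q0 by auto

lemma tp_last: "tp (m - 1) = t"
  unfolding t_def using m_facts by (intro prod.cong) auto

lemma wf_T: "wf_quiver (quiv T)" and wf_C: "wf_quiver (quiv C)"
  using wf_quivers m by auto

lemma ambient_formats: "ambient T \<subseteq> formats (quiv T) (dimv T)" "ambient C \<subseteq> formats (quiv C) (dimv C)"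
  by (auto simp: tad_ambient_iff cyc_ambient_iff)

lemma ambient_alg_reps: "p \<in> ambient T \<Longrightarrow> p \<in> alg_reps tadpole_quiver (cm_dim n)"
  "p \<in> ambient C \<Longrightarrow> p \<in> alg_reps (cyclic_quiver m) (cm_dim n)"
  by (auto simp: tad_space_def cyc_space_def)

lemma gauge_stable:
  "p \<in> ambient T \<Longrightarrow> g \<in> gauge_group T \<Longrightarrow> gauge_act T g p \<in> ambient T"
  "p \<in> ambient C \<Longrightarrow> g \<in> gauge_group C \<Longrightarrow> gauge_act C g p \<in> ambient C"
proof -
  assume a: "p \<in> ambient T" "g \<in> gauge_group T"
  have "gauge_act T g p (Arrow (X_arr 0)) \<in> GLn n"
    using a(2)[unfolded gauge_group_tad] a(1) by (simp add: gauge_act_def tad_darrs tad_ambient_iff quad_ok_def quad_of_def GLn_mult GLn_minv)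
  thus "gauge_act T g p \<in> ambient T"
    using gauge_alg_reps[OF wf_T a(2)] ambient_alg_reps(1)[OF a(1)] by (simp add: tad_space_def)
next
  assume a: "p \<in> ambient C" "g \<in> gauge_group C"
  have "gauge_act C g p (Arrow (X_arr i)) \<in> GLn n" if "i < m" for i
    using a(2)[unfolded gauge_group_cyc] a(1) that m by (simp add: gauge_act_def cyc_darrs cyc_ambient_iff GLn_mult GLn_minv)
  thus "gauge_act C g p \<in> ambient C"
    using gauge_alg_reps[OF wf_C a(2)] ambient_alg_reps(2)[OF a(1)] by (simp add: cyc_space_def)
qed

lemma cyc_collectionsD:
  assumes "(X, Y, V, W) \<in> cyc_collections m n q"
  shows "\<forall>i<m. X i \<in> GLn n \<and> Y i \<in> carrier_mat n n \<and> Y i + minv (X i) \<in> GLn n"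
    "V \<in> carrier_mat n 1" "W \<in> carrier_mat 1 n"
  using assms by (auto simp: cyc_collections_def Let_def)

lemma em_XZ:
  assumes "X \<in> GLn n" "Y \<in> carrier_mat n n"
  shows "em X * em (Y + minv X) = fid n + em X * em Y" "em (Y + minv X) * em X = fid n + em Y * em X"
  using assms GLn_cancel[OF assms(1)] by (auto simp: distrib_left distrib_right add.commute)

text \<open>As \<open>X_i Z_i = 1 + X_i Y_i\<close> and \<open>Z_i X_i = 1 + Y_i X_i\<close>, the
  relation at i compares the loops along the two arrows meeting at i, and the inverses
  disappear.\<close>

lemma cyc_collections_iff:
  assumes X: "\<forall>i<m. X i \<in> GLn n \<and> Y i \<in> carrier_mat n n \<and> Y i + minv (X i) \<in> GLn n"
    and V: "V \<in> carrier_mat n 1" and W: "W \<in> carrier_mat 1 n"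
  shows "(X, Y, V, W) \<in> cyc_collections m n q \<longleftrightarrow>
     (\<forall>i. 0 < i \<and> i < m \<longrightarrow> fid n + em (X i) * em (Y i) = q i \<odot> (fid n + em (Y (i - 1)) * em (X (i - 1)))) \<and>
     (fid n + em (X 0) * em (Y 0)) * (fid n + em V * em W) = q 0 \<odot> (fid n + em (Y (m - 1)) * em (X (m - 1))) \<and>
     1\<^sub>m 1 + W * V \<in> GLn 1 \<and> minv (1\<^sub>m 1 + W * V) = inverse (t ^ n) \<cdot>\<^sub>m 1\<^sub>m 1"
proof -
  let ?Z = "\<lambda>i. Y i + minv (X i)"
  have G: "?Z j * X j \<in> GLn n" if "j < m" for j using X that by (auto intro: GLn_mult)
  have main: "minv (?Z j * X j) * X i * ?Z i * L = c \<cdot>\<^sub>m 1\<^sub>m n \<longleftrightarrow>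
    (fid n + em (X i) * em (Y i)) * em L = c \<odot> (fid n + em (Y j) * em (X j))"
    if ij: "i < m" "j < m" and L: "L \<in> carrier_mat n n" for i j L c
  proof -
    have Xi: "X i \<in> GLn n" "X j \<in> GLn n" "Y i \<in> carrier_mat n n" "Y j \<in> carrier_mat n n" "?Z i \<in> GLn n" "?Z j \<in> GLn n"
      using X ij by auto
    note d = GLn_dims[OF Xi(1)] GLn_dims[OF Xi(2)] GLn_dims[OF Xi(5)] GLn_dims[OF Xi(6)] GLn_dims[OF G[OF ij(2)]] carrier_matD[OF L]
    have "minv (?Z j * X j) * X i * ?Z i * L = c \<cdot>\<^sub>m 1\<^sub>m n \<longleftrightarrow>
      em (minv (?Z j * X j)) * (em (X i) * em (?Z i) * em L) = c \<odot> fid n"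
      by (subst em_eq_iff) (use d in \<open>simp_all add: em_mult mult.assoc del: index_add_mat\<close>)
    also have "\<dots> \<longleftrightarrow> em (X i) * em (?Z i) * em L = c \<odot> em (?Z j * X j)"
      by (rule em_minv_mult_iff[OF G[OF ij(2)]]) (use GLn_cancel[OF Xi(1)] in \<open>simp add: mult.assoc\<close>)
    also have "em (?Z j * X j) = em (?Z j) * em (X j)" by (rule em_mult) (use d in \<open>simp del: index_add_mat\<close>)
    finally show ?thesis unfolding em_XZ[OF Xi(1,3)] em_XZ[OF Xi(2,4)] .
  qed
  have main1: "minv (?Z j * X j) * X i * ?Z i = c \<cdot>\<^sub>m 1\<^sub>m n \<longleftrightarrow>
    fid n + em (X i) * em (Y i) = c \<odot> (fid n + em (Y j) * em (X j))" if ij: "i < m" "j < m" for i j c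
  proof -
    have "minv (?Z j * X j) * X i * ?Z i * 1\<^sub>m n = minv (?Z j * X j) * X i * ?Z i"
      using X ij G[OF ij(2)] by (intro right_mult_one_mat') (metis GLn_dims(2) index_mult_mat(3))
    moreover have "em (Y i) * fid n = em (Y i)" using X ij by (intro em_fid(2)) auto
    hence "(fid n + em (X i) * em (Y i)) * fid n = fid n + em (X i) * em (Y i)"
      by (simp add: distrib_right mult.assoc)
    ultimately show ?thesis using main[OF ij one_carrier_mat, of c] by simp
  qed
  have "minv (?Z (i - 1) * X (i - 1)) * X i * ?Z i = q i \<cdot>\<^sub>m 1\<^sub>m n \<longleftrightarrow>
    fid n + em (X i) * em (Y i) = q i \<odot> (fid n + em (Y (i - 1)) * em (X (i - 1)))" if "0 < i \<and> i < m" for i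
    using that by (intro main1) auto
  hence 1: "(\<forall>i\<in>{0<..<m}. minv (?Z (i - 1) * X (i - 1)) * X i * ?Z i = q i \<cdot>\<^sub>m 1\<^sub>m n) \<longleftrightarrow>
    (\<forall>i. 0 < i \<and> i < m \<longrightarrow> fid n + em (X i) * em (Y i) = q i \<odot> (fid n + em (Y (i - 1)) * em (X (i - 1))))"
    by auto
  have c: "1\<^sub>m n + V * W \<in> carrier_mat n n" and e: "em (1\<^sub>m n + V * W) = fid n + em V * em W"
    using V W by (auto simp: em_mult)
  show ?thesis
    unfolding cyc_collections_def Let_def mem_Collect_eq prod.case 1 t_def[symmetric]
      main[OF m_facts(1,2) c] e
    using X V W by blast
qed

text \<open>The relations at 0 and at infinity are left out: those at the other vertices suffice for
  \<open>psi_phi\<close>, and they can be solved successively for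
  \<open>Y_1, ..., Y_{m-1}\<close>.\<close>

definition locus1 :: "arr rep \<Rightarrow> bool" where
  "locus1 p \<longleftrightarrow> p \<in> ambient C \<and>
     (\<forall>i. 0 < i \<and> i < m \<longrightarrow> fid n + cx p i * cy p i = q i \<odot> (fid n + cy p (i - 1) * cx p (i - 1)))"

lemma cyc_locusD:
  assumes "p \<in> locus C"
  shows "locus1 p" "(fid n + cx p 0 * cy p 0) * (fid n + cv p * cw p) = q 0 \<odot> (fid n + cy p (m - 1) * cx p (m - 1))"
proof -
  from assms obtain X Y V W where p: "p = cyc_rep m (X, Y, V, W)" and c: "(X, Y, V, W) \<in> cyc_collections m n q"
    by (auto simp: cyc_space_def)
  note d = cyc_collectionsD[OF c]
  have "p \<in> ambient C"
    unfolding cyc_ambient_iff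
  proof (intro conjI allI impI)
    show "p \<in> formats (cyclic_quiver m) (cm_dim n)" unfolding p using d GLn_carrier by (intro cyc_rep_formats) auto
    show "1\<^sub>m n + p (Arrow V_arr) * p (Opp V_arr) \<in> GLn n"
      using c d(2,3) GLn_one_plus_commute[OF d(2,3)] by (simp add: p cyc_collections_def Let_def)
    fix i assume i: "i < m"
    show "p (Arrow (X_arr i)) \<in> GLn n" using d i by (simp add: p)
    show "1\<^sub>m n + p (Arrow (X_arr i)) * p (Opp (X_arr i)) \<in> GLn n"
    proof (rule GLn_em_cong)
      show "X i * (Y i + minv (X i)) \<in> GLn n" using d(1)[rule_format, OF i] by (intro GLn_mult) auto
      show "em (1\<^sub>m n + p (Arrow (X_arr i)) * p (Opp (X_arr i))) = em (X i * (Y i + minv (X i)))"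
        using d(1)[rule_format, OF i] i em_XZ(1)[of "X i" "Y i"] by (auto simp: p em_mult)
    qed (use d(1)[rule_format, OF i] i GLn_carrier in \<open>auto simp: p\<close>)
  qed
  with c show "locus1 p" "(fid n + cx p 0 * cy p 0) * (fid n + cv p * cw p) = q 0 \<odot> (fid n + cy p (m - 1) * cx p (m - 1))"
    using m_facts c[unfolded cyc_collections_iff[OF d]] by (simp_all add: p locus1_def less_imp_diff_less)
qed

section \<open>From tadpole to cyclic representations\<close>

lemma psi_simps:
  assumes "quad_of p = (A, B, V, W)"
  shows "s < m \<Longrightarrow> psi m n q p (Arrow (X_arr s)) = (if s = m - 1 then A else 1\<^sub>m n)"
    "s < m \<Longrightarrow> psi m n q p (Opp (X_arr s)) = (if s = m - 1 then t \<cdot>\<^sub>m (minv A * B) - minv A else tp s \<cdot>\<^sub>m B - 1\<^sub>m n)"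
    "psi m n q p (Arrow V_arr) = minv A * minv B * V" "psi m n q p (Opp V_arr) = W * B * A"
  unfolding psi_def assms by (auto simp: xi_collection_def Let_def t_def)

lemma psi_em:
  assumes "quad_ok n (A, B, V, W)" and p: "quad_of p = (A, B, V, W)"
  shows "s < m \<Longrightarrow> cx (psi m n q p) s = (if s = m - 1 then em A else fid n)"
    "s < m \<Longrightarrow> cy (psi m n q p) s = (if s = m - 1 then t \<odot> (em (minv A) * em B) - em (minv A) else tp s \<odot> em B - fid n)"
    "cv (psi m n q p) = em (minv A) * em (minv B) * em V" "cw (psi m n q p) = em W * em B * em A"
  using assms by (auto simp: psi_simps[OF p] quad_ok_def em_mult)

lemma psi_formats:
  assumes "quad_ok n (A, B, V, W)" and p: "quad_of p = (A, B, V, W)"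
  shows "psi m n q p \<in> formats (cyclic_quiver m) (cm_dim n)"
proof -
  have c: "A \<in> carrier_mat n n" "B \<in> carrier_mat n n" "V \<in> carrier_mat n 1" "W \<in> carrier_mat 1 n"
    "minv A \<in> carrier_mat n n" "minv B \<in> carrier_mat n n"
    using assms(1) minv(1) GLn_carrier by (auto simp: quad_ok_def)
  show ?thesis unfolding psi_def p xi_collection_def Let_def prod.case
    by (intro cyc_rep_formats) (use c in auto)
qed

text \<open>Every \<open>1 + X_i Y_i = X_i Z_i\<close> is the multiple \<open>t_i B\<close>, also
  for i = m - 1 because \<open>A (t A^-1 B) = t B\<close>. The new \<open>1 + V W\<close> is the old
  one conjugated by \<open>(B A)^-1\<close>.\<close>

lemma psi_ambient:
  assumes "p \<in> ambient T"
  shows "psi m n q p \<in> ambient C"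
proof -
  obtain A B V W where p: "quad_of p = (A, B, V, W)" by (cases "quad_of p")
  have ok: "quad_ok n (A, B, V, W)" using assms by (simp add: tad_ambient_iff p)
  hence G: "A \<in> GLn n" "B \<in> GLn n" "V \<in> carrier_mat n 1" "W \<in> carrier_mat 1 n" "1\<^sub>m n + V * W \<in> GLn n"
    by (auto simp: quad_ok_def)
  note f = psi_formats[OF ok p] note c = cyc_formatsD[OF f] and e = psi_em[OF ok p]
  note d = carrier_matD[OF G(3)] carrier_matD[OF G(4)] carrier_matD[OF c(3)] carrier_matD[OF c(4)] em_fid_carrier[OF G(3)] em_fid_carrier[OF G(4)]
  show ?thesis unfolding cyc_ambient_iff
  proof (intro conjI allI impI)
    show "psi m n q p \<in> formats (cyclic_quiver m) (cm_dim n)" by (rule f)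
    show "1\<^sub>m n + psi m n q p (Arrow V_arr) * psi m n q p (Opp V_arr) \<in> GLn n"
    proof (rule GLn_em_conj[where G="minv A * minv B" and N="1\<^sub>m n + V * W"])
      show "minv A * minv B \<in> GLn n" using G by (intro GLn_mult GLn_minv)
      have "minv (minv A * minv B) = B * A"
        using minv_mult[OF GLn_minv[OF G(1)] GLn_minv[OF G(2)]] minv_minv[OF G(1)] minv_minv[OF G(2)] by simp
      thus "em (1\<^sub>m n + psi m n q p (Arrow V_arr) * psi m n q p (Opp V_arr)) =
        em (minv A * minv B) * (em (1\<^sub>m n + V * W) * em (minv (minv A * minv B)))"
        using G(1,2) e d GLn_cancel[OF G(1)] GLn_cancel[OF G(2)]
        by (simp add: em_mult distrib_left distrib_right mult.assoc)
    qed (use G c in auto)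
    fix i assume i: "i < m"
    show "psi m n q p (Arrow (X_arr i)) \<in> GLn n" using psi_simps(1)[OF p i] G by simp
    show "1\<^sub>m n + psi m n q p (Arrow (X_arr i)) * psi m n q p (Opp (X_arr i)) \<in> GLn n"
    proof (rule GLn_em_cong)
      show "tp i \<cdot>\<^sub>m B \<in> GLn n" using G tp_nonzero[OF i] by (rule_tac GLn_smult) auto
      show "em (1\<^sub>m n + psi m n q p (Arrow (X_arr i)) * psi m n q p (Opp (X_arr i))) = em (tp i \<cdot>\<^sub>m B)"
        using carrier_matD[OF c(1)[OF i]] carrier_matD[OF c(2)[OF i]] i G(1,2) e GLn_cancel[OF G(1)] GLn_cancel[OF G(2)] tp_last
        by (simp add: em_mult right_diff_distrib)
    qed (use mult_carrier_mat[OF c(1)[OF i] c(2)[OF i]] in auto)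
  qed
qed

lemma xi_collection_mem:
  assumes P: "P \<in> tad_quads n t"
  shows "xi_collection m n q P \<in> cyc_collections m n q"
proof -
  obtain A B V W where P': "P = (A, B, V, W)" by (cases P)
  have ok: "quad_ok n (A, B, V, W)" using tad_quads_ok[OF P t_nonzero] by (simp add: P')
  have rel: "(fid n + em V * em W) * (em A * em B) = t \<odot> (em B * em A)" using P by (simp add: P' tad_quads_iff)
  have G: "A \<in> GLn n" "B \<in> GLn n" "V \<in> carrier_mat n 1" "W \<in> carrier_mat 1 n"
    using ok by (auto simp: quad_ok_def)
  note ca = GLn_cancel[OF G(1)] GLn_cancel[OF G(2)] em_fid_carrier[OF G(3)] em_fid_carrier[OF G(4)]
    carrier_matD[OF G(3)] carrier_matD[OF G(4)] GLn_dims[OF G(1)] GLn_dims[OF G(2)]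
  let ?X = "\<lambda>s. if s = m - 1 then A else 1\<^sub>m n"
  let ?Z = "\<lambda>s. if s = m - 1 then t \<cdot>\<^sub>m (minv A * B) else tp s \<cdot>\<^sub>m B"
  let ?Y = "\<lambda>s. ?Z s - minv (?X s)"
  have xi: "xi_collection m n q P = (?X, ?Y, minv A * minv B * V, W * B * A)"
    by (simp only: xi_collection_def P' Let_def prod.case t_def)
  have Z: "?Z s \<in> GLn n" if "s < m" for s
    using G tp_nonzero[OF that] t_nonzero GLn_mult[OF GLn_minv[OF G(1)] G(2)] by (auto intro!: GLn_smult)
  have X: "?X s \<in> GLn n" for s using G by simp
  have 1: "\<forall>s<m. ?X s \<in> GLn n \<and> ?Y s \<in> carrier_mat n n \<and> ?Y s + minv (?X s) \<in> GLn n"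
  proof (intro allI impI)
    fix s assume s: "s < m"
    have "?Y s + minv (?X s) = ?Z s"
      by (rule em_inject) (use GLn_dims[OF X[of s]] GLn_dims[OF Z[OF s]] in simp_all)
    thus "?X s \<in> GLn n \<and> ?Y s \<in> carrier_mat n n \<and> ?Y s + minv (?X s) \<in> GLn n"
      using X[of s] Z[OF s] minus_carrier_mat[OF minv(1)[OF X[of s]], of "?Z s"] by simp
  qed
  have XY: "fid n + em (?X s) * em (?Y s) = tp s \<odot> em B" if "s < m" for s
  proof -
    have "em (?Y s) = em (?Z s) - em (minv (?X s))" using GLn_dims[OF X[of s]] GLn_dims[OF Z[OF that]] by simp
    thus ?thesis using G ca tp_last by (auto simp: right_diff_distrib em_mult)
  qed
  have YX: "fid n + em (?Y s) * em (?X s) = (if s = m - 1 then t \<odot> (em (minv A) * em B * em A) else tp s \<odot> em B)" if "s < m" for s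
  proof -
    have "em (?Y s) = em (?Z s) - em (minv (?X s))" using GLn_dims[OF X[of s]] GLn_dims[OF Z[OF that]] by simp
    thus ?thesis using G ca by (auto simp: left_diff_distrib em_mult mult.assoc)
  qed
  have v: "minv A * minv B * V \<in> carrier_mat n 1" "W * B * A \<in> carrier_mat 1 n"
    using G GLn_carrier minv(1) by (auto intro!: mult_carrier_mat)
  show ?thesis unfolding xi
  proof (subst cyc_collections_iff[OF 1 v], intro conjI allI impI)
    fix i assume i: "0 < i \<and> i < m"
    hence "i - 1 < m" "i - 1 \<noteq> m - 1" "tp i = q i * tp (i - 1)" by (auto simp: gr0_conv_Suc)
    thus "fid n + em (?X i) * em (?Y i) = q i \<odot> (fid n + em (?Y (i - 1)) * em (?X (i - 1)))"
      using XY[of i] YX[of "i - 1"] i by simp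
  next
    \<comment> \<open>The product \<open>A B\<close> and its inverse are inserted next to
      \<open>1 + V W\<close>, so that the tadpole relation can be substituted as it stands.\<close>
    have "(fid n + em (?X 0) * em (?Y 0)) * (fid n + em (minv A * minv B * V) * em (W * B * A)) =
      q 0 \<odot> (em B * em (minv A) * em (minv B) * ((fid n + em V * em W) * (em A * em B)) * em (minv B) * em (minv A) * em B * em A)"
      unfolding XY[OF m_facts(1)] by (simp add: ca em_mult distrib_left distrib_right fscale_distrib mult.assoc)
    also have "\<dots> = q 0 \<odot> t \<odot> (em (minv A) * em B * em A)"
      unfolding rel by (simp add: ca mult.assoc)
    finally show "(fid n + em (?X 0) * em (?Y 0)) * (fid n + em (minv A * minv B * V) * em (W * B * A)) =
      q 0 \<odot> (fid n + em (?Y (m - 1)) * em (?X (m - 1)))"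
      using YX[of "m - 1"] m_facts by simp
  next
    have WV: "W * B * A * (minv A * minv B * V) = W * V"
      by (rule em_inject) (simp_all add: ca em_mult mult.assoc)
    have "1\<^sub>m 1 + W * V \<in> carrier_mat 1 1" using G by auto
    from minv_one_dim[OF this tad_quads_det[OF P[unfolded P']]] t_nonzero
    show "1\<^sub>m 1 + W * B * A * (minv A * minv B * V) \<in> GLn 1"
      "minv (1\<^sub>m 1 + W * B * A * (minv A * minv B * V)) = inverse (t ^ n) \<cdot>\<^sub>m 1\<^sub>m 1"
      unfolding WV by auto
  qed
qed

section \<open>From cyclic to tadpole representations\<close>

lemma phi_quad_ok:
  assumes p: "p \<in> ambient C"
  shows "quad_ok n (phi_quad m n q p)" "phi m n q p \<in> ambient T" "quad_of (phi m n q p) = phi_quad m n q p"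
proof -
  have f: "p \<in> formats (cyclic_quiver m) (cm_dim n)" using p by (simp add: cyc_ambient_iff)
  note c = cyc_formatsD[OF f]
  define A where "A = cprod n (\<lambda>i. p (Arrow (X_arr i))) m"
  define B where "B = inverse (q 0) \<cdot>\<^sub>m (1\<^sub>m n + p (Arrow (X_arr 0)) * p (Opp (X_arr 0)))"
  let ?V = "p (Arrow V_arr)" and ?W = "p (Opp V_arr)"
  have G: "A \<in> GLn n" "B \<in> GLn n" "1\<^sub>m n + ?V * ?W \<in> GLn n"
    using p q0[OF m_facts(1)] m_facts unfolding A_def B_def by (auto simp: cyc_ambient_iff intro!: cprod_GLn GLn_smult)
  have BA: "B * A \<in> GLn n" using G by (intro GLn_mult)
  note ca = GLn_cancel[OF G(1)] GLn_cancel[OF G(2)] em_fid_carrier[OF c(3)] em_fid_carrier[OF c(4)]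
    carrier_matD[OF c(3)] carrier_matD[OF c(4)] GLn_dims[OF G(1)] GLn_dims[OF G(2)]
  have V: "B * A * ?V \<in> carrier_mat n 1" "?W * minv A * minv B \<in> carrier_mat 1 n"
    using GLn_carrier[OF BA] minv(1)[OF G(1)] minv(1)[OF G(2)] c by auto
  have "1\<^sub>m n + B * A * ?V * (?W * minv A * minv B) \<in> GLn n"
  proof (rule GLn_em_conj[OF _ G(3) BA])
    show "1\<^sub>m n + B * A * ?V * (?W * minv A * minv B) \<in> carrier_mat n n" using V by auto
    show "em (1\<^sub>m n + B * A * ?V * (?W * minv A * minv B)) = em (B * A) * (em (1\<^sub>m n + ?V * ?W) * em (minv (B * A)))"
      unfolding minv_mult[OF G(2,1)]
      by (simp add: ca em_mult distrib_left distrib_right mult.assoc)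
  qed
  thus ok: "quad_ok n (phi_quad m n q p)"
    using G V unfolding quad_ok_def phi_quad_def Let_def prod.case A_def[symmetric] B_def[symmetric] by blast
  show "phi m n q p \<in> ambient T" "quad_of (phi m n q p) = phi_quad m n q p"
    using quad_of_tad_rep[OF ok] by (auto simp: phi_def)
qed

lemma cprod_one: "(\<And>i. i < k \<Longrightarrow> X i = 1\<^sub>m n) \<Longrightarrow> cprod n X k = 1\<^sub>m n"
  by (induction k) auto

lemma phi_psi:
  assumes p: "p \<in> ambient T"
  shows "phi m n q (psi m n q p) = p"
proof -
  obtain A B V W where Q: "quad_of p = (A, B, V, W)" by (cases "quad_of p")
  have ok: "quad_ok n (A, B, V, W)" using p by (simp add: tad_ambient_iff Q)
  hence G: "A \<in> GLn n" "B \<in> GLn n" "V \<in> carrier_mat n 1" "W \<in> carrier_mat 1 n"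
    by (auto simp: quad_ok_def)
  note ca = GLn_cancel[OF G(1)] GLn_cancel[OF G(2)] em_fid_carrier[OF G(3)] em_fid_carrier[OF G(4)]
    carrier_matD[OF G(3)] carrier_matD[OF G(4)] GLn_dims[OF G(1)] GLn_dims[OF G(2)]
  let ?p = "psi m n q p"
  have "cprod n (\<lambda>i. ?p (Arrow (X_arr i))) (m - 1) = 1\<^sub>m n"
    by (rule cprod_one) (simp add: psi_simps[OF Q])
  hence A: "cprod n (\<lambda>i. ?p (Arrow (X_arr i))) m = A"
    using cprod.simps(2)[of n "\<lambda>i. ?p (Arrow (X_arr i))" "m - 1"] m_facts psi_simps(1)[OF Q, of "m - 1"] GLn_carrier[OF G(1)]
    by simp
  have B: "inverse (q 0) \<cdot>\<^sub>m (1\<^sub>m n + ?p (Arrow (X_arr 0)) * ?p (Opp (X_arr 0))) = B"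
    by (rule em_inject) (use q0[OF m_facts(1)] m_facts in \<open>simp_all add: psi_simps[OF Q] ca em_mult\<close>)
  have V: "B * A * (minv A * minv B * V) = V" "W * B * A * minv A * minv B = W"
    by (rule em_inject; simp add: ca em_mult mult.assoc)+
  have "phi_quad m n q ?p = quad_of p"
    unfolding phi_quad_def Let_def A B Q by (simp only: psi_simps(3,4)[OF Q] V)
  thus ?thesis unfolding phi_def using tad_rep_quad_of(1)[OF p] by simp
qed

lemma phi_data:
  assumes p: "p \<in> ambient C"
  obtains A B V W where "phi_quad m n q p = (A, B, V, W)" "A \<in> GLn n" "B \<in> GLn n" "V \<in> carrier_mat n 1" "W \<in> carrier_mat 1 n"
    "A = cprod n (\<lambda>i. p (Arrow (X_arr i))) m" "q 0 \<odot> em B = fid n + cx p 0 * cy p 0"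
    "em V = em B * em A * cv p" "em W = cw p * em (minv A) * em (minv B)"
proof -
  obtain A B V W where Q: "phi_quad m n q p = (A, B, V, W)" by (cases "phi_quad m n q p")
  have ok: "quad_ok n (A, B, V, W)" using phi_quad_ok(1)[OF p] by (simp add: Q)
  have f: "p \<in> formats (cyclic_quiver m) (cm_dim n)" using p by (simp add: cyc_ambient_iff)
  note c = cyc_formatsD[OF f] note c0 = c(1,2)[OF m_facts(1)]
  have G: "A \<in> GLn n" "B \<in> GLn n" "V \<in> carrier_mat n 1" "W \<in> carrier_mat 1 n" using ok by (auto simp: quad_ok_def)
  have e: "A = cprod n (\<lambda>i. p (Arrow (X_arr i))) m" "B = inverse (q 0) \<cdot>\<^sub>m (1\<^sub>m n + p (Arrow (X_arr 0)) * p (Opp (X_arr 0)))"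
    "V = B * A * p (Arrow V_arr)" "W = p (Opp V_arr) * minv A * minv B"
    using Q by (auto simp: phi_quad_def Let_def)
  have "em B = inverse (q 0) \<odot> (fid n + cx p 0 * cy p 0)"
    unfolding e(2) using carrier_matD[OF c0(1)] carrier_matD[OF c0(2)] by (simp add: em_mult)
  hence "q 0 \<odot> em B = fid n + cx p 0 * cy p 0" using q0[OF m_facts(1)] by simp
  moreover have "em V = em B * em A * cv p" "em W = cw p * em (minv A) * em (minv B)"
    unfolding e(3,4) using carrier_matD[OF c(3)] carrier_matD[OF c(4)] GLn_dims[OF G(1)] GLn_dims[OF G(2)]
    by (simp_all add: em_mult)
  ultimately show ?thesis using that Q G e(1) by blast
qed

lemma phi_em:
  assumes p: "p \<in> ambient C" and Q: "phi_quad m n q p = (A, B, V, W)"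
  shows "cx (phi m n q p) 0 = em A" "cy (phi m n q p) 0 = em B - em (minv A)" "cv (phi m n q p) = em V" "cw (phi m n q p) = em W"
  using phi_quad_ok(1)[OF p] by (auto simp: phi_def Q quad_ok_def)

lemma em_cprod:
  assumes p: "p \<in> ambient C" and "k < m"
  shows "em (cprod n (\<lambda>i. p (Arrow (X_arr i))) (Suc k)) = em (cprod n (\<lambda>i. p (Arrow (X_arr i))) k) * cx p k"
    "k \<le> m \<Longrightarrow> cprod n (\<lambda>i. p (Arrow (X_arr i))) k \<in> GLn n"
proof -
  show G: "cprod n (\<lambda>i. p (Arrow (X_arr i))) k \<in> GLn n"
    using p \<open>k < m\<close> by (intro cprod_GLn) (auto simp: cyc_ambient_iff)
  have "p (Arrow (X_arr k)) \<in> GLn n" using p \<open>k < m\<close> by (auto simp: cyc_ambient_iff)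
  thus "em (cprod n (\<lambda>i. p (Arrow (X_arr i))) (Suc k)) = em (cprod n (\<lambda>i. p (Arrow (X_arr i))) k) * cx p k"
    using G by (simp add: em_mult)
qed

text \<open>Conjugation by the partial product \<open>P_k = X_0 ... X_{k-1}\<close> turns every loop
  \<open>X_k Z_k\<close> into \<open>t_k B\<close>. In the induction step the relation at k + 1
  gives \<open>1 + X_{k+1} Y_{k+1} = q_{k+1} (1 + Y_k X_k)\<close>, and
  \<open>X_k (1 + Y_k X_k) = (1 + X_k Y_k) X_k\<close> moves the factor \<open>X_k\<close>
  across.\<close>

lemma locus1_cprod:
  assumes p: "locus1 p" and Q: "phi_quad m n q p = (A, B, V, W)" and k: "k < m"
  shows "em (cprod n (\<lambda>i. p (Arrow (X_arr i))) k) * (fid n + cx p k * cy p k) =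
     tp k \<odot> (em B * em (cprod n (\<lambda>i. p (Arrow (X_arr i))) k))"
  using k
proof (induction k)
  case 0
  have a: "p \<in> ambient C" using p by (simp add: locus1_def)
  have "q 0 \<odot> em B = fid n + cx p 0 * cy p 0" "em B * fid n = em B" "fid n * em B = em B"
    by (rule phi_data[OF a]; simp add: Q GLn_cancel)+
  thus ?case by (metis cprod.simps(1) em_simps(4) fscale_simps(2) atMost_0 prod.insert[of "{}"] prod.empty finite.emptyI empty_iff mult_1_right)
next
  case (Suc k)
  have a: "p \<in> ambient C" using p by (simp add: locus1_def)
  have f: "p \<in> formats (cyclic_quiver m) (cm_dim n)" using a by (simp add: cyc_ambient_iff)
  let ?P = "\<lambda>k. em (cprod n (\<lambda>i. p (Arrow (X_arr i))) k)"
  have k: "k < m" using Suc by simp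
  note x = em_fid_carrier[OF cyc_formatsD(1)[OF f k]] em_fid_carrier[OF cyc_formatsD(2)[OF f k]]
  have rel: "fid n + cx p (Suc k) * cy p (Suc k) = q (Suc k) \<odot> (fid n + cy p k * cx p k)"
    using p Suc.prems by (auto simp: locus1_def)
  have "?P (Suc k) * (fid n + cx p (Suc k) * cy p (Suc k)) = q (Suc k) \<odot> (?P k * (fid n + cx p k * cy p k) * cx p k)"
    unfolding rel em_cprod(1)[OF a k] by (simp add: distrib_left distrib_right mult.assoc x)
  also have "\<dots> = tp (Suc k) \<odot> (em B * ?P (Suc k))"
    unfolding Suc.IH[OF k] em_cprod(1)[OF a k] by (simp add: mult.assoc mult.commute)
  finally show ?case .
qed

lemma phi_locus:
  assumes "p \<in> locus C"
  shows "phi m n q p \<in> locus T"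
proof -
  note L = cyc_locusD[OF assms]
  have a: "p \<in> ambient C" using L by (simp add: locus1_def)
  have f: "p \<in> formats (cyclic_quiver m) (cm_dim n)" using a by (simp add: cyc_ambient_iff)
  obtain A B V W where D: "phi_quad m n q p = (A, B, V, W)" "A \<in> GLn n" "B \<in> GLn n" "V \<in> carrier_mat n 1" "W \<in> carrier_mat 1 n"
    "A = cprod n (\<lambda>i. p (Arrow (X_arr i))) m" "q 0 \<odot> em B = fid n + cx p 0 * cy p 0"
    "em V = em B * em A * cv p" "em W = cw p * em (minv A) * em (minv B)"
    by (rule phi_data[OF a])
  let ?P = "\<lambda>k. em (cprod n (\<lambda>i. p (Arrow (X_arr i))) k)"
  note ml = m_facts(2)
  note x = em_fid_carrier[OF cyc_formatsD(1)[OF f ml]] em_fid_carrier[OF cyc_formatsD(2)[OF f ml]]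
    em_fid_carrier[OF cyc_formatsD(3)[OF f]] em_fid_carrier[OF cyc_formatsD(4)[OF f]]
  note ca = GLn_cancel[OF D(2)] GLn_cancel[OF D(3)] x
  have A: "em A = ?P (m - 1) * cx p (m - 1)" unfolding D(6) using em_cprod(1)[OF a ml] m_facts by simp
  \<comment> \<open>The case m - 1 of \<open>locus1_cprod\<close>, moved across the last factor
    \<open>X_{m-1}\<close> of A.\<close>
  have AT: "em A * (fid n + cy p (m - 1) * cx p (m - 1)) = t \<odot> (em B * em A)"
  proof -
    have "em A * (fid n + cy p (m - 1) * cx p (m - 1)) = ?P (m - 1) * (fid n + cx p (m - 1) * cy p (m - 1)) * cx p (m - 1)"
      unfolding A by (simp add: distrib_left distrib_right mult.assoc x del: One_nat_def)
    also have "\<dots> = t \<odot> (em B * em A)"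
      unfolding locus1_cprod[OF L(1) D(1) ml] tp_last A by (simp add: mult.assoc)
    finally show ?thesis .
  qed
  have "q 0 \<odot> (em B * (fid n + cv p * cw p)) = q 0 \<odot> (fid n + cy p (m - 1) * cx p (m - 1))"
    using L(2) by (simp add: D(7)[symmetric])
  \<comment> \<open>The relation at vertex 0 with \<open>1 + X_0 Y_0\<close> replaced by
    \<open>q_0 B\<close>. Since \<open>1 + V W\<close> is the cyclic \<open>1 + v w\<close>
    conjugated by \<open>B A\<close>, this and \<open>AT\<close> give the tadpole relation.\<close>
  hence BV: "em B * (fid n + cv p * cw p) = fid n + cy p (m - 1) * cx p (m - 1)"
    using q0[OF m_facts(1)] by (simp add: fscale_cancel)
  have "(fid n + em V * em W) * (em A * em B) = em B * em A * (em (minv B) * (em B * (fid n + cv p * cw p))) * (em (minv A) * em (minv B) * em A * em B)"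
    unfolding D(8,9) by (simp add: distrib_left distrib_right mult.assoc ca)
  also have "\<dots> = em B * em A * em (minv B) * em (minv A) * (em A * (fid n + cy p (m - 1) * cx p (m - 1))) * (em (minv A) * em (minv B) * em A * em B)"
    unfolding BV by (simp add: distrib_left distrib_right mult.assoc ca del: One_nat_def)
  also have "\<dots> = t \<odot> (em B * em A)" unfolding AT by (simp add: mult.assoc ca)
  finally have "(A, B, V, W) \<in> tad_quads n t" using D by (simp add: tad_quads_iff)
  thus ?thesis using phi_quad_ok[OF a] D(1) by (simp add: tad_locus_iff[OF t_nonzero])
qed

lemma psi_locus: "p \<in> locus T \<Longrightarrow> psi m n q p \<in> locus C"
  using xi_collection_mem by (auto simp: tad_locus_iff[OF t_nonzero] psi_def cyc_space_def)
end

section \<open>Composition, equivariance and regularity of the two maps\<close>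

context cm_spaces
begin

abbreviation "cp p k \<equiv> cprod n (\<lambda>i. p (Arrow (X_arr i))) k"

text \<open>The transformation has \<open>X_0 ... X_{i-1}\<close> at vertex i, with the empty
  product at 0. It makes \<open>X_i\<close> trivial for i < m - 1, while the last arrow ends at
  vertex 0, where nothing is divided off, and becomes A. The opposite arrows are computed by
  \<open>locus1_cprod\<close>, which is where the relations enter.\<close>

lemma psi_phi:
  assumes p: "locus1 p"
  shows "\<exists>g\<in>gauge_group C. psi m n q (phi m n q p) = gauge_act C g p"
proof -
  have a: "p \<in> ambient C" using p by (simp add: locus1_def)
  have f: "p \<in> formats (cyclic_quiver m) (cm_dim n)" using a by (simp add: cyc_ambient_iff)
  obtain A B V W where D: "phi_quad m n q p = (A, B, V, W)" "A \<in> GLn n" "B \<in> GLn n" "V \<in> carrier_mat n 1" "W \<in> carrier_mat 1 n"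
    "A = cp p m" "q 0 \<odot> em B = fid n + cx p 0 * cy p 0"
    "em V = em B * em A * cv p" "em W = cw p * em (minv A) * em (minv B)"
    by (rule phi_data[OF a])
  have ok: "quad_ok n (A, B, V, W)" and Q: "quad_of (phi m n q p) = (A, B, V, W)"
    using phi_quad_ok[OF a] D(1) by auto
  note e = psi_em[OF ok Q]
  define g where "g v = (case v of Infty \<Rightarrow> 1\<^sub>m 1 | Cyc k \<Rightarrow> cp p k)" for v
  have gs: "g Infty = 1\<^sub>m 1" "g (Cyc k) = cp p k" for k by (simp_all add: g_def)
  have P: "cp p k \<in> GLn n" if "k \<le> m" for k
    using a that by (intro cprod_GLn) (auto simp: cyc_ambient_iff)
  have g: "g \<in> gauge_group C" using P by (simp add: gauge_group_cyc gs)
  have "psi m n q (phi m n q p) = gauge_act C g p"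
  proof (rule rep_eqI)
    show "psi m n q (phi m n q p) \<in> formats (quiv C) (dimv C)" using psi_formats[OF ok Q] by simp
    show "gauge_act C g p \<in> formats (quiv C) (dimv C)" by (rule gauge_act_formats[OF wf_C g]) (use f in simp)
    fix b assume "b \<in> set (darrs (quiv C))"
    hence b: "b \<in> set (darrs (cyclic_quiver m))" by simp
    note E = em_gauge_act[OF wf_C g _ \<open>b \<in> set (darrs (quiv C))\<close>, of p, simplified, OF f]
    have Am: "em A = em (cp p (m - 1)) * cx p (m - 1)" unfolding D(6) using em_cprod(1)[OF a m_facts(2)] m_facts by simp
    from b[unfolded cyc_darrs] consider i where "i < m" "b = Arrow (X_arr i)" | i where "i < m" "b = Opp (X_arr i)"
      | "b = Arrow V_arr" | "b = Opp V_arr" by blast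
    thus "em (psi m n q (phi m n q p) b) = em (gauge_act C g p b)"
    proof cases
      case (1 i)
      note Pi = GLn_cancel[OF P[of i]] GLn_cancel[OF P[of "Suc i"]]
      show ?thesis
      proof (cases "i = m - 1")
        case True
        have "cx p i * fid n = cx p i" using em_fid_carrier(2)[OF cyc_formatsD(1)[OF f 1(1)]] .
        thus ?thesis using True m_facts 1 unfolding E unfolding 1(2) by (simp add: e gs Am del: One_nat_def)
      next
        case False
        hence "Suc i < m" using 1 by simp
        have "em (cp p i) * (cx p i * em (minv (cp p (Suc i)))) = em (cp p (Suc i)) * em (minv (cp p (Suc i)))"
          unfolding em_cprod(1)[OF a 1(1)] by (simp add: mult.assoc)
        thus ?thesis using False 1 \<open>Suc i < m\<close> em_minv(1)[OF P[of "Suc i"]] unfolding E unfolding 1(2) by (simp add: e gs)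
      qed
    next
      case (2 i)
      have Pi: "cp p i \<in> GLn n" using P 2 by simp
      note x = em_fid_carrier[OF cyc_formatsD(1)[OF f 2(1)]] em_fid_carrier[OF cyc_formatsD(2)[OF f 2(1)]]
      note ca = GLn_cancel[OF Pi] GLn_cancel[OF D(2)] GLn_cancel[OF D(3)] x
      have L: "em (cp p i) * (cx p i * (cy p i * em (minv (cp p i)))) = tp i \<odot> em B - fid n"
      proof -
        have "em (cp p i) * (cx p i * (cy p i * em (minv (cp p i)))) =
          em (cp p i) * (fid n + cx p i * cy p i) * em (minv (cp p i)) - fid n"
          by (simp add: distrib_left distrib_right mult.assoc ca)
        also have "\<dots> = tp i \<odot> em B - fid n"
          unfolding locus1_cprod[OF p D(1) 2(1)] by (simp add: mult.assoc ca)
        finally show ?thesis .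
      qed
      show ?thesis
      proof (cases "i = m - 1")
        case True
        have "em (minv A) * (em A * (cy p i * em (minv (cp p i)))) = em (minv A) * (t \<odot> em B - fid n)"
          using L tp_last True unfolding Am True by (simp add: mult.assoc del: One_nat_def)
        hence "cy p i * em (minv (cp p i)) = t \<odot> (em (minv A) * em B) - em (minv A)"
          by (simp add: ca right_diff_distrib)
        thus ?thesis using True m_facts 2 x unfolding E unfolding 2(2) by (simp add: e gs ca right_diff_distrib del: One_nat_def)
      next
        case False
        hence "Suc i < m" using 2 by simp
        moreover have "em (cp p (Suc i)) = em (cp p i) * cx p i" by (rule em_cprod(1)[OF a 2(1)])
        ultimately show ?thesis using False 2 L unfolding E unfolding 2(2)
          by (simp add: e gs mult.assoc del: cprod.simps)
      qed
    next
      case 3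
      note x = em_fid_carrier[OF cyc_formatsD(3)[OF f]]
      show ?thesis unfolding E unfolding 3 using x GLn_cancel[OF D(2)] GLn_cancel[OF D(3)] by (simp add: e gs D(8) mult.assoc del: One_nat_def)
    next
      case 4
      note x = em_fid_carrier[OF cyc_formatsD(4)[OF f]]
      show ?thesis unfolding E unfolding 4 using x GLn_cancel[OF D(2)] GLn_cancel[OF D(3)] by (simp add: e gs D(9) mult.assoc del: One_nat_def)
    qed
  qed
  thus ?thesis using g by blast
qed

text \<open>The factors at inner vertices cancel. For k = m the index \<open>k mod m\<close> returns
  to 0, so A is conjugated by the component of g at vertex 0.\<close>

lemma em_cprod_gauge:
  assumes p: "p \<in> ambient C" and g: "g \<in> gauge_group C" and k: "k \<le> m"
  shows "em (cp (gauge_act C g p) k) = em (g (Cyc 0)) * (em (cp p k) * em (minv (g (Cyc (k mod m)))))"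
  using k
proof (induction k)
  case 0
  have "g (Cyc 0) \<in> GLn n" using g m_facts by (simp add: gauge_group_cyc)
  thus ?case using em_minv[of "g (Cyc 0)" n] GLn_cancel[of "g (Cyc 0)" n] by simp
next
  case (Suc k)
  hence k: "k < m" by simp
  have f: "p \<in> formats (cyclic_quiver m) (cm_dim n)" using p by (simp add: cyc_ambient_iff)
  have gk: "g (Cyc k) \<in> GLn n" using g k by (simp add: gauge_group_cyc)
  have "em (gauge_act C g p (Arrow (X_arr k))) = em (g (Cyc k)) * (cx p k * em (minv (g (Cyc (Suc k mod m)))))"
    using em_gauge_act[OF wf_C g, of p "Arrow (X_arr k)"] f k by (simp add: cyc_darrs)
  moreover have "em (cp p (Suc k)) = em (cp p k) * cx p k" by (rule em_cprod(1)[OF p k])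
  moreover have "em (cp (gauge_act C g p) (Suc k)) = em (cp (gauge_act C g p) k) * cx (gauge_act C g p) k"
    by (rule em_cprod(1)[OF gauge_stable(2)[OF p g] k])
  moreover have "fid n * (cx p k * z) = cx p k * z" for z using em_fid_carrier(3)[OF cyc_formatsD(1)[OF f k]] .
  ultimately show ?case using Suc k GLn_cancel[OF gk] by (simp add: mult.assoc del: cprod.simps)
qed

text \<open>The same g serves on both sides: the tadpole group reads its components at vertex 0 and
  at infinity, and the remaining ones cancel in A and in \<open>X_0 Y_0\<close>.\<close>

lemma phi_gauge:
  assumes p: "p \<in> ambient C" and g: "g \<in> gauge_group C"
  shows "g \<in> gauge_group T" "phi m n q (gauge_act C g p) = gauge_act T g (phi m n q p)"
proof -
  have g0: "g (Cyc 0) \<in> GLn n" "g Infty = 1\<^sub>m 1" using g m_facts by (auto simp: gauge_group_cyc)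
  show gT: "g \<in> gauge_group T" using g0 by (simp add: gauge_group_tad)
  let ?p = "gauge_act C g p"
  have p': "?p \<in> ambient C" by (rule gauge_stable(2)[OF p g])
  have f: "p \<in> formats (cyclic_quiver m) (cm_dim n)" using p by (simp add: cyc_ambient_iff)
  obtain A B V W where D: "phi_quad m n q p = (A, B, V, W)" "A \<in> GLn n" "B \<in> GLn n" "V \<in> carrier_mat n 1" "W \<in> carrier_mat 1 n"
    "A = cp p m" "q 0 \<odot> em B = fid n + cx p 0 * cy p 0"
    "em V = em B * em A * cv p" "em W = cw p * em (minv A) * em (minv B)"
    by (rule phi_data[OF p])
  obtain A' B' V' W' where D': "phi_quad m n q ?p = (A', B', V', W')" "A' \<in> GLn n" "B' \<in> GLn n" "V' \<in> carrier_mat n 1" "W' \<in> carrier_mat 1 n"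
    "A' = cp ?p m" "q 0 \<odot> em B' = fid n + cx ?p 0 * cy ?p 0"
    "em V' = em B' * em A' * cv ?p" "em W' = cw ?p * em (minv A') * em (minv B')"
    by (rule phi_data[OF p'])
  let ?g = "g (Cyc 0)" and ?h = "g (Cyc 1)"
  have h: "?h \<in> GLn n" "Suc 0 mod m = 1" using g m by (simp_all add: gauge_group_cyc)
  note x = em_fid_carrier[OF cyc_formatsD(1)[OF f m_facts(1)]] em_fid_carrier[OF cyc_formatsD(2)[OF f m_facts(1)]]
    em_fid_carrier[OF cyc_formatsD(3)[OF f]] em_fid_carrier[OF cyc_formatsD(4)[OF f]]
  note ca = GLn_cancel[OF D(2)] GLn_cancel[OF D(3)] GLn_cancel[OF g0(1)] GLn_cancel[OF h(1)] x
  note E = em_gauge_act[OF wf_C g, of p, simplified, OF f]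
  have e: "cx ?p 0 = em ?g * (cx p 0 * em (minv ?h))" "cy ?p 0 = em ?h * (cy p 0 * em (minv ?g))"
    "cv ?p = em ?g * cv p" "cw ?p = cw p * em (minv ?g)"
    using m_facts g0 x by (simp_all add: E cyc_darrs h(2) del: One_nat_def)
  have A: "A' = ?g * A * minv ?g"
  proof (rule em_inject)
    have "em A' = em ?g * (em A * em (minv ?g))"
      unfolding D(6) D'(6) using em_cprod_gauge[OF p g order_refl] by simp
    thus "em A' = em (?g * A * minv ?g)" using D(2) g0 by (simp add: em_mult mult.assoc)
  qed (use D D' g0 in simp_all)
  have B: "B' = ?g * B * minv ?g"
  proof (rule em_inject)
    have "q 0 \<odot> em B' = em ?g * (q 0 \<odot> em B) * em (minv ?g)"
      unfolding D(7) D'(7) e by (simp add: distrib_left distrib_right mult.assoc ca del: One_nat_def)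
    hence "em B' = em ?g * em B * em (minv ?g)" using q0[OF m_facts(1)] by (simp add: fscale_cancel)
    thus "em B' = em (?g * B * minv ?g)" using D(3) g0 by (simp add: em_mult mult.assoc)
  qed (use D D' g0 in simp_all)
  have inv: "minv (?g * M * minv ?g) = ?g * minv M * minv ?g" if "M \<in> GLn n" for M
  proof -
    have "minv (?g * M * minv ?g) = minv (minv ?g) * (minv M * minv ?g)"
      using minv_mult[OF GLn_mult[OF g0(1) that] GLn_minv[OF g0(1)]] minv_mult[OF g0(1) that] by simp
    also have "\<dots> = ?g * minv M * minv ?g"
      unfolding minv_minv[OF g0(1)]
      by (rule em_inject) (use g0 that in \<open>simp_all add: em_mult mult.assoc\<close>)
    finally show ?thesis .
  qed
  have m': "em A' = em ?g * (em A * em (minv ?g))" "em B' = em ?g * (em B * em (minv ?g))"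
    "em (minv A') = em ?g * (em (minv A) * em (minv ?g))" "em (minv B') = em ?g * (em (minv B) * em (minv ?g))"
    unfolding A B inv[OF D(2)] inv[OF D(3)] using D(2,3) g0 by (simp_all add: em_mult mult.assoc)
  have F: "phi m n q ?p \<in> formats tadpole_quiver (cm_dim n)" "phi m n q p \<in> formats tadpole_quiver (cm_dim n)"
    using phi_quad_ok(2)[OF p] phi_quad_ok(2)[OF p'] by (auto simp: tad_ambient_iff)
  show "phi m n q ?p = gauge_act T g (phi m n q p)"
  proof (rule rep_eqI)
    show "phi m n q ?p \<in> formats (quiv T) (dimv T)" using F by simp
    show "gauge_act T g (phi m n q p) \<in> formats (quiv T) (dimv T)" by (rule gauge_act_formats[OF wf_T gT]) (use F in simp)
    note E' = em_gauge_act[OF wf_T gT, of "phi m n q p", simplified, OF F(2)]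
    fix b assume "b \<in> set (darrs (quiv T))"
    hence "b = Arrow (X_arr 0) \<or> b = Opp (X_arr 0) \<or> b = Arrow V_arr \<or> b = Opp V_arr" by (simp add: tad_darrs)
    thus "em (phi m n q ?p b) = em (gauge_act T g (phi m n q p) b)"
      by (elim disjE; simp add: E' tad_darrs phi_em[OF p D(1)] phi_em[OF p' D'(1)] m' g0 D(8,9) D'(8,9) e ca
          mult.assoc left_diff_distrib right_diff_distrib del: One_nat_def)
  qed
qed

text \<open>\<open>psi\<close> identifies the spaces at all cyclic vertices, so each of them
  receives the component of g at the tadpole vertex.\<close>

lemma psi_gauge:
  assumes p: "p \<in> ambient T" and g: "g \<in> gauge_group T"
  shows "\<exists>g'\<in>gauge_group C. psi m n q (gauge_act T g p) = gauge_act C g' (psi m n q p)"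
proof -
  have g0: "g (Cyc 0) \<in> GLn n" "g Infty = 1\<^sub>m 1" using g by (auto simp: gauge_group_tad)
  define g' where "g' v = (case v of Infty \<Rightarrow> 1\<^sub>m 1 | Cyc i \<Rightarrow> g (Cyc 0))" for v
  have gs: "g' Infty = 1\<^sub>m 1" "g' (Cyc i) = g (Cyc 0)" for i by (simp_all add: g'_def)
  have gC: "g' \<in> gauge_group C" using g0 by (simp add: gauge_group_cyc gs)
  let ?p = "gauge_act T g p" and ?g = "g (Cyc 0)"
  have p': "?p \<in> ambient T" by (rule gauge_stable(1)[OF p g])
  obtain A B V W where Q: "quad_of p = (A, B, V, W)" by (cases "quad_of p")
  obtain A' B' V' W' where Q': "quad_of ?p = (A', B', V', W')" by (cases "quad_of ?p")
  have ok: "quad_ok n (A, B, V, W)" and f: "p \<in> formats tadpole_quiver (cm_dim n)" using p by (simp_all add: tad_ambient_iff Q)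
  have ok': "quad_ok n (A', B', V', W')" using p' by (simp add: tad_ambient_iff Q')
  have G: "A \<in> GLn n" "B \<in> GLn n" "V \<in> carrier_mat n 1" "W \<in> carrier_mat 1 n" using ok by (auto simp: quad_ok_def)
  have G': "A' \<in> GLn n" "B' \<in> GLn n" "V' \<in> carrier_mat n 1" "W' \<in> carrier_mat 1 n" using ok' by (auto simp: quad_ok_def)
  note E = em_gauge_act[OF wf_T g, of p, simplified, OF f]
  note ca = GLn_cancel[OF G(1)] GLn_cancel[OF G(2)] GLn_cancel[OF g0(1)] em_fid_carrier[OF G(3)] em_fid_carrier[OF G(4)]
  have q1: "p (Arrow (X_arr 0)) = A" "p (Opp (X_arr 0)) + minv A = B" "p (Arrow V_arr) = V" "p (Opp V_arr) = W"
    "?p (Arrow (X_arr 0)) = A'" "?p (Opp (X_arr 0)) + minv A' = B'" "?p (Arrow V_arr) = V'" "?p (Opp V_arr) = W'"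
    using Q Q' by (auto simp: quad_of_def)
  have A: "A' = ?g * A * minv ?g"
    using q1(1,5) by (simp add: gauge_act_def tad_darrs)
  have inv: "minv (?g * M * minv ?g) = ?g * minv M * minv ?g" if "M \<in> GLn n" for M
  proof -
    have "minv (?g * M * minv ?g) = minv (minv ?g) * (minv M * minv ?g)"
      using minv_mult[OF GLn_mult[OF g0(1) that] GLn_minv[OF g0(1)]] minv_mult[OF g0(1) that] by simp
    also have "\<dots> = ?g * minv M * minv ?g"
      unfolding minv_minv[OF g0(1)]
      by (rule em_inject) (use g0 that in \<open>simp_all add: em_mult mult.assoc\<close>)
    finally show ?thesis .
  qed
  have y: "cy p 0 = em B - em (minv A)" "cy ?p 0 = em B' - em (minv A')"
    using q1(2,6) G G' tad_formatsD(2)[OF f] tad_formatsD(2)[of ?p n] gauge_act_formats[OF wf_T g, of p] f by auto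
  have iA: "em (minv A') = em ?g * (em (minv A) * em (minv ?g))"
    unfolding A inv[OF G(1)] using G g0 by (simp add: em_mult mult.assoc)
  have B: "B' = ?g * B * minv ?g"
  proof (rule em_inject)
    have "cy ?p 0 = em ?g * (cy p 0 * em (minv ?g))" by (simp add: E tad_darrs)
    hence "em B' = em ?g * (em B * em (minv ?g))"
      unfolding y iA by (simp add: left_diff_distrib right_diff_distrib)
    thus "em B' = em (?g * B * minv ?g)" using G(2) g0 by (simp add: em_mult mult.assoc)
  qed (use G G' g0 in simp_all)
  have m': "em A' = em ?g * (em A * em (minv ?g))" "em B' = em ?g * (em B * em (minv ?g))"
    "em (minv B') = em ?g * (em (minv B) * em (minv ?g))" "em V' = em ?g * em V" "em W' = em W * em (minv ?g)"
  proof -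
    show "em A' = em ?g * (em A * em (minv ?g))" "em B' = em ?g * (em B * em (minv ?g))"
      "em (minv B') = em ?g * (em (minv B) * em (minv ?g))"
      unfolding A B inv[OF G(2)] using G(1,2) g0 by (simp_all add: em_mult mult.assoc)
    show "em V' = em ?g * em V" "em W' = em W * em (minv ?g)"
      using E[of "Arrow V_arr"] E[of "Opp V_arr"] by (simp_all add: tad_darrs g0 q1 ca del: One_nat_def)
  qed
  have "psi m n q ?p = gauge_act C g' (psi m n q p)"
  proof (rule rep_eqI)
    show F: "psi m n q ?p \<in> formats (quiv C) (dimv C)" using psi_formats[OF ok' Q'] by simp
    have F': "psi m n q p \<in> formats (cyclic_quiver m) (cm_dim n)" using psi_formats[OF ok Q] .
    show "gauge_act C g' (psi m n q p) \<in> formats (quiv C) (dimv C)" by (rule gauge_act_formats[OF wf_C gC]) (use F' in simp)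
    note E' = em_gauge_act[OF wf_C gC, of "psi m n q p", simplified, OF F']
    fix b assume "b \<in> set (darrs (quiv C))"
    hence "(\<exists>i<m. b = Arrow (X_arr i)) \<or> (\<exists>i<m. b = Opp (X_arr i)) \<or> b = Arrow V_arr \<or> b = Opp V_arr" by (simp add: cyc_darrs)
    thus "em (psi m n q ?p b) = em (gauge_act C g' (psi m n q p) b)"
      by (elim disjE exE conjE; simp add: E' cyc_darrs psi_em[OF ok Q] psi_em[OF ok' Q'] m' iA g0 gs ca
          mult.assoc left_diff_distrib right_diff_distrib fscale_distrib del: One_nat_def)
  qed
  thus ?thesis using gC by blast
qed

lemma psi_regular:
  assumes a: "a \<in> set (darrs (quiv C))"
  shows "regular_mat T (\<lambda>p. em (psi m n q p a))"
proof -
  let ?A = "\<lambda>p. p (Arrow (X_arr 0))" and ?B = "\<lambda>p. p (Opp (X_arr 0)) + minv (p (Arrow (X_arr 0)))"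
  have coord: "regular_mat T (\<lambda>p. em (p b))" if "b \<in> set (darrs tadpole_quiver)" for b
    by (rule regular_mat_coord) (use that ambient_formats in auto)
  have G: "?A p \<in> GLn n" "?B p \<in> GLn n" "p (Opp (X_arr 0)) \<in> carrier_mat n n" if "p \<in> ambient T" for p
    using that tad_formatsD(2)[of p n] by (auto simp: tad_ambient_iff quad_ok_def quad_of_def)
  have rA: "regular_mat T (\<lambda>p. em (?A p))" by (rule coord) (simp add: tad_darrs)
  have rAi: "regular_mat T (\<lambda>p. em (minv (?A p)))" by (rule regular_mat_minv[where D=T and A="?A" and n=n]) (erule G(1), rule rA)
  have rB: "regular_mat T (\<lambda>p. em (?B p))"
  proof (rule regular_mat_cong)
    show "regular_mat T (\<lambda>p. em (p (Opp (X_arr 0))) + em (minv (?A p)))"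
      by (rule regular_mat_add[OF coord rAi]) (simp add: tad_darrs)
  qed (use carrier_matD[OF G(3)] GLn_dims[OF G(1)] in simp)
  have rBi: "regular_mat T (\<lambda>p. em (minv (?B p)))" by (rule regular_mat_minv[where D=T and A="?B" and n=n]) (erule G(2), rule rB)
  have rV: "regular_mat T (\<lambda>p. em (p (Arrow V_arr)))" "regular_mat T (\<lambda>p. em (p (Opp V_arr)))"
    by (rule coord, simp add: tad_darrs)+
  have regular_mat_if: "regular_mat T M \<Longrightarrow> regular_mat T M' \<Longrightarrow> regular_mat T (\<lambda>p. if c then M p else M' p)" for M M' c
    by (cases c) simp_all
  note r = regular_mat_if regular_mat_add regular_mat_diff regular_mat_mult regular_mat_scale regular_mat_const rA rAi rB rBi rV
  have ok: "quad_ok n (?A p, ?B p, p (Arrow V_arr), p (Opp V_arr))" if "p \<in> ambient T" for p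
    using that by (simp add: tad_ambient_iff quad_of_def)
  have e: "em (psi m n q p a) = (case a of Arrow (X_arr s) \<Rightarrow> (if s = m - 1 then em (?A p) else fid n)
     | Opp (X_arr s) \<Rightarrow> (if s = m - 1 then t \<odot> (em (minv (?A p)) * em (?B p)) - em (minv (?A p)) else tp s \<odot> em (?B p) - fid n)
     | Arrow V_arr \<Rightarrow> em (minv (?A p)) * em (minv (?B p)) * em (p (Arrow V_arr))
     | Opp V_arr \<Rightarrow> em (p (Opp V_arr)) * em (?B p) * em (?A p))" if "p \<in> ambient T" for p
    using a psi_em[OF ok[OF that], OF quad_of_def] by (auto simp: cyc_darrs simp del: em_simps)
  show ?thesis
    by (rule regular_mat_cong[OF _ e[symmetric]])
      (use a in \<open>auto simp: cyc_darrs simp del: em_simps intro!: r\<close>)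
qed

lemma phi_regular:
  assumes a: "a \<in> set (darrs (quiv T))"
  shows "regular_mat C (\<lambda>p. em (phi m n q p a))"
proof -
  let ?A = "\<lambda>p. cp p m" and ?B = "\<lambda>p. inverse (q 0) \<cdot>\<^sub>m (1\<^sub>m n + p (Arrow (X_arr 0)) * p (Opp (X_arr 0)))"
  have Q: "phi_quad m n q p = (?A p, ?B p, ?B p * ?A p * p (Arrow V_arr), p (Opp V_arr) * minv (?A p) * minv (?B p))" for p
    by (simp add: phi_quad_def Let_def)
  have coord: "regular_mat C (\<lambda>p. em (p b))" if "b \<in> set (darrs (cyclic_quiver m))" for b
    by (rule regular_mat_coord) (use that ambient_formats in auto)
  have G: "?A p \<in> GLn n" "?B p \<in> GLn n" if "p \<in> ambient C" for p
    using phi_quad_ok(1)[OF that] by (auto simp: Q quad_ok_def)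
  have rc: "regular_mat C (\<lambda>p. em (cp p k))" if "k \<le> m" for k
    using that
  proof (induction k)
    case 0 show ?case by (simp add: regular_mat_const)
  next
    case (Suc k)
    hence k: "k < m" by simp
    show ?case
    proof (rule regular_mat_cong)
      show "regular_mat C (\<lambda>p. em (cp p k) * cx p k)"
        by (intro regular_mat_mult coord) (use Suc k in \<open>auto simp: cyc_darrs\<close>)
    qed (use em_cprod(1)[OF _ k] in simp)
  qed
  have rA: "regular_mat C (\<lambda>p. em (?A p))" by (rule rc) simp
  have rAi: "regular_mat C (\<lambda>p. em (minv (?A p)))" by (rule regular_mat_minv[where D=C and A="?A" and n=n]) (erule G(1), rule rA)
  have rB: "regular_mat C (\<lambda>p. em (?B p))"
  proof (rule regular_mat_cong)
    show "regular_mat C (\<lambda>p. inverse (q 0) \<odot> (fid n + cx p 0 * cy p 0))"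
      using m_facts by (intro regular_mat_scale regular_mat_add regular_mat_const regular_mat_mult coord) (auto simp: cyc_darrs)
    fix p assume "p \<in> ambient C"
    thus "inverse (q 0) \<odot> (fid n + cx p 0 * cy p 0) = em (?B p)"
      using cyc_formatsD(1,2)[of p m n 0] m_facts by (auto simp: em_mult cyc_ambient_iff)
  qed
  have rBi: "regular_mat C (\<lambda>p. em (minv (?B p)))" by (rule regular_mat_minv[where D=C and A="?B" and n=n]) (erule G(2), rule rB)
  have rV: "regular_mat C (\<lambda>p. cv p)" "regular_mat C (\<lambda>p. cw p)"
    by (rule coord, simp add: cyc_darrs)+
  note r = regular_mat_diff regular_mat_mult rA rAi rB rBi rV
  have e: "em (phi m n q p a) = (case a of Arrow (X_arr s) \<Rightarrow> em (?A p) | Opp (X_arr s) \<Rightarrow> em (?B p) - em (minv (?A p))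
     | Arrow V_arr \<Rightarrow> em (?B p) * em (?A p) * cv p | Opp V_arr \<Rightarrow> cw p * em (minv (?A p)) * em (minv (?B p)))"
    if p: "p \<in> ambient C" for p
  proof -
    have f: "p \<in> formats (cyclic_quiver m) (cm_dim n)" using p by (simp add: cyc_ambient_iff)
    have V: "em (?B p * ?A p * p (Arrow V_arr)) = em (?B p) * em (?A p) * cv p"
      "em (p (Opp V_arr) * minv (?A p) * minv (?B p)) = cw p * em (minv (?A p)) * em (minv (?B p))"
      using carrier_matD[OF cyc_formatsD(3)[OF f]] carrier_matD[OF cyc_formatsD(4)[OF f]]
        GLn_dims[OF G(1)[OF p]] GLn_dims[OF G(2)[OF p]] by (simp_all add: em_mult del: em_simps index_smult_mat index_add_mat)
    show ?thesis using a phi_em[OF p Q] by (auto simp: tad_darrs V simp del: em_simps)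
  qed
  show ?thesis
    by (rule regular_mat_cong[OF _ e[symmetric]])
      (use a in \<open>auto simp: tad_darrs simp del: em_simps intro!: r\<close>)
qed

end

section \<open>Hamiltonian vector fields on the two spaces\<close>

lemma moment_fid:
  assumes p: "p \<in> formats Q \<alpha>" and a: "a \<in> set (darrs Q)"
  shows "fid (\<alpha> (dtail Q a)) * moment Q \<alpha> F p a = moment Q \<alpha> F p a"
    "moment Q \<alpha> F p a * fid (\<alpha> (dtail Q a)) = moment Q \<alpha> F p a"
proof -
  have a': "dstar a \<in> set (darrs Q)" using a by simp
  have e: "fid (\<alpha> (dtail Q a)) * em (p a) = em (p a)" "em (p (dstar a)) * fid (\<alpha> (dtail Q a)) = em (p (dstar a))"
    "fid (\<alpha> (dtail Q a)) * grad Q \<alpha> F p (dstar a) = grad Q \<alpha> F p (dstar a)"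
    "grad Q \<alpha> F p a * fid (\<alpha> (dtail Q a)) = grad Q \<alpha> F p a"
    using formats_em_fid[OF p a] formats_em_fid[OF p a'] by auto
  thus "fid (\<alpha> (dtail Q a)) * moment Q \<alpha> F p a = moment Q \<alpha> F p a"
    "moment Q \<alpha> F p a * fid (\<alpha> (dtail Q a)) = moment Q \<alpha> F p a"
    by (simp_all add: moment_def algebra_simps fid_absorb_mult)
qed

lemma moment_shift_fid:
  assumes p: "p \<in> formats Q \<alpha>"
  shows "fid (\<alpha> (dtail Q a)) * moment_shift Q \<alpha> F p a = moment_shift Q \<alpha> F p a"
    "moment_shift Q \<alpha> F p a * fid (\<alpha> (dtail Q a)) = moment_shift Q \<alpha> F p a"
proof -
  have s: "fid (\<alpha> (dtail Q a)) * (\<Sum>b\<in>{b\<in>set (darrs Q). dtail Q b = dtail Q a \<and> P b}. moment Q \<alpha> F p b) =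
      (\<Sum>b\<in>{b\<in>set (darrs Q). dtail Q b = dtail Q a \<and> P b}. moment Q \<alpha> F p b)"
    "(\<Sum>b\<in>{b\<in>set (darrs Q). dtail Q b = dtail Q a \<and> P b}. moment Q \<alpha> F p b) * fid (\<alpha> (dtail Q a)) =
      (\<Sum>b\<in>{b\<in>set (darrs Q). dtail Q b = dtail Q a \<and> P b}. moment Q \<alpha> F p b)" for P
    unfolding sum_distrib_left sum_distrib_right
    by (intro sum.cong HOL.refl; use moment_fid[OF p] in \<open>metis (mono_tags, lifting) mem_Collect_eq\<close>)+
  thus "fid (\<alpha> (dtail Q a)) * moment_shift Q \<alpha> F p a = moment_shift Q \<alpha> F p a"
    "moment_shift Q \<alpha> F p a * fid (\<alpha> (dtail Q a)) = moment_shift Q \<alpha> F p a"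
    by (simp_all only: moment_shift_def right_diff_distrib left_diff_distrib)
qed

lemma hamiltonian_fid:
  assumes p: "p \<in> formats Q \<alpha>" and a: "a \<in> set (darrs Q)"
  shows "fid (\<alpha> (dtail Q a)) * hamiltonian Q \<alpha> F p a = hamiltonian Q \<alpha> F p a"
    "hamiltonian Q \<alpha> F p a * fid (\<alpha> (dhead Q a)) = hamiltonian Q \<alpha> F p a"
proof -
  have a': "dstar a \<in> set (darrs Q)" using a by simp
  have e: "fid (\<alpha> (dtail Q a)) * em (p a) = em (p a)" "em (p a) * fid (\<alpha> (dhead Q a)) = em (p a)"
    "fid (\<alpha> (dtail Q a)) * grad Q \<alpha> F p (dstar a) = grad Q \<alpha> F p (dstar a)"
    "grad Q \<alpha> F p (dstar a) * fid (\<alpha> (dhead Q a)) = grad Q \<alpha> F p (dstar a)"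
    "fid (\<alpha> (dhead Q a)) * em (p (dstar a)) = em (p (dstar a))" "em (p (dstar a)) * fid (\<alpha> (dtail Q a)) = em (p (dstar a))"
    using formats_em_fid[OF p a] formats_em_fid[OF p a'] by auto
  note s = moment_shift_fid[OF p, where a=a and F=F] moment_shift_fid[OF p, where a="dstar a" and F=F, simplified]
  show "fid (\<alpha> (dtail Q a)) * hamiltonian Q \<alpha> F p a = hamiltonian Q \<alpha> F p a"
    by (simp add: hamiltonian_def algebra_simps fscale_distrib e s fid_absorb_mult)
  show "hamiltonian Q \<alpha> F p a * fid (\<alpha> (dhead Q a)) = hamiltonian Q \<alpha> F p a"
    by (simp add: hamiltonian_def algebra_simps fscale_distrib e s)
qed

definition unem :: "nat \<Rightarrow> nat \<Rightarrow> fmat \<Rightarrow> complex mat" where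
  "unem r c x = mat r c (\<lambda>(i, j). ent x i j)"

lemma unem_carrier [simp]: "unem r c x \<in> carrier_mat r c" "dim_row (unem r c x) = r" "dim_col (unem r c x) = c"
  by (simp_all add: unem_def)

lemma em_unem: "fid r * x = x \<Longrightarrow> x * fid c = x \<Longrightarrow> em (unem r c x) = x"
  using fid_absorb[of r x] fid_absorb[of c x] by (intro fmat_eqI) (auto simp: unem_def not_less)

text \<open>The derivatives of \<open>1 + x y\<close> and \<open>1 + y x\<close> along a Hamiltonian vector field; \<open>C\<close> and \<open>C'\<close> are
  the values of the moment shift at the tail and at the head of \<open>x\<close>.\<close>

lemma hamiltonian_xy:
  fixes x y gx gy C C' e :: fmat
  assumes e: "e * x = x" "x * e = x" "e * y = y" "y * e = y" "e * gx = gx" "gx * e = gx" "e * gy = gy" "gy * e = gy"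
    "e * C = C" "C * e = C"
    and M: "M = gy * y - x * gx"
  shows "(((e + x * y) * gy + gy * (e + y * x)) - C * x + x * C') * y +
     x * (- ((e + y * x) * gx + gx * (e + x * y)) - C' * y + y * C) =
     M * (e + x * y) + (e + x * y) * M - C * (e + x * y) + (e + x * y) * C"
proof -
  have e': "e * (x * z) = x * z" "e * (y * z) = y * z" "e * (gx * z) = gx * z" "e * (gy * z) = gy * z" for z
    using e by (simp_all flip: mult.assoc)
  show ?thesis unfolding M by (simp add: algebra_simps e e')
qed

lemma neg_fscale: "(-1) \<odot> x = - x" by (rule fmat_eqI) simp

section \<open>The cyclic side: Hamiltonian fields are tangent to the relations\<close>

context cm_spaces
begin

abbreviation "gradC F p \<equiv> grad (cyclic_quiver m) (cm_dim n) F p"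
abbreviation "momC F p \<equiv> moment (cyclic_quiver m) (cm_dim n) F p"
abbreviation "hamC F p \<equiv> hamiltonian (cyclic_quiver m) (cm_dim n) F p"
abbreviation "shiftC F p \<equiv> moment_shift (cyclic_quiver m) (cm_dim n) F p"

definition invariantC :: "(arr rep \<Rightarrow> complex) \<Rightarrow> bool" where
  "invariantC F \<longleftrightarrow> regular_fun C F \<and> (\<forall>p\<in>ambient C. \<forall>g\<in>gauge_group C. F (gauge_act C g p) = F p)"

definition invariantT :: "(arr rep \<Rightarrow> complex) \<Rightarrow> bool" where
  "invariantT F \<longleftrightarrow> regular_fun T F \<and> (\<forall>p\<in>ambient T. \<forall>g\<in>gauge_group T. F (gauge_act T g p) = F p)"

definition pred_m :: "nat \<Rightarrow> nat" where "pred_m i = (if i = 0 then m - 1 else i - 1)"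

lemma suc_mod_iff: "j < m \<Longrightarrow> i < m \<Longrightarrow> Suc j mod m = i \<longleftrightarrow> j = pred_m i"
  by (cases "Suc j = m") (auto simp: pred_m_def)

lemma tails_cyc: "i < m \<Longrightarrow> {a \<in> set (darrs (cyclic_quiver m)). dtail (cyclic_quiver m) a = Cyc i} =
   {Arrow (X_arr i), Opp (X_arr (pred_m i))} \<union> (if i = 0 then {Arrow V_arr} else {})"
  using suc_mod_iff[of _ i] by (auto simp: cyc_darrs pred_m_def split: if_splits)

text \<open>At each vertex \<open>y_{i-1}\<close> precedes \<open>x_i\<close>, and v comes last at
  0. The arrow \<open>y_i\<close> starts at i + 1 modulo m, which accounts for the cyclic successor
  and for the extra term when this vertex is 0.\<close>

lemma shiftC_simps:
  "i < m \<Longrightarrow> shiftC F p (Arrow (X_arr i)) = momC F p (Opp (X_arr (pred_m i))) - (if i = 0 then momC F p (Arrow V_arr) else 0)"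
  "i < m \<Longrightarrow> shiftC F p (Opp (X_arr i)) = - momC F p (Arrow (X_arr (Suc i mod m))) - (if Suc i = m then momC F p (Arrow V_arr) else 0)"
  "shiftC F p (Arrow V_arr) = momC F p (Opp (X_arr (m - 1))) + momC F p (Arrow (X_arr 0))"
  "shiftC F p (Opp V_arr) = 0"
proof -
  have tail: "(\<Sum>b\<in>{b \<in> set (darrs (cyclic_quiver m)). dtail (cyclic_quiver m) b = Cyc i \<and> P b}. h b) =
     (\<Sum>b\<in>{Arrow (X_arr i), Opp (X_arr (pred_m i))} \<union> (if i = 0 then {Arrow V_arr} else {}). if P b then h b else 0)"
    if "i < m" for i P and h :: "arr darr \<Rightarrow> fmat"
    unfolding tails_cyc[OF that, symmetric]
    by (subst sum.inter_filter[symmetric]) (auto intro!: sum.cong)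
  have inf: "{b \<in> set (darrs (cyclic_quiver m)). dtail (cyclic_quiver m) b = Infty \<and> P b} = {b. b = Opp V_arr \<and> P b}" for P
    by (auto simp: cyc_darrs)
  show "shiftC F p (Arrow (X_arr i)) = momC F p (Opp (X_arr (pred_m i))) - (if i = 0 then momC F p (Arrow V_arr) else 0)" if "i < m"
    by (simp add: moment_shift_def tail[OF that])
  show "shiftC F p (Opp (X_arr i)) = - momC F p (Arrow (X_arr (Suc i mod m))) - (if Suc i = m then momC F p (Arrow V_arr) else 0)" if i: "i < m"
  proof -
    have "Suc i mod m = 0 \<longleftrightarrow> Suc i = m" using i by (auto simp: mod_Suc)
    thus ?thesis using m_facts by (simp add: moment_shift_def tail)
  qed
  show "shiftC F p (Arrow V_arr) = momC F p (Opp (X_arr (m - 1))) + momC F p (Arrow (X_arr 0))"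
    using m_facts by (simp add: moment_shift_def tail pred_m_def)
  show "shiftC F p (Opp V_arr) = 0"
    by (simp add: moment_shift_def inf cong: conj_cong)
qed

lemma momC_sum:
  assumes F: "invariantC F" and p: "p \<in> ambient C"
  shows "0 < i \<Longrightarrow> i < m \<Longrightarrow> momC F p (Opp (X_arr (i - 1))) = - momC F p (Arrow (X_arr i))"
    "momC F p (Opp (X_arr (m - 1))) + momC F p (Arrow (X_arr 0)) + momC F p (Arrow V_arr) = 0"
proof -
  have f: "p \<in> formats (quiv C) (dimv C)" using p ambient_formats by auto
  have "(\<Sum>a\<in>{a \<in> set (darrs (quiv C)). dtail (quiv C) a = Cyc i}. moment (quiv C) (dimv C) F p a) = 0" if "i < m" for i
    by (rule moment_sum_zero[OF wf_C _ _ p f]) (use F p that in \<open>auto simp: invariantC_def\<close>)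
  hence z: "(\<Sum>a\<in>{Arrow (X_arr i), Opp (X_arr (pred_m i))} \<union> (if i = 0 then {Arrow V_arr} else {}). momC F p a) = 0" if "i < m" for i
    using that by (simp add: tails_cyc)
  show "momC F p (Opp (X_arr (i - 1))) = - momC F p (Arrow (X_arr i))" if "0 < i" "i < m"
    using z[OF that(2)] that by (simp add: pred_m_def add_eq_0_iff)
  show "momC F p (Opp (X_arr (m - 1))) + momC F p (Arrow (X_arr 0)) + momC F p (Arrow V_arr) = 0"
    using z[OF m_facts(1)] by (simp add: pred_m_def ac_simps)
qed

lemma hamC_simps:
  assumes "i < m"
  shows "hamC F p (Arrow (X_arr i)) = (fid n + cx p i * cy p i) * gradC F p (Opp (X_arr i)) +
      gradC F p (Opp (X_arr i)) * (fid n + cy p i * cx p i) - shiftC F p (Arrow (X_arr i)) * cx p i + cx p i * shiftC F p (Opp (X_arr i))"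
    "hamC F p (Opp (X_arr i)) = - ((fid n + cy p i * cx p i) * gradC F p (Arrow (X_arr i)) +
      gradC F p (Arrow (X_arr i)) * (fid n + cx p i * cy p i)) - shiftC F p (Opp (X_arr i)) * cy p i + cy p i * shiftC F p (Arrow (X_arr i))"
  by (simp_all add: hamiltonian_def neg_fscale)

text \<open>Let M be the moment of \<open>x_i\<close>. By invariance at vertex i the moment of
  \<open>y_{i-1}\<close> is -M, and the shifts of both arrows are -M as well. Then
  \<open>hamiltonian_xy\<close> gives \<open>2 M (1 + x_i y_i)\<close> and
  \<open>2 M (1 + y_{i-1} x_{i-1})\<close> as derivatives of the two loops, and the relation itself
  makes these differ by the factor \<open>q_i\<close>.\<close>

lemma hamC_tangent:
  assumes F: "invariantC F" and p: "locus1 p" and i: "0 < i" "i < m"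
  shows "hamC F p (Arrow (X_arr i)) * cy p i + cx p i * hamC F p (Opp (X_arr i)) =
    q i \<odot> (hamC F p (Opp (X_arr (i - 1))) * cx p (i - 1) + cy p (i - 1) * hamC F p (Arrow (X_arr (i - 1))))"
proof -
  have a: "p \<in> ambient C" using p by (simp add: locus1_def)
  have f: "p \<in> formats (cyclic_quiver m) (cm_dim n)" using a by (simp add: cyc_ambient_iff)
  define j where "j = i - 1"
  have j: "j < m" "Suc j = i" using i by (auto simp: j_def)
  let ?M = "momC F p (Arrow (X_arr i))" and ?U = "fid n + cx p i * cy p i" and ?T = "fid n + cy p j * cx p j"
  have UT: "?U = q i \<odot> ?T" using p i by (simp add: locus1_def j_def)
  have abs: "fid n * cx p k = cx p k" "cx p k * fid n = cx p k" "fid n * cy p k = cy p k" "cy p k * fid n = cy p k" if "k < m" for k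
    using em_fid_carrier[OF cyc_formatsD(1)[OF f that]] em_fid_carrier[OF cyc_formatsD(2)[OF f that]] by auto
  have gabs: "fid n * gradC F p (Arrow (X_arr k)) = gradC F p (Arrow (X_arr k))" "gradC F p (Arrow (X_arr k)) * fid n = gradC F p (Arrow (X_arr k))"
    "fid n * gradC F p (Opp (X_arr k)) = gradC F p (Opp (X_arr k))" "gradC F p (Opp (X_arr k)) * fid n = gradC F p (Opp (X_arr k))" for k
    by simp_all
  have sabs: "fid n * shiftC F p (Arrow (X_arr k)) = shiftC F p (Arrow (X_arr k))" "shiftC F p (Arrow (X_arr k)) * fid n = shiftC F p (Arrow (X_arr k))"
    "fid n * shiftC F p (Opp (X_arr k)) = shiftC F p (Opp (X_arr k))" "shiftC F p (Opp (X_arr k)) * fid n = shiftC F p (Opp (X_arr k))" for k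
    using moment_shift_fid[OF f, where a="Arrow (X_arr k)" and F=F] moment_shift_fid[OF f, where a="Opp (X_arr k)" and F=F] by simp_all
  have sx: "shiftC F p (Arrow (X_arr i)) = - ?M" "shiftC F p (Opp (X_arr j)) = - ?M"
    using shiftC_simps(1)[of i F p] shiftC_simps(2)[of j F p] momC_sum(1)[OF F a i] i j by (auto simp: pred_m_def j_def)
  have "hamC F p (Arrow (X_arr i)) * cy p i + cx p i * hamC F p (Opp (X_arr i)) =
     ?M * ?U + ?U * ?M - shiftC F p (Arrow (X_arr i)) * ?U + ?U * shiftC F p (Arrow (X_arr i))"
    unfolding hamC_simps[OF i(2)]
    by (rule hamiltonian_xy) (use abs[OF i(2)] gabs sabs in \<open>simp_all add: moment_def\<close>)
  hence 1: "hamC F p (Arrow (X_arr i)) * cy p i + cx p i * hamC F p (Opp (X_arr i)) = ?M * ?U + ?M * ?U"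
    unfolding sx by simp
  have yx: "momC F p (Opp (X_arr j)) = gradC F p (Arrow (X_arr j)) * cx p j - cy p j * gradC F p (Opp (X_arr j))"
    by (simp add: moment_def)
  \<comment> \<open>Exchanging the roles of x and y reverses \<open>eps\<close>, so
    \<open>hamiltonian_xy\<close> is applied to the negated field.\<close>
  have "- hamC F p (Opp (X_arr j)) * cx p j + cy p j * - hamC F p (Arrow (X_arr j)) =
     momC F p (Opp (X_arr j)) * ?T + ?T * momC F p (Opp (X_arr j)) - (- shiftC F p (Opp (X_arr j))) * ?T + ?T * (- shiftC F p (Opp (X_arr j)))"
  proof -
    have e: "- hamC F p (Opp (X_arr j)) = ((fid n + cy p j * cx p j) * gradC F p (Arrow (X_arr j)) +
      gradC F p (Arrow (X_arr j)) * (fid n + cx p j * cy p j)) - (- shiftC F p (Opp (X_arr j))) * cy p j + cy p j * (- shiftC F p (Arrow (X_arr j)))"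
      "- hamC F p (Arrow (X_arr j)) = - ((fid n + cx p j * cy p j) * gradC F p (Opp (X_arr j)) +
      gradC F p (Opp (X_arr j)) * (fid n + cy p j * cx p j)) - (- shiftC F p (Arrow (X_arr j))) * cx p j + cx p j * (- shiftC F p (Opp (X_arr j)))"
      unfolding hamC_simps[OF j(1)] by (simp_all add: algebra_simps)
    show ?thesis unfolding e
      by (rule hamiltonian_xy) (use abs[OF j(1)] gabs sabs yx in simp_all)
  qed
  moreover have "momC F p (Opp (X_arr j)) = - ?M" using momC_sum(1)[OF F a i] by (simp add: j_def)
  ultimately have "- hamC F p (Opp (X_arr j)) * cx p j + cy p j * - hamC F p (Arrow (X_arr j)) = - (?M * ?T + ?M * ?T)"
    unfolding sx by simp
  hence 2: "hamC F p (Opp (X_arr j)) * cx p j + cy p j * hamC F p (Arrow (X_arr j)) = ?M * ?T + ?M * ?T"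
    by (simp add: neg_eq_iff_add_eq_0 algebra_simps)
  show ?thesis unfolding 1 j_def[symmetric] 2 UT by (simp add: fscale_distrib distrib_left)
qed

text \<open>The Hamiltonian vector field of an invariant function is tangent to \<open>locus1\<close>, which is a graph
  over the coordinates other than \<open>Y\<^sub>1, \<dots>, Y\<^sub>m\<^sub>-\<^sub>1\<close>. Hence the bracket with it only depends on
  the restriction to \<open>locus1\<close>.\<close>

lemma rep_bracket_locus1:
  assumes F: "regular_fun C F" and F': "regular_fun C F'" and eq: "\<And>p. locus1 p \<Longrightarrow> F p = F' p"
    and G: "invariantC G" and p: "locus1 p"
  shows "rep_bracket (cyclic_quiver m) (cm_dim n) F G p = rep_bracket (cyclic_quiver m) (cm_dim n) F' G p"
proof -
  have a: "p \<in> ambient C" using p by (simp add: locus1_def)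
  have f: "p \<in> formats (cyclic_quiver m) (cm_dim n)" using a by (simp add: cyc_ambient_iff)
  note c = cyc_formatsD[OF f]
  have wf: "wf_quiver (cyclic_quiver m)" using wf_C by simp
  let ?Q = "cyclic_quiver m"
  let ?H = "hamC G p"
  let ?lin = "\<lambda>b z. p b + z \<cdot>\<^sub>m unem (cm_dim n (dtail ?Q b)) (cm_dim n (dhead ?Q b)) (?H b)"
  have lin: "?lin b z \<in> carrier_mat (cm_dim n (dtail ?Q b)) (cm_dim n (dhead ?Q b))"
    "mderiv (\<lambda>z. em (?lin b z)) (?H b)" "?lin b 0 = p b" if b: "b \<in> set (darrs ?Q)" for b z
  proof -
    note d = formatsD[OF f b] and h = hamiltonian_fid[OF f b, where F=G]
    show "?lin b z \<in> carrier_mat (cm_dim n (dtail ?Q b)) (cm_dim n (dhead ?Q b))" for z using d by simp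
    have e: "em (?lin b z) = em (p b) + z \<odot> ?H b" for z using d h by (simp add: em_unem)
    have "mderiv (\<lambda>z. em (p b) + z \<odot> ?H b) (0 + ?H b)" by (intro mderiv_add mderiv_const mderiv_id_scale)
    thus "mderiv (\<lambda>z. em (?lin b z)) (?H b)" by (simp add: e)
    show "?lin b 0 = p b" by (rule em_inject) (use d h in \<open>simp_all add: em_unem\<close>)
  qed
  \<comment> \<open>A curve inside \<open>locus1\<close> with the Hamiltonian field as its tangent
    at 0: all coordinates move on straight lines except \<open>Y_1, ..., Y_{m-1}\<close>, which are
    obtained by solving the relations one after another. That these have the right derivatives is
    \<open>hamC_tangent\<close>.\<close>
  define X where "X i z = ?lin (Arrow (X_arr i)) z" for i z
  define Y where "Y = rec_nat (\<lambda>z. ?lin (Opp (X_arr 0)) z)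
     (\<lambda>i y z. minv (X (Suc i) z) * (q (Suc i) \<cdot>\<^sub>m (1\<^sub>m n + y z * X i z) - 1\<^sub>m n))"
  have Y: "Y 0 z = ?lin (Opp (X_arr 0)) z"
    "Y (Suc i) z = minv (X (Suc i) z) * (q (Suc i) \<cdot>\<^sub>m (1\<^sub>m n + Y i z * X i z) - 1\<^sub>m n)" for i z
    by (simp_all add: Y_def)
  have X: "X i z \<in> carrier_mat n n" "mderiv (\<lambda>z. em (X i z)) (?H (Arrow (X_arr i)))" "X i 0 = p (Arrow (X_arr i))" "X i 0 \<in> GLn n" if "i < m" for i z
    using lin(1)[of "Arrow (X_arr i)" z] lin(2,3)[of "Arrow (X_arr i)"] that a unfolding X_def by (auto simp: cyc_darrs cyc_ambient_iff)
  \<comment> \<open>The recursion for Y divides by \<open>X (Suc i) z\<close>; where some X is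
    singular, the curve \<gamma> below is set to p.\<close>
  define ok where "ok z \<longleftrightarrow> (\<forall>i<m. X i z \<in> GLn n)" for z
  have ev: "eventually ok (nhds 0)"
  proof -
    have "eventually (\<lambda>z. \<forall>i\<in>{..<m}. X i z \<in> GLn n) (nhds 0)"
      by (subst eventually_ball_finite_distrib) (auto intro!: mderiv_GLn(1)[OF X(1,2,4)])
    thus ?thesis by (rule eventually_mono) (auto simp: ok_def)
  qed
  have abs: "fid n * cx p k = cx p k" "cx p k * fid n = cx p k" "fid n * cy p k = cy p k" "cy p k * fid n = cy p k"
    "fid n * (cy p k * z) = cy p k * z" if "k < m" for k z
    using em_fid_carrier[OF c(1)[OF that]] em_fid_carrier[OF c(2)[OF that]] by auto
  have Y': "(\<forall>z. ok z \<longrightarrow> Y i z \<in> carrier_mat n n) \<and> mderiv (\<lambda>z. em (Y i z)) (?H (Opp (X_arr i))) \<and> Y i 0 = p (Opp (X_arr i))"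
    if "i < m" for i
    using that
  proof (induction i)
    case 0
    show ?case using lin[of "Opp (X_arr 0)"] 0 unfolding Y by (simp add: cyc_darrs)
  next
    case (Suc i)
    hence i: "i < m" and si: "Suc i < m" by auto
    have IH: "\<And>z. ok z \<Longrightarrow> Y i z \<in> carrier_mat n n" "mderiv (\<lambda>z. em (Y i z)) (?H (Opp (X_arr i)))" "Y i 0 = p (Opp (X_arr i))"
      using Suc.IH[OF i] by auto
    have G1: "X (Suc i) z \<in> GLn n" if "ok z" for z using that si by (simp add: ok_def)
    have ok0: "ok 0" using X(4) by (simp add: ok_def)
    have yc: "q (Suc i) \<cdot>\<^sub>m (1\<^sub>m n + Y i z * X i z) - 1\<^sub>m n \<in> carrier_mat n n" for z by (rule minus_carrier_mat) simp
    have cc: "Y (Suc i) z \<in> carrier_mat n n" if "ok z" for z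
      unfolding Y by (rule mult_carrier_mat[OF minv(1)[OF G1[OF that]] yc])
    have rel: "fid n + cx p (Suc i) * cy p (Suc i) = q (Suc i) \<odot> (fid n + cy p i * cx p i)"
      using p si by (auto simp: locus1_def)
    have eY: "em (Y (Suc i) z) = em (minv (X (Suc i) z)) * (q (Suc i) \<odot> (fid n + em (Y i z) * em (X i z)) - fid n)" if "ok z" for z
      using G1[OF that] IH(1)[OF that] X(1)[OF i, of z] unfolding Y by (simp add: em_mult carrier_matD)
    let ?xi = "em (minv (p (Arrow (X_arr (Suc i)))))"
    have xi: "?xi * cx p (Suc i) = fid n" "?xi * (cx p (Suc i) * z) = fid n * z" for z
      using GLn_cancel[OF X(4)[OF si]] X(3)[OF si] by auto
    have "q (Suc i) \<odot> (fid n + cy p i * cx p i) - fid n = cx p (Suc i) * cy p (Suc i)"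
      unfolding rel[symmetric] by simp
    note r0 = this
    have "mderiv (\<lambda>z. em (minv (X (Suc i) z)) * (q (Suc i) \<odot> (fid n + em (Y i z) * em (X i z)) - fid n))
       (- (em (minv (X (Suc i) 0)) * ?H (Arrow (X_arr (Suc i))) * em (minv (X (Suc i) 0))) *
          (q (Suc i) \<odot> (fid n + em (Y i 0) * em (X i 0)) - fid n) +
        em (minv (X (Suc i) 0)) * (q (Suc i) \<odot> (0 + (?H (Opp (X_arr i)) * em (X i 0) + em (Y i 0) * ?H (Arrow (X_arr i)))) - 0))"
      by (intro mderiv_mult mderiv_minv[OF X(1,2,4)] mderiv_diff mderiv_scale mderiv_add mderiv_const X(2) IH(2) i si)
    also have "(- (em (minv (X (Suc i) 0)) * ?H (Arrow (X_arr (Suc i))) * em (minv (X (Suc i) 0))) *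
          (q (Suc i) \<odot> (fid n + em (Y i 0) * em (X i 0)) - fid n) +
        em (minv (X (Suc i) 0)) * (q (Suc i) \<odot> (0 + (?H (Opp (X_arr i)) * em (X i 0) + em (Y i 0) * ?H (Arrow (X_arr i)))) - 0)) =
      ?H (Opp (X_arr (Suc i)))"
    proof -
      have "q (Suc i) \<odot> (?H (Opp (X_arr i)) * cx p i + cy p i * ?H (Arrow (X_arr i))) =
        ?H (Arrow (X_arr (Suc i))) * cy p (Suc i) + cx p (Suc i) * ?H (Opp (X_arr (Suc i)))"
        using hamC_tangent[OF G p, of "Suc i"] si by simp
      moreover have "fid n * ?H (Opp (X_arr (Suc i))) = ?H (Opp (X_arr (Suc i)))"
        using hamiltonian_fid(1)[OF f, where a="Opp (X_arr (Suc i))" and F=G] si by (simp add: cyc_darrs)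
      ultimately show ?thesis
        unfolding X(3)[OF i] X(3)[OF si] IH(3) r0 by (simp add: mult.assoc distrib_left xi abs si)
    qed
    finally have "mderiv (\<lambda>z. em (Y (Suc i) z)) (?H (Opp (X_arr (Suc i))))"
      by (rule mderiv_cong) (use ev in eventually_elim, simp add: eY)
    moreover have "Y (Suc i) 0 = p (Opp (X_arr (Suc i)))"
    proof (rule em_inject)
      show "em (Y (Suc i) 0) = em (p (Opp (X_arr (Suc i))))"
        unfolding eY[OF ok0] X(3)[OF i] X(3)[OF si] IH(3) r0 by (simp add: xi abs si)
    qed (use cc[OF ok0] c(2)[OF si] in auto)
    ultimately show ?case using cc by blast
  qed
  define \<gamma>0 where "\<gamma>0 z = cyc_rep m (\<lambda>i. X i z, \<lambda>i. Y i z, ?lin (Arrow V_arr) z, ?lin (Opp V_arr) z)" for z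
  define \<gamma> where "\<gamma> z = (if ok z then \<gamma>0 z else p)" for z
  have f0: "\<gamma>0 z \<in> formats ?Q (cm_dim n)" if "ok z" for z
    unfolding \<gamma>0_def
    by (rule cyc_rep_formats) (use X(1) Y' that lin(1)[of "Arrow V_arr"] lin(1)[of "Opp V_arr"] in \<open>auto simp: cyc_darrs\<close>)
  have ok0: "ok 0" using X(4) by (simp add: ok_def)
  have \<gamma>_0: "\<gamma> 0 = p"
  proof (rule rep_eqI[of _ ?Q "cm_dim n"])
    show "\<gamma> 0 \<in> formats ?Q (cm_dim n)" using f0 ok0 by (simp add: \<gamma>_def)
    fix b assume "b \<in> set (darrs ?Q)"
    thus "em (\<gamma> 0 b) = em (p b)"
      using ok0 X(3) Y' lin(3)[of "Arrow V_arr"] lin(3)[of "Opp V_arr"]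
      by (auto simp: \<gamma>_def \<gamma>0_def cyc_darrs simp del: em_simps)
  qed (rule f)
  have \<gamma>f: "\<gamma> z \<in> formats ?Q (cm_dim n)" for z using f0 f by (simp add: \<gamma>_def)
  have d: "mderiv (\<lambda>z. em (\<gamma> z b)) (?H b)" if b: "b \<in> set (darrs ?Q)" for b
  proof (rule mderiv_cong)
    show "eventually (\<lambda>z. em (\<gamma>0 z b) = em (\<gamma> z b)) (nhds 0)" using ev by eventually_elim (simp add: \<gamma>_def)
    have V: "mderiv (\<lambda>z. em (?lin (Arrow V_arr) z)) (?H (Arrow V_arr))" "mderiv (\<lambda>z. em (?lin (Opp V_arr) z)) (?H (Opp V_arr))"
      by (rule lin(2), simp add: cyc_darrs)+
    from b[unfolded cyc_darrs] show "mderiv (\<lambda>z. em (\<gamma>0 z b)) (?H b)"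
      by (elim disjE exE conjE) (use X(2) Y' V in \<open>auto simp: \<gamma>0_def simp del: em_simps\<close>)
  qed
  have evC: "eventually (\<lambda>z. \<gamma> z \<in> alg_reps ?Q (cm_dim n)) (nhds 0)"
    by (rule eventually_alg_reps[OF \<gamma>f _ d]) (use ambient_alg_reps(2)[OF a] \<gamma>_0 in auto)
  have L: "eventually (\<lambda>z. locus1 (\<gamma> z)) (nhds 0)"
    using ev evC
  proof eventually_elim
    case (elim z)
    have A: "\<gamma> z \<in> ambient C"
      using elim by (auto simp: cyc_space_def \<gamma>_def \<gamma>0_def ok_def)
    have "fid n + cx (\<gamma> z) (Suc i) * cy (\<gamma> z) (Suc i) = q (Suc i) \<odot> (fid n + cy (\<gamma> z) i * cx (\<gamma> z) i)" if si: "Suc i < m" for i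
    proof -
      have G1: "X (Suc i) z \<in> GLn n" using elim(1) si by (simp add: ok_def)
      have i: "i < m" using si by simp
      have "em (Y (Suc i) z) = em (minv (X (Suc i) z)) * (q (Suc i) \<odot> (fid n + em (Y i z) * em (X i z)) - fid n)"
        using G1 conjunct1[OF Y'[OF i], rule_format, OF elim(1)] X(1)[OF i, of z] unfolding Y by (simp add: em_mult carrier_matD)
      moreover have "fid n * em (Y i z) = em (Y i z)" using Y' elim(1) i by (intro em_fid(1)) auto
      hence "fid n * (em (Y i z) * u) = em (Y i z) * u" for u by (simp flip: mult.assoc)
      ultimately show ?thesis
        using elim(1) i si GLn_cancel[OF G1] by (simp add: \<gamma>_def \<gamma>0_def right_diff_distrib distrib_left)
    qed
    hence "fid n + cx (\<gamma> z) i * cy (\<gamma> z) i = q i \<odot> (fid n + cy (\<gamma> z) (i - 1) * cx (\<gamma> z) (i - 1))" if "0 < i" "i < m" for i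
      using that by (cases i) auto
    thus ?case using A by (simp add: locus1_def)
  qed
  \<comment> \<open>Differentiation along this curve is twice the bracket with G, for every regular
    H; it is applied to F and F', which agree on the curve near 0.\<close>
  have "((\<lambda>z. H (\<gamma> z)) has_field_derivative 2 * rep_bracket ?Q (cm_dim n) H G p) (at 0)" if "regular_fun C H" for H
    using regular_fun_chain[where \<gamma>=\<gamma> and \<delta>="?H", OF that a \<gamma>_0] \<gamma>f d rep_bracket_hamiltonian[OF wf ambient_alg_reps(2)[OF a], of H G] by simp
  note der = this
  have "((\<lambda>z. F' (\<gamma> z)) has_field_derivative 2 * rep_bracket ?Q (cm_dim n) F G p) (at 0)"
    by (rule has_derivative_cong_nhds[OF der[OF F]]) (use L in eventually_elim, rule eq)
  with der[OF F'] have "2 * rep_bracket ?Q (cm_dim n) F G p = 2 * rep_bracket ?Q (cm_dim n) F' G p"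
    by (rule DERIV_unique[rotated])
  thus ?thesis by simp
qed

end

text \<open>The algebraic core of \<open>phi_poisson\<close>. GA and GB are the gradients of G in A
  and B, where x = A and y = B - A^-1. The moment l of v is expressed through them by invariance. K
  and N are the gradients in A and B of the pulled back function when the cyclic v and w are fixed,
  and DA and DB are the velocities of A and B. The first two identities match these velocities with
  the tadpole field at x and y, corrected by the gauge direction Xi. The third computes
  \<open>d(B A) (B A)^-1\<close>, which governs the framing arrows since \<open>V = B A v\<close>
  and \<open>W = w (B A)^-1\<close>.\<close>

lemma ring_identities:
  fixes A Ai B Bi GA GB e :: fmat
  assumes inv: "A * Ai = e" "Ai * A = e" "B * Bi = e" "Bi * B = e"
    and e: "e * A = A" "A * e = A" "e * Ai = Ai" "Ai * e = Ai" "e * B = B" "B * e = B" "e * Bi = Bi" "Bi * e = Bi"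
      "e * GA = GA" "GA * e = GA" "e * GB = GB" "GB * e = GB"
    and l: "l = A * GA - GB * B - GA * A + B * GB"
    and N: "N = GB - Bi * l" and K: "K = GA - Ai * Bi * l * B"
    and lb: "lb = N * B - B * N - A * K" and Xi: "Xi = N * B + B * N - A * K - K * A"
    and DA: "DA = B * N * A + N * B * A - K * A * A - A * lb"
    and DB: "DB = B * lb + lb * B - K * A * B + B * K * A"
    and gx: "gx = GA - Ai * GB * Ai"
  shows "A * B * GB + GB * (B * A) + (GA * A - B * GB + l) * A + A * (GB * B - A * GA - l) + Xi * A - A * Xi = DA"
    "- (B * A * gx + gx * (A * B)) - (GB * B - A * GA - l) * (B - Ai) - (B - Ai) * (GA * A - B * GB + l) + Xi * (B - Ai) - (B - Ai) * Xi
      = DB + Ai * DA * Ai"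
    "B * DA * Ai * Bi + DB * Bi = Xi + l"
proof -
  have c: "A * (Ai * z) = e * z" "Ai * (A * z) = e * z" "B * (Bi * z) = e * z" "Bi * (B * z) = e * z"
    "e * (A * z) = A * z" "e * (Ai * z) = Ai * z" "e * (B * z) = B * z" "e * (Bi * z) = Bi * z"
    "e * (GA * z) = GA * z" "e * (GB * z) = GB * z" for z
    using inv e by (simp_all flip: mult.assoc)
  show "A * B * GB + GB * (B * A) + (GA * A - B * GB + l) * A + A * (GB * B - A * GA - l) + Xi * A - A * Xi = DA"
    unfolding DA Xi lb N K l by (simp add: algebra_simps inv e c)
  show "B * DA * Ai * Bi + DB * Bi = Xi + l"
    unfolding DA DB Xi lb N K l by (simp add: algebra_simps inv e c)
  show "- (B * A * gx + gx * (A * B)) - (GB * B - A * GA - l) * (B - Ai) - (B - Ai) * (GA * A - B * GB + l) + Xi * (B - Ai) - (B - Ai) * Xi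
      = DB + Ai * DA * Ai"
    unfolding gx DA DB Xi lb N K l by (simp add: algebra_simps inv e c)
qed

lemma grad_eqI:
  assumes "a \<in> set (darrs Q)" and K: "fid (\<alpha> (dhead Q a)) * K = K" "K * fid (\<alpha> (dtail Q a)) = K"
    and d: "\<And>i j. (a, i, j) \<in> arrow_idx Q \<alpha> \<Longrightarrow> coord_deriv F a i j p = ent K j i"
  shows "grad Q \<alpha> F p a = K"
proof (rule fmat_eqI)
  fix j i
  show "ent (grad Q \<alpha> F p a) j i = ent K j i"
    using assms(1) d[of i j] fid_absorb[of "\<alpha> (dhead Q a)" K] fid_absorb[of "\<alpha> (dtail Q a)" K] K
    by (auto simp: arrow_idx_def not_less)
qed

lemma sum_tad_darrs: "(\<Sum>a\<in>set (darrs tadpole_quiver). f a) =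
   f (Arrow (X_arr 0)) + f (Opp (X_arr 0)) + f (Arrow V_arr) + f (Opp V_arr)"
proof -
  have "set (darrs tadpole_quiver) = {Arrow (X_arr 0), Opp (X_arr 0), Arrow V_arr, Opp V_arr}"
    by (auto simp: tad_darrs)
  thus ?thesis by (simp add: add.assoc)
qed

text \<open>Each trace in the differential of a pulled back function is rotated until its increment
  stands last. The coefficients of DA and DB found here are the matrices K and N of
  \<open>phi_grad\<close>.\<close>

lemma differential_traces:
  fixes Ai A B Bi v w DA DB dv dw :: fmat
  shows "ftrace (fx * DA) + ftrace (fy * (DB + Ai * DA * Ai)) + ftrace (fv * (DB * A * v + B * DA * v + B * A * dv)) +
     ftrace (fw * (dw * Ai * Bi - w * Ai * DA * Ai * Bi - w * Ai * Bi * DB * Bi)) =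
   ftrace ((fx + Ai * fy * Ai + v * fv * B - Ai * Bi * fw * w * Ai) * DA) +
   ftrace ((fy + A * v * fv - Bi * fw * w * Ai * Bi) * DB) + ftrace (fv * B * A * dv) + ftrace (Ai * Bi * fw * dw)"
proof -
  have "ftrace (fy * (Ai * (DA * Ai))) = ftrace (Ai * (fy * (Ai * DA)))"
    using ftrace_commute[of "fy * Ai * DA" Ai] by (simp add: mult.assoc)
  moreover have "ftrace (fv * (DB * (A * v))) = ftrace (A * (v * (fv * DB)))"
    using ftrace_commute[of "fv * DB" "A * v"] by (simp add: mult.assoc)
  moreover have "ftrace (fv * (B * (DA * v))) = ftrace (v * (fv * (B * DA)))"
    using ftrace_commute[of "fv * B * DA" v] by (simp add: mult.assoc)
  moreover have "ftrace (fw * (dw * (Ai * Bi))) = ftrace (Ai * (Bi * (fw * dw)))"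
    using ftrace_commute[of "fw * dw" "Ai * Bi"] by (simp add: mult.assoc)
  moreover have "ftrace (fw * (w * (Ai * (DA * (Ai * Bi))))) = ftrace (Ai * (Bi * (fw * (w * (Ai * DA)))))"
    using ftrace_commute[of "fw * w * Ai * DA" "Ai * Bi"] by (simp add: mult.assoc)
  moreover have "ftrace (fw * (w * (Ai * (Bi * (DB * Bi))))) = ftrace (Bi * (fw * (w * (Ai * (Bi * DB)))))"
    using ftrace_commute[of "fw * w * Ai * Bi * DB" Bi] by (simp add: mult.assoc)
  ultimately show ?thesis by (simp add: distrib_left distrib_right left_diff_distrib right_diff_distrib mult.assoc)
qed

section \<open>The differential of the map to the tadpole side\<close>

context cm_spaces
begin

abbreviation "gradT F p \<equiv> grad tadpole_quiver (cm_dim n) F p"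
abbreviation "momT F p \<equiv> moment tadpole_quiver (cm_dim n) F p"
abbreviation "hamT F p \<equiv> hamiltonian tadpole_quiver (cm_dim n) F p"
abbreviation "Pm p k \<equiv> em (cp p k)"
abbreviation "Pinv p k \<equiv> em (minv (cp p k))"

lemma cp_GLn: "p \<in> ambient C \<Longrightarrow> k \<le> m \<Longrightarrow> cp p k \<in> GLn n"
  by (rule cprod_GLn) (auto simp: cyc_ambient_iff)

text \<open>The product rule, with the remaining factors \<open>X_{j+1} ... X_{k-1}\<close> written
  as \<open>P_{j+1}^-1 P_k\<close>, a form suited to telescoping.\<close>

lemma mderiv_cprod:
  assumes p: "p \<in> ambient C" and \<gamma>: "\<gamma> 0 = p" "\<And>z. \<gamma> z \<in> formats (cyclic_quiver m) (cm_dim n)"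
    and d: "\<And>i. i < m \<Longrightarrow> mderiv (\<lambda>z. cx (\<gamma> z) i) (\<delta> i)" "\<And>i. i < m \<Longrightarrow> \<delta> i * fid n = \<delta> i"
    and k: "k \<le> m"
  shows "mderiv (\<lambda>z. Pm (\<gamma> z) k) (\<Sum>j<k. Pm p j * (\<delta> j * (Pinv p (Suc j) * Pm p k)))"
  using k
proof (induction k)
  case 0 show ?case by (simp add: mderiv_const)
next
  case (Suc k)
  hence k: "k < m" by simp
  have c: "cp (\<gamma> z) k \<in> carrier_mat n n" for z
    by (rule cprod_carrier) (use cyc_formatsD(1)[OF \<gamma>(2)] k in auto)
  have e: "Pm (\<gamma> z) (Suc k) = Pm (\<gamma> z) k * cx (\<gamma> z) k" for z
    using carrier_matD[OF c] carrier_matD[OF cyc_formatsD(1)[OF \<gamma>(2) k]] by (simp add: em_mult)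
  have "mderiv (\<lambda>z. Pm (\<gamma> z) k * cx (\<gamma> z) k)
    ((\<Sum>j<k. Pm p j * (\<delta> j * (Pinv p (Suc j) * Pm p k))) * cx (\<gamma> 0) k + Pm (\<gamma> 0) k * \<delta> k)"
    by (intro mderiv_mult Suc.IH d) (use k in auto)
  also have "(\<Sum>j<k. Pm p j * (\<delta> j * (Pinv p (Suc j) * Pm p k))) * cx (\<gamma> 0) k + Pm (\<gamma> 0) k * \<delta> k =
    (\<Sum>j<Suc k. Pm p j * (\<delta> j * (Pinv p (Suc j) * Pm p (Suc k))))"
    unfolding \<gamma>(1) em_cprod(1)[OF p k, symmetric] sum.lessThan_Suc
    using GLn_cancel(1)[OF cp_GLn[OF p Suc.prems]] d(2)[OF k]
    by (simp only: sum_distrib_right mult.assoc em_cprod(1)[OF p k])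
  finally show ?case by (simp only: e)
qed

text \<open>The velocity DA of A is a parameter because it is evaluated differently in the two
  applications: as a single term for coordinate directions, and by telescoping for a Hamiltonian
  field.\<close>

lemma phi_chain:
  assumes F: "regular_fun T F" and F': "\<forall>p\<in>ambient C. F' p = F (phi m n q p)"
    and p: "p \<in> ambient C" and \<gamma>: "\<gamma> 0 = p" "\<And>z. \<gamma> z \<in> formats (cyclic_quiver m) (cm_dim n)"
    and d: "\<And>a. a \<in> set (darrs (cyclic_quiver m)) \<Longrightarrow> mderiv (\<lambda>z. em (\<gamma> z a)) (\<delta> a)"
    and dA: "mderiv (\<lambda>z. Pm (\<gamma> z) m) DA"
    and Q: "phi_quad m n q p = (A, B, V, W)"
    and DB: "DB = inverse (q 0) \<odot> (\<delta> (Arrow (X_arr 0)) * cy p 0 + cx p 0 * \<delta> (Opp (X_arr 0)))"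
  shows "((\<lambda>z. F' (\<gamma> z)) has_field_derivative
     ftrace (gradT F (phi m n q p) (Arrow (X_arr 0)) * DA) +
     ftrace (gradT F (phi m n q p) (Opp (X_arr 0)) * (DB + em (minv A) * DA * em (minv A))) +
     ftrace (gradT F (phi m n q p) (Arrow V_arr) * (DB * em A * cv p + em B * DA * cv p + em B * em A * \<delta> (Arrow V_arr))) +
     ftrace (gradT F (phi m n q p) (Opp V_arr) * (\<delta> (Opp V_arr) * em (minv A) * em (minv B)
       - cw p * em (minv A) * DA * em (minv A) * em (minv B) - cw p * em (minv A) * em (minv B) * DB * em (minv B)))) (at 0)"
proof -
  define At where "At z = cp (\<gamma> z) m" for z
  define Bt where "Bt z = inverse (q 0) \<cdot>\<^sub>m (1\<^sub>m n + \<gamma> z (Arrow (X_arr 0)) * \<gamma> z (Opp (X_arr 0)))" for z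
  have Qt: "phi_quad m n q (\<gamma> z) = (At z, Bt z, Bt z * At z * \<gamma> z (Arrow V_arr), \<gamma> z (Opp V_arr) * minv (At z) * minv (Bt z))" for z
    by (simp add: phi_quad_def Let_def At_def Bt_def)
  have 0: "At 0 = A" "Bt 0 = B" using Qt[of 0] Q \<gamma>(1) by auto
  have G: "A \<in> GLn n" "B \<in> GLn n" using phi_quad_ok(1)[OF p] by (auto simp: Q quad_ok_def)
  have c: "At z \<in> carrier_mat n n" "Bt z \<in> carrier_mat n n" for z
    using cyc_formatsD(1)[OF \<gamma>(2)] mult_carrier_mat[OF cyc_formatsD(1,2)[OF \<gamma>(2) m_facts(1)], of z]
    unfolding At_def Bt_def by (auto intro!: cprod_carrier)
  have dA': "mderiv (\<lambda>z. em (At z)) DA" using dA by (simp add: At_def)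
  have d0: "Arrow (X_arr 0) \<in> set (darrs (cyclic_quiver m))" "Opp (X_arr 0) \<in> set (darrs (cyclic_quiver m))"
    "Arrow V_arr \<in> set (darrs (cyclic_quiver m))" "Opp V_arr \<in> set (darrs (cyclic_quiver m))"
    using m_facts by (auto simp: cyc_darrs)
  have dB: "mderiv (\<lambda>z. em (Bt z)) DB"
  proof -
    have e: "em (Bt z) = inverse (q 0) \<odot> (fid n + cx (\<gamma> z) 0 * cy (\<gamma> z) 0)" for z
      using cyc_formatsD(1,2)[OF \<gamma>(2) m_facts(1), of z] by (auto simp: Bt_def em_mult)
    have "mderiv (\<lambda>z. inverse (q 0) \<odot> (fid n + cx (\<gamma> z) 0 * cy (\<gamma> z) 0))
      (inverse (q 0) \<odot> (0 + (\<delta> (Arrow (X_arr 0)) * cy (\<gamma> 0) 0 + cx (\<gamma> 0) 0 * \<delta> (Opp (X_arr 0)))))"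
      by (intro mderiv_scale mderiv_add mderiv_const mderiv_mult d d0)
    thus ?thesis by (simp add: e DB \<gamma>(1))
  qed
  have dAi: "mderiv (\<lambda>z. em (minv (At z))) (- (em (minv A) * DA * em (minv A)))"
    using mderiv_minv[OF c(1) dA'] G by (simp add: 0)
  have dBi: "mderiv (\<lambda>z. em (minv (Bt z))) (- (em (minv B) * DB * em (minv B)))"
    using mderiv_minv[OF c(2) dB] G by (simp add: 0)
  have ev: "eventually (\<lambda>z. \<gamma> z \<in> ambient C) (nhds 0)"
  proof -
    have 1: "eventually (\<lambda>z. \<gamma> z \<in> alg_reps (cyclic_quiver m) (cm_dim n)) (nhds 0)"
      by (rule eventually_alg_reps[OF \<gamma>(2) _ d]) (use ambient_alg_reps(2)[OF p] \<gamma>(1) in auto)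
    have "eventually (\<lambda>z. \<forall>i\<in>{..<m}. \<gamma> z (Arrow (X_arr i)) \<in> GLn n) (nhds 0)"
    proof (subst eventually_ball_finite_distrib, simp, intro ballI)
      fix i assume "i \<in> {..<m}"
      hence i: "i < m" by simp
      show "\<forall>\<^sub>F z in nhds 0. \<gamma> z (Arrow (X_arr i)) \<in> GLn n"
        by (rule mderiv_GLn(1)[OF cyc_formatsD(1)[OF \<gamma>(2) i] d])
          (use i p in \<open>auto simp: cyc_darrs \<gamma>(1) cyc_ambient_iff\<close>)
    qed
    with 1 show ?thesis by eventually_elim (auto simp: cyc_space_def)
  qed
  \<comment> \<open>Near 0 the curve stays in \<open>ambient C\<close>; elsewhere the formats of
    \<open>phi\<close> are not under control, and a constant is taken.\<close>
  define \<beta> where "\<beta> z = (if \<gamma> z \<in> ambient C then phi m n q (\<gamma> z) else phi m n q p)" for z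
  define D where "D b = (case b of Arrow (X_arr i) \<Rightarrow> DA | Opp (X_arr i) \<Rightarrow> DB + em (minv A) * DA * em (minv A)
    | Arrow V_arr \<Rightarrow> DB * em A * cv p + em B * DA * cv p + em B * em A * \<delta> (Arrow V_arr)
    | Opp V_arr \<Rightarrow> \<delta> (Opp V_arr) * em (minv A) * em (minv B)
       - cw p * em (minv A) * DA * em (minv A) * em (minv B) - cw p * em (minv A) * em (minv B) * DB * em (minv B))" for b
  have "((\<lambda>z. F (\<beta> z)) has_field_derivative (\<Sum>b\<in>set (darrs (quiv T)). ftrace (grad (quiv T) (dimv T) F (phi m n q p) b * D b))) (at 0)"
  proof (rule regular_fun_chain[OF F phi_quad_ok(2)[OF p]])
    show "\<beta> 0 = phi m n q p" using \<gamma>(1) p by (simp add: \<beta>_def)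
    show "\<beta> z \<in> formats (quiv T) (dimv T)" for z
      using phi_quad_ok(2) p ambient_formats(1) by (auto simp: \<beta>_def)
    fix b assume "b \<in> set (darrs (quiv T))"
    hence b: "b = Arrow (X_arr 0) \<or> b = Opp (X_arr 0) \<or> b = Arrow V_arr \<or> b = Opp V_arr" by (simp add: tad_darrs)
    define E where "E z = (case b of Arrow (X_arr i) \<Rightarrow> em (At z) | Opp (X_arr i) \<Rightarrow> em (Bt z) - em (minv (At z))
      | Arrow V_arr \<Rightarrow> em (Bt z) * em (At z) * cv (\<gamma> z) | Opp V_arr \<Rightarrow> cw (\<gamma> z) * em (minv (At z)) * em (minv (Bt z)))" for z
    have "mderiv E (D b)"
    proof -
      have "mderiv (\<lambda>z. em (Bt z) - em (minv (At z))) (DB - - (em (minv A) * DA * em (minv A)))"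
        by (intro mderiv_diff dB dAi)
      moreover have "mderiv (\<lambda>z. em (Bt z) * em (At z) * cv (\<gamma> z))
        ((DB * em (At 0) + em (Bt 0) * DA) * cv (\<gamma> 0) + em (Bt 0) * em (At 0) * \<delta> (Arrow V_arr))"
        by (intro mderiv_mult dB dA' d d0)
      moreover have "mderiv (\<lambda>z. cw (\<gamma> z) * em (minv (At z)) * em (minv (Bt z)))
        ((\<delta> (Opp V_arr) * em (minv (At 0)) + cw (\<gamma> 0) * - (em (minv A) * DA * em (minv A))) * em (minv (Bt 0)) +
         cw (\<gamma> 0) * em (minv (At 0)) * - (em (minv B) * DB * em (minv B)))"
        by (intro mderiv_mult dBi dAi d d0)
      ultimately show ?thesis using b dA' unfolding 0 \<gamma>(1)
        by (elim disjE) (simp_all add: E_def[abs_def] D_def distrib_right left_diff_distrib mult.assoc)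
    qed
    moreover have "eventually (\<lambda>z. E z = em (\<beta> z b)) (nhds 0)"
      using ev
    proof eventually_elim
      case (elim z)
      note e = phi_em[OF elim Qt[of z]]
      have Gz: "At z \<in> GLn n" "Bt z \<in> GLn n" using phi_quad_ok(1)[OF elim] by (auto simp: Qt quad_ok_def)
      have f: "\<gamma> z (Arrow V_arr) \<in> carrier_mat n 1" "\<gamma> z (Opp V_arr) \<in> carrier_mat 1 n" using cyc_formatsD(3,4)[OF \<gamma>(2)] by auto
      show ?case using b Gz f elim by (auto simp: E_def \<beta>_def e em_mult)
    qed
    ultimately show "mderiv (\<lambda>z. em (\<beta> z b)) (D b)" by (rule mderiv_cong)
  qed
  hence "((\<lambda>z. F (\<beta> z)) has_field_derivative
     ftrace (gradT F (phi m n q p) (Arrow (X_arr 0)) * DA) +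
     ftrace (gradT F (phi m n q p) (Opp (X_arr 0)) * (DB + em (minv A) * DA * em (minv A))) +
     ftrace (gradT F (phi m n q p) (Arrow V_arr) * (DB * em A * cv p + em B * DA * cv p + em B * em A * \<delta> (Arrow V_arr))) +
     ftrace (gradT F (phi m n q p) (Opp V_arr) * (\<delta> (Opp V_arr) * em (minv A) * em (minv B)
       - cw p * em (minv A) * DA * em (minv A) * em (minv B) - cw p * em (minv A) * em (minv B) * DB * em (minv B)))) (at 0)"
    by (simp only: space_simps sum_tad_darrs D_def darr.case arr.case)
  thus ?thesis
    by (rule has_derivative_cong_nhds) (use ev in eventually_elim, simp add: \<beta>_def F')
qed

text \<open>Obtained by testing the differential on coordinate directions. A involves every
  \<open>x_k\<close>, but B only \<open>x_0\<close> and \<open>y_0\<close>; hence the gradient in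
  \<open>y_k\<close> vanishes for k > 0, on which the telescoping in \<open>phi_poisson\<close>
  rests.\<close>

lemma phi_grad:
  assumes G: "regular_fun T G" and G': "\<forall>p\<in>ambient C. G' p = G (phi m n q p)"
    and p: "p \<in> ambient C" and Q: "phi_quad m n q p = (A, B, V, W)"
    and K: "K = gradT G (phi m n q p) (Arrow (X_arr 0)) + em (minv A) * gradT G (phi m n q p) (Opp (X_arr 0)) * em (minv A)
       + cv p * gradT G (phi m n q p) (Arrow V_arr) * em B - em (minv A) * em (minv B) * gradT G (phi m n q p) (Opp V_arr) * cw p * em (minv A)"
    and N: "N = gradT G (phi m n q p) (Opp (X_arr 0)) + em A * cv p * gradT G (phi m n q p) (Arrow V_arr)
       - em (minv B) * gradT G (phi m n q p) (Opp V_arr) * cw p * em (minv A) * em (minv B)"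
  shows "k < m \<Longrightarrow> gradC G' p (Arrow (X_arr k)) = Pinv p (Suc k) * em A * K * Pm p k + (if k = 0 then inverse (q 0) \<odot> (cy p 0 * N) else 0)"
    "k < m \<Longrightarrow> gradC G' p (Opp (X_arr k)) = (if k = 0 then inverse (q 0) \<odot> (N * cx p 0) else 0)"
    "gradC G' p (Arrow V_arr) = gradT G (phi m n q p) (Arrow V_arr) * em B * em A"
    "gradC G' p (Opp V_arr) = em (minv A) * em (minv B) * gradT G (phi m n q p) (Opp V_arr)"
proof -
  have f: "p \<in> formats (cyclic_quiver m) (cm_dim n)" using p by (simp add: cyc_ambient_iff)
  have GA: "A \<in> GLn n" "B \<in> GLn n" using phi_quad_ok(1)[OF p] by (auto simp: Q quad_ok_def)
  have A: "A = cp p m" using Q by (simp add: phi_quad_def Let_def)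
  note ca = GLn_cancel[OF GA(1)] GLn_cancel[OF GA(2)]
  note x = em_fid_carrier[OF cyc_formatsD(3)[OF f]] em_fid_carrier[OF cyc_formatsD(4)[OF f]]
  note x0 = em_fid_carrier[OF cyc_formatsD(1)[OF f m_facts(1)]] em_fid_carrier[OF cyc_formatsD(2)[OF f m_facts(1)]]
  have Gm: "fid n * gradT G P (Arrow (X_arr 0)) = gradT G P (Arrow (X_arr 0))" "gradT G P (Arrow (X_arr 0)) * fid n = gradT G P (Arrow (X_arr 0))"
    "fid n * gradT G P (Opp (X_arr 0)) = gradT G P (Opp (X_arr 0))" "gradT G P (Opp (X_arr 0)) * fid n = gradT G P (Opp (X_arr 0))"
    "fid 1 * gradT G P (Arrow V_arr) = gradT G P (Arrow V_arr)" "gradT G P (Arrow V_arr) * fid n = gradT G P (Arrow V_arr)"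
    "fid n * gradT G P (Opp V_arr) = gradT G P (Opp V_arr)" "gradT G P (Opp V_arr) * fid 1 = gradT G P (Opp V_arr)" for P
    by simp_all
  have KN: "fid n * K = K" "K * fid n = K" "fid n * N = N" "N * fid n = N"
    unfolding K N by (simp_all add: distrib_left distrib_right left_diff_distrib right_diff_distrib mult.assoc ca x Gm
        fid_absorb_mult[OF Gm(1)] fid_absorb_mult[OF Gm(3)] del: One_nat_def)
  have Pk: "fid n * Pm p k = Pm p k" "Pm p k * fid n = Pm p k" "fid n * (Pinv p (Suc k) * z) = Pinv p (Suc k) * z" if "k < m" for k z
    using GLn_cancel[OF cp_GLn[OF p, of k]] GLn_cancel[OF cp_GLn[OF p, of "Suc k"]] that by auto
  let ?\<delta> = "\<lambda>a i j b. if b = a then felem i j else (0 :: fmat)"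
  have der: "coord_deriv G' a i j p =
     ftrace (K * (\<Sum>l<m. Pm p l * (?\<delta> a i j (Arrow (X_arr l)) * (Pinv p (Suc l) * em A)))) +
     ftrace (N * (inverse (q 0) \<odot> (?\<delta> a i j (Arrow (X_arr 0)) * cy p 0 + cx p 0 * ?\<delta> a i j (Opp (X_arr 0))))) +
     ftrace (gradT G (phi m n q p) (Arrow V_arr) * em B * em A * ?\<delta> a i j (Arrow V_arr)) +
     ftrace (em (minv A) * em (minv B) * gradT G (phi m n q p) (Opp V_arr) * ?\<delta> a i j (Opp V_arr))"
    if aij: "(a, i, j) \<in> arrow_idx (cyclic_quiver m) (cm_dim n)" for a i j
  proof -
    have a: "a \<in> set (darrs (cyclic_quiver m))" using aij by (auto simp: arrow_idx_def)
    have s0: "shift_entry p a i j 0 = p" using shift_zero[OF ambient_alg_reps(2)[OF p]] .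
    have sf: "shift_entry p a i j z \<in> formats (cyclic_quiver m) (cm_dim n)" for z
      using shift_carrier[OF f[unfolded formats_def] a] by (simp add: formats_def)
    have sd: "mderiv (\<lambda>z. em (shift_entry p a i j z b)) (?\<delta> a i j b)" if "b \<in> set (darrs (cyclic_quiver m))" for b
      by (rule mderiv_shift_entry[OF f aij that])
    have "mderiv (\<lambda>z. Pm (shift_entry p a i j z) m) (\<Sum>l<m. Pm p l * (?\<delta> a i j (Arrow (X_arr l)) * (Pinv p (Suc l) * Pm p m)))"
    proof (rule mderiv_cprod[where \<gamma>="shift_entry p a i j" and \<delta>="\<lambda>l. ?\<delta> a i j (Arrow (X_arr l))", OF p s0 sf])
      show "?\<delta> a i j (Arrow (X_arr l)) * fid n = ?\<delta> a i j (Arrow (X_arr l))" if "l < m" for l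
        using aij by (auto simp: arrow_idx_def intro!: fid_felem)
    qed (use sd in \<open>auto simp: cyc_darrs\<close>)
    from phi_chain[where \<gamma>="shift_entry p a i j" and \<delta>="?\<delta> a i j" and F'=G', OF G G' p s0 sf sd this Q HOL.refl]
    show ?thesis unfolding coord_deriv_def differential_traces K N A by (rule DERIV_imp_deriv)
  qed
  show "gradC G' p (Arrow (X_arr k)) = Pinv p (Suc k) * em A * K * Pm p k + (if k = 0 then inverse (q 0) \<odot> (cy p 0 * N) else 0)" if k: "k < m"
  proof (rule grad_eqI)
    fix i j assume "(Arrow (X_arr k), i, j) \<in> arrow_idx (cyclic_quiver m) (cm_dim n)"
    note dd = der[OF this]
    have s: "(\<Sum>l<m. Pm p l * ((if l = k then felem i j else 0) * (Pinv p (Suc l) * em A))) = Pm p k * (felem i j * (Pinv p (Suc k) * em A))"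
    proof -
      have "(\<Sum>l<m. Pm p l * ((if l = k then felem i j else 0) * (Pinv p (Suc l) * em A))) =
        (\<Sum>l<m. if l = k then Pm p k * (felem i j * (Pinv p (Suc k) * em A)) else 0)"
        by (intro sum.cong) auto
      thus ?thesis using k by simp
    qed
    have t: "ftrace (K * (Pm p k * (felem i j * (Pinv p (Suc k) * em A)))) = ent (Pinv p (Suc k) * em A * K * Pm p k) j i"
      using ftrace_commute[of "K * Pm p k * felem i j" "Pinv p (Suc k) * em A"] ftrace_felem[of "Pinv p (Suc k) * em A * K * Pm p k" i j]
      by (simp add: mult.assoc)
    have t': "ftrace (N * (felem i j * cy p 0)) = ent (cy p 0 * N) j i"
      using ftrace_commute[of "N * felem i j" "cy p 0"] ftrace_felem[of "cy p 0 * N" i j] by (simp add: mult.assoc)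
    show "coord_deriv G' (Arrow (X_arr k)) i j p =
      ent (Pinv p (Suc k) * em A * K * Pm p k + (if k = 0 then inverse (q 0) \<odot> (cy p 0 * N) else 0)) j i"
      unfolding dd using t t' by (auto simp: s simp del: cprod.simps)
  qed (use k Pk[OF k] KN x0 in \<open>auto simp: cyc_darrs distrib_left distrib_right mult.assoc simp del: cprod.simps\<close>)
  show "gradC G' p (Opp (X_arr k)) = (if k = 0 then inverse (q 0) \<odot> (N * cx p 0) else 0)" if k: "k < m"
  proof (rule grad_eqI)
    fix i j assume "(Opp (X_arr k), i, j) \<in> arrow_idx (cyclic_quiver m) (cm_dim n)"
    note dd = der[OF this]
    have t': "ftrace (N * (cx p 0 * felem i j)) = ent (N * cx p 0) j i"
      using ftrace_felem[of "N * cx p 0" i j] by (simp add: mult.assoc)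
    show "coord_deriv G' (Opp (X_arr k)) i j p = ent (if k = 0 then inverse (q 0) \<odot> (N * cx p 0) else 0) j i"
      unfolding dd using t' by auto
  qed (use k KN x0 fid_absorb_mult[OF KN(3)] in \<open>auto simp: cyc_darrs mult.assoc\<close>)
  show "gradC G' p (Arrow V_arr) = gradT G (phi m n q p) (Arrow V_arr) * em B * em A"
  proof (rule grad_eqI)
    fix i j assume "(Arrow V_arr, i, j) \<in> arrow_idx (cyclic_quiver m) (cm_dim n)"
    note dd = der[OF this]
    show "coord_deriv G' (Arrow V_arr) i j p = ent (gradT G (phi m n q p) (Arrow V_arr) * em B * em A) j i"
      unfolding dd by simp
  qed (use ca Gm(5)[of "phi m n q p"] in \<open>auto simp: cyc_darrs mult.assoc fid_absorb_mult\<close>)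
  show "gradC G' p (Opp V_arr) = em (minv A) * em (minv B) * gradT G (phi m n q p) (Opp V_arr)"
  proof (rule grad_eqI)
    fix i j assume "(Opp V_arr, i, j) \<in> arrow_idx (cyclic_quiver m) (cm_dim n)"
    note dd = der[OF this]
    show "coord_deriv G' (Opp V_arr) i j p = ent (em (minv A) * em (minv B) * gradT G (phi m n q p) (Opp V_arr)) j i"
      unfolding dd by simp
  qed (use ca Gm(8)[of "phi m n q p"] in \<open>auto simp: cyc_darrs mult.assoc\<close>)
qed

end

section \<open>Comparison of the two Hamiltonian fields\<close>

context cm_spaces
begin

lemma momT_sum:
  assumes F: "invariantT F" and p: "p \<in> ambient T"
  shows "momT F p (Arrow (X_arr 0)) + momT F p (Opp (X_arr 0)) + momT F p (Arrow V_arr) = 0"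
proof -
  have f: "p \<in> formats (quiv T) (dimv T)" using p ambient_formats by auto
  have "(\<Sum>a\<in>{a \<in> set (darrs (quiv T)). dtail (quiv T) a = Cyc 0}. moment (quiv T) (dimv T) F p a) = 0"
    by (rule moment_sum_zero[OF wf_T _ _ p f]) (use F p in \<open>auto simp: invariantT_def\<close>)
  moreover have "{a \<in> set (darrs tadpole_quiver). dtail tadpole_quiver a = Cyc 0} = {Arrow (X_arr 0), Opp (X_arr 0), Arrow V_arr}"
    by (auto simp: tad_darrs)
  ultimately show ?thesis by (simp add: ac_simps)
qed

lemma shiftT_simps:
  "moment_shift tadpole_quiver (cm_dim n) F p (Arrow (X_arr 0)) = - momT F p (Opp (X_arr 0)) - momT F p (Arrow V_arr)"
  "moment_shift tadpole_quiver (cm_dim n) F p (Opp (X_arr 0)) = momT F p (Arrow (X_arr 0)) - momT F p (Arrow V_arr)"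
  "moment_shift tadpole_quiver (cm_dim n) F p (Arrow V_arr) = momT F p (Arrow (X_arr 0)) + momT F p (Opp (X_arr 0))"
  "moment_shift tadpole_quiver (cm_dim n) F p (Opp V_arr) = 0"
proof -
  have tail: "(\<Sum>b\<in>{b \<in> set (darrs tadpole_quiver). dtail tadpole_quiver b = Cyc 0 \<and> P b}. h b) =
     (\<Sum>b\<in>{Arrow (X_arr 0), Opp (X_arr 0), Arrow V_arr}. if P b then h b else 0)" for P and h :: "arr darr \<Rightarrow> fmat"
    by (subst sum.inter_filter[symmetric]) (auto simp: tad_darrs intro!: sum.cong)
  have inf: "{b \<in> set (darrs tadpole_quiver). dtail tadpole_quiver b = Infty \<and> P b} = {b. b = Opp V_arr \<and> P b}" for P
    by (auto simp: tad_darrs)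
  show "moment_shift tadpole_quiver (cm_dim n) F p (Arrow (X_arr 0)) = - momT F p (Opp (X_arr 0)) - momT F p (Arrow V_arr)"
    "moment_shift tadpole_quiver (cm_dim n) F p (Opp (X_arr 0)) = momT F p (Arrow (X_arr 0)) - momT F p (Arrow V_arr)"
    "moment_shift tadpole_quiver (cm_dim n) F p (Arrow V_arr) = momT F p (Arrow (X_arr 0)) + momT F p (Opp (X_arr 0))"
    by (simp_all add: moment_shift_def tail)
  show "moment_shift tadpole_quiver (cm_dim n) F p (Opp V_arr) = 0"
    by (simp add: moment_shift_def inf cong: conj_cong)
qed

text \<open>Both Hamiltonian vector fields are normalised by infinitesimal gauge transformations
  (\<open>\<Xi>\<close> below), which invariant functions do not see; then \<open>\<phi>\<close> maps one to the other.\<close>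

lemma phi_poisson:
  assumes F: "invariantT F" and F': "invariantC F'" "\<forall>p\<in>ambient C. F' p = F (phi m n q p)"
    and G: "invariantT G" and G': "invariantC G'" "\<forall>p\<in>ambient C. G' p = G (phi m n q p)"
    and p: "p \<in> ambient C"
  shows "rep_bracket (cyclic_quiver m) (cm_dim n) F' G' p = rep_bracket tadpole_quiver (cm_dim n) F G (phi m n q p)"
proof -
  note [simp del] = cprod.simps(2)
  define P where "P = phi m n q p"
  have f: "p \<in> formats (cyclic_quiver m) (cm_dim n)" using p by (simp add: cyc_ambient_iff)
  have PT: "P \<in> ambient T" "P \<in> formats tadpole_quiver (cm_dim n)"
    using phi_quad_ok(2)[OF p] by (auto simp: P_def tad_ambient_iff)
  obtain A0 B0 V0 W0 where D: "phi_quad m n q p = (A0, B0, V0, W0)" "A0 \<in> GLn n" "B0 \<in> GLn n" "V0 \<in> carrier_mat n 1" "W0 \<in> carrier_mat 1 n"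
    "A0 = cp p m" "q 0 \<odot> em B0 = fid n + cx p 0 * cy p 0"
    "em V0 = em B0 * em A0 * cv p" "em W0 = cw p * em (minv A0) * em (minv B0)"
    by (rule phi_data[OF p])
  define A Ai B Bi V W e e1 where "A = em A0" "Ai = em (minv A0)" "B = em B0" "Bi = em (minv B0)" "V = em V0" "W = em W0" "e = fid n" "e1 = fid 1"
  define c where "c = inverse (q 0)"
  define gx gy gv gw where "gx = gradT G P (Arrow (X_arr 0))" "gy = gradT G P (Opp (X_arr 0))" "gv = gradT G P (Arrow V_arr)" "gw = gradT G P (Opp V_arr)"
  define x0 y0 v w where "x0 = cx p 0" "y0 = cy p 0" "v = cv p" "w = cw p"
  note e_def = A_Ai_B_Bi_V_W_e_e1_def(7)
  note defs = A_Ai_B_Bi_V_W_e_e1_def c_def gx_gy_gv_gw_def x0_y0_v_w_def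
  have cA: "A * Ai = e" "Ai * A = e" "B * Bi = e" "Bi * B = e" "e * A = A" "A * e = A" "e * Ai = Ai" "Ai * e = Ai"
    "e * B = B" "B * e = B" "e * Bi = Bi" "Bi * e = Bi"
    unfolding defs by (simp_all only: GLn_cancel[OF D(2)] GLn_cancel[OF D(3)])
  have cg: "e * gx = gx" "gx * e = gx" "e * gy = gy" "gy * e = gy" "e1 * gv = gv" "gv * e = gv" "e * gw = gw" "gw * e1 = gw"
    unfolding defs by simp_all
  have cv: "e * V = V" "V * e1 = V" "e1 * W = W" "W * e = W" "e * v = v" "v * e1 = v" "e1 * w = w" "w * e = w"
    unfolding defs using em_fid_carrier(1,2)[OF D(4)] em_fid_carrier(1,2)[OF D(5)]
      em_fid_carrier(1,2)[OF cyc_formatsD(3)[OF f]] em_fid_carrier(1,2)[OF cyc_formatsD(4)[OF f]] by (simp_all only:)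
  have cx0: "e * x0 = x0" "x0 * e = x0" "e * y0 = y0" "y0 * e = y0"
    unfolding defs using em_fid_carrier(1,2)[OF cyc_formatsD(1)[OF f m_facts(1)]] em_fid_carrier(1,2)[OF cyc_formatsD(2)[OF f m_facts(1)]] by (simp_all only:)
  \<comment> \<open>Turns a rule for two factors into one for right-nested products, so that
    rewriting together with \<open>mult.assoc\<close> reaches a normal form.\<close>
  have asl: "a * b = d \<Longrightarrow> a * (b * z) = d * z" for a b d z :: fmat by (simp flip: mult.assoc)
  note cc = cA cg cv cx0 cA[THEN asl] cg[THEN asl] cv[THEN asl] cx0[THEN asl]
  have q00: "q 0 \<noteq> 0" using q0 m_facts by auto
  have U: "e + x0 * y0 = q 0 \<odot> B" unfolding defs using D(7) by simp
  have cU: "B = c \<odot> (e + x0 * y0)" unfolding U c_def using q00 by simp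
  have V: "V = B * A * v" "W = w * Ai * Bi" unfolding defs using D(8,9) by auto
  have vw: "v = Ai * Bi * V" "w = W * B * A" unfolding V by (simp_all add: mult.assoc cc)
  define l where "l = gw * W - V * gv"
  define GA where "GA = gx + Ai * gy * Ai"
  have GA: "e * GA = GA" "GA * e = GA" unfolding GA_def by (simp_all add: distrib_left distrib_right mult.assoc cc)
  have gx: "gx = GA - Ai * gy * Ai" unfolding GA_def by simp
  define N K where "N = gy - Bi * l" "K = GA - Ai * Bi * l * B"
  note N_def = N_K_def(1) and K_def = N_K_def(2)
  have cl: "e * l = l" "l * e = l" unfolding l_def by (simp_all add: left_diff_distrib right_diff_distrib mult.assoc cc)
  have cNK: "e * N = N" "N * e = N" "e * K = K" "K * e = K"
    unfolding N_def K_def by (simp_all add: left_diff_distrib right_diff_distrib mult.assoc cc GA cl cl[THEN asl])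
  note pe = phi_em[OF p D(1), folded P_def]
  have T_em: "cx P 0 = A" "cy P 0 = B - Ai" "local.cv P = V" "cw P = W" unfolding pe defs by simp_all
  have mT: "momT G P (Arrow (X_arr 0)) = gy * B - A * GA" "momT G P (Opp (X_arr 0)) = GA * A - B * gy" "momT G P (Arrow V_arr) = l"
    unfolding moment_def dstar.simps T_em l_def GA_def gx_gy_gv_gw_def[symmetric]
    by (simp_all add: left_diff_distrib right_diff_distrib distrib_left distrib_right mult.assoc cc)
  \<comment> \<open>The moments of x, y and v at the tadpole vertex add up to 0; solving for the one
    of v expresses the framing contribution by the gradients in A and B.\<close>
  have l: "l = A * GA - gy * B - GA * A + B * gy"
    using momT_sum[OF G PT(1)] unfolding mT by (simp add: algebra_simps add_eq_0_iff)
  have K: "K = gradT G (phi m n q p) (Arrow (X_arr 0)) + em (minv A0) * gradT G (phi m n q p) (Opp (X_arr 0)) * em (minv A0)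
       + local.cv p * gradT G (phi m n q p) (Arrow V_arr) * em B0 - em (minv A0) * em (minv B0) * gradT G (phi m n q p) (Opp V_arr) * cw p * em (minv A0)"
    unfolding defs[symmetric] P_def[symmetric] K_def l_def GA_def unfolding vw
    by (simp add: left_diff_distrib right_diff_distrib distrib_left distrib_right mult.assoc cc)
  have N: "N = gradT G (phi m n q p) (Opp (X_arr 0)) + em A0 * local.cv p * gradT G (phi m n q p) (Arrow V_arr)
       - em (minv B0) * gradT G (phi m n q p) (Opp V_arr) * cw p * em (minv A0) * em (minv B0)"
    unfolding defs[symmetric] P_def[symmetric] N_def l_def unfolding vw
    by (simp add: left_diff_distrib right_diff_distrib distrib_left distrib_right mult.assoc cc)
  have GT: "regular_fun T G" "regular_fun T F" using F G by (auto simp: invariantT_def)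
  note grads = phi_grad[where G'=G', OF GT(1) G'(2) p D(1) K N, unfolded P_def[symmetric], folded defs]
  have "em (cp p m) = A" "em (minv (cp p m)) = Ai" unfolding defs D(6) by simp_all
  note AP = this
  have P1: "Pm p (Suc 0) = x0" "Pm p 0 = e" unfolding defs using em_cprod(1)[OF p m_facts(1)] em_fid_carrier(1)[OF cyc_formatsD(1)[OF f m_facts(1)]] by simp_all
  have cP: "Pm p k * Pinv p k = e" "Pinv p k * Pm p k = e" "e * Pm p k = Pm p k" "Pm p k * e = Pm p k" "e * Pinv p k = Pinv p k" "Pinv p k * e = Pinv p k" if "k \<le> m" for k
    unfolding e_def using GLn_cancel[OF cp_GLn[OF p that]] by (simp_all only:)
  have x0P: "x0 * Pinv p (Suc 0) = e" "Pinv p (Suc 0) * x0 = e" using cP(1,2)[of "Suc 0"] P1 m_facts by auto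
  let ?H = "hamC G' p"
  define lb where "lb = momC G' p (Arrow (X_arr 0))"
  define ka where "ka = momC G' p (Opp (X_arr (m - 1)))"
  define l' where "l' = momC G' p (Arrow V_arr)"
  have gx0: "gradC G' p (Arrow (X_arr 0)) = Pinv p (Suc 0) * A * K + c \<odot> (y0 * N)"
    and gy0: "gradC G' p (Opp (X_arr 0)) = c \<odot> (N * x0)"
    and gv': "gradC G' p (Arrow V_arr) = gv * B * A" and gw': "gradC G' p (Opp V_arr) = Ai * Bi * gw"
    and gyk: "k < m \<Longrightarrow> 0 < k \<Longrightarrow> gradC G' p (Opp (X_arr k)) = 0" for k
    using grads(1)[of 0] grads(2)[of 0] grads(3,4) grads(2)[of k] m_facts P1 cNK
    by (simp_all add: mult.assoc)
  have cxy: "c \<odot> (x0 * y0) = B - c \<odot> e" unfolding cU by (simp add: fscale_distrib)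
  have lb: "lb = N * B - B * N - A * K"
  proof -
    have "lb = N * (c \<odot> (x0 * y0)) - (x0 * Pinv p (Suc 0)) * A * K - (c \<odot> (x0 * y0)) * N"
      unfolding lb_def moment_def dstar.simps gx0 gy0 x0_y0_v_w_def[symmetric]
      by (simp add: distrib_left mult.assoc algebra_simps)
    also have "\<dots> = N * B - B * N - A * K"
      unfolding cxy x0P by (simp add: left_diff_distrib right_diff_distrib mult.assoc cc cNK)
    finally show ?thesis .
  qed
  have ka: "ka = K * A"
  proof -
    have "Pm p (m - 1) * cx p (m - 1) = A" using em_cprod(1)[OF p m_facts(2)] m_facts AP by simp
    moreover have "gradC G' p (Arrow (X_arr (m - 1))) = Pinv p m * A * K * Pm p (m - 1)"
      using grads(1)[OF m_facts(2)] m_facts by simp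
    ultimately show ?thesis
      unfolding ka_def moment_def dstar.simps using gyk[OF m_facts(2)] m_facts AP
      by (simp add: mult.assoc cc cNK(3)[THEN asl] del: One_nat_def)
  qed
  have sumC: "ka + lb + l' = 0" unfolding ka_def lb_def l'_def by (rule momC_sum(2)[OF G'(1) p])
  \<comment> \<open>This gauge direction cancels the moment of v in the shifts at vertex 0.
    Afterwards no shift is left on v and w, and the shift at \<open>x_0\<close> is reduced to
    \<open>ka\<close>.\<close>
  define \<Xi>' where "\<Xi>' u = (if u = Cyc 0 then - l' else 0)" for u
  define X where "X a = ?H a + (\<Xi>' (dtail (cyclic_quiver m) a) * em (p a) - em (p a) * \<Xi>' (dhead (cyclic_quiver m) a))" for a
  \<comment> \<open>For 0 < k < m this is the common shift of \<open>x_k\<close> and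
    \<open>y_{k-1}\<close>. Index m stands for vertex 0 reached from \<open>x_{m-1}\<close>: there
    the normalised shift is \<open>- lb\<close>, whereas \<open>x_0\<close> sees \<open>ka\<close>
    at the same vertex. This difference survives the telescoping.\<close>
  define CC where "CC k = (if k = m then - lb else shiftC G' p (Arrow (X_arr k)))" for k
  have m1: "1 < m" "m \<noteq> Suc 0" using m by auto
  have sy: "shiftC G' p (Opp (X_arr k)) = CC (Suc k) - (if Suc k = m then l' else 0)" if k: "k < m" for k
  proof (cases "Suc k = m")
    case True
    thus ?thesis using shiftC_simps(2)[OF k, of G' p] by (simp add: CC_def lb_def l'_def)
  next
    case False
    hence sk: "Suc k < m" using k by simp
    thus ?thesis using shiftC_simps(2)[OF k, of G' p] shiftC_simps(1)[OF sk, of G' p] momC_sum(1)[OF G'(1) p _ sk]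
      by (simp add: CC_def pred_m_def)
  qed
  have sx0: "shiftC G' p (Arrow (X_arr 0)) = ka - l'"
    using shiftC_simps(1)[OF m_facts(1), of G' p] by (simp add: pred_m_def ka_def l'_def)
  \<comment> \<open>The gradient in \<open>y_k\<close> is 0, so only the shifts remain, as a change
    of basis at the vertices k and k + 1.\<close>
  have Xk: "X (Arrow (X_arr k)) = - CC k * cx p k + cx p k * CC (Suc k)" if k: "0 < k" "k < m" for k
  proof -
    have "Suc k mod m = 0 \<longleftrightarrow> Suc k = m" using k by (auto simp: mod_Suc)
    thus ?thesis using k sy[OF k(2)]
      by (auto simp: X_def hamC_simps[OF k(2)] gyk[OF k(2,1)] \<Xi>'_def CC_def right_diff_distrib)
  qed
  have Xx0: "X (Arrow (X_arr 0)) = ((e + x0 * y0) * gradC G' p (Opp (X_arr 0)) + gradC G' p (Opp (X_arr 0)) * (e + y0 * x0)) - ka * x0 + x0 * CC 1"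
    using m1 sy[OF m_facts(1)] unfolding X_def hamC_simps[OF m_facts(1)] sx0 defs \<Xi>'_def
    by (simp add: left_diff_distrib)
  have Xy0: "X (Opp (X_arr 0)) = - ((e + y0 * x0) * gradC G' p (Arrow (X_arr 0)) + gradC G' p (Arrow (X_arr 0)) * (e + x0 * y0)) - CC 1 * y0 + y0 * ka"
    using m1 sy[OF m_facts(1)] unfolding X_def hamC_simps[OF m_facts(1)] sx0 defs \<Xi>'_def
    by (simp add: right_diff_distrib)
  have Xv: "X (Arrow V_arr) = (e + v * w) * gradC G' p (Opp V_arr) + gradC G' p (Opp V_arr) * (e1 + w * v)"
  proof -
    have "shiftC G' p (Arrow V_arr) = - l'"
      unfolding shiftC_simps using sumC unfolding ka_def lb_def l'_def by (simp add: add_eq_0_iff2 del: One_nat_def)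
    thus ?thesis unfolding X_def hamiltonian_def shiftC_simps(4) \<Xi>'_def defs by (simp add: shiftC_simps(4))
  qed
  have Xw: "X (Opp V_arr) = - ((e1 + w * v) * gradC G' p (Arrow V_arr) + gradC G' p (Arrow V_arr) * (e + v * w))"
  proof -
    have "shiftC G' p (Arrow V_arr) = - l'"
      unfolding shiftC_simps using sumC unfolding ka_def lb_def l'_def by (simp add: add_eq_0_iff2 del: One_nat_def)
    thus ?thesis unfolding X_def hamiltonian_def \<Xi>'_def defs by (simp add: shiftC_simps(4) neg_fscale)
  qed
  have bil: "2 * rep_bracket (cyclic_quiver m) (cm_dim n) F' G' p = (\<Sum>a\<in>set (darrs (cyclic_quiver m)). ftrace (gradC F' p a * X a))"
  proof -
    have "(\<Sum>a\<in>set (darrs (quiv C)). ftrace (grad (quiv C) (dimv C) F' p a *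
       (\<Xi>' (dtail (quiv C) a) * em (p a) - em (p a) * \<Xi>' (dhead (quiv C) a)))) = 0"
      by (rule gauge_direction_zero[OF wf_C _ _ p]) (use F'(1) p f in \<open>auto simp: invariantC_def \<Xi>'_def\<close>)
    thus ?thesis
      using rep_bracket_hamiltonian[OF wf_C[simplified] ambient_alg_reps(2)[OF p], of F' G']
      by (simp add: X_def distrib_left sum.distrib)
  qed
  define DA where "DA = (\<Sum>j<m. Pm p j * (X (Arrow (X_arr j)) * (Pinv p (Suc j) * Pm p m)))"
  define DB where "DB = c \<odot> (X (Arrow (X_arr 0)) * y0 + x0 * X (Opp (X_arr 0)))"
  have xP: "cx p k * (Pinv p (Suc k) * z) = Pinv p k * z" if "k < m" for k z
  proof -
    have "Pinv p k * (Pm p (Suc k) * (Pinv p (Suc k) * z)) = Pinv p k * (Pm p k * (cx p k * (Pinv p (Suc k) * z)))"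
      unfolding em_cprod(1)[OF p that] by (simp add: mult.assoc)
    moreover have "e * (cx p k * u) = cx p k * u" "e * (Pinv p k * u) = Pinv p k * u" for u
      unfolding e_def using em_fid_carrier(3)[OF cyc_formatsD(1)[OF f that]] GLn_cancel(10)[OF cp_GLn[OF p, of k]] that by auto
    ultimately show ?thesis using cP[of k] cP[of "Suc k"] that by (simp add: asl[OF cP(1)] asl[OF cP(2)] asl[OF cP(6)] del: cprod.simps)
  qed
  \<comment> \<open>The terms with k > 0 telescope: the upper end contributes \<open>- A lb\<close>,
    and the lower end \<open>s 1\<close> cancels against the part of the field at \<open>x_0\<close>
    that contains \<open>CC 1\<close>.\<close>
  have DA: "DA = B * N * A + N * B * A - K * A * A - A * lb"
  proof -
    define s where "s k = Pm p k * (CC k * (Pinv p k * A))" for k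
    have t: "Pm p k * (X (Arrow (X_arr k)) * (Pinv p (Suc k) * Pm p m)) = s (Suc k) - s k" if "k \<in> {1..<m}" for k
    proof -
      have k: "0 < k" "k < m" using that by auto
      show ?thesis unfolding Xk[OF k] AP s_def em_cprod(1)[OF p k(2)]
        by (simp add: left_diff_distrib right_diff_distrib distrib_left distrib_right mult.assoc xP[OF k(2)])
    qed
    have "DA = X (Arrow (X_arr 0)) * (Pinv p (Suc 0) * A) + (\<Sum>k\<in>{1..<m}. s (Suc k) - s k)"
    proof -
      have cX: "e * (X (Arrow (X_arr 0)) * z) = X (Arrow (X_arr 0)) * z" for z
      proof -
        have "e * X (Arrow (X_arr 0)) = X (Arrow (X_arr 0))"
          unfolding Xx0 gy0 ka by (simp add: left_diff_distrib right_diff_distrib distrib_left distrib_right mult.assoc cc cNK cNK[THEN asl])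
        thus ?thesis by (rule asl)
      qed
      have "{..<m} = insert 0 {1..<m}" using m_facts by auto
      thus ?thesis unfolding DA_def using t cX by (simp add: P1 AP e_def[symmetric])
    qed
    also have "(\<Sum>k\<in>{1..<m}. s (Suc k) - s k) = s m - s 1" using m by (intro sum_Suc_diff') simp
    also have "s m = - (A * lb)" unfolding s_def CC_def AP using cc lb cNK by (simp add: left_diff_distrib right_diff_distrib mult.assoc)
    also have "s 1 = x0 * (CC 1 * (Pinv p (Suc 0) * A))" unfolding s_def using P1 by simp
    finally have "DA = c \<odot> ((e + x0 * y0) * (N * (x0 * Pinv p (Suc 0)))) * A + c \<odot> (N * ((e + x0 * y0) * (x0 * Pinv p (Suc 0)))) * A
       - ka * (x0 * Pinv p (Suc 0)) * A - A * lb"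
      unfolding Xx0 gy0 by (simp add: left_diff_distrib right_diff_distrib distrib_left distrib_right mult.assoc fscale_distrib cc cNK cNK[THEN asl] asl[OF x0P(1)])
    also have "\<dots> = (c \<odot> (e + x0 * y0)) * N * A + N * (c \<odot> (e + x0 * y0)) * A - K * A * A - A * lb"
      unfolding x0P ka by (simp add: left_diff_distrib right_diff_distrib distrib_left distrib_right mult.assoc fscale_distrib cc cNK cNK[THEN asl])
    finally show ?thesis unfolding cU[symmetric] .
  qed
  \<comment> \<open>Up to the scalar \<open>q_0\<close>, B is the loop \<open>1 + x_0 y_0\<close>,
    whose derivative \<open>hamiltonian_xy\<close> gives in terms of its moment \<open>lb\<close>
    and of the shift \<open>ka\<close> at the tail; the shift at the head drops out.\<close>
  have DB: "DB = B * lb + lb * B - K * A * B + B * K * A"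
  proof -
    have ab: "e * gradC G' p (Arrow (X_arr 0)) = gradC G' p (Arrow (X_arr 0))" "gradC G' p (Arrow (X_arr 0)) * e = gradC G' p (Arrow (X_arr 0))"
      "e * gradC G' p (Opp (X_arr 0)) = gradC G' p (Opp (X_arr 0))" "gradC G' p (Opp (X_arr 0)) * e = gradC G' p (Opp (X_arr 0))"
      unfolding e_def by simp_all
    have "X (Arrow (X_arr 0)) * y0 + x0 * X (Opp (X_arr 0)) =
      lb * (e + x0 * y0) + (e + x0 * y0) * lb - ka * (e + x0 * y0) + (e + x0 * y0) * ka"
      unfolding Xx0 Xy0
      by (rule hamiltonian_xy) (use cx0 ab cNK cA in \<open>simp_all add: ka mult.assoc cNK(3)[THEN asl] lb_def moment_def x0_y0_v_w_def\<close>)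
    hence "DB = lb * (c \<odot> (e + x0 * y0)) + (c \<odot> (e + x0 * y0)) * lb - ka * (c \<odot> (e + x0 * y0)) + (c \<odot> (e + x0 * y0)) * ka"
      unfolding DB_def by (simp add: fscale_distrib distrib_left distrib_right)
    thus ?thesis unfolding cU[symmetric] ka by (simp add: mult.assoc)
  qed
  \<comment> \<open>The value is dictated by the framing arrows: as \<open>V = B A v\<close>, the
    coefficient \<open>Xi + l\<close> of V in the corrected tadpole field has to be
    \<open>d(B A) (B A)^-1\<close>.\<close>
  define Xi where "Xi = N * B + B * N - A * K - K * A"
  note R = ring_identities[OF cA(1-4) cA(5-12) GA cg(3,4) l N_def K_def lb Xi_def DA DB gx]
  define \<Xi> where "\<Xi> u = (if u = Cyc 0 then Xi else 0)" for u
  define Y where "Y a = hamT G P a + (\<Xi> (dtail tadpole_quiver a) * em (P a) - em (P a) * \<Xi> (dhead tadpole_quiver a))" for a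
  have biT: "2 * rep_bracket tadpole_quiver (cm_dim n) F G P = (\<Sum>a\<in>set (darrs tadpole_quiver). ftrace (gradT F P a * Y a))"
  proof -
    have "(\<Sum>a\<in>set (darrs (quiv T)). ftrace (grad (quiv T) (dimv T) F P a *
       (\<Xi> (dtail (quiv T) a) * em (P a) - em (P a) * \<Xi> (dhead (quiv T) a)))) = 0"
      by (rule gauge_direction_zero[OF wf_T _ _ PT(1)]) (use F PT in \<open>auto simp: invariantT_def \<Xi>_def\<close>)
    thus ?thesis
      using rep_bracket_hamiltonian[OF wf_T[simplified] ambient_alg_reps(1)[OF PT(1)], of F G]
      by (simp add: Y_def distrib_left sum.distrib)
  qed
  have UT: "e + A * (B - Ai) = A * B" "e + (B - Ai) * A = B * A"
    by (simp_all add: left_diff_distrib right_diff_distrib cc)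
  have Y: "Y (Arrow (X_arr 0)) = DA" "Y (Opp (X_arr 0)) = DB + Ai * DA * Ai"
    "Y (Arrow V_arr) = DB * A * v + B * DA * v + B * A * X (Arrow V_arr)"
    "Y (Opp V_arr) = X (Opp V_arr) * Ai * Bi - w * Ai * DA * Ai * Bi - w * Ai * Bi * DB * Bi"
  proof -
    note s = gx_gy_gv_gw_def[symmetric] A_Ai_B_Bi_V_W_e_e1_def(7,8)[symmetric]
    have "Y (Arrow (X_arr 0)) = A * B * gy + gy * (B * A) + (GA * A - B * gy + l) * A + A * (gy * B - A * GA - l) + Xi * A - A * Xi"
      unfolding Y_def hamiltonian_def shiftT_simps mT UT[symmetric] \<Xi>_def
      by (simp add: T_em s shiftT_simps mT algebra_simps)
    thus "Y (Arrow (X_arr 0)) = DA" by (simp only: R(1))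
    have "Y (Opp (X_arr 0)) = - (B * A * gx + gx * (A * B)) - (gy * B - A * GA - l) * (B - Ai) - (B - Ai) * (GA * A - B * gy + l) + Xi * (B - Ai) - (B - Ai) * Xi"
      unfolding Y_def hamiltonian_def shiftT_simps mT UT[symmetric] \<Xi>_def
      by (simp add: T_em s shiftT_simps mT neg_fscale algebra_simps)
    thus "Y (Opp (X_arr 0)) = DB + Ai * DA * Ai" by (simp only: R(2))
    have "Y (Arrow V_arr) = (e + V * W) * gw + gw * (e1 + W * V) + (Xi + l) * V"
      unfolding Y_def hamiltonian_def shiftT_simps mT \<Xi>_def
      by (simp add: T_em shiftT_simps mT l s[unfolded One_nat_def] algebra_simps)
    also have "\<dots> = DB * A * v + B * DA * v + B * A * X (Arrow V_arr)"
      unfolding R(3)[symmetric] Xv gw' unfolding vw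
      by (simp add: left_diff_distrib right_diff_distrib distrib_left distrib_right mult.assoc cc)
    finally show "Y (Arrow V_arr) = DB * A * v + B * DA * v + B * A * X (Arrow V_arr)" .
    have "Y (Opp V_arr) = - ((e1 + W * V) * gv + gv * (e + V * W)) - W * (Xi + l)"
      unfolding Y_def hamiltonian_def shiftT_simps mT \<Xi>_def
      by (simp add: T_em shiftT_simps mT l neg_fscale s[unfolded One_nat_def] algebra_simps)
    also have "\<dots> = X (Opp V_arr) * Ai * Bi - w * Ai * DA * Ai * Bi - w * Ai * Bi * DB * Bi"
      unfolding R(3)[symmetric] Xw gv' unfolding vw
      by (simp add: left_diff_distrib right_diff_distrib distrib_left distrib_right mult.assoc cc)
    finally show "Y (Opp V_arr) = X (Opp V_arr) * Ai * Bi - w * Ai * DA * Ai * Bi - w * Ai * Bi * DB * Bi" .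
  qed
  define \<gamma> where "\<gamma> z = (\<lambda>a\<in>set (darrs (cyclic_quiver m)). p a + z \<cdot>\<^sub>m unem (cm_dim n (dtail (cyclic_quiver m) a)) (cm_dim n (dhead (cyclic_quiver m) a)) (X a))" for z
  have Xabs: "fid (cm_dim n (dtail (cyclic_quiver m) a)) * X a = X a" "X a * fid (cm_dim n (dhead (cyclic_quiver m) a)) = X a"
    if a: "a \<in> set (darrs (cyclic_quiver m))" for a
  proof -
    have cl': "fid n * l' = l'" "l' * fid n = l'"
      using moment_fid[OF f, of "Arrow V_arr" G'] by (simp_all add: l'_def cyc_darrs)
    have "fid (cm_dim n u) * \<Xi>' u = \<Xi>' u" "\<Xi>' u * fid (cm_dim n u) = \<Xi>' u" for u using cl' by (auto simp: \<Xi>'_def)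
    with hamiltonian_fid[OF f a, where F=G'] formats_em_fid[OF f a]
    show "fid (cm_dim n (dtail (cyclic_quiver m) a)) * X a = X a" "X a * fid (cm_dim n (dhead (cyclic_quiver m) a)) = X a"
      by (simp_all add: X_def distrib_left distrib_right left_diff_distrib right_diff_distrib mult.assoc fid_absorb_mult)
  qed
  have e\<gamma>: "em (\<gamma> z a) = em (p a) + z \<odot> X a" if a: "a \<in> set (darrs (cyclic_quiver m))" for z a
    using a formatsD[OF f a] Xabs[OF a] by (simp add: \<gamma>_def em_unem)
  have \<gamma>f: "\<gamma> z \<in> formats (cyclic_quiver m) (cm_dim n)" for z
    unfolding formats_def \<gamma>_def using formatsD(1)[OF f] by (auto intro!: add_carrier_mat)
  have \<gamma>0: "\<gamma> 0 = p" by (rule rep_eqI[OF \<gamma>f f]) (simp add: e\<gamma>)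
  have d\<gamma>: "mderiv (\<lambda>z. em (\<gamma> z a)) (X a)" if a: "a \<in> set (darrs (cyclic_quiver m))" for a
  proof -
    have "mderiv (\<lambda>z. em (p a) + z \<odot> X a) (0 + X a)" by (intro mderiv_add mderiv_const mderiv_id_scale)
    thus ?thesis by (simp add: e\<gamma>[OF a])
  qed
  have dA: "mderiv (\<lambda>z. Pm (\<gamma> z) m) DA"
    unfolding DA_def
  proof (rule mderiv_cprod[where \<gamma>=\<gamma> and \<delta>="\<lambda>l. X (Arrow (X_arr l))", OF p \<gamma>0 \<gamma>f])
    show "X (Arrow (X_arr i)) * fid n = X (Arrow (X_arr i))" if "i < m" for i
      using Xabs(2)[of "Arrow (X_arr i)"] that by (simp add: cyc_darrs)
  qed (use d\<gamma> in \<open>auto simp: cyc_darrs\<close>)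
  \<comment> \<open>The derivative of F' along X is computed twice: through \<open>phi\<close>,
    whose differential sends X to Y, and directly on the cyclic side. The two sums are twice the two
    brackets.\<close>
  have "((\<lambda>z. F' (\<gamma> z)) has_field_derivative (\<Sum>a\<in>set (darrs tadpole_quiver). ftrace (gradT F P a * Y a))) (at 0)"
    using phi_chain[where \<gamma>=\<gamma> and \<delta>=X and F'=F', OF GT(2) F'(2) p \<gamma>0 \<gamma>f d\<gamma> dA D(1) DB_def[unfolded defs]]
    unfolding sum_tad_darrs Y unfolding P_def defs by simp
  moreover have "((\<lambda>z. F' (\<gamma> z)) has_field_derivative (\<Sum>a\<in>set (darrs (cyclic_quiver m)). ftrace (gradC F' p a * X a))) (at 0)"
    using regular_fun_chain[where D=C and F=F' and \<gamma>=\<gamma> and \<delta>=X, OF _ p \<gamma>0] \<gamma>f d\<gamma> F'(1) by (simp add: invariantC_def)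
  ultimately have "2 * rep_bracket tadpole_quiver (cm_dim n) F G P = 2 * rep_bracket (cyclic_quiver m) (cm_dim n) F' G' p"
    unfolding biT bil by (rule DERIV_unique)
  thus ?thesis by (simp add: P_def)
qed

end

section \<open>The isomorphism and its Poisson property\<close>

context cm_spaces
begin

lemma locus_ambient: "p \<in> locus T \<Longrightarrow> p \<in> ambient T" "p \<in> locus C \<Longrightarrow> p \<in> ambient C"
  using cyc_locusD(1) by (auto simp: tad_locus_iff[OF t_nonzero] locus1_def)

lemma locus1_gauge:
  assumes p: "locus1 p" and g: "g \<in> gauge_group C"
  shows "locus1 (gauge_act C g p)"
proof -
  have a: "p \<in> ambient C" using p by (simp add: locus1_def)
  have f: "p \<in> formats (cyclic_quiver m) (cm_dim n)" using a by (simp add: cyc_ambient_iff)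
  have "fid n + cx (gauge_act C g p) i * cy (gauge_act C g p) i =
    q i \<odot> (fid n + cy (gauge_act C g p) (i - 1) * cx (gauge_act C g p) (i - 1))" if i: "0 < i" "i < m" for i
  proof -
    have j: "i - 1 < m" "Suc (i - 1) mod m = i" using i by auto
    have gi: "g (Cyc i) \<in> GLn n" "g (Cyc (i - 1)) \<in> GLn n" "g (Cyc (Suc i mod m)) \<in> GLn n"
      using g i m_facts by (auto simp: gauge_group_cyc)
    note E = em_gauge_act[OF wf_C g, of p, simplified, OF f]
    have e: "cx (gauge_act C g p) i = em (g (Cyc i)) * (cx p i * em (minv (g (Cyc (Suc i mod m)))))"
      "cy (gauge_act C g p) i = em (g (Cyc (Suc i mod m))) * (cy p i * em (minv (g (Cyc i))))"
      "cx (gauge_act C g p) (i - 1) = em (g (Cyc (i - 1))) * (cx p (i - 1) * em (minv (g (Cyc i))))"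
      "cy (gauge_act C g p) (i - 1) = em (g (Cyc i)) * (cy p (i - 1) * em (minv (g (Cyc (i - 1)))))"
      using E[of "Arrow (X_arr i)"] E[of "Opp (X_arr i)"] E[of "Arrow (X_arr (i - 1))"] E[of "Opp (X_arr (i - 1))"] i j
      by (auto simp: cyc_darrs)
    note x = em_fid_carrier[OF cyc_formatsD(1)[OF f i(2)]] em_fid_carrier[OF cyc_formatsD(2)[OF f i(2)]]
      em_fid_carrier[OF cyc_formatsD(1)[OF f j(1)]] em_fid_carrier[OF cyc_formatsD(2)[OF f j(1)]]
    note ca = GLn_cancel[OF gi(1)] GLn_cancel[OF gi(2)] GLn_cancel[OF gi(3)] x
    have "fid n + cx (gauge_act C g p) i * cy (gauge_act C g p) i = em (g (Cyc i)) * (fid n + cx p i * cy p i) * em (minv (g (Cyc i)))"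
      unfolding e by (simp add: distrib_left distrib_right mult.assoc ca)
    also have "fid n + cx p i * cy p i = q i \<odot> (fid n + cy p (i - 1) * cx p (i - 1))"
      using p i by (simp add: locus1_def)
    also have "em (g (Cyc i)) * (q i \<odot> (fid n + cy p (i - 1) * cx p (i - 1))) * em (minv (g (Cyc i))) =
      q i \<odot> (fid n + cy (gauge_act C g p) (i - 1) * cx (gauge_act C g p) (i - 1))"
      unfolding e by (simp add: distrib_left distrib_right mult.assoc ca del: One_nat_def)
    finally show ?thesis .
  qed
  thus ?thesis using gauge_stable(2)[OF a g] by (simp add: locus1_def)
qed

text \<open>The union in the definition of \<open>xi\<close> runs over all representatives of the
  class; by \<open>psi_gauge\<close> each of them contributes the same orbit.\<close>

lemma xi_orbit:
  assumes p: "p \<in> locus T"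
  shows "xi m n q (gauge_orbit T p) = gauge_orbit C (psi m n q p)"
proof -
  have a: "p \<in> ambient T" by (rule locus_ambient(1)[OF p])
  have fT: "p \<in> formats (quiv T) (dimv T)" using a ambient_formats by blast
  have "gauge_orbit C (cyc_rep m (xi_collection m n q P)) = gauge_orbit C (psi m n q p)"
    if P: "P \<in> tad_quads n t" "tad_rep P \<in> gauge_orbit T p" for P
  proof -
    obtain g where g: "g \<in> gauge_group T" "tad_rep P = gauge_act T g p" using P(2) by (auto simp: gauge_orbit_def)
    obtain g' where g': "g' \<in> gauge_group C" "psi m n q (gauge_act T g p) = gauge_act C g' (psi m n q p)"
      using psi_gauge[OF a g(1)] by blast
    have "cyc_rep m (xi_collection m n q P) = psi m n q (tad_rep P)"
      using quad_of_tad_rep(1)[OF tad_quads_ok[OF P(1) t_nonzero]] by (simp add: psi_def)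
    moreover have "psi m n q p \<in> formats (quiv C) (dimv C)" using psi_ambient[OF a] ambient_formats by blast
    ultimately show ?thesis using gauge_orbit_act[OF wf_C g'(1)] g(2) g'(2) by simp
  qed
  moreover have "quad_of p \<in> tad_quads n t" "tad_rep (quad_of p) \<in> gauge_orbit T p"
    using p tad_rep_quad_of(1)[OF a] gauge_orbit_self[OF wf_T fT] by (auto simp: tad_locus_iff[OF t_nonzero])
  ultimately show ?thesis unfolding xi_def t_def[symmetric] by blast
qed

lemma orbit_psi_phi:
  assumes "locus1 p"
  shows "gauge_orbit C (psi m n q (phi m n q p)) = gauge_orbit C p"
proof -
  have "p \<in> formats (quiv C) (dimv C)" using assms ambient_formats by (auto simp: locus1_def)
  thus ?thesis using psi_phi[OF assms] gauge_orbit_act[OF wf_C] by metis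
qed

lemma psi_pullback:
  assumes "lifts C \<phi> F"
  obtains G where "lifts T (\<phi> \<circ> xi m n q) G" "\<And>p. p \<in> ambient T \<Longrightarrow> G p = F (psi m n q p)"
  by (rule lifts_pullback[OF assms, of T "psi m n q" "\<phi> \<circ> xi m n q"])
    (use psi_ambient ambient_formats psi_regular gauge_stable psi_gauge locus_ambient psi_locus xi_orbit in auto)

lemma phi_pullback:
  assumes "lifts T (\<phi> \<circ> xi m n q) G"
  obtains F where "lifts C \<phi> F" "\<And>p. p \<in> ambient C \<Longrightarrow> F p = G (phi m n q p)"
  by (rule lifts_pullback[OF assms, of C "phi m n q" \<phi>])
    (use phi_quad_ok(2) ambient_formats phi_regular gauge_stable phi_gauge locus_ambient phi_locus xi_orbit
      orbit_psi_phi cyc_locusD(1) in auto)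

lemma lifts_invariant:
  "lifts T \<phi> F \<Longrightarrow> invariantT F" "lifts C \<phi> F \<Longrightarrow> invariantC F"
  by (auto simp: lifts_def invariantT_def invariantC_def)

text \<open>Injectivity follows by applying \<open>phi\<close>, which is equivariant and a left
  inverse of \<open>psi\<close>; surjectivity from \<open>psi_phi\<close>, since the cyclic locus
  lies in \<open>locus1\<close>. Functions are transferred by pulling lifts back along either
  map.\<close>

lemma xi_variety_iso: "variety_iso T C (xi m n q)"
  unfolding variety_iso_def
proof (intro conjI allI)
  show "bij_betw (xi m n q) (quot_space T) (quot_space C)"
  proof (rule bij_betw_imageI)
    show "inj_on (xi m n q) (quot_space T)"
    proof (rule inj_onI)
      fix c c' assume "c \<in> quot_space T" "c' \<in> quot_space T" and eq: "xi m n q c = xi m n q c'"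
      then obtain p p' where p: "p \<in> locus T" "c = gauge_orbit T p" and p': "p' \<in> locus T" "c' = gauge_orbit T p'"
        by (auto simp: quot_space_def)
      note a = locus_ambient(1)[OF p(1)] and a' = locus_ambient(1)[OF p'(1)]
      have f: "p \<in> formats (quiv T) (dimv T)" "psi m n q p' \<in> formats (quiv C) (dimv C)"
        using a psi_ambient[OF a'] ambient_formats by blast+
      have "psi m n q p' \<in> gauge_orbit C (psi m n q p)"
        using eq xi_orbit[OF p(1)] xi_orbit[OF p'(1)] p(2) p'(2) gauge_orbit_self[OF wf_C f(2)] by simp
      then obtain g where g: "g \<in> gauge_group C" "psi m n q p' = gauge_act C g (psi m n q p)"
        by (auto simp: gauge_orbit_def)
      have "p' = gauge_act T g p"
        using phi_gauge(2)[OF psi_ambient[OF a] g(1)] phi_psi[OF a] phi_psi[OF a'] g(2) by simp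
      thus "c = c'" unfolding p(2) p'(2) using gauge_orbit_act[OF wf_T phi_gauge(1)[OF psi_ambient[OF a] g(1)] f(1)] by simp
    qed
    show "xi m n q ` quot_space T = quot_space C"
    proof (intro equalityI subsetI)
      fix d assume "d \<in> xi m n q ` quot_space T"
      thus "d \<in> quot_space C" using xi_orbit psi_locus by (auto simp: quot_space_def)
    next
      fix d assume "d \<in> quot_space C"
      then obtain p where p: "p \<in> locus C" "d = gauge_orbit C p" by (auto simp: quot_space_def)
      have "xi m n q (gauge_orbit T (phi m n q p)) = d"
        using xi_orbit[OF phi_locus[OF p(1)]] orbit_psi_phi[OF cyc_locusD(1)[OF p(1)]] p(2) by simp
      thus "d \<in> xi m n q ` quot_space T" using phi_locus[OF p(1)] by (force simp: quot_space_def)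
    qed
  qed
  fix \<phi>
  show "\<phi> \<in> quot_functions C \<longleftrightarrow> \<phi> \<circ> xi m n q \<in> quot_functions T"
    unfolding quot_functions_def mem_Collect_eq using psi_pullback phi_pullback by metis
qed

text \<open>The values of both brackets are definite descriptions; they agree because the two predicates
  are equivalent.\<close>

lemma xi_poisson: "poisson_map T C (xi m n q)"
  unfolding poisson_map_def
proof (intro ballI)
  fix \<phi> \<psi> c assume "c \<in> quot_space T"
  then obtain p0 where p0: "p0 \<in> locus T" "c = gauge_orbit T p0" by (auto simp: quot_space_def)
  note a0 = locus_ambient(1)[OF p0(1)]
  have xc: "xi m n q c = gauge_orbit C (psi m n q p0)" using xi_orbit[OF p0(1)] p0(2) by simp
  have "(\<exists>F G p. lifts C \<phi> F \<and> lifts C \<psi> G \<and> p \<in> xi m n q c \<and> z = rep_bracket (quiv C) (dimv C) F G p) \<longleftrightarrow>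
    (\<exists>F G p. lifts T (\<phi> \<circ> xi m n q) F \<and> lifts T (\<psi> \<circ> xi m n q) G \<and> p \<in> c \<and> z = rep_bracket (quiv T) (dimv T) F G p)"
    (is "?L z \<longleftrightarrow> ?R z") for z
  proof
    assume "?R z"
    then obtain F G p where F: "lifts T (\<phi> \<circ> xi m n q) F" and G: "lifts T (\<psi> \<circ> xi m n q) G" and p: "p \<in> c"
      and z: "z = rep_bracket (quiv T) (dimv T) F G p" by blast
    obtain g where g: "g \<in> gauge_group T" "p = gauge_act T g p0" using p p0(2) by (auto simp: gauge_orbit_def)
    have a: "p \<in> ambient T" using gauge_stable(1)[OF a0 g(1)] g(2) by simp
    \<comment> \<open>Tadpole lifts are pulled back along \<open>phi\<close> and evaluated at
      \<open>psi p\<close>, which \<open>phi\<close> returns exactly to p.\<close>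
    obtain F' where F': "lifts C \<phi> F'" "\<And>p. p \<in> ambient C \<Longrightarrow> F' p = F (phi m n q p)" using phi_pullback[OF F] by blast
    obtain G' where G': "lifts C \<psi> G'" "\<And>p. p \<in> ambient C \<Longrightarrow> G' p = G (phi m n q p)" using phi_pullback[OF G] by blast
    have "psi m n q p \<in> xi m n q c"
      unfolding xc g(2) using psi_gauge[OF a0 g(1)] by (auto simp: gauge_orbit_def)
    moreover have "rep_bracket (quiv C) (dimv C) F' G' (psi m n q p) = z"
      using phi_poisson[OF lifts_invariant(1)[OF F] lifts_invariant(2)[OF F'(1)] _ lifts_invariant(1)[OF G] lifts_invariant(2)[OF G'(1)] _ psi_ambient[OF a]]
        F'(2) G'(2) phi_psi[OF a] z by simp
    ultimately show "?L z" using F'(1) G'(1) by blast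
  next
    assume "?L z"
    then obtain F' G' p where F': "lifts C \<phi> F'" and G': "lifts C \<psi> G'" and p: "p \<in> xi m n q c"
      and z: "z = rep_bracket (quiv C) (dimv C) F' G' p" by blast
    obtain g where g: "g \<in> gauge_group C" "p = gauge_act C g (psi m n q p0)" using p xc by (auto simp: gauge_orbit_def)
    have l: "locus1 p" using locus1_gauge[OF cyc_locusD(1)[OF psi_locus[OF p0(1)]] g(1)] g(2) by simp
    hence a: "p \<in> ambient C" by (simp add: locus1_def)
    \<comment> \<open>An arbitrary lift need not factor through \<open>phi\<close>. Passing to the
      tadpole side by \<open>psi\<close> and back by \<open>phi\<close> yields a lift of the same
      function that does; by \<open>psi_phi\<close> and invariance the two agree on
      \<open>locus1\<close>.\<close>
    have *: "\<exists>F F''. lifts T (\<phi> \<circ> xi m n q) F \<and> lifts C \<phi> F'' \<and> (\<forall>p\<in>ambient C. F'' p = F (phi m n q p)) \<and> (\<forall>p. locus1 p \<longrightarrow> F' p = F'' p)"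
      if F': "lifts C \<phi> F'" for \<phi> F'
    proof -
      obtain F where F: "lifts T (\<phi> \<circ> xi m n q) F" "\<And>p. p \<in> ambient T \<Longrightarrow> F p = F' (psi m n q p)" using psi_pullback[OF F'] by blast
      obtain F'' where F'': "lifts C \<phi> F''" "\<And>p. p \<in> ambient C \<Longrightarrow> F'' p = F (phi m n q p)" using phi_pullback[OF F(1)] by blast
      have "F' p = F'' p" if lp: "locus1 p" for p
      proof -
        have a: "p \<in> ambient C" using lp by (simp add: locus1_def)
        obtain h where h: "h \<in> gauge_group C" "psi m n q (phi m n q p) = gauge_act C h p" using psi_phi[OF lp] by blast
        have "F'' p = F' (gauge_act C h p)" using F''(2)[OF a] F(2)[OF phi_quad_ok(2)[OF a]] h(2) by simp
        thus ?thesis using lifts_invariant(2)[OF F'] a h(1) by (simp add: invariantC_def)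
      qed
      thus ?thesis using F(1) F'' by blast
    qed
    obtain F F'' where F: "lifts T (\<phi> \<circ> xi m n q) F" and F'': "lifts C \<phi> F''" "\<forall>p\<in>ambient C. F'' p = F (phi m n q p)" "\<forall>p. locus1 p \<longrightarrow> F' p = F'' p"
      using *[OF F'] by blast
    obtain G G'' where G: "lifts T (\<psi> \<circ> xi m n q) G" and G'': "lifts C \<psi> G''" "\<forall>p\<in>ambient C. G'' p = G (phi m n q p)" "\<forall>p. locus1 p \<longrightarrow> G' p = G'' p"
      using *[OF G'] by blast
    have reg: "regular_fun C H" if "lifts C \<theta> H" for H \<theta> using that by (simp add: lifts_def)
    note anti = rep_bracket_antisym[OF wf_C[simplified] ambient_alg_reps(2)[OF a]]
    \<comment> \<open>The arguments are replaced one at a time: the first with the field of G', the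
      second, after exchanging the arguments by antisymmetry, with the field of F''.\<close>
    have "z = rep_bracket (cyclic_quiver m) (cm_dim n) F'' G' p"
      using rep_bracket_locus1[OF reg[OF F'] reg[OF F''(1)] _ lifts_invariant(2)[OF G'] l] F''(3) z by simp
    also have "\<dots> = rep_bracket (cyclic_quiver m) (cm_dim n) F'' G'' p"
      using rep_bracket_locus1[OF reg[OF G'] reg[OF G''(1)] _ lifts_invariant(2)[OF F''(1)] l] G''(3) anti[of F'' G'] anti[of F'' G''] by simp
    also have "\<dots> = rep_bracket tadpole_quiver (cm_dim n) F G (phi m n q p)"
      by (rule phi_poisson) (use F G F'' G'' lifts_invariant a in auto)
    finally have "z = rep_bracket (quiv T) (dimv T) F G (phi m n q p)" by simp
    moreover have "phi m n q p \<in> c"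
      unfolding p0(2) g(2) phi_gauge(2)[OF psi_ambient[OF a0] g(1)] phi_psi[OF a0]
      using phi_gauge(1)[OF psi_ambient[OF a0] g(1)] by (auto simp: gauge_orbit_def)
    ultimately show "?R z" using F G by blast
  qed
  thus "poisson_bracket C \<phi> \<psi> (xi m n q c) = poisson_bracket T (\<phi> \<circ> xi m n q) (\<psi> \<circ> xi m n q) c"
    unfolding poisson_bracket_def by simp
qed

end

theorem proposition4p10:
  fixes m n :: nat and q :: "nat \<Rightarrow> complex" and t :: complex
  assumes "m \<ge> 2" and "n \<ge> 1"
    and "\<forall>i<m. q i \<noteq> 0"
    and "regular_param m q"
    and "t = (\<Prod>i<m. q i)"
  shows "(\<forall>P\<in>tad_quads n t.
            xi_collection m n q P \<in> cyc_collections m n q \<and>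
            xi m n q (gauge_orbit (tad_space n t) (tad_rep P)) =
              gauge_orbit (cyc_space m n q) (cyc_rep m (xi_collection m n q P))) \<and>
         variety_iso (tad_space n t) (cyc_space m n q) (xi m n q) \<and>
         poisson_map (tad_space n t) (cyc_space m n q) (xi m n q)"
proof -
  interpret cm_spaces m n q t by unfold_locales (use assms in auto)
  have "xi m n q (gauge_orbit (tad_space n t) (tad_rep P)) = gauge_orbit (cyc_space m n q) (cyc_rep m (xi_collection m n q P))"
    if P: "P \<in> tad_quads n t" for P
  proof -
    have "tad_rep P \<in> locus (tad_space n t)" using P by (simp add: tad_space_def)
    from xi_orbit[OF this] show ?thesis
      using quad_of_tad_rep(1)[OF tad_quads_ok[OF P t_nonzero]] by (simp add: psi_def)
  qed
  thus ?thesis using xi_collection_mem xi_variety_iso xi_poisson by blast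
qed

end
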